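(* Let $\mathcal{X}\subseteq\mathbb{R}^d$ have non-empty interior, and let $Q$ be a probability measure with support $\mathcal{X}$ and a strictly positive, continuously differentiable Lebesgue density $q$ on $\mathcal{X}$. Let $(X_i)_{i\in\mathbb{N}}$ be i.i.d. with distribution $Q$, and let $X,X'$ be independent with distribution $Q$. Assume: (1) $\Theta\subset\mathbb{R}^p$ is compact and convex with non-empty interior, and $\theta_0\in\arg\min_{\theta\in\Theta}\mathrm{KSD}_q(p_\theta)$ belongs to the interior of $\Theta$. (2) The kernel $k:\mathcal{X}\times\mathcal{X}\to\mathbb{R}$ is bounded, integrally strictly positive definite, in the Stein class of $q$, and has bounded first order derivatives. (3) $\{P_\theta\}_{\theta\in\Theta}$ is an identifiable parametric family of probability measures on $\mathcal{X}$; each $P_\theta$ has support $\mathcal{X}$ and a Lebesgue density $p_\theta$ such that: (a) for every $\theta\in\Theta$, $x\mapsto p_\theta(x)$ is strictly positive and continuously differentiable on $\mathcal{X}$; (b) for every $x\in\mathcal{X}$, $\theta\mapsto p_\theta(x)$ is in $\mathcal{C}^4(\Theta)$; (c) $\mathbb{E}[\sup_{\theta\in\Theta}\|\nabla_\theta^m s_{p_\theta}(X)\|_1^4]<\infty$ for $m\in\{0,1\}$; (d) $\mathbb{E}[\sup_{\theta\in\Theta}\|\nabla_\theta^m s_{p_\theta}(X)\|_1^2]<\infty$ for $m\in\{2,3\}$; (e) $\int_{\mathcal{X}}\|q(x)(s_{p_\theta}(x)-s_q(x))\|_2^2\,dx<\infty$ for all $\theta\in\Theta$. (4) $\hat\theta_n=\psi(X_1,\dots,X_n)\in\Theta$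 is an estimator of $\theta_0$ which is a functional of the empirical measure $\mathbb{Q}_n$, and $$\big(n(U_nh_{\theta_0}-\mathbb{E}[h_{\theta_0}(X,X')]),\ \sqrt{n}(U_n\nabla_\theta h_{\theta_0}-\mathbb{E}[\nabla_\theta h_{\theta_0}(X,X')]),\ \sqrt{n}(\hat\theta_n-\theta_0)\big)$$ converges weakly to a random vector $(Z_1,Z_2,Z_3)$ in $\mathbb{R}^{2p+1}$; moreover, under $H_0^C$ (i.e. $Q=P_{\theta_0}$), $\big(n\,U_nh_{\theta_0},\sqrt{n}\,U_n\nabla_\theta h_{\theta_0},\sqrt{n}(\hat\theta_n-\theta_0)\big)$ converges weakly to $(Z_1,Z_2,Z_3)$. (5) For $(Y_1,Y_2)$ with $Y_1,Y_2\in\{X,X'\}$: $\mathbb{E}[\sup_{\theta\in\Theta}\|\nabla_\theta^mh_\theta(Y_1,Y_2)\|_2^2]<\infty$ for $m\in\{0,1\}$ and $\mathbb{E}[\sup_{\theta\in\Theta}\|\nabla_\theta^mh_\theta(Y_1,Y_2)\|_1]<\infty$ for $m\in\{2,3\}$. (6) $\big(nU_n^\star h_{\theta_0,n},\ \sqrt{n}(U_n^\star\nabla_\theta h_{\theta_0}-U_n\nabla_\theta h_{\theta_0}),\ \sqrt{n}(\theta_n^\star-\hat\theta_n)\big)\overset{\star}{\to}(Z_1,Z_2,Z_3)$. Let $$\widetilde{\mathrm{KSD}}{}^2_q(p_{\theta_n^\star}):=U_n^\star h_{\theta_n^\star,n}+(\theta_n^\star-\hat\theta_n)^T\big(U_n^\star\nabla_\theta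 h_{\theta_n^\star}-U_n\nabla_\theta h_{\hat\theta_n}\big).$$ Then, under $H_0^C$ (that is, $Q=P_{\theta_0}$), $$n\,\widetilde{\mathrm{KSD}}{}^2_q(p_{\theta_n^\star})\overset{\star}{\to}Z:=Z_1+Z_2^TZ_3+Z_3^TH^*Z_3,\qquad H^*:=\Big(\frac{\partial^2}{\partial\theta_i\partial\theta_j}\mathrm{KSD}^2_q(p_\theta)\Big|_{\theta=\theta_0}\Big)_{1\le i,j\le p}.$$ Moreover, under $H_1^C$ (that is, $Q\notin\{P_\theta\}_{\theta\in\Theta}$), $n\,\widetilde{\mathrm{KSD}}{}^2_q(p_{\theta_n^\star})=O^\star(1)$.
   Context: Notation: for a density $p$, $s_p=\nabla_x\log p$. $\nabla^m_\theta f$ denotes the collection of all $m$-th order partial derivatives in $\theta$ ($\nabla^0 f=f$); expectations and norms of arrays are taken entrywise. $\overset{\star}{\to}$ denotes weak convergence conditional on almost every sequence $(X_i)_{i\in\mathbb{N}}$; $Z_n=O^\star(a_n)$ means that $Z_n/a_n$ is bounded in probability conditional on almost every sequence $(X_i)_{i\in\mathbb{N}}$. Stein class: a continuously differentiable $f:\mathcal{X}\to\mathbb{R}$ is in the Stein class of $q$ if $\int_{\mathcal{X}}\nabla_x(f(x)q(x))\,dx=0$. A positive definite kernel $k$ on $\mathcal{X}$ is in the Stein class of $q$ if it has continuous second-order partial derivatives and $k(x,\cdot)$ is in the Stein class of $q$ for every fixed $x\in\mathcal{X}$. $k$ is integrally strictly positive definite if $\int_{\mathcal{X}}\int_{\mathcal{X}}g(x)k(x,x')g(x')\,dx\,dx'>0$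 for every $g$ with $0<\int_{\mathcal{X}}g(x)^2dx<\infty$. Kernel Stein Discrepancy: for a strictly positive continuously differentiable density $p$ with support $\mathcal{X}$ and $\delta_{p,q}=s_p-s_q$ (with $\int_{\mathcal X}\|q\,\delta_{p,q}\|_2^2\,dx<\infty$ and $\mathbb{E}[\delta_{p,q}(X)^Tk(X,X')\delta_{p,q}(X')]<\infty$), $\mathrm{KSD}^2_q(p)=\mathbb{E}_{X,X'\sim q}[h_p(X,X')]$ with $X,X'$ independent and $$h_p(x,x')=s_p(x)^Tk(x,x')s_p(x')+s_p(x)^T\nabla_{x'}k(x,x')+\nabla_xk(x,x')^Ts_p(x')+\sum_{i=1}^d\frac{\partial^2}{\partial x_i\partial x_i'}k(x,x').$$ Write $h_\theta:=h_{p_\theta}$. Bootstrap: for a function $f$ of two arguments, $U_nf=\frac{1}{n(n-1)}\sum_{1\le i\ne j\le n}f(X_i,X_j)$. With $\mathbb{Q}_n=n^{-1}\sum_{i=1}^n\delta_{X_i}$, the empirically centered version of $f$ is $$f_n(\cdot,\cdot)=f(\cdot,\cdot)-\mathbb{E}_{Y\sim\mathbb{Q}_n}[f(\cdot,Y)]-\mathbb{E}_{Y\sim\mathbb{Q}_n}[f(Y,\cdot)]+\mathbb{E}_{Y,Y'\sim\mathbb{Q}_n}[f(Y',Y)],$$ with $Y,Y'$ independent; $h_{\theta,n}$ is the empirically centered version of $h_\theta$, and $h_{\theta_n^\star,n}$ is $h_{\theta,n}$ evaluated at $\theta=\theta_n^\star$. Given the data, $(X_1^\star,\dots,X_n^\star)$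 is an i.i.d. sample of size $n$ from $\mathbb{Q}_n$, $U_n^\star f=\frac{1}{n(n-1)}\sum_{1\le i\ne j\le n}f(X_i^\star,X_j^\star)$, and $\theta_n^\star=\psi(X_1^\star,\dots,X_n^\star)$. *)

theory Defs
  imports "HOL-Probability.Probability"
begin

section \<open>Partial derivatives and smoothness on a set\<close>

text \<open>
  All derivatives are taken within the domain \<open>S\<close>: ordinary derivatives at interior points,
  one-sided ones at boundary points. At some boundary points (such as cusps) the derivative within
  \<open>S\<close> need not be unique; a continuous choice is made there whenever one exists, so that a
  continuously differentiable function has a continuous derivative on \<open>S\<close>.
\<close>

definition is_deriv_field ::
  "'a::euclidean_space set \<Rightarrow> ('a \<Rightarrow> 'b::real_normed_vector) \<Rightarrow> ('a \<Rightarrow> 'a \<Rightarrow> 'b) \<Rightarrow> bool" where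
  "is_deriv_field S f D \<longleftrightarrow> (\<forall>x\<in>S. (f has_derivative D x) (at x within S))"

definition continuous_field :: "'a::euclidean_space set \<Rightarrow> ('a \<Rightarrow> 'a \<Rightarrow> 'b::real_normed_vector) \<Rightarrow> bool"
where
  "continuous_field S D \<longleftrightarrow> (\<forall>u. continuous_on S (\<lambda>x. D x u))"

definition deriv_field ::
  "'a::euclidean_space set \<Rightarrow> ('a \<Rightarrow> 'b::real_normed_vector) \<Rightarrow> 'a \<Rightarrow> 'a \<Rightarrow> 'b" where
  "deriv_field S f =
     (if \<exists>D. is_deriv_field S f D \<and> continuous_field S D
      then SOME D. is_deriv_field S f D \<and> continuous_field S D
      else (\<lambda>x. frechet_derivative f (at x within S)))"

lemma deriv_field_works:
  assumes "f differentiable_on S" and "x \<in> S"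
  shows "(f has_derivative deriv_field S f x) (at x within S)"
proof (cases "\<exists>D. is_deriv_field S f D \<and> continuous_field S D")
  case True
  then have "is_deriv_field S f (deriv_field S f)"
    unfolding deriv_field_def by (simp, metis (mono_tags, lifting) someI_ex)
  then show ?thesis
    using assms by (simp add: is_deriv_field_def)
next
  case False
  then show ?thesis
    using assms frechet_derivative_works
    by (auto simp: deriv_field_def differentiable_on_def)
qed

lemma deriv_field_interior:
  assumes "f differentiable_on S" and "x \<in> interior S"
  shows "deriv_field S f x = frechet_derivative f (at x)"
  using deriv_field_works[OF assms(1)] assms(2) interior_subset
  by (metis at_within_interior frechet_derivative_at subsetD)

text \<open>The head of the list is the outermost derivative.\<close>

primrec partials :: "'a::euclidean_space set \<Rightarrow> 'a list \<Rightarrow> ('a \<Rightarrow> 'b::real_normed_vector) \<Rightarrow> 'a \<Rightarrow> 'b"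
where
  "partials S [] f = f"
| "partials S (u # us) f = (\<lambda>x. deriv_field S (partials S us f) x u)"

definition dirs :: "nat \<Rightarrow> 'a::euclidean_space list set" where
  "dirs m = {us. set us \<subseteq> Basis \<and> length us = m}"

definition times_differentiable_on :: "nat \<Rightarrow> 'a::euclidean_space set \<Rightarrow> ('a \<Rightarrow> 'b::real_normed_vector) \<Rightarrow> bool"
where
  "times_differentiable_on m S f \<longleftrightarrow> (\<forall>l<m. \<forall>us\<in>dirs l. partials S us f differentiable_on S)"

definition C_on :: "nat \<Rightarrow> 'a::euclidean_space set \<Rightarrow> ('a \<Rightarrow> 'b::real_normed_vector) \<Rightarrow> bool" where
  "C_on m S f \<longleftrightarrow> times_differentiable_on m S f \<and> (\<forall>us\<in>dirs m. continuous_on S (partials S us f))"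

definition grad :: "(real ^ 'n) set \<Rightarrow> (real ^ 'n \<Rightarrow> real) \<Rightarrow> real ^ 'n \<Rightarrow> real ^ 'n" where
  "grad S f x = (\<chi> i. partials S [axis i 1] f x)"

definition hessian :: "(real ^ 'n) set \<Rightarrow> (real ^ 'n \<Rightarrow> real) \<Rightarrow> real ^ 'n \<Rightarrow> real ^ 'n ^ 'n" where
  "hessian S f x = (\<chi> i j. partials S [axis i 1, axis j 1] f x)"

text \<open>Entrywise norms of the array of all partial derivatives of order \<open>m\<close>.\<close>

definition nabla_norm1 ::
  "nat \<Rightarrow> 'a::euclidean_space set \<Rightarrow> ('a \<Rightarrow> 'b::euclidean_space) \<Rightarrow> 'a \<Rightarrow> real" where
  "nabla_norm1 m S f x = (\<Sum>us\<in>dirs m. \<Sum>b\<in>Basis. \<bar>partials S us f x \<bullet> b\<bar>)"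

definition nabla_norm2 ::
  "nat \<Rightarrow> 'a::euclidean_space set \<Rightarrow> ('a \<Rightarrow> 'b::euclidean_space) \<Rightarrow> 'a \<Rightarrow> real" where
  "nabla_norm2 m S f x = sqrt (\<Sum>us\<in>dirs m. \<Sum>b\<in>Basis. (partials S us f x \<bullet> b)\<^sup>2)"


section \<open>Measures on a Borel subset of Euclidean space\<close>

abbreviation leb_on :: "'a::euclidean_space set \<Rightarrow> 'a measure" where
  "leb_on S \<equiv> restrict_space lborel S"

text \<open>
  A measure on the space \<open>S\<close> has support \<open>S\<close>: every relatively open nonempty set is charged.
  For closed \<open>S\<close> this says that \<open>S\<close> is the topological support in the ambient space.
\<close>

definition full_support :: "'a::topological_space set \<Rightarrow> 'a measure \<Rightarrow> bool" where
  "full_support S \<mu> \<longleftrightarrow> (\<forall>x\<in>S. \<forall>U. open U \<and> x \<in> U \<longrightarrow> 0 < emeasure \<mu> (U \<inter> S))"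

text \<open>
  Used for suprema over uncountable parameter sets, whence the measurability requirement:
  \<open>nn_integral\<close> alone is only a lower integral.
\<close>

definition finite_mean :: "'a measure \<Rightarrow> ('a \<Rightarrow> ennreal) \<Rightarrow> bool" where
  "finite_mean M f \<longleftrightarrow> f \<in> borel_measurable M \<and> (\<integral>\<^sup>+ x. f x \<partial>M) < \<infinity>"


section \<open>Kernels, Stein class and kernel Stein discrepancy\<close>

definition score :: "(real ^ 'd) set \<Rightarrow> (real ^ 'd \<Rightarrow> real) \<Rightarrow> real ^ 'd \<Rightarrow> real ^ 'd" where
  "score S p = grad S (\<lambda>x. ln (p x))"

definition stein_class :: "(real ^ 'd) set \<Rightarrow> (real ^ 'd \<Rightarrow> real) \<Rightarrow> (real ^ 'd \<Rightarrow> real) \<Rightarrow> bool" where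
  "stein_class S q f \<longleftrightarrow> C_on 1 S f \<and>
     integrable (leb_on S) (grad S (\<lambda>x. f x * q x)) \<and>
     (\<integral>x. grad S (\<lambda>x. f x * q x) x \<partial>leb_on S) = 0"

definition pos_def_kernel :: "'a set \<Rightarrow> ('a \<Rightarrow> 'a \<Rightarrow> real) \<Rightarrow> bool" where
  "pos_def_kernel S k \<longleftrightarrow> (\<forall>x\<in>S. \<forall>y\<in>S. k x y = k y x) \<and>
     (\<forall>A c. finite A \<and> A \<subseteq> S \<longrightarrow> 0 \<le> (\<Sum>x\<in>A. \<Sum>y\<in>A. c x * c y * k x y))"

definition kernel_stein_class ::
  "(real ^ 'd) set \<Rightarrow> (real ^ 'd \<Rightarrow> real) \<Rightarrow> (real ^ 'd \<Rightarrow> real ^ 'd \<Rightarrow> real) \<Rightarrow> bool" where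
  "kernel_stein_class S q k \<longleftrightarrow> pos_def_kernel S k \<and> C_on 2 (S \<times> S) (case_prod k) \<and>
     (\<forall>x\<in>S. stein_class S q (k x))"

text \<open>
  For a merely bounded kernel the double integral need not exist for every square integrable \<open>g\<close>;
  positivity is required whenever it does.
\<close>

definition int_strictly_pos_def ::
  "'a::euclidean_space set \<Rightarrow> ('a \<Rightarrow> 'a \<Rightarrow> real) \<Rightarrow> bool" where
  "int_strictly_pos_def S k \<longleftrightarrow>
     (\<forall>g. g \<in> borel_measurable (leb_on S) \<and> integrable (leb_on S) (\<lambda>x. (g x)\<^sup>2) \<and>
          0 < (\<integral>x. (g x)\<^sup>2 \<partial>leb_on S) \<and>
          integrable (leb_on S \<Otimes>\<^sub>M leb_on S) (\<lambda>(x, x'). g x * k x x' * g x')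
        \<longrightarrow> 0 < (\<integral>x. \<integral>x'. g x * k x x' * g x' \<partial>leb_on S \<partial>leb_on S))"

definition stein_h ::
  "(real ^ 'd) set \<Rightarrow> (real ^ 'd \<Rightarrow> real ^ 'd \<Rightarrow> real) \<Rightarrow> (real ^ 'd \<Rightarrow> real) \<Rightarrow>
   real ^ 'd \<Rightarrow> real ^ 'd \<Rightarrow> real" where
  "stein_h S k p x x' =
     score S p x \<bullet> (k x x' *\<^sub>R score S p x')
   + score S p x \<bullet> (\<chi> i. partials (S \<times> S) [(0, axis i 1)] (case_prod k) (x, x'))
   + (\<chi> i. partials (S \<times> S) [(axis i 1, 0)] (case_prod k) (x, x')) \<bullet> score S p x'
   + (\<Sum>i\<in>UNIV. partials (S \<times> S) [(axis i 1, 0), (0, axis i 1)] (case_prod k) (x, x'))"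

definition KSD2 ::
  "(real ^ 'd) set \<Rightarrow> (real ^ 'd \<Rightarrow> real ^ 'd \<Rightarrow> real) \<Rightarrow> (real ^ 'd) measure \<Rightarrow>
   (real ^ 'd \<Rightarrow> real) \<Rightarrow> real" where
  "KSD2 S k Q p = (\<integral>(x, x'). stein_h S k p x x' \<partial>(Q \<Otimes>\<^sub>M Q))"

definition KSD ::
  "(real ^ 'd) set \<Rightarrow> (real ^ 'd \<Rightarrow> real ^ 'd \<Rightarrow> real) \<Rightarrow> (real ^ 'd) measure \<Rightarrow>
   (real ^ 'd \<Rightarrow> real) \<Rightarrow> real" where
  "KSD S k Q p = sqrt (KSD2 S k Q p)"

definition grad_h ::
  "(real ^ 'p) set \<Rightarrow> (real ^ 'd) set \<Rightarrow> (real ^ 'd \<Rightarrow> real ^ 'd \<Rightarrow> real) \<Rightarrow>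
   (real ^ 'p \<Rightarrow> real ^ 'd \<Rightarrow> real) \<Rightarrow> real ^ 'p \<Rightarrow> real ^ 'd \<Rightarrow> real ^ 'd \<Rightarrow> real ^ 'p" where
  "grad_h \<Theta> S k p \<theta> x x' = grad \<Theta> (\<lambda>t. stein_h S k (p t) x x') \<theta>"


section \<open>U-statistics and the bootstrap\<close>

text \<open>A sample of size \<open>n\<close> consists of the values at the indices \<open>0, \<dots>, n - 1\<close>.\<close>

definition Ustat :: "nat \<Rightarrow> ('a \<Rightarrow> 'a \<Rightarrow> 'b::real_vector) \<Rightarrow> (nat \<Rightarrow> 'a) \<Rightarrow> 'b" where
  "Ustat n f x = (1 / (real n * (real n - 1))) *\<^sub>R (\<Sum>i<n. \<Sum>j\<in>{..<n} - {i}. f (x i) (x j))"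

definition empirical :: "nat \<Rightarrow> (nat \<Rightarrow> 'a) \<Rightarrow> 'a pmf" where
  "empirical n x = map_pmf x (pmf_of_set {..<n})"

definition centered :: "'a pmf \<Rightarrow> ('a \<Rightarrow> 'a \<Rightarrow> real) \<Rightarrow> 'a \<Rightarrow> 'a \<Rightarrow> real" where
  "centered P f a b = f a b - measure_pmf.expectation P (\<lambda>y. f a y)
     - measure_pmf.expectation P (\<lambda>y. f y b)
     + measure_pmf.expectation (pair_pmf P P) (\<lambda>(y, y'). f y' y)"

text \<open>The conditional law, given the data \<open>x\<close>, of the bootstrap sample of size \<open>n\<close>.\<close>

definition bootstrap :: "nat \<Rightarrow> (nat \<Rightarrow> 'a) \<Rightarrow> (nat \<Rightarrow> 'a) pmf" where
  "bootstrap n x = Pi_pmf {..<n} undefined (\<lambda>_. empirical n x)"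

text \<open>The statistic, as a function of the data \<open>x\<close> and of the bootstrap sample \<open>y\<close>.\<close>

definition KSD2_boot ::
  "(real ^ 'p) set \<Rightarrow> (real ^ 'd) set \<Rightarrow> (real ^ 'd \<Rightarrow> real ^ 'd \<Rightarrow> real) \<Rightarrow>
   (real ^ 'p \<Rightarrow> real ^ 'd \<Rightarrow> real) \<Rightarrow> ((real ^ 'd) pmf \<Rightarrow> real ^ 'p) \<Rightarrow>
   nat \<Rightarrow> (nat \<Rightarrow> real ^ 'd) \<Rightarrow> (nat \<Rightarrow> real ^ 'd) \<Rightarrow> real" where
  "KSD2_boot \<Theta> S k p \<psi> n x y =
     (let \<theta>hat = \<psi> (empirical n x); \<theta>star = \<psi> (empirical n y) in
        Ustat n (centered (empirical n x) (stein_h S k (p \<theta>star))) y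
      + (\<theta>star - \<theta>hat) \<bullet> (Ustat n (grad_h \<Theta> S k p \<theta>star) y - Ustat n (grad_h \<Theta> S k p \<theta>hat) x))"


section \<open>Modes of convergence\<close>

definition weakly_converges ::
  "(nat \<Rightarrow> 'a::topological_space measure) \<Rightarrow> 'a measure \<Rightarrow> bool" where
  "weakly_converges \<mu> \<nu> \<longleftrightarrow>
     (\<forall>f::'a \<Rightarrow> real. continuous_on UNIV f \<and> bounded (range f) \<longrightarrow>
        (\<lambda>n. \<integral>x. f x \<partial>\<mu> n) \<longlonglongrightarrow> (\<integral>x. f x \<partial>\<nu>))"

lemma weakly_converges_iff_weak_conv_m:
  fixes \<mu> :: "nat \<Rightarrow> real measure"
  assumes \<mu>: "\<And>n. real_distribution (\<mu> n)" and \<nu>: "real_distribution \<nu>"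
  shows "weakly_converges \<mu> \<nu> \<longleftrightarrow> weak_conv_m \<mu> \<nu>"
proof
  assume *: "weakly_converges \<mu> \<nu>"
  show "weak_conv_m \<mu> \<nu>"
  proof (rule integral_cts_step_conv_imp_weak_conv[OF \<mu> \<nu>])
    fix x y :: real
    assume "x < y"
    have "bounded (range (cts_step x y))"
      by (rule boundedI[of _ 1]) (use \<open>x < y\<close> in \<open>auto simp: cts_step_def field_simps\<close>)
    moreover have "continuous_on UNIV (cts_step x y)"
      using cts_step_uniformly_continuous[OF \<open>x < y\<close>] uniformly_continuous_imp_continuous by blast
    ultimately show "(\<lambda>n. integral\<^sup>L (\<mu> n) (cts_step x y)) \<longlonglongrightarrow> integral\<^sup>L \<nu> (cts_step x y)"
      using * by (auto simp: weakly_converges_def)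
  qed
next
  assume *: "weak_conv_m \<mu> \<nu>"
  show "weakly_converges \<mu> \<nu>"
    unfolding weakly_converges_def
  proof (intro allI impI)
    fix f :: "real \<Rightarrow> real"
    assume f: "continuous_on UNIV f \<and> bounded (range f)"
    then obtain B where "\<And>x. norm (f x) \<le> B"
      by (auto simp: bounded_iff)
    moreover have "isCont f x" for x
      using f by (simp add: continuous_on_eq_continuous_at)
    ultimately show "(\<lambda>n. integral\<^sup>L (\<mu> n) f) \<longlonglongrightarrow> integral\<^sup>L \<nu> f"
      using weak_conv_imp_integral_bdd_continuous_conv[OF \<mu> \<nu> *] by blast
  qed
qed

text \<open>
  Conditional statements given almost every realisation of the data sequence \<open>X\<close>; \<open>T n x y\<close> is a
  statistic of the data \<open>x\<close> and of the bootstrap sample \<open>y\<close>.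
\<close>

definition boot_weakly_converges ::
  "'w measure \<Rightarrow> (nat \<Rightarrow> 'w \<Rightarrow> 'a) \<Rightarrow> (nat \<Rightarrow> (nat \<Rightarrow> 'a) \<Rightarrow> (nat \<Rightarrow> 'a) \<Rightarrow> 'b::topological_space) \<Rightarrow>
   'b measure \<Rightarrow> bool" where
  "boot_weakly_converges M X T \<nu> \<longleftrightarrow>
     (AE \<omega> in M. weakly_converges
        (\<lambda>n. distr (measure_pmf (bootstrap n (\<lambda>i. X i \<omega>))) borel (T n (\<lambda>i. X i \<omega>))) \<nu>)"

definition boot_bigo ::
  "'w measure \<Rightarrow> (nat \<Rightarrow> 'w \<Rightarrow> 'a) \<Rightarrow> (nat \<Rightarrow> (nat \<Rightarrow> 'a) \<Rightarrow> (nat \<Rightarrow> 'a) \<Rightarrow> real) \<Rightarrow>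
   (nat \<Rightarrow> real) \<Rightarrow> bool" where
  "boot_bigo M X T a \<longleftrightarrow>
     (AE \<omega> in M. \<forall>\<epsilon>>0. \<exists>C. \<forall>n.
        measure_pmf.prob (bootstrap n (\<lambda>i. X i \<omega>)) {y. C < \<bar>T n (\<lambda>i. X i \<omega>) y / a n\<bar>} \<le> \<epsilon>)"

end

theory Submission
  imports Defs
begin

text \<open>
  The expansion of the statistic around \<open>\<theta>\<^sub>0\<close> needs \<open>\<psi> (empirical n x) \<longlonglongrightarrow> \<theta>\<^sub>0\<close> for almost every
  data sequence, whereas the central limit theorem only gives convergence in probability. The
  bootstrap hypothesis supplies the rest. Let \<open>f n x\<close> be the distance of the estimator to \<open>\<theta>\<^sub>0\<close>. The bootstrap
  mean of a clipped multiple of \<open>sqrt n * f n\<close> at a given level is a function of the data whose conditional variance,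
  given the first \<open>s\<close> observations, is controlled by the bootstrap variance (Efron-Stein combined with
  Bessel's inequality over the indices that a resample misses). By tightness of the
  bootstrap this variance is small. Hence the martingale of conditional means can pass to each
  further level only with probability at most \<open>1 / 16\<close>, so that \<open>f n > a\<close> has probability
  exponentially small in \<open>sqrt n\<close>, up to one event not depending on \<open>n\<close>.

  With consistency at hand, the statistic is expanded to second order. The strong law for
  U-statistics (a reverse-martingale maximal inequality) bounds the empirical averages of the
  suprema of the derivatives, and moments under the finite bootstrap law show that all remainder
  terms vanish in probability; second derivatives are only integrable and have to be truncated.
  The leading terms form a continuous function of the vector in the bootstrap central limit theorem,
  and the boundedness in probability is the tightness of a weakly convergent sequence.
\<close>

section \<open>Conditioning an i.i.d. sequence on its first coordinates\<close>

text \<open>The estimator is an arbitrary functional of the empirical measure, so its values at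
  different sample sizes are unrelated and no maximal inequality joins them: almost sure convergence
  can only come from probabilities summable in n, while tightness gives fixed small ones. The range
  of \<open>sqrt n * f n\<close> up to \<open>a * sqrt n\<close> is therefore cut into levels of
  constant width, about \<open>sqrt n\<close> of them; one factor \<open>1 / 16\<close> per level is
  summable. Tightness of the bootstrap holds off an event that involves the whole sequence, so the
  martingales are followed only while the conditional probability of that event stays below
  \<open>1 / 4096\<close>. A resample misses a given observation with probability near 1/e, so the
  bootstrap already contains the perturbations that Efron-Stein needs, whatever the statistic. In
  the expansion the centered U-statistic loses its first and second order terms; the quadratic form
  in the Hessian has weight 1, not 1/2, because it comes entirely from the gradient difference added
  to the statistic.\<close>

lemma (in prob_space) square_integral_le:
  fixes f :: "'a \<Rightarrow> real"
  assumes "integrable M (\<lambda>x. (f x)\<^sup>2)" "integrable M f"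
  shows "(\<integral>x. f x \<partial>M)\<^sup>2 \<le> (\<integral>x. (f x)\<^sup>2 \<partial>M)"
  using variance_positive[of f] variance_eq[OF assms(2) assms(1)] by simp

text \<open>The bound holds at every point, not only almost everywhere or on the space: it then
  passes to compositions, sections and partial integrals with no null sets to track.\<close>

definition bounded_meas :: "'a measure \<Rightarrow> ('a \<Rightarrow> real) \<Rightarrow> bool" where
  "bounded_meas N f \<longleftrightarrow> f \<in> borel_measurable N \<and> (\<exists>B. \<forall>x. \<bar>f x\<bar> \<le> B)"

lemma bounded_measI: "f \<in> borel_measurable N \<Longrightarrow> (\<And>x. \<bar>f x\<bar> \<le> B) \<Longrightarrow> bounded_meas N f"
  by (auto simp: bounded_meas_def)

lemma bounded_meas_measurable: "bounded_meas N f \<Longrightarrow> f \<in> borel_measurable N"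
  by (simp add: bounded_meas_def)

lemma bounded_measE:
  assumes "bounded_meas N f" obtains B where "0 \<le> B" "\<And>x. \<bar>f x\<bar> \<le> B"
  using assms unfolding bounded_meas_def by (meson abs_ge_zero order_trans)

lemma bounded_meas_diff:
  assumes "bounded_meas N f" "bounded_meas N g" shows "bounded_meas N (\<lambda>x. f x - g x)"
proof -
  obtain B C where "\<And>x. \<bar>f x\<bar> \<le> B" "\<And>x. \<bar>g x\<bar> \<le> C"
    using assms by (metis bounded_measE)
  then have "\<bar>f x - g x\<bar> \<le> B + C" for x by (metis abs_triangle_ineq4 add_mono order_trans)
  with assms show ?thesis by (intro bounded_measI[of _ _ "B + C"]) (auto simp: bounded_meas_def)
qed

lemma bounded_meas_mult:
  assumes "bounded_meas N f" "bounded_meas N g" shows "bounded_meas N (\<lambda>x. f x * g x)"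
proof -
  obtain B C where B: "0 \<le> B" "\<And>x. \<bar>f x\<bar> \<le> B" and C: "\<And>x. \<bar>g x\<bar> \<le> C"
    using assms by (metis bounded_measE)
  then have "\<bar>f x * g x\<bar> \<le> B * C" for x by (auto simp: abs_mult intro!: mult_mono)
  with assms show ?thesis by (intro bounded_measI[of _ _ "B * C"]) (auto simp: bounded_meas_def)
qed

lemma bounded_meas_power2: "bounded_meas N f \<Longrightarrow> bounded_meas N (\<lambda>x. (f x)\<^sup>2)"
  unfolding power2_eq_square by (rule bounded_meas_mult)

lemma bounded_meas_compose:
  "bounded_meas N f \<Longrightarrow> g \<in> measurable N' N \<Longrightarrow> bounded_meas N' (\<lambda>x. f (g x))"
  by (auto simp: bounded_meas_def intro: measurable_compose)

lemma (in finite_measure) bounded_meas_integrable: "bounded_meas M f \<Longrightarrow> integrable M f"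
  unfolding bounded_meas_def by (elim conjE exE, rule integrable_const_bound) auto

lemma (in prob_space) abs_integral_le_bound:
  fixes f :: "'a \<Rightarrow> real"
  assumes "\<And>x. \<bar>f x\<bar> \<le> B" "0 \<le> B" shows "\<bar>\<integral>x. f x \<partial>M\<bar> \<le> B"
proof (cases "integrable M f")
  case True
  have "\<bar>\<integral>x. f x \<partial>M\<bar> \<le> (\<integral>x. \<bar>f x\<bar> \<partial>M)" by (rule integral_abs_bound)
  also have "\<dots> \<le> (\<integral>x. B \<partial>M)" using True assms by (intro integral_mono) auto
  finally show ?thesis by (simp add: prob_space)
next
  case False then show ?thesis using assms by (simp add: not_integrable_integral_eq)
qed

lemma (in prob_space) bounded_meas_partial_integral:
  assumes "bounded_meas (N \<Otimes>\<^sub>M M) (case_prod f)"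
  shows "bounded_meas N (\<lambda>x. \<integral>y. f x y \<partial>M)"
proof -
  obtain B where B: "0 \<le> B" "\<And>z. \<bar>case_prod f z\<bar> \<le> B" using assms by (metis bounded_measE)
  have [measurable]: "case_prod f \<in> borel_measurable (N \<Otimes>\<^sub>M M)" using assms by (simp add: bounded_meas_def)
  show ?thesis
    by (rule bounded_measI[of _ _ B]) (use B in \<open>auto intro!: abs_integral_le_bound\<close>)
qed

text \<open>Dependence on the first \<open>n\<close> coordinates in pointwise form. With
  \<open>comb_seq\<close> splicing sequences it takes the place of a filtration.\<close>

definition depends_below :: "nat \<Rightarrow> ((nat \<Rightarrow> 'a) \<Rightarrow> 'b) \<Rightarrow> bool" where
  "depends_below n G \<longleftrightarrow> (\<forall>x y. (\<forall>i<n. x i = y i) \<longrightarrow> G x = G y)"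

lemma depends_belowD: "depends_below n G \<Longrightarrow> (\<And>i. i < n \<Longrightarrow> x i = y i) \<Longrightarrow> G x = G y"
  by (auto simp: depends_below_def)

lemma depends_below_comb_seq:
  "depends_below n G \<Longrightarrow> n \<le> s \<Longrightarrow> G (comb_seq s x z) = G x"
  by (erule depends_belowD) (auto simp: comb_seq_def)

section \<open>Conditional expectations on sequence space and the Efron-Stein inequality\<close>

context sequence_space begin

lemma integral_iter:
  assumes "bounded_meas S F"
  shows "(\<integral>x. F x \<partial>S) = (\<integral>a. \<integral>z. F (case_nat a z) \<partial>S \<partial>M)"
proof -
  interpret pair: pair_prob_space M S ..
  have [measurable]: "F \<in> borel_measurable S" using assms by (simp add: bounded_meas_def)
  have "(\<integral>x. F x \<partial>S) = (\<integral>x. F x \<partial>(distr (M \<Otimes>\<^sub>M S) S (\<lambda>(s, \<omega>). case_nat s \<omega>)))"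
    by (simp only: PiM_iter)
  also have "\<dots> = (\<integral>x. F (case_nat (fst x) (snd x)) \<partial>(M \<Otimes>\<^sub>M S))"
    by (subst integral_distr) (auto simp: case_prod_beta)
  also have "\<dots> = (\<integral>a. \<integral>z. F (case_nat a z) \<partial>S \<partial>M)"
  proof -
    have "integrable (M \<Otimes>\<^sub>M S) (\<lambda>x. F (case_nat (fst x) (snd x)))"
      by (rule pair.P.bounded_meas_integrable, rule bounded_meas_compose[of S F]) (use assms in simp_all)
    from pair.integral_fst'[OF this] show ?thesis by (simp only: fst_conv snd_conv)
  qed
  finally show ?thesis .
qed

text \<open>A version of the conditional expectation given the first \<open>s\<close> coordinates,
  defined at every point: the coordinates from \<open>s\<close> on are replaced by an independent
  copy and integrated out.\<close>

definition cond :: "nat \<Rightarrow> ((nat \<Rightarrow> 'a) \<Rightarrow> real) \<Rightarrow> (nat \<Rightarrow> 'a) \<Rightarrow> real" where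
  "cond s G x = (\<integral>z. G (comb_seq s x z) \<partial>S)"

lemma bounded_meas_comb_seq:
  "bounded_meas S G \<Longrightarrow> x \<in> space S \<Longrightarrow> bounded_meas S (\<lambda>z. G (comb_seq s x z))"
  by (erule bounded_meas_compose) simp

lemma bounded_meas_cond:
  assumes "bounded_meas S G" shows "bounded_meas S (cond s G)"
  unfolding cond_def
proof (rule P.bounded_meas_partial_integral)
  have "(\<lambda>x. G (comb_seq s (fst x) (snd x))) \<in> borel_measurable (S \<Otimes>\<^sub>M S)"
    using bounded_meas_measurable[OF assms] by measurable
  with assms show "bounded_meas (S \<Otimes>\<^sub>M S) (\<lambda>(x, y). G (comb_seq s x y))"
    by (auto simp: bounded_meas_def case_prod_beta)
qed

lemma integral_cond:
  assumes "bounded_meas S G"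
  shows "(\<integral>x. cond s G x \<partial>S) = (\<integral>x. G x \<partial>S)"
proof -
  interpret pair: pair_prob_space S S ..
  have [measurable]: "G \<in> borel_measurable S" using assms by (simp add: bounded_meas_def)
  have "(\<integral>x. G x \<partial>S) = (\<integral>x. G x \<partial>(distr (S \<Otimes>\<^sub>M S) S (\<lambda>(x, z). comb_seq s x z)))"
    by (simp only: PiM_comb_seq)
  also have "\<dots> = (\<integral>x. G (comb_seq s (fst x) (snd x)) \<partial>(S \<Otimes>\<^sub>M S))"
    by (subst integral_distr) (auto simp: case_prod_beta)
  also have "\<dots> = (\<integral>x. cond s G x \<partial>S)"
  proof -
    have "integrable (S \<Otimes>\<^sub>M S) (\<lambda>x. G (comb_seq s (fst x) (snd x)))"
      by (rule pair.P.bounded_meas_integrable, rule bounded_meas_compose[of S G]) (use assms in simp_all)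
    from pair.integral_fst'[OF this] show ?thesis by (simp only: fst_conv snd_conv cond_def)
  qed
  finally show ?thesis by simp
qed

text \<open>Taking out what is known: with \<open>u\<close> a function of the first \<open>s\<close>
  coordinates, this is the defining property of conditional expectation.\<close>

lemma integral_cond_mult:
  assumes "bounded_meas S u" "bounded_meas S G" "depends_below s u"
  shows "(\<integral>x. u x * cond s G x \<partial>S) = (\<integral>x. u x * G x \<partial>S)"
proof -
  have "cond s (\<lambda>x. u x * G x) x = u x * cond s G x" for x
    using assms(3) by (simp add: cond_def depends_below_comb_seq)
  with integral_cond[OF bounded_meas_mult[OF assms(1,2)], of s] show ?thesis by simp
qed

lemma depends_below_cond: "depends_below s (cond s G)"
  unfolding depends_below_def cond_def
proof (intro allI impI)
  fix x y :: "nat \<Rightarrow> 'a" assume "\<forall>i<s. x i = y i"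
  then have "comb_seq s x = comb_seq s y" by (auto simp: comb_seq_def fun_eq_iff)
  then show "(\<integral>z. G (comb_seq s x z) \<partial>S) = (\<integral>z. G (comb_seq s y z) \<partial>S)" by simp
qed

lemma case_nat_upd: "(case_nat a z)(Suc i := b) = case_nat a (z(i := b))"
  by (auto simp: fun_eq_iff split: nat.split)

text \<open>
  Any functions \<open>\<phi> i\<close> that ignore the coordinate \<open>i\<close> will do; they need not be conditional means.
\<close>

theorem efron_stein:
  assumes "bounded_meas S G" "depends_below n G"
    and "\<And>i. i < n \<Longrightarrow> bounded_meas S (\<phi> i)" "\<And>i x a. i < n \<Longrightarrow> \<phi> i (x(i := a)) = \<phi> i x"
  shows "(\<integral>x. (G x)\<^sup>2 \<partial>S) - (\<integral>x. G x \<partial>S)\<^sup>2 \<le> (\<Sum>i<n. \<integral>x. (G x - \<phi> i x)\<^sup>2 \<partial>S)"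
  using assms
proof (induction n arbitrary: G \<phi>)
  case 0
  have G: "G = (\<lambda>x. G undefined)"
  proof
    fix x show "G x = G undefined" using 0(2) by (auto simp: depends_below_def)
  qed
  have "(\<integral>x. (G x)\<^sup>2 \<partial>S) = (\<integral>x. G x \<partial>S)\<^sup>2"
    by (subst (1 2) G) (simp add: P.prob_space)
  then show ?case by simp
next
  case (Suc n)
  interpret pair: pair_prob_space M S ..
  note G = Suc.prems(1) and \<phi> = Suc.prems(3)
  \<comment> \<open>Coordinate 0 is split off: \<open>m\<close> is the mean given that coordinate,
    and the same mean of \<open>\<phi> 0\<close> is a constant \<open>c\<close>, since
    \<open>\<phi> 0\<close> ignores it.\<close>
  define m where "m a = (\<integral>z. G (case_nat a z) \<partial>S)" for a
  define c where "c = (\<integral>z. \<phi> 0 (case_nat undefined z) \<partial>S)"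
  have c: "(\<integral>z. \<phi> 0 (case_nat a z) \<partial>S) = c" for a
  proof -
    have "\<phi> 0 (case_nat a z) = \<phi> 0 (case_nat undefined z)" for z
    proof -
      have "case_nat a z = (case_nat undefined z)(0 := a)" by (auto simp: fun_eq_iff split: nat.split)
      then show ?thesis using Suc.prems(4)[OF zero_less_Suc, of "case_nat undefined z" a] by (simp only:)
    qed
    then show ?thesis by (simp add: c_def)
  qed
  have sec: "bounded_meas S (\<lambda>z. F (case_nat a z))" if "a \<in> space M" "bounded_meas S F" for a F
    by (rule bounded_meas_compose[of S F]) (use that in auto)
  have part: "bounded_meas M (\<lambda>a. \<integral>z. F (case_nat a z) \<partial>S)" if "bounded_meas S F" for F
  proof (rule P.bounded_meas_partial_integral)
    have "(\<lambda>x. F (case_nat (fst x) (snd x))) \<in> borel_measurable (M \<Otimes>\<^sub>M S)"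
      using bounded_meas_measurable[OF that] by measurable
    with that show "bounded_meas (M \<Otimes>\<^sub>M S) (\<lambda>(x, y). F (case_nat x y))"
      by (auto simp: bounded_meas_def case_prod_beta)
  qed
  have m: "bounded_meas M m" unfolding m_def by (rule part[OF G])
  have d2: "bounded_meas S (\<lambda>x. (G x - \<phi> i x)\<^sup>2)" if "i < Suc n" for i
    using that by (intro bounded_meas_power2 bounded_meas_diff G \<phi>)
  \<comment> \<open>The induction hypothesis for the remaining coordinates, with the first one
    frozen at \<open>a\<close>; the comparison functions shift by one.\<close>
  have step: "(\<integral>z. (G (case_nat a z))\<^sup>2 \<partial>S) \<le> (m a)\<^sup>2 + (\<Sum>i<n. \<integral>z. (G (case_nat a z) - \<phi> (Suc i) (case_nat a z))\<^sup>2 \<partial>S)"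
    if a: "a \<in> space M" for a
  proof -
    have "(\<integral>z. (G (case_nat a z))\<^sup>2 \<partial>S) - (\<integral>z. G (case_nat a z) \<partial>S)\<^sup>2
        \<le> (\<Sum>i<n. \<integral>z. (G (case_nat a z) - \<phi> (Suc i) (case_nat a z))\<^sup>2 \<partial>S)"
    proof (rule Suc.IH)
      show "depends_below n (\<lambda>z. G (case_nat a z))"
        unfolding depends_below_def
      proof (intro allI impI)
        fix x y :: "nat \<Rightarrow> 'a" assume "\<forall>i<n. x i = y i"
        then show "G (case_nat a x) = G (case_nat a y)"
          by (intro depends_belowD[OF Suc.prems(2)]) (auto split: nat.split)
      qed
      show "bounded_meas S (\<lambda>z. G (case_nat a z))" using a G by (rule sec)
      show "bounded_meas S (\<lambda>z. \<phi> (Suc i) (case_nat a z))" if "i < n" for i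
        using a \<phi> that by (intro sec) auto
      show "\<phi> (Suc i) (case_nat a (x(i := b))) = \<phi> (Suc i) (case_nat a x)" if "i < n" for i x b
        using Suc.prems(4)[of "Suc i" "case_nat a x" b] that by (simp only: case_nat_upd)
    qed
    then show ?thesis by (simp add: m_def)
  qed
  have "(\<integral>x. (G x)\<^sup>2 \<partial>S) = (\<integral>a. \<integral>z. (G (case_nat a z))\<^sup>2 \<partial>S \<partial>M)"
    by (rule integral_iter[OF bounded_meas_power2[OF G]])
  also have "\<dots> \<le> (\<integral>a. (m a)\<^sup>2 + (\<Sum>i<n. \<integral>z. (G (case_nat a z) - \<phi> (Suc i) (case_nat a z))\<^sup>2 \<partial>S) \<partial>M)"
    using step part[OF bounded_meas_power2[OF G]] bounded_meas_power2[OF m] part[OF d2]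
    by (intro integral_mono Bochner_Integration.integrable_add Bochner_Integration.integrable_sum
        M.bounded_meas_integrable) auto
  also have "\<dots> = (\<integral>a. (m a)\<^sup>2 \<partial>M) + (\<Sum>i<n. \<integral>a. \<integral>z. (G (case_nat a z) - \<phi> (Suc i) (case_nat a z))\<^sup>2 \<partial>S \<partial>M)"
    using M.bounded_meas_integrable[OF bounded_meas_power2[OF m]] M.bounded_meas_integrable[OF part[OF d2]]
    by (subst Bochner_Integration.integral_add)
       (auto intro!: Bochner_Integration.integrable_sum Bochner_Integration.integral_sum)
  also have "(\<Sum>i<n. \<integral>a. \<integral>z. (G (case_nat a z) - \<phi> (Suc i) (case_nat a z))\<^sup>2 \<partial>S \<partial>M) = (\<Sum>i<n. \<integral>x. (G x - \<phi> (Suc i) x)\<^sup>2 \<partial>S)"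
    by (intro sum.cong refl integral_iter[symmetric] d2) auto
  finally have 1: "(\<integral>x. (G x)\<^sup>2 \<partial>S) \<le> (\<integral>a. (m a)\<^sup>2 \<partial>M) + (\<Sum>i<n. \<integral>x. (G x - \<phi> (Suc i) x)\<^sup>2 \<partial>S)" .
  have mean: "(\<integral>x. G x \<partial>S) = (\<integral>a. m a \<partial>M)" unfolding m_def by (rule integral_iter[OF G])
  have mi: "integrable M m" "integrable M (\<lambda>a. (m a)\<^sup>2)"
    using m bounded_meas_power2[OF m] by (auto intro: M.bounded_meas_integrable)
  \<comment> \<open>The variance is at most the mean square distance to any constant; the choice
    \<open>c\<close> turns this, by Jensen, into the summand of index 0.\<close>
  have "(\<integral>a. (m a)\<^sup>2 \<partial>M) - (\<integral>a. m a \<partial>M)\<^sup>2 \<le> (\<integral>a. (m a - c)\<^sup>2 \<partial>M)"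
  proof -
    have "(\<integral>a. (m a - c)\<^sup>2 \<partial>M) = (\<integral>a. (m a)\<^sup>2 - 2 * c * m a + c\<^sup>2 \<partial>M)"
      by (simp add: power2_diff mult_ac add.commute add_diff_eq)
    also have "\<dots> = (\<integral>a. (m a)\<^sup>2 \<partial>M) - 2 * c * (\<integral>a. m a \<partial>M) + c\<^sup>2"
      using mi by (simp add: M.prob_space)
    finally show ?thesis using zero_le_power2[of "(\<integral>a. m a \<partial>M) - c", unfolded power2_diff] by (simp add: mult_ac)
  qed
  also have "\<dots> \<le> (\<integral>a. \<integral>z. (G (case_nat a z) - \<phi> 0 (case_nat a z))\<^sup>2 \<partial>S \<partial>M)"
  proof (rule integral_mono)
    show "integrable M (\<lambda>a. (m a - c)\<^sup>2)"
      by (intro M.bounded_meas_integrable bounded_meas_power2 bounded_meas_diff m bounded_measI[of "\<lambda>_. c" _ "\<bar>c\<bar>"]) auto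
    show "integrable M (\<lambda>a. \<integral>z. (G (case_nat a z) - \<phi> 0 (case_nat a z))\<^sup>2 \<partial>S)"
      by (intro M.bounded_meas_integrable part d2) simp
    fix a assume a: "a \<in> space M"
    have "m a - c = (\<integral>z. G (case_nat a z) - \<phi> 0 (case_nat a z) \<partial>S)"
      using a G \<phi>[of 0] by (simp add: m_def c[of a, symmetric] P.bounded_meas_integrable sec)
    moreover have "bounded_meas S (\<lambda>z. G (case_nat a z) - \<phi> 0 (case_nat a z))"
      using a G \<phi>[of 0] by (intro bounded_meas_diff sec) auto
    ultimately show "(m a - c)\<^sup>2 \<le> (\<integral>z. (G (case_nat a z) - \<phi> 0 (case_nat a z))\<^sup>2 \<partial>S)"
      using P.square_integral_le[of "\<lambda>z. G (case_nat a z) - \<phi> 0 (case_nat a z)"]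
      by (simp add: P.bounded_meas_integrable bounded_meas_power2)
  qed
  also have "\<dots> = (\<integral>x. (G x - \<phi> 0 x)\<^sup>2 \<partial>S)"
    by (rule integral_iter[symmetric, OF d2]) simp
  finally show ?case using 1 mean
    unfolding sum.lessThan_Suc_shift[of "\<lambda>i. \<integral>x. (G x - \<phi> i x)\<^sup>2 \<partial>S" n] by simp
qed

end

section \<open>Bootstrap means and resampling\<close>

text \<open>
  Bessel's inequality for the centered indicators of the \<open>E i\<close>: their correlations are nonpositive, which only helps.
\<close>

lemma pmf_bessel:
  fixes J :: "'i pmf" and H :: "'i \<Rightarrow> real" and E :: "nat \<Rightarrow> 'i set"
  assumes fin: "finite (set_pmf J)" and \<pi>: "\<pi> > 0"
    and E1: "\<And>i. i < n \<Longrightarrow> measure_pmf.prob J (E i) = \<pi>"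
    and E2: "\<And>i j. i < n \<Longrightarrow> j < n \<Longrightarrow> i \<noteq> j \<Longrightarrow> measure_pmf.prob J (E i \<inter> E j) = \<rho>"
    and \<rho>: "0 \<le> \<rho>" "\<rho> \<le> \<pi>\<^sup>2"
  defines "\<mu> \<equiv> measure_pmf.expectation J H"
  shows "(\<Sum>i<n. (\<mu> - measure_pmf.expectation J (\<lambda>I. H I * indicator (E i) I) / \<pi>)\<^sup>2)
     \<le> measure_pmf.expectation J (\<lambda>I. (H I - \<mu>)\<^sup>2) / \<pi>"
proof -
  have int[simp]: "integrable (measure_pmf J) f" for f :: "'i \<Rightarrow> real"
    by (rule integrable_measure_pmf_finite[OF fin])
  let ?ex = "measure_pmf.expectation J"
  define e where "e i I = (indicator (E i) I :: real)" for i I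
  \<comment> \<open>\<open>c i\<close> is the covariance of \<open>H\<close> with the indicator of
    \<open>E i\<close>; the combination \<open>W\<close> of centered indicators will be subtracted
    from \<open>H\<close>.\<close>
  define c where "c i = ?ex (\<lambda>I. (H I - \<mu>) * e i I)" for i
  define W where "W I = (\<Sum>i<n. c i * (e i I - \<pi>))" for I
  define C where "C = (\<Sum>i<n. (c i)\<^sup>2)"
  have C0: "0 \<le> C" by (simp add: C_def sum_nonneg)
  have ee: "?ex (e i) = \<pi>" if "i < n" for i using E1[OF that] by (simp add: e_def[abs_def])
  have ee2: "?ex (\<lambda>I. e i I * e j I) = (if i = j then \<pi> else \<rho>)" if "i < n" "j < n" for i j
  proof -
    have "(\<lambda>I. e i I * e j I) = indicator (E i \<inter> E j)" by (auto simp: e_def indicator_def)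
    then show ?thesis using E1[OF that(1)] E2[OF that] by auto
  qed
  have m0: "?ex (\<lambda>I. H I - \<mu>) = 0" by (simp add: \<mu>_def)
  have "?ex (\<lambda>I. (H I - \<mu>) * W I) = (\<Sum>i<n. c i * ?ex (\<lambda>I. (H I - \<mu>) * (e i I - \<pi>)))"
  proof -
    have "(\<lambda>I. (H I - \<mu>) * W I) = (\<lambda>I. \<Sum>i<n. c i * ((H I - \<mu>) * (e i I - \<pi>)))"
      by (simp add: W_def sum_distrib_left mult_ac)
    then show ?thesis by simp
  qed
  also have "\<dots> = C"
  proof -
    have "?ex (\<lambda>I. (H I - \<mu>) * (e i I - \<pi>)) = c i" for i
    proof -
      have "(\<lambda>I. (H I - \<mu>) * (e i I - \<pi>)) = (\<lambda>I. (H I - \<mu>) * e i I - \<pi> * (H I - \<mu>))"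
        by (simp add: algebra_simps)
      then have "?ex (\<lambda>I. (H I - \<mu>) * (e i I - \<pi>)) = c i - \<pi> * ?ex (\<lambda>I. H I - \<mu>)"
        unfolding c_def by (simp del: Bochner_Integration.integral_diff add: Bochner_Integration.integral_diff[OF int int])
      then show ?thesis by (simp add: m0)
    qed
    then show ?thesis by (simp add: C_def power2_eq_square)
  qed
  finally have HW: "?ex (\<lambda>I. (H I - \<mu>) * W I) = C" .
  have "?ex (\<lambda>I. (W I)\<^sup>2) = (\<Sum>i<n. \<Sum>j<n. c i * c j * ?ex (\<lambda>I. (e i I - \<pi>) * (e j I - \<pi>)))"
  proof -
    have "(\<lambda>I. (W I)\<^sup>2) = (\<lambda>I. \<Sum>i<n. \<Sum>j<n. c i * c j * ((e i I - \<pi>) * (e j I - \<pi>)))"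
      by (simp add: W_def power2_eq_square sum_product mult_ac)
    then show ?thesis by simp
  qed
  also have "\<dots> = (\<Sum>i<n. \<Sum>j<n. c i * c j * (if i = j then \<pi> - \<rho> else 0) + (\<rho> - \<pi>\<^sup>2) * (c i * c j))"
  proof (intro sum.cong refl)
    fix i j assume ij: "i \<in> {..<n}" "j \<in> {..<n}"
    have "(\<lambda>I. (e i I - \<pi>) * (e j I - \<pi>)) = (\<lambda>I. e i I * e j I - \<pi> * e i I - \<pi> * e j I + \<pi>\<^sup>2)"
      by (auto simp: algebra_simps power2_eq_square)
    then have "?ex (\<lambda>I. (e i I - \<pi>) * (e j I - \<pi>)) = (if i = j then \<pi> else \<rho>) - \<pi>\<^sup>2"
      using ij by (simp add: ee ee2 power2_eq_square)
    then show "c i * c j * ?ex (\<lambda>I. (e i I - \<pi>) * (e j I - \<pi>)) = c i * c j * (if i = j then \<pi> - \<rho> else 0) + (\<rho> - \<pi>\<^sup>2) * (c i * c j)"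
      by (simp only:) (simp add: algebra_simps)
  qed
  also have "\<dots> = (\<pi> - \<rho>) * C + (\<rho> - \<pi>\<^sup>2) * (\<Sum>i<n. c i)\<^sup>2"
  proof -
    have "(\<Sum>i<n. \<Sum>j<n. c i * c j * (if i = j then \<pi> - \<rho> else 0)) = (\<pi> - \<rho>) * C"
      by (simp add: if_distrib[of "\<lambda>t. _ * t"] C_def sum_distrib_left power2_eq_square mult_ac cong: if_cong)
    moreover have "(\<Sum>i<n. \<Sum>j<n. (\<rho> - \<pi>\<^sup>2) * (c i * c j)) = (\<rho> - \<pi>\<^sup>2) * (\<Sum>i<n. c i)\<^sup>2"
      by (simp add: power2_eq_square[of "sum c _"] sum_product flip: sum_distrib_left)
    ultimately show ?thesis by (simp add: sum.distrib)
  qed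
  \<comment> \<open>Nonpositive correlation enters here: the cross terms collapse into a square with
    coefficient \<open>\<rho> - \<pi>\<^sup>2\<close>, which may be dropped.\<close>
  also have "\<dots> \<le> \<pi> * C"
  proof -
    have "(\<rho> - \<pi>\<^sup>2) * (\<Sum>i<n. c i)\<^sup>2 \<le> 0" using \<rho> by (intro mult_nonpos_nonneg) auto
    with mult_nonneg_nonneg[OF \<rho>(1) C0] show ?thesis unfolding left_diff_distrib by linarith
  qed
  finally have WW: "?ex (\<lambda>I. (W I)\<^sup>2) \<le> \<pi> * C" .
  \<comment> \<open>The multiple \<open>1 / \<pi>\<close> of \<open>W\<close> minimises the bound:
    the mean square is at least 0 and at most the variance minus \<open>C / \<pi>\<close>.\<close>
  have "0 \<le> ?ex (\<lambda>I. (H I - \<mu> - W I / \<pi>)\<^sup>2)" by (intro integral_nonneg_AE) auto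
  also have "\<dots> = ?ex (\<lambda>I. (H I - \<mu>)\<^sup>2) - 2 / \<pi> * C + ?ex (\<lambda>I. (W I)\<^sup>2) / \<pi>\<^sup>2"
  proof -
    have "(\<lambda>I. (H I - \<mu> - W I / \<pi>)\<^sup>2) = (\<lambda>I. (H I - \<mu>)\<^sup>2 - 2 / \<pi> * ((H I - \<mu>) * W I) + (W I)\<^sup>2 / \<pi>\<^sup>2)"
      by (auto simp: power2_diff power_divide)
    then show ?thesis by (simp only: Bochner_Integration.integral_diff Bochner_Integration.integral_add int HW integral_mult_right_zero integral_divide_zero)
  qed
  also have "\<dots> \<le> ?ex (\<lambda>I. (H I - \<mu>)\<^sup>2) - 2 / \<pi> * C + (\<pi> * C) / \<pi>\<^sup>2"
    using WW by (simp add: divide_right_mono)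
  also have "\<dots> = ?ex (\<lambda>I. (H I - \<mu>)\<^sup>2) - C / \<pi>" using \<pi> by (simp add: field_simps power2_eq_square)
  finally have key: "C / \<pi> \<le> ?ex (\<lambda>I. (H I - \<mu>)\<^sup>2)" by simp
  have "\<mu> - ?ex (\<lambda>I. H I * indicator (E i) I) / \<pi> = - c i / \<pi>" if "i < n" for i
  proof -
    have "(\<lambda>I. (H I - \<mu>) * e i I) = (\<lambda>I. H I * e i I - \<mu> * e i I)" by (simp add: algebra_simps)
    then have "c i = ?ex (\<lambda>I. H I * e i I) - \<mu> * \<pi>" using that by (simp add: c_def ee)
    then have "?ex (\<lambda>I. H I * indicator (E i) I) = c i + \<mu> * \<pi>" by (simp add: e_def)
    then show ?thesis using \<pi> by (simp add: add_divide_distrib)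
  qed
  then have "(\<Sum>i<n. (\<mu> - ?ex (\<lambda>I. H I * indicator (E i) I) / \<pi>)\<^sup>2) = (\<Sum>i<n. (c i)\<^sup>2 / \<pi>\<^sup>2)"
    by (intro sum.cong) (simp_all add: power_divide)
  also have "\<dots> = C / \<pi> / \<pi>" by (simp add: C_def power2_eq_square flip: sum_divide_distrib)
  also have "\<dots> \<le> ?ex (\<lambda>I. (H I - \<mu>)\<^sup>2) / \<pi>" using key \<pi> by (intro divide_right_mono) auto
  finally show ?thesis .
qed

text \<open>The default index is \<open>n\<close>, which is never drawn: data set to
  \<open>undefined\<close> at \<open>n\<close> then turn the default of this product into the
  default of \<open>bootstrap\<close>, and the two laws agree exactly.\<close>

definition resample :: "nat \<Rightarrow> (nat \<Rightarrow> nat) pmf" where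
  "resample n = Pi_pmf {..<n} n (\<lambda>_. pmf_of_set {..<n})"

lemma set_resample: "0 < n \<Longrightarrow> I \<in> set_pmf (resample n) \<Longrightarrow> j < n \<Longrightarrow> I j < n"
  unfolding resample_def by (subst (asm) set_Pi_pmf) (auto simp: PiE_dflt_def set_pmf_of_set lessThan_empty_iff)

lemma finite_resample [simp]: "0 < n \<Longrightarrow> finite (set_pmf (resample n))"
  unfolding resample_def by (subst set_Pi_pmf) (auto intro!: finite_PiE_dflt simp: set_pmf_of_set lessThan_empty_iff)

lemma bootstrap_conv_resample:
  assumes "0 < n"
  shows "bootstrap n x = map_pmf (\<lambda>I. x(n := undefined) \<circ> I) (resample n)"
proof -
  have "empirical n x = map_pmf (x(n := undefined)) (pmf_of_set {..<n})"
    unfolding empirical_def using assms by (intro map_pmf_cong) (auto simp: lessThan_empty_iff)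
  then show ?thesis unfolding bootstrap_def resample_def
    by (simp add: Pi_pmf_map[where dflt = n])
qed

lemma finite_bootstrap [simp]: "0 < n \<Longrightarrow> finite (set_pmf (bootstrap n x))"
  by (simp add: bootstrap_conv_resample)

lemma expectation_bootstrap:
  fixes H :: "(nat \<Rightarrow> 'a) \<Rightarrow> 'b::{banach, second_countable_topology}"
  assumes "0 < n" "depends_below n H"
  shows "measure_pmf.expectation (bootstrap n x) H = measure_pmf.expectation (resample n) (\<lambda>I. H (x \<circ> I))"
proof -
  have "H (x(n := undefined) \<circ> I) = H (x \<circ> I)" if "I \<in> set_pmf (resample n)" for I
    using set_resample[OF assms(1) that] by (intro depends_belowD[OF assms(2)]) auto
  then show ?thesis unfolding bootstrap_conv_resample[OF assms(1)] integral_map_pmf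
    by (intro integral_cong_AE) (auto simp: AE_measure_pmf_iff)
qed

lemma prob_resample_avoid:
  assumes "0 < n" "K \<subseteq> {..<n}"
  shows "measure_pmf.prob (resample n) {I. \<forall>j<n. I j \<notin> K} = (1 - card K / n) ^ n"
proof -
  have "{I. \<forall>j<n. I j \<notin> K} = Pi {..<n} (\<lambda>_. - K)" by auto
  moreover have "measure_pmf.prob (pmf_of_set {..<n}) (- K) = 1 - card K / n"
  proof -
    have f: "finite K" using assms(2) finite_subset by blast
    have "measure_pmf.prob (pmf_of_set {..<n}) (- K) = card ({..<n} \<inter> - K) / n"
      using assms(1) by (subst measure_pmf_of_set) auto
    also have "{..<n} \<inter> - K = {..<n} - K" by auto
    also have "card ({..<n} - K) = n - card K" using assms(2) f by (simp add: card_Diff_subset)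
    finally show ?thesis using assms card_mono[OF _ assms(2)] by (simp add: of_nat_diff field_simps)
  qed
  ultimately show ?thesis unfolding resample_def by (simp add: measure_Pi_pmf_Pi)
qed

text \<open>With \<open>m = n - 1\<close> the reciprocal of \<open>1 - 1 / n\<close> is
  \<open>1 + 1 / m\<close>, and its power \<open>m + 1\<close> is at most e times 2, which is below
  8.\<close>

lemma one_minus_inverse_power_ge:
  fixes n :: nat assumes "2 \<le> n" shows "1 / 8 \<le> (1 - 1 / real n) ^ n"
proof -
  define m where "m = n - 1"
  have n: "n = Suc m" "1 \<le> m" using assms by (auto simp: m_def)
  have "(1 + 1 / real m) ^ m \<le> exp (1 / real m) ^ m"
    by (intro power_mono exp_ge_add_one_self) auto
  also have "\<dots> = exp 1" using n by (simp flip: exp_of_nat_mult)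
  also have "\<dots> \<le> 4" using exp_le by simp
  finally have 1: "(1 + 1 / real m) ^ m \<le> 4" .
  have "1 + 1 / real m \<le> 2" using n by simp
  then have "(1 + 1 / real m) ^ m * (1 + 1 / real m) \<le> 4 * 2" by (intro mult_mono 1) auto
  then have 2: "(1 + 1 / real m) ^ n \<le> 8" by (simp add: n mult.commute)
  have "(1 - 1 / real n) * (1 + 1 / real m) = 1" using n by (simp add: divide_simps)
  then have "(1 - 1 / real n) ^ n * (1 + 1 / real m) ^ n = 1" by (simp flip: power_mult_distrib)
  then have "1 \<le> (1 - 1 / real n) ^ n * 8"
    using 2 mult_left_mono[OF 2, of "(1 - 1 / real n) ^ n"] assms by simp
  then show ?thesis by simp
qed

section \<open>Bootstrap means and variances, and means over resamples that miss an index\<close>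

definition boot_mean :: "nat \<Rightarrow> ((nat \<Rightarrow> 'a) \<Rightarrow> real) \<Rightarrow> (nat \<Rightarrow> 'a) \<Rightarrow> real" where
  "boot_mean n H x = measure_pmf.expectation (bootstrap n x) H"

definition boot_var :: "nat \<Rightarrow> ((nat \<Rightarrow> 'a) \<Rightarrow> real) \<Rightarrow> (nat \<Rightarrow> 'a) \<Rightarrow> real" where
  "boot_var n H x = measure_pmf.expectation (bootstrap n x) (\<lambda>y. (H y - boot_mean n H x)\<^sup>2)"

definition avoid :: "nat \<Rightarrow> nat \<Rightarrow> (nat \<Rightarrow> nat) set" where
  "avoid n i = {I. \<forall>j<n. I j \<noteq> i}"

text \<open>
  The denominator is the probability that a resample of size \<open>n\<close> misses a given index.
\<close>

definition leave_out :: "nat \<Rightarrow> ((nat \<Rightarrow> 'a) \<Rightarrow> real) \<Rightarrow> nat \<Rightarrow> (nat \<Rightarrow> 'a) \<Rightarrow> real" where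
  "leave_out n H i x = measure_pmf.expectation (resample n) (\<lambda>I. H (x \<circ> I) * indicator (avoid n i) I) / (1 - 1 / n) ^ n"

text \<open>A resample that misses \<open>i\<close> never reads \<open>x i\<close>. This is the
  independence of one coordinate that Efron-Stein asks of its comparison functions.\<close>

lemma leave_out_upd:
  assumes "depends_below n H" "i < n"
  shows "leave_out n H i (x(i := a)) = leave_out n H i x"
proof -
  have "H (x(i := a) \<circ> I) * indicator (avoid n i) I = (H (x \<circ> I) * indicator (avoid n i) I :: real)" for I
    by (cases "I \<in> avoid n i") (auto simp: avoid_def intro!: depends_belowD[OF assms(1)])
  then show ?thesis unfolding leave_out_def by (simp only:)
qed

text \<open>Bessel for the events of missing one index: \<open>(1 - 2 / n) ^ n\<close> is at most
  the square of \<open>(1 - 1 / n) ^ n\<close>, which is the nonpositive correlation, and 8 bounds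
  the reciprocal of the probability to miss.\<close>

lemma sum_leave_out_le:
  assumes "2 \<le> n" "depends_below n H"
  shows "(\<Sum>i<n. (boot_mean n H x - leave_out n H i x)\<^sup>2) \<le> 8 * boot_var n H x"
proof -
  have n0: "0 < n" using assms by simp
  let ?p = "(1 - 1 / real n) ^ n"
  have p: "1 / 8 \<le> ?p" by (rule one_minus_inverse_power_ge[OF assms(1)])
  have m: "boot_mean n H x = measure_pmf.expectation (resample n) (\<lambda>I. H (x \<circ> I))"
    unfolding boot_mean_def by (rule expectation_bootstrap[OF n0 assms(2)])
  have v: "boot_var n H x = measure_pmf.expectation (resample n) (\<lambda>I. (H (x \<circ> I) - boot_mean n H x)\<^sup>2)"
    unfolding boot_var_def
    by (rule expectation_bootstrap[OF n0, of "\<lambda>y. (H y - boot_mean n H x)\<^sup>2"])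
       (use assms(2) in \<open>unfold depends_below_def, metis\<close>)
  have "(\<Sum>i<n. (boot_mean n H x - leave_out n H i x)\<^sup>2) \<le> boot_var n H x / ?p"
    unfolding leave_out_def v unfolding m
  proof (rule pmf_bessel[where \<rho> = "(1 - 2 / real n) ^ n"])
    show "measure_pmf.prob (resample n) (avoid n i) = ?p" if "i < n" for i
      using prob_resample_avoid[OF n0, of "{i}"] that by (simp add: avoid_def)
    show "measure_pmf.prob (resample n) (avoid n i \<inter> avoid n j) = (1 - 2 / real n) ^ n"
      if "i < n" "j < n" "i \<noteq> j" for i j
    proof -
      have "avoid n i \<inter> avoid n j = {I. \<forall>k<n. I k \<notin> {i, j}}" by (auto simp: avoid_def)
      then show ?thesis using prob_resample_avoid[OF n0, of "{i, j}"] that by simp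
    qed
    have "1 - 2 / real n \<le> (1 - 1 / real n)\<^sup>2" by (simp add: power2_eq_square algebra_simps)
    then have "(1 - 2 / real n) ^ n \<le> ((1 - 1 / real n)\<^sup>2) ^ n"
      using assms(1) by (intro power_mono) auto
    then show "(1 - 2 / real n) ^ n \<le> ?p\<^sup>2" by (simp add: power_mult[symmetric] mult.commute)
  qed (use p n0 assms(1) in auto)
  also have "\<dots> \<le> boot_var n H x / (1 / 8)"
    using p by (intro divide_left_mono) (auto simp: boot_var_def intro!: mult_pos_pos integral_nonneg_AE)
  finally show ?thesis by simp
qed

lemma bounded_meas_add:
  assumes "bounded_meas N f" "bounded_meas N g" shows "bounded_meas N (\<lambda>x. f x + g x)"
proof -
  obtain B C where "\<And>x. \<bar>f x\<bar> \<le> B" "\<And>x. \<bar>g x\<bar> \<le> C"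
    using assms by (metis bounded_measE)
  then have "\<bar>f x + g x\<bar> \<le> B + C" for x by (metis abs_triangle_ineq add_mono order_trans)
  with assms show ?thesis by (intro bounded_measI[of _ _ "B + C"]) (auto simp: bounded_meas_def)
qed

lemma bounded_meas_const: "bounded_meas N (\<lambda>x. c)"
  by (rule bounded_measI[of _ _ "\<bar>c\<bar>"]) auto

lemma bounded_meas_sum:
  assumes "\<And>i. i \<in> A \<Longrightarrow> bounded_meas N (f i)" shows "bounded_meas N (\<lambda>x. \<Sum>i\<in>A. f i x)"
  using assms by (induction A rule: infinite_finite_induct) (auto intro: bounded_meas_add bounded_meas_const)

lemma boot_mean_bounds:
  assumes "0 < n" "\<And>y. 0 \<le> H y" "\<And>y. H y \<le> 1"
  shows "0 \<le> boot_mean n H x" "boot_mean n H x \<le> 1"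
proof -
  show "0 \<le> boot_mean n H x" unfolding boot_mean_def using assms by (intro integral_nonneg_AE) auto
  have "boot_mean n H x \<le> measure_pmf.expectation (bootstrap n x) (\<lambda>_. 1)"
    unfolding boot_mean_def
    using assms by (intro integral_mono integrable_measure_pmf_finite) auto
  then show "boot_mean n H x \<le> 1" by simp
qed

lemma boot_var_bounds:
  assumes "0 < n" "\<And>y. 0 \<le> H y" "\<And>y. H y \<le> 1"
  shows "0 \<le> boot_var n H x" "boot_var n H x \<le> 1"
proof -
  show "0 \<le> boot_var n H x" unfolding boot_var_def by (intro integral_nonneg_AE) auto
  have "(H y - boot_mean n H x)\<^sup>2 \<le> 1" for y
  proof -
    have "0 \<le> H y" "H y \<le> 1" "0 \<le> boot_mean n H x" "boot_mean n H x \<le> 1"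
      using assms(2,3) boot_mean_bounds[of n H x] assms by auto
    then have "\<bar>H y - boot_mean n H x\<bar> \<le> 1" by linarith
    then show ?thesis by (simp add: abs_square_le_1)
  qed
  then have "boot_var n H x \<le> measure_pmf.expectation (bootstrap n x) (\<lambda>_. 1)"
    unfolding boot_var_def
    using assms by (intro integral_mono integrable_measure_pmf_finite) auto
  then show "boot_var n H x \<le> 1" by simp
qed

lemma depends_below_boot:
  fixes H :: "(nat \<Rightarrow> 'a) \<Rightarrow> real"
  assumes "0 < n" "depends_below n H"
  shows "depends_below n (\<lambda>x. measure_pmf.expectation (bootstrap n x) H)"
proof -
  have "measure_pmf.expectation (resample n) (\<lambda>I. H (x \<circ> I)) = measure_pmf.expectation (resample n) (\<lambda>I. H (y \<circ> I))"
    if "\<And>i. i < n \<Longrightarrow> x i = y i" for x y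
  proof (rule integral_cong_AE)
    show "AE I in measure_pmf (resample n). H (x \<circ> I) = H (y \<circ> I)"
      unfolding AE_measure_pmf_iff
    proof
      fix I assume "I \<in> set_pmf (resample n)"
      then show "H (x \<circ> I) = H (y \<circ> I)" using set_resample[OF assms(1)] that
        by (intro depends_belowD[OF assms(2)]) auto
    qed
  qed auto
  then show ?thesis unfolding depends_below_def expectation_bootstrap[OF assms] by blast
qed

section \<open>Conditional means of a bootstrap mean\<close>

context sequence_space begin

lemma comb_seq_in_space: "x \<in> space S \<Longrightarrow> z \<in> space S \<Longrightarrow> comb_seq s x z \<in> space S"
  by (auto simp: space_PiM comb_seq_def PiE_iff)

lemma integrable_comb_seq: "bounded_meas S f \<Longrightarrow> x \<in> space S \<Longrightarrow> integrable S (\<lambda>z. f (comb_seq s x z))"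
  by (intro P.bounded_meas_integrable bounded_meas_comb_seq)

lemma cond_mono:
  assumes "bounded_meas S f" "bounded_meas S g" "x \<in> space S" "\<And>y. y \<in> space S \<Longrightarrow> f y \<le> g y"
  shows "cond s f x \<le> cond s g x"
  unfolding cond_def using assms(1-3) by (intro integral_mono integrable_comb_seq assms(4) comb_seq_in_space) auto

lemma cond_diff:
  assumes "bounded_meas S f" "bounded_meas S g" "x \<in> space S"
  shows "cond s (\<lambda>y. f y - g y) x = cond s f x - cond s g x"
  unfolding cond_def using assms by (intro Bochner_Integration.integral_diff integrable_comb_seq)

lemma cond_add:
  assumes "bounded_meas S f" "bounded_meas S g" "x \<in> space S"
  shows "cond s (\<lambda>y. f y + g y) x = cond s f x + cond s g x"
  unfolding cond_def using assms by (intro Bochner_Integration.integral_add integrable_comb_seq)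

lemma cond_cmult: "cond s (\<lambda>y. c * f y) x = c * cond s f x"
  by (simp add: cond_def)

lemma cond_const: "cond s (\<lambda>y. c) x = c"
  by (simp add: cond_def P.prob_space)

lemma cond_square_le:
  assumes "bounded_meas S f" "x \<in> space S" shows "(cond s f x)\<^sup>2 \<le> cond s (\<lambda>y. (f y)\<^sup>2) x"
  unfolding cond_def
  using assms bounded_meas_power2[OF assms(1)] by (intro P.square_integral_le integrable_comb_seq) auto

lemma cond_0: "cond 0 f x = (\<integral>z. f z \<partial>S)"
proof -
  have "comb_seq 0 x z = z" for z by (simp add: comb_seq_def fun_eq_iff)
  then show ?thesis by (simp add: cond_def)
qed

lemma cond_depends_below: "depends_below n f \<Longrightarrow> n \<le> s \<Longrightarrow> cond s f x = f x"
  by (simp add: cond_def depends_below_comb_seq P.prob_space)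

text \<open>Revealing a coordinate that \<open>g\<close> does not read changes nothing: coordinate
  \<open>s\<close> of the spliced sequence is the head of the tail, which
  \<open>integral_iter\<close> splits off.\<close>

lemma cond_Suc_indep:
  assumes "bounded_meas S g" "\<And>y a. g (y(s := a)) = g y" "x \<in> space S"
  shows "cond (Suc s) g x = cond s g x"
proof -
  have eq: "g (comb_seq s x (case_nat a z)) = g (comb_seq (Suc s) x z)" for a z
  proof -
    have "comb_seq s x (case_nat a z) = (comb_seq (Suc s) x z)(s := a)"
    proof
      fix i show "comb_seq s x (case_nat a z) i = ((comb_seq (Suc s) x z)(s := a)) i"
      proof (cases "s < i")
        case True
        then have "i - s = Suc (i - Suc s)" by simp
        with True show ?thesis by (simp add: comb_seq_def)
      qed (auto simp: comb_seq_def not_less less_Suc_eq_le le_less)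
    qed
    then show ?thesis by (simp add: assms(2))
  qed
  have "cond s g x = (\<integral>a. \<integral>z. g (comb_seq s x (case_nat a z)) \<partial>S \<partial>M)"
    unfolding cond_def by (rule integral_iter[OF bounded_meas_comb_seq[OF assms(1,3)]])
  then show ?thesis unfolding eq by (simp add: cond_def M.prob_space)
qed

lemma measurable_reindex [measurable]: "(\<lambda>x. x \<circ> I) \<in> measurable S S"
  unfolding comp_def by (rule measurable_PiM_single') (auto simp: space_PiM)

lemma bounded_meas_resample:
  assumes "0 < n" "\<And>I. bounded_meas S (K I)"
  shows "bounded_meas S (\<lambda>x. measure_pmf.expectation (resample n) (\<lambda>I. K I x))"
proof -
  have "measure_pmf.expectation (resample n) (\<lambda>I. K I x) = (\<Sum>I\<in>set_pmf (resample n). K I x * pmf (resample n) I)" for x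
    using assms(1) by (subst integral_measure_pmf_real[where A = "set_pmf (resample n)"]) auto
  then show ?thesis using assms by (auto intro!: bounded_meas_sum bounded_meas_mult bounded_meas_const)
qed

lemma bounded_meas_reindex: "bounded_meas S H \<Longrightarrow> bounded_meas S (\<lambda>x. H (x \<circ> I))"
  by (rule bounded_meas_compose[of S H]) auto

lemma bounded_meas_boot:
  assumes "0 < n" "bounded_meas S H" "depends_below n H"
  shows "bounded_meas S (\<lambda>x. measure_pmf.expectation (bootstrap n x) H)"
  unfolding expectation_bootstrap[OF assms(1,3)]
  by (rule bounded_meas_resample[OF assms(1)], rule bounded_meas_reindex[OF assms(2)])

lemma bounded_meas_leave_out:
  assumes "0 < n" "bounded_meas S H"
  shows "bounded_meas S (leave_out n H i)"
proof -
  have "bounded_meas S (\<lambda>x. measure_pmf.expectation (resample n) (\<lambda>I. H (x \<circ> I) * indicator (avoid n i) I) * inverse ((1 - 1 / n) ^ n))"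
    by (rule bounded_meas_mult[OF bounded_meas_resample[OF assms(1)] bounded_meas_const],
        rule bounded_meas_mult[OF bounded_meas_reindex[OF assms(2)] bounded_meas_const])
  then show ?thesis by (simp add: leave_out_def[abs_def] divide_inverse)
qed

lemma boot_var_eq:
  assumes "0 < n" shows "boot_var n H x = boot_mean n (\<lambda>y. (H y)\<^sup>2) x - (boot_mean n H x)\<^sup>2"
proof -
  note [simp] = integrable_measure_pmf_finite[OF finite_bootstrap[OF assms]]
  have "(\<lambda>y. (H y - boot_mean n H x)\<^sup>2) = (\<lambda>y. (H y)\<^sup>2 - 2 * boot_mean n H x * H y + (boot_mean n H x)\<^sup>2)"
    by (rule ext) (simp add: power2_diff)
  then have "boot_var n H x = boot_mean n (\<lambda>y. (H y)\<^sup>2) x - 2 * boot_mean n H x * boot_mean n H x + (boot_mean n H x)\<^sup>2"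
    unfolding boot_var_def by (simp add: boot_mean_def)
  then show ?thesis by (simp add: power2_eq_square)
qed

lemma bounded_meas_boot_mean:
  "0 < n \<Longrightarrow> bounded_meas S H \<Longrightarrow> depends_below n H \<Longrightarrow> bounded_meas S (boot_mean n H)"
  using bounded_meas_boot[of n H] by (simp add: boot_mean_def[abs_def])

lemma depends_below_power2: "depends_below n H \<Longrightarrow> depends_below n (\<lambda>x. (H x)\<^sup>2 :: real)"
  unfolding depends_below_def by metis

lemma bounded_meas_boot_var:
  assumes "0 < n" "bounded_meas S H" "depends_below n H"
  shows "bounded_meas S (boot_var n H)"
proof -
  have "bounded_meas S (\<lambda>x. boot_mean n (\<lambda>y. (H y)\<^sup>2) x - (boot_mean n H x)\<^sup>2)"
    by (intro bounded_meas_diff bounded_meas_power2 bounded_meas_boot_mean depends_below_power2 assms)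
  then show ?thesis by (simp add: boot_var_eq[OF assms(1), abs_def])
qed

lemma depends_below_boot_mean: "0 < n \<Longrightarrow> depends_below n H \<Longrightarrow> depends_below n (boot_mean n H)"
  using depends_below_boot[of n H] by (simp add: boot_mean_def[abs_def])

text \<open>Efron-Stein on the \<open>n - s\<close> coordinates not yet seen, with the leave-one-out
  means as comparison functions. The sum of squares is bounded for each data sequence by
  \<open>8 * boot_var\<close> and then averaged over the unseen part.\<close>

lemma cond_var_boot_mean_le:
  assumes n: "2 \<le> n" and H: "bounded_meas S H" "depends_below n H" and x: "x \<in> space S"
  shows "cond s (\<lambda>y. (boot_mean n H y)\<^sup>2) x - (cond s (boot_mean n H) x)\<^sup>2 \<le> 8 * cond s (boot_var n H) x"
proof -
  let ?G = "boot_mean n H"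
  have n0: "0 < n" using n by simp
  note G = bounded_meas_boot_mean[OF n0 H] and V = bounded_meas_boot_var[OF n0 H]
    and L = bounded_meas_leave_out[OF n0 H(1)]
  have "(\<integral>z. (?G (comb_seq s x z))\<^sup>2 \<partial>S) - (\<integral>z. ?G (comb_seq s x z) \<partial>S)\<^sup>2
     \<le> (\<Sum>i<n - s. \<integral>z. (?G (comb_seq s x z) - leave_out n H (s + i) (comb_seq s x z))\<^sup>2 \<partial>S)"
  proof (rule efron_stein)
    show "bounded_meas S (\<lambda>z. ?G (comb_seq s x z))" by (rule bounded_meas_comb_seq[OF G x])
    show "bounded_meas S (\<lambda>z. leave_out n H (s + i) (comb_seq s x z))" for i by (rule bounded_meas_comb_seq[OF L x])
    show "depends_below (n - s) (\<lambda>z. ?G (comb_seq s x z))"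
      unfolding depends_below_def
      by (auto intro!: depends_belowD[OF depends_below_boot_mean[OF n0 H(2)]] simp: comb_seq_def)
    fix i y a assume "i < n - s"
    then have "s + i < n" by simp
    moreover have "comb_seq s x (y(i := a)) = (comb_seq s x y)(s + i := a)"
      by (auto simp: comb_seq_def fun_eq_iff)
    ultimately show "leave_out n H (s + i) (comb_seq s x (y(i := a))) = leave_out n H (s + i) (comb_seq s x y)"
      by (simp add: leave_out_upd[OF H(2)])
  qed
  also have "\<dots> = (\<integral>z. (\<Sum>i<n - s. (?G (comb_seq s x z) - leave_out n H (s + i) (comb_seq s x z))\<^sup>2) \<partial>S)"
    by (rule Bochner_Integration.integral_sum[symmetric])
       (rule integrable_comb_seq[OF bounded_meas_power2[OF bounded_meas_diff[OF G L]] x])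
  also have "\<dots> \<le> (\<integral>z. 8 * boot_var n H (comb_seq s x z) \<partial>S)"
  proof (rule integral_mono)
    show "integrable S (\<lambda>z. \<Sum>i<n - s. (?G (comb_seq s x z) - leave_out n H (s + i) (comb_seq s x z))\<^sup>2)"
      by (rule Bochner_Integration.integrable_sum)
         (rule integrable_comb_seq[OF bounded_meas_power2[OF bounded_meas_diff[OF G L]] x])
    show "integrable S (\<lambda>z. 8 * boot_var n H (comb_seq s x z))"
      by (rule integrable_mult_right, rule integrable_comb_seq[OF V x])
    fix z
    have "(\<Sum>i<n - s. (?G y - leave_out n H (s + i) y)\<^sup>2) \<le> (\<Sum>i<n. (?G y - leave_out n H i y)\<^sup>2)" for y
    proof -
      have "(\<Sum>i<n - s. (?G y - leave_out n H (s + i) y)\<^sup>2) = (\<Sum>i\<in>(+) s ` {..<n - s}. (?G y - leave_out n H i y)\<^sup>2)"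
        by (subst sum.reindex) auto
      also have "\<dots> \<le> (\<Sum>i<n. (?G y - leave_out n H i y)\<^sup>2)"
        by (intro sum_mono2) auto
      finally show ?thesis .
    qed
    from this[of "comb_seq s x z"] sum_leave_out_le[OF n H(2), of "comb_seq s x z"]
    show "(\<Sum>i<n - s. (?G (comb_seq s x z) - leave_out n H (s + i) (comb_seq s x z))\<^sup>2) \<le> 8 * boot_var n H (comb_seq s x z)"
      by linarith
  qed
  finally show ?thesis by (simp add: cond_def)
qed

text \<open>The leave-one-out mean for index \<open>s\<close> has the same conditional mean at times
  \<open>s\<close> and \<open>s + 1\<close>. At both times the conditional mean of
  \<open>boot_mean\<close> lies within \<open>\<delta>\<close> of it, since one square is at most
  the sum in \<open>sum_leave_out_le\<close>.\<close>

lemma cond_boot_mean_jump_le: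
  assumes n: "2 \<le> n" and H: "bounded_meas S H" "depends_below n H" and x: "x \<in> space S"
    and e: "8 * cond s (boot_var n H) x \<le> \<delta>\<^sup>2" "8 * cond (Suc s) (boot_var n H) x \<le> \<delta>\<^sup>2" "0 \<le> \<delta>"
  shows "\<bar>cond (Suc s) (boot_mean n H) x - cond s (boot_mean n H) x\<bar> \<le> 2 * \<delta>"
proof (cases "s < n")
  case False
  then show ?thesis using e n by (simp add: cond_depends_below[OF depends_below_boot_mean[OF _ H(2)]])
next
  case True
  have n0: "0 < n" using n by simp
  note G = bounded_meas_boot_mean[OF n0 H] and V = bounded_meas_boot_var[OF n0 H]
    and L = bounded_meas_leave_out[OF n0 H(1)]
  have close: "\<bar>cond t (boot_mean n H) x - cond t (leave_out n H s) x\<bar> \<le> \<delta>"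
    if "8 * cond t (boot_var n H) x \<le> \<delta>\<^sup>2" for t
  proof -
    have "(cond t (boot_mean n H) x - cond t (leave_out n H s) x)\<^sup>2 = (cond t (\<lambda>y. boot_mean n H y - leave_out n H s y) x)\<^sup>2"
      by (simp add: cond_diff[OF G L x])
    also have "\<dots> \<le> cond t (\<lambda>y. (boot_mean n H y - leave_out n H s y)\<^sup>2) x"
      by (rule cond_square_le[OF bounded_meas_diff[OF G L] x])
    also have "\<dots> \<le> cond t (\<lambda>y. 8 * boot_var n H y) x"
    proof (rule cond_mono[OF bounded_meas_power2[OF bounded_meas_diff[OF G L]] bounded_meas_mult[OF bounded_meas_const V] x])
      fix y
      have "(boot_mean n H y - leave_out n H s y)\<^sup>2 \<le> (\<Sum>i<n. (boot_mean n H y - leave_out n H i y)\<^sup>2)"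
        using True by (intro member_le_sum) auto
      then show "(boot_mean n H y - leave_out n H s y)\<^sup>2 \<le> 8 * boot_var n H y"
        using sum_leave_out_le[OF n H(2), of y] by linarith
    qed
    also have "\<dots> \<le> \<delta>\<^sup>2" using that by (simp add: cond_cmult)
    finally show ?thesis using e(3) by (metis abs_le_square_iff abs_of_nonneg)
  qed
  have "cond (Suc s) (leave_out n H s) x = cond s (leave_out n H s) x"
    by (rule cond_Suc_indep[OF L leave_out_upd[OF H(2) True] x])
  with close[OF e(1)] close[OF e(2)] show ?thesis by linarith
qed

end

section \<open>Crossing levels\<close>

lemma boot_mean_square_dev:
  fixes H :: "(nat \<Rightarrow> 'a) \<Rightarrow> real"
  assumes "0 < n"
  shows "boot_mean n (\<lambda>y. (H y - m)\<^sup>2) x = boot_var n H x + (boot_mean n H x - m)\<^sup>2"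
proof -
  note [simp] = integrable_measure_pmf_finite[OF finite_bootstrap[OF assms]]
  have "(\<lambda>y. (H y - m)\<^sup>2) = (\<lambda>y. (H y - boot_mean n H x)\<^sup>2 + 2 * (boot_mean n H x - m) * (H y - boot_mean n H x) + (boot_mean n H x - m)\<^sup>2)"
    by (rule ext) (simp add: power2_eq_square algebra_simps)
  then have "boot_mean n (\<lambda>y. (H y - m)\<^sup>2) x = boot_var n H x + 2 * (boot_mean n H x - m) * (boot_mean n H x - boot_mean n H x) + (boot_mean n H x - m)\<^sup>2"
    unfolding boot_mean_def[of n "\<lambda>y. (H y - m)\<^sup>2"] boot_var_def by (simp add: boot_mean_def[of n H])
  then show ?thesis by simp
qed

lemma boot_mean_mono:
  assumes "0 < n" "\<And>y. f y \<le> g y" shows "boot_mean n f x \<le> boot_mean n g x"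
  unfolding boot_mean_def using assms by (intro integral_mono integrable_measure_pmf_finite) auto

lemma boot_mean_cmult: "boot_mean n (\<lambda>y. c * f y) x = c * boot_mean n f x"
  by (simp add: boot_mean_def)

section \<open>First passages of conditional means and a maximal inequality\<close>

context sequence_space begin

text \<open>Markov's inequality for a stopped martingale: \<open>A s\<close> is the event of
  stopping at \<open>s\<close>. On \<open>B\<close>, known at time \<open>t\<close>, the martingale
  of conditional means of \<open>F\<close> is at most \<open>d\<close>, and when stopped it is at
  least \<open>c\<close>.\<close>

lemma sum_first_le:
  assumes A: "\<And>s. bounded_meas S (indicator (A s))" "disjoint_family A"
    and F: "bounded_meas S F" "\<And>x. x \<in> space S \<Longrightarrow> 0 \<le> F x"
    and dep: "\<And>s. depends_below s (\<lambda>x. indicator (A s) x :: real)"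
    and B: "bounded_meas S (indicator B)" "depends_below t (\<lambda>x. indicator B x :: real)"
    and c: "c > 0" "\<And>s x. x \<in> A s \<Longrightarrow> x \<in> space S \<Longrightarrow> c \<le> cond s F x"
    and d: "\<And>x. x \<in> B \<Longrightarrow> x \<in> space S \<Longrightarrow> cond t F x \<le> d"
    and K: "finite K" "\<And>s. s \<in> K \<Longrightarrow> t \<le> s"
  shows "(\<Sum>s\<in>K. \<integral>x. indicat_real (B \<inter> A s) x \<partial>S) \<le> d / c * (\<integral>x. indicat_real B x \<partial>S)"
proof -
  have BA: "bounded_meas S (indicator (B \<inter> A s))" for s
    using bounded_meas_mult[OF B(1) A(1)] by (simp add: indicator_inter_arith[abs_def])
  note [intro] = P.bounded_meas_integrable
  have "c * (\<integral>x. indicat_real (B \<inter> A s) x \<partial>S) \<le> (\<integral>x. indicat_real (B \<inter> A s) x * F x \<partial>S)" if "s \<in> K" for s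
  proof -
    have "c * (\<integral>x. indicat_real (B \<inter> A s) x \<partial>S) = (\<integral>x. c * indicator (B \<inter> A s) x \<partial>S)" by simp
    also have "\<dots> \<le> (\<integral>x. indicat_real (B \<inter> A s) x * cond s F x \<partial>S)"
    proof (rule integral_mono)
      show "integrable S (\<lambda>x. c * indicator (B \<inter> A s) x)" by (rule P.bounded_meas_integrable[OF bounded_meas_mult[OF bounded_meas_const BA]])
      show "integrable S (\<lambda>x. indicator (B \<inter> A s) x * cond s F x)" by (rule P.bounded_meas_integrable[OF bounded_meas_mult[OF BA bounded_meas_cond[OF F(1)]]])
    qed (use c(2) in \<open>auto simp: indicator_def\<close>)
    also have "\<dots> = (\<integral>x. indicat_real (B \<inter> A s) x * F x \<partial>S)"
    proof (rule integral_cond_mult[OF BA F(1)])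
      show "depends_below s (\<lambda>x. indicat_real (B \<inter> A s) x)"
        unfolding depends_below_def
      proof (intro allI impI)
        fix x y :: "nat \<Rightarrow> 'a" assume *: "\<forall>i<s. x i = y i"
        have "indicat_real B x = indicat_real B y" "indicat_real (A s) x = indicat_real (A s) y"
          using * K(2)[OF that] by (auto intro!: depends_belowD[OF B(2)] depends_belowD[OF dep])
        then show "indicat_real (B \<inter> A s) x = indicat_real (B \<inter> A s) y"
          by (simp add: indicator_inter_arith)
      qed
    qed
    finally show ?thesis .
  qed
  then have "c * (\<Sum>s\<in>K. \<integral>x. indicat_real (B \<inter> A s) x \<partial>S) \<le> (\<Sum>s\<in>K. \<integral>x. indicat_real (B \<inter> A s) x * F x \<partial>S)"
    by (simp add: sum_distrib_left sum_mono)
  also have "\<dots> = (\<integral>x. (\<Sum>s\<in>K. indicator (B \<inter> A s) x * F x) \<partial>S)"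
    by (rule Bochner_Integration.integral_sum[symmetric], rule P.bounded_meas_integrable, rule bounded_meas_mult[OF BA F(1)])
  also have "\<dots> \<le> (\<integral>x. indicat_real B x * F x \<partial>S)"
  proof (rule integral_mono)
    show "integrable S (\<lambda>x. \<Sum>s\<in>K. indicator (B \<inter> A s) x * F x)"
      by (rule Bochner_Integration.integrable_sum, rule P.bounded_meas_integrable, rule bounded_meas_mult[OF BA F(1)])
    show "integrable S (\<lambda>x. indicator B x * F x)"
      by (rule P.bounded_meas_integrable, rule bounded_meas_mult[OF B(1) F(1)])
    fix x assume x: "x \<in> space S"
    have "(\<Sum>s\<in>K. indicat_real (B \<inter> A s) x) = indicat_real (\<Union>s\<in>K. B \<inter> A s) x"
      using A(2) K(1) by (intro indicator_UN_disjoint[symmetric]) (auto simp: disjoint_family_on_def)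
    also have "\<dots> \<le> indicat_real B x" by (auto simp: indicator_def)
    finally show "(\<Sum>s\<in>K. indicat_real (B \<inter> A s) x * F x) \<le> indicat_real B x * F x"
      using F(2)[OF x] by (simp add: mult_right_mono flip: sum_distrib_right)
  qed
  also have "\<dots> = (\<integral>x. indicat_real B x * cond t F x \<partial>S)"
    by (rule integral_cond_mult[symmetric, OF B(1) F(1) B(2)])
  also have "\<dots> \<le> (\<integral>x. d * indicator B x \<partial>S)"
  proof (rule integral_mono)
    show "integrable S (\<lambda>x. d * indicator B x)" by (rule P.bounded_meas_integrable[OF bounded_meas_mult[OF bounded_meas_const B(1)]])
    show "integrable S (\<lambda>x. indicator B x * cond t F x)" by (rule P.bounded_meas_integrable[OF bounded_meas_mult[OF B(1) bounded_meas_cond[OF F(1)]]])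
  qed (use d in \<open>auto simp: indicator_def\<close>)
  also have "\<dots> = d * (\<integral>x. indicat_real B x \<partial>S)" by simp
  finally show ?thesis using c(1) by (simp add: field_simps)
qed

text \<open>The exceptional event is read off from the whole sequence; its conditional mean is known
  at time \<open>s\<close>, so that stopping rules may use it. With the pointwise margin
  \<open>1 / 4096\<close> of \<open>level_chain\<close> the total is
  \<open>1 / 2048\<close>.\<close>

definition ok :: "((nat \<Rightarrow> 'a) \<Rightarrow> real) \<Rightarrow> nat \<Rightarrow> (nat \<Rightarrow> 'a) \<Rightarrow> bool" where
  "ok Bd s x \<longleftrightarrow> (\<forall>t\<le>s. cond t Bd x \<le> 1 / 4096)"

definition first :: "((nat \<Rightarrow> 'a) \<Rightarrow> real) \<Rightarrow> ((nat \<Rightarrow> 'a) \<Rightarrow> real) \<Rightarrow> nat \<Rightarrow> (nat \<Rightarrow> 'a) set" where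
  "first Bd G s = {x. 1 / 2 \<le> cond s G x \<and> ok Bd s x \<and> (\<forall>t<s. cond t G x < 1 / 2)}"

lemma bounded_meas_indicator:
  "{x \<in> space N. P x} \<in> sets N \<Longrightarrow> bounded_meas N (indicator {x. P x})"
  by (rule bounded_measI[of _ _ 1]) (auto simp: borel_measurable_indicator_iff indicator_def Int_def conj_commute)

lemma bounded_meas_first:
  assumes "bounded_meas S Bd" "bounded_meas S G" shows "bounded_meas S (indicator (first Bd G s))"
proof -
  have [measurable]: "cond t Bd \<in> borel_measurable S" "cond t G \<in> borel_measurable S" for t
    using bounded_meas_cond assms by (auto simp: bounded_meas_def)
  show ?thesis unfolding first_def ok_def by (rule bounded_meas_indicator) measurable
qed

lemma cond_cong_below: "(\<And>i. i < s \<Longrightarrow> x i = y i) \<Longrightarrow> t \<le> s \<Longrightarrow> cond t G x = cond t G y"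
  by (rule depends_belowD[OF depends_below_cond]) auto

lemma depends_below_first: "depends_below s (\<lambda>x. indicator (first Bd G s) x :: real)"
  unfolding depends_below_def
proof (intro allI impI)
  fix x y :: "nat \<Rightarrow> 'a" assume "\<forall>i<s. x i = y i"
  then have "cond t Bd x = cond t Bd y" "cond t G x = cond t G y" if "t \<le> s" for t
    using that by (auto intro!: cond_cong_below[of s])
  then have "x \<in> first Bd G s \<longleftrightarrow> y \<in> first Bd G s" by (auto simp: first_def ok_def)
  then show "indicat_real (first Bd G s) x = indicat_real (first Bd G s) y" by (simp add: indicator_def)
qed

lemma disjoint_first: "disjoint_family (first Bd G)"
proof -
  have "m = n" if "x \<in> first Bd G m" "x \<in> first Bd G n" for m n x
    using that by (cases m n rule: linorder_cases) (auto simp: first_def not_less[symmetric])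
  then show ?thesis unfolding disjoint_family_on_def by blast
qed

text \<open>The condition \<open>ok\<close> covers all earlier times, so it also holds at the first
  passage.\<close>

lemma first_ex:
  assumes "1 / 2 \<le> cond s G x" "ok Bd s x"
  shows "\<exists>t\<le>s. x \<in> first Bd G t"
proof -
  define t where "t = (LEAST t. 1 / 2 \<le> cond t G x)"
  have "1 / 2 \<le> cond t G x" "t \<le> s" unfolding t_def using assms(1) by (auto intro: LeastI Least_le)
  moreover have "cond u G x < 1 / 2" if "u < t" for u using not_less_Least that unfolding t_def by fastforce
  ultimately show ?thesis using assms by (intro exI[of _ t]) (auto simp: first_def ok_def)
qed

end

text \<open>
  The functions \<open>H j\<close> are nested level functions: \<open>H (Suc j)\<close> lives where \<open>H j\<close> is saturated. When the
  conditional mean of \<open>G j\<close> first reaches \<open>1 / 2\<close>, it has not jumped far beyond it and the conditional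
  variance is small, so that \<open>G (Suc j)\<close> still has a small conditional mean.
\<close>

locale level_chain = sequence_space +
  fixes n :: nat and H :: "nat \<Rightarrow> (nat \<Rightarrow> 'a) \<Rightarrow> real" and Bd :: "(nat \<Rightarrow> 'a) \<Rightarrow> real"
  assumes n: "2 \<le> n" and H: "\<And>j. bounded_meas S (H j)" "\<And>j. depends_below n (H j)"
    and H01: "\<And>j y. 0 \<le> H j y" "\<And>j y. H j y \<le> 1" "\<And>j y. 0 < H (Suc j) y \<Longrightarrow> H j y = 1"
    and Bd: "bounded_meas S Bd" "\<And>j x. x \<in> space S \<Longrightarrow> boot_var n (H j) x \<le> 1 / 4096 + Bd x"
    and start: "(\<integral>x. boot_mean n (H 0) x \<partial>S) < 1 / 2"
begin

abbreviation "G j \<equiv> boot_mean n (H j)"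

lemma n0: "0 < n" using n by simp

lemma bounded_meas_G: "bounded_meas S (G j)" by (rule bounded_meas_boot_mean[OF n0 H])

lemma H_Suc_le: "H (Suc j) y \<le> H j y"
  using H01(1)[of j y] H01(2)[of "Suc j" y] H01(3)[of j y] by (cases "0 < H (Suc j) y") auto

lemma cond_var_le:
  assumes "x \<in> space S" "ok Bd s x" shows "cond s (boot_var n (H j)) x \<le> 1 / 2048"
proof -
  have "cond s (boot_var n (H j)) x \<le> cond s (\<lambda>y. 1 / 4096 + Bd y) x"
    using bounded_meas_boot_var[OF n0 H] Bd assms by (intro cond_mono bounded_meas_add bounded_meas_const) auto
  also have "\<dots> = 1 / 4096 + cond s Bd x"
    using Bd assms by (simp add: cond_add bounded_meas_const cond_const)
  also have "\<dots> \<le> 1 / 4096 + 1 / 4096" using assms(2) by (auto simp: ok_def)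
  finally show ?thesis by simp
qed

text \<open>Rules out a first passage at time 0, so that \<open>cond_next_level\<close> may compare
  with the preceding time.\<close>

lemma cond_G0_less: "cond 0 (G j) x < 1 / 2"
proof (induction j)
  case 0 then show ?case using start by (simp add: cond_0)
next
  case (Suc j)
  have "(\<integral>x. G (Suc j) x \<partial>S) \<le> (\<integral>x. G j x \<partial>S)"
    using H_Suc_le n0 by (intro integral_mono P.bounded_meas_integrable bounded_meas_G boot_mean_mono) auto
  with Suc show ?case by (simp add: cond_0)
qed

text \<open>\<open>ok\<close> bounds the conditional mean of the bootstrap variance by
  \<open>1 / 2048\<close>, and \<open>8 / 2048 = (1 / 16)^2\<close>: the last jump is at most
  \<open>1 / 8\<close>, so \<open>m <= 5 / 8\<close>. Where \<open>H (Suc j)\<close> is positive,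
  \<open>H j = 1\<close> is at distance at least \<open>3 / 8\<close> from \<open>m\<close>.
  Chebyshev costs \<open>64 / 9\<close>, the mean square distance to \<open>m\<close> is at most
  \<open>(1 + 8) / 2048\<close>, and the product is \<open>1 / 32\<close>.\<close>

lemma cond_next_level:
  assumes x: "x \<in> first Bd (G j) s" and xS: "x \<in> space S"
  shows "cond s (G (Suc j)) x \<le> 1 / 32"
proof -
  have ge: "1 / 2 \<le> cond s (G j) x" and ok: "ok Bd s x"
    and lt: "\<And>t. t < s \<Longrightarrow> cond t (G j) x < 1 / 2"
    using x by (auto simp: first_def)
  have "s \<noteq> 0"
  proof
    assume "s = 0" then show False using ge cond_G0_less[of j x] by simp
  qed
  then obtain t where s: "s = Suc t" by (cases s) auto
  have okt: "ok Bd t x" using ok by (auto simp: ok_def s)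
  define m where "m = cond s (G j) x"
  have "\<bar>cond (Suc t) (G j) x - cond t (G j) x\<bar> \<le> 2 * (1 / 16)"
    using cond_var_le[OF xS okt, of j] cond_var_le[OF xS ok, of j]
    by (intro cond_boot_mean_jump_le n H xS) (auto simp: s power2_eq_square)
  moreover have "cond t (G j) x < 1 / 2" using lt[of t] by (simp add: s)
  ultimately have m: "m \<le> 5 / 8" unfolding m_def s by linarith
  have pt: "G (Suc j) y \<le> 64 / 9 * (boot_var n (H j) y + (G j y - m)\<^sup>2)" for y
  proof -
    have "G (Suc j) y \<le> boot_mean n (\<lambda>w. 64 / 9 * (H j w - m)\<^sup>2) y"
    proof (rule boot_mean_mono[OF n0])
      fix w show "H (Suc j) w \<le> 64 / 9 * (H j w - m)\<^sup>2"
      proof (cases "0 < H (Suc j) w")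
        case True
        have "(3 / 8)\<^sup>2 \<le> (1 - m)\<^sup>2" using m by (intro power_mono) auto
        then show ?thesis using H01(3)[OF True] H01(2)[of "Suc j" w] by (simp add: power2_eq_square)
      next
        case False
        then show ?thesis using zero_le_power2[of "H j w - m"] by linarith
      qed
    qed
    also have "\<dots> = 64 / 9 * (boot_var n (H j) y + (G j y - m)\<^sup>2)"
      by (simp only: boot_mean_cmult boot_mean_square_dev[OF n0])
    finally show ?thesis .
  qed
  note G = bounded_meas_G[of j] and V = bounded_meas_boot_var[OF n0 H, of j]
  have D: "bounded_meas S (\<lambda>y. (G j y - m)\<^sup>2)" by (rule bounded_meas_power2[OF bounded_meas_diff[OF G bounded_meas_const]])
  have G2: "bounded_meas S (\<lambda>y. (G j y)\<^sup>2)" by (rule bounded_meas_power2[OF G])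
  have "cond s (G (Suc j)) x \<le> cond s (\<lambda>y. 64 / 9 * (boot_var n (H j) y + (G j y - m)\<^sup>2)) x"
    by (rule cond_mono[OF bounded_meas_G bounded_meas_mult[OF bounded_meas_const bounded_meas_add[OF V D]] xS pt])
  also have "\<dots> = 64 / 9 * (cond s (boot_var n (H j)) x + cond s (\<lambda>y. (G j y - m)\<^sup>2) x)"
    by (simp only: cond_cmult cond_add[OF V D xS])
  also have "cond s (\<lambda>y. (G j y - m)\<^sup>2) x = cond s (\<lambda>y. (G j y)\<^sup>2) x - m\<^sup>2"
  proof -
    have "(\<lambda>y. (G j y - m)\<^sup>2) = (\<lambda>y. (G j y)\<^sup>2 + (m\<^sup>2 - 2 * m * G j y))"
      by (rule ext) (simp add: power2_diff)
    then have "cond s (\<lambda>y. (G j y - m)\<^sup>2) x = cond s (\<lambda>y. (G j y)\<^sup>2) x + (m\<^sup>2 - 2 * m * cond s (G j) x)"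
      by (simp only: cond_add[OF G2 bounded_meas_diff[OF bounded_meas_const bounded_meas_mult[OF bounded_meas_const G]] xS]
        cond_diff[OF bounded_meas_const bounded_meas_mult[OF bounded_meas_const G] xS] cond_const cond_cmult)
    then show ?thesis by (simp add: m_def power2_eq_square)
  qed
  also have "\<dots> \<le> 8 * cond s (boot_var n (H j)) x"
    unfolding m_def by (rule cond_var_boot_mean_le[OF n H xS])
  finally show ?thesis using cond_var_le[OF xS ok, of j] by simp
qed

text \<open>As \<open>G (Suc j) <= G j\<close>, a first passage of level \<open>j + 1\<close> cannot
  precede the one of level \<open>j\<close>. Splitting by the time \<open>t\<close> of the latter,
  \<open>sum_first_le\<close> applies with \<open>d = 1 / 32\<close> and
  \<open>c = 1 / 2\<close>.\<close>

lemma chain_step: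
  "(\<Sum>s\<le>N. \<integral>x. indicat_real (first Bd (G (Suc j)) s) x \<partial>S) \<le> 1 / 16 * (\<Sum>s\<le>N. \<integral>x. indicat_real (first Bd (G j) s) x \<partial>S)"
proof -
  let ?A = "\<lambda>j. first Bd (G j)"
  have bA: "bounded_meas S (indicator (?A j s))" for j s by (rule bounded_meas_first[OF Bd(1) bounded_meas_G])
  have bAA: "bounded_meas S (indicator (?A i s \<inter> ?A j t))" for i j s t
    using bounded_meas_mult[OF bA bA] by (simp add: indicator_inter_arith[abs_def])
  have "(\<integral>x. indicat_real (?A (Suc j) s) x \<partial>S) \<le> (\<Sum>t\<le>s. \<integral>x. indicat_real (?A j t \<inter> ?A (Suc j) s) x \<partial>S)" for s
  proof -
    have "(\<integral>x. indicat_real (?A (Suc j) s) x \<partial>S) \<le> (\<integral>x. (\<Sum>t\<le>s. indicat_real (?A j t \<inter> ?A (Suc j) s) x) \<partial>S)"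
    proof (rule integral_mono)
      fix x assume xS: "x \<in> space S"
      show "indicat_real (?A (Suc j) s) x \<le> (\<Sum>t\<le>s. indicat_real (?A j t \<inter> ?A (Suc j) s) x)"
      proof (cases "x \<in> ?A (Suc j) s")
        case True
        have "cond s (G (Suc j)) x \<le> cond s (G j) x"
          using H_Suc_le n0 by (intro cond_mono[OF bounded_meas_G bounded_meas_G xS] boot_mean_mono) auto
        then have "1 / 2 \<le> cond s (G j) x" "ok Bd s x" using True by (auto simp: first_def)
        then obtain t where "t \<le> s" "x \<in> ?A j t" using first_ex by blast
        then have "indicat_real (?A (Suc j) s) x \<le> indicator (?A j t \<inter> ?A (Suc j) s) x" by (simp add: indicator_def)
        also have "\<dots> \<le> (\<Sum>t\<le>s. indicat_real (?A j t \<inter> ?A (Suc j) s) x)"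
          using \<open>t \<le> s\<close> by (intro member_le_sum) auto
        finally show ?thesis .
      qed (simp add: sum_nonneg)
    qed (intro Bochner_Integration.integrable_sum P.bounded_meas_integrable bA bAA)+
    then show ?thesis by (simp add: Bochner_Integration.integral_sum P.bounded_meas_integrable bAA)
  qed
  then have "(\<Sum>s\<le>N. \<integral>x. indicat_real (?A (Suc j) s) x \<partial>S)
     \<le> (\<Sum>s\<le>N. \<Sum>t\<le>s. \<integral>x. indicat_real (?A j t \<inter> ?A (Suc j) s) x \<partial>S)" by (intro sum_mono)
  also have "\<dots> = (\<Sum>t\<le>N. \<Sum>s\<in>{t..N}. \<integral>x. indicat_real (?A j t \<inter> ?A (Suc j) s) x \<partial>S)"
    by (subst sum.Sigma, simp, simp, subst sum.Sigma, simp, simp,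
        rule sum.reindex_bij_witness[of _ "\<lambda>(t, s). (s, t)" "\<lambda>(s, t). (t, s)"]) auto
  also have "\<dots> \<le> (\<Sum>t\<le>N. (1 / 32) / (1 / 2) * (\<integral>x. indicat_real (?A j t) x \<partial>S))"
  proof (rule sum_mono)
    fix t
    show "(\<Sum>s\<in>{t..N}. \<integral>x. indicat_real (?A j t \<inter> ?A (Suc j) s) x \<partial>S) \<le> (1 / 32) / (1 / 2) * (\<integral>x. indicat_real (?A j t) x \<partial>S)"
    proof (rule sum_first_le[where F = "G (Suc j)" and t = t])
      show "0 \<le> G (Suc j) x" for x by (rule boot_mean_bounds[OF n0 H01(1,2)])
      show "1 / 2 \<le> cond s (G (Suc j)) x" if "x \<in> ?A (Suc j) s" for s x using that by (simp add: first_def)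
    qed (use cond_next_level in \<open>auto intro: bA disjoint_first bounded_meas_G depends_below_first\<close>)
  qed
  finally show ?thesis by (simp add: sum_distrib_left)
qed

text \<open>Level 0 costs nothing, its first passages being disjoint events; each further level
  costs a factor \<open>1 / 16\<close>.\<close>

theorem level_chain_bound:
  "(\<integral>x. indicat_real {x. \<exists>s\<le>N. 1 / 2 \<le> cond s (G j) x \<and> ok Bd s x} x \<partial>S) \<le> (1 / 16) ^ j"
proof -
  let ?A = "\<lambda>j. first Bd (G j)"
  have bA: "bounded_meas S (indicator (?A j s))" for j s by (rule bounded_meas_first[OF Bd(1) bounded_meas_G])
  have sum1: "(\<Sum>s\<le>N. \<integral>x. indicat_real (?A j s) x \<partial>S) = (\<integral>x. indicat_real (\<Union>s\<le>N. ?A j s) x \<partial>S)" for j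
  proof -
    have "(\<Sum>s\<le>N. indicat_real (?A j s) x) = indicat_real (\<Union>s\<le>N. ?A j s) x" for x
      using disjoint_first[of Bd "G j"] by (intro indicator_UN_disjoint[symmetric]) (auto simp: disjoint_family_on_def)
    then have "(\<integral>x. indicat_real (\<Union>s\<le>N. ?A j s) x \<partial>S) = (\<integral>x. (\<Sum>s\<le>N. indicat_real (?A j s) x) \<partial>S)" by (simp only:)
    also have "\<dots> = (\<Sum>s\<le>N. \<integral>x. indicat_real (?A j s) x \<partial>S)"
      by (rule Bochner_Integration.integral_sum[OF P.bounded_meas_integrable[OF bA]])
    finally show ?thesis by (rule sym)
  qed
  have "(\<Sum>s\<le>N. \<integral>x. indicat_real (?A j s) x \<partial>S) \<le> (1 / 16) ^ j"
  proof (induction j)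
    case 0
    have "\<bar>\<integral>x. indicat_real (\<Union>s\<le>N. ?A 0 s) x \<partial>S\<bar> \<le> (1::real)"
      by (rule P.abs_integral_le_bound) (auto simp: indicator_def)
    then show ?case using sum1[of 0] by simp
  next
    case (Suc j)
    then show ?case using chain_step[of j N] by simp
  qed
  moreover have "{x. \<exists>s\<le>N. 1 / 2 \<le> cond s (G j) x \<and> ok Bd s x} = (\<Union>s\<le>N. ?A j s)"
  proof
    show "{x. \<exists>s\<le>N. 1 / 2 \<le> cond s (G j) x \<and> ok Bd s x} \<subseteq> (\<Union>s\<le>N. ?A j s)"
      using first_ex order_trans by fastforce
  qed (auto simp: first_def)
  ultimately show ?thesis by (simp only: sum1)
qed

end

section \<open>Clipped levels of one statistic\<close>

definition clip :: "real \<Rightarrow> real" where "clip t = max 0 (min 1 t)"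

lemma clip_bounds: "0 \<le> clip t" "clip t \<le> 1" by (auto simp: clip_def)

lemma clip_Lipschitz: "\<bar>clip s - clip t\<bar> \<le> \<bar>s - t\<bar>" by (auto simp: clip_def)

lemma boot_mean_le_prob:
  assumes "0 < n" "\<And>y. 0 \<le> H y" "\<And>y. H y \<le> 1" "\<And>y. y \<notin> A \<Longrightarrow> H y = 0"
  shows "boot_mean n H x \<le> measure_pmf.prob (bootstrap n x) A"
proof -
  have "boot_mean n H x \<le> measure_pmf.expectation (bootstrap n x) (indicator A)"
    unfolding boot_mean_def using assms
    by (intro integral_mono integrable_measure_pmf_finite) (auto simp: indicator_def)
  then show ?thesis by simp
qed

lemma prob_le_boot_mean:
  assumes "0 < n" "\<And>y. 0 \<le> H y" "\<And>y. y \<in> A \<Longrightarrow> H y = 1"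
  shows "measure_pmf.prob (bootstrap n x) A \<le> boot_mean n H x"
proof -
  have "measure_pmf.expectation (bootstrap n x) (indicator A) \<le> boot_mean n H x"
    unfolding boot_mean_def using assms
    by (intro integral_mono integrable_measure_pmf_finite) (auto simp: indicator_def)
  then show ?thesis by simp
qed

text \<open>The variance is at most the mean square distance to \<open>m\<close>; on
  \<open>A\<close> that distance is at most 1, both points being in the unit interval.\<close>

lemma boot_var_le_of_close:
  assumes n: "0 < n" and H: "\<And>y. 0 \<le> H y" "\<And>y. H y \<le> 1"
    and d: "\<And>y. y \<notin> A \<Longrightarrow> \<bar>H y - m\<bar> \<le> d" and m: "0 \<le> m" "m \<le> 1"
  shows "boot_var n H x \<le> d\<^sup>2 + measure_pmf.prob (bootstrap n x) A"
proof -
  have "boot_var n H x \<le> boot_mean n (\<lambda>y. (H y - m)\<^sup>2) x"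
    by (simp add: boot_mean_square_dev[OF n])
  also have "\<dots> \<le> measure_pmf.expectation (bootstrap n x) (\<lambda>y. d\<^sup>2 + indicator A y)"
    unfolding boot_mean_def
  proof (intro integral_mono integrable_measure_pmf_finite)
    fix y
    have "\<bar>H y - m\<bar> \<le> 1" using H[of y] m by linarith
    then have "(H y - m)\<^sup>2 \<le> 1" by (simp add: abs_square_le_1)
    moreover have "(H y - m)\<^sup>2 \<le> d\<^sup>2" if "y \<notin> A" using d[OF that] by (simp add: abs_le_square_iff[symmetric])
    ultimately show "(H y - m)\<^sup>2 \<le> d\<^sup>2 + indicator A y"
      by (cases "y \<in> A") (auto simp: add_increasing)
  qed (use n in auto)
  also have "\<dots> = d\<^sup>2 + measure_pmf.prob (bootstrap n x) A"
    using n by (subst Bochner_Integration.integral_add) (auto intro: integrable_measure_pmf_finite)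
  finally show ?thesis .
qed

context sequence_space begin

text \<open>Level \<open>i\<close> is the clipped \<open>g / w - (i + 1)\<close>, rising from 0 to 1
  between \<open>(i + 1) * w\<close> and \<open>(i + 2) * w\<close>. Off \<open>bad\<close> a
  resample moves \<open>g\<close> by at most \<open>K <= w / 128\<close>, except with probability
  \<open>1 / 8192\<close>, and \<open>(1 / 128)^2 + 1 / 8192\<close> is below
  \<open>1 / 4096\<close>. If \<open>g x > b\<close>, most resamples stay above \<open>b - K\<close>
  and saturate level \<open>j\<close>; at time \<open>n\<close> its martingale equals the bootstrap
  mean and is at least \<open>1 / 2\<close>.\<close>

lemma large_deviation_bound:
  fixes g :: "(nat \<Rightarrow> 'a) \<Rightarrow> real"
  assumes n: "2 \<le> n" and g: "g \<in> borel_measurable S" "depends_below n g" "\<And>y. 0 \<le> g y"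
    and K: "0 \<le> K" "128 * K \<le> w" "0 < w" "K1 + K \<le> w"
    and bad: "bounded_meas S (indicator bad)"
      "\<And>x. x \<in> space S \<Longrightarrow> x \<notin> bad \<Longrightarrow> measure_pmf.prob (bootstrap n x) {y. K < \<bar>g y - g x\<bar>} \<le> 1 / 8192"
    and small: "(\<integral>x. indicat_real bad x \<partial>S) \<le> 1 / 8" "P.prob {x \<in> space S. K1 < g x} \<le> 1 / 8"
    and j: "w * (real j + 2) \<le> b - K"
  shows "P.prob {x \<in> space S. x \<notin> bad \<and> ok (indicator bad) n x \<and> b < g x} \<le> (1 / 16) ^ j"
proof -
  define H where "H i y = clip (g y / w - (real i + 1))" for i y
  have n0: "0 < n" using n by simp
  let ?A = "\<lambda>x. {y. K < \<bar>g y - g x\<bar>}"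
  have [measurable]: "H i \<in> borel_measurable S" for i
    unfolding H_def[abs_def] clip_def using g(1) by measurable
  have bH: "bounded_meas S (H i)" for i
    by (rule bounded_measI[of _ _ 1]) (auto simp: H_def clip_def)
  have dH: "depends_below n (H i)" for i using g(2) unfolding H_def depends_below_def by metis
  have H01: "0 \<le> H i y" "H i y \<le> 1" for i y by (auto simp: H_def clip_bounds)
  have Hstep: "H i y = 1" if "0 < H (Suc i) y" for i y using that by (auto simp: H_def clip_def)
  have var: "boot_var n (H i) x \<le> 1 / 4096 + indicator bad x" if x: "x \<in> space S" for i x
  proof (cases "x \<in> bad")
    case True
    then show ?thesis using boot_var_bounds(2)[of n "H i" x, OF n0 H01] by simp
  next
    case False
    have "boot_var n (H i) x \<le> (1 / 128)\<^sup>2 + measure_pmf.prob (bootstrap n x) (?A x)"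
    proof (rule boot_var_le_of_close[where m = "H i x"])
      show "0 < n" "0 \<le> H i x" "H i x \<le> 1" "0 \<le> H i y" "H i y \<le> 1" for y by (rule n0 H01)+
      fix y assume "y \<notin> ?A x"
      then have "\<bar>g y - g x\<bar> \<le> K" by simp
      then have "\<bar>g y / w - g x / w\<bar> \<le> K / w" using K by (simp add: divide_right_mono flip: diff_divide_distrib)
      also have "\<dots> \<le> 1 / 128" using K by (simp add: field_simps)
      finally show "\<bar>H i y - H i x\<bar> \<le> 1 / 128"
        unfolding H_def by (intro order_trans[OF clip_Lipschitz]) simp
    qed
    with bad(2)[OF x False] False show ?thesis by (simp add: power2_eq_square)
  qed
  \<comment> \<open>Off \<open>bad\<close> and where \<open>g x <= K1\<close>, most resamples have
    \<open>g y <= K1 + K <= w\<close>, where level 0 vanishes. The other data have probability at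
    most \<open>1 / 8 + 1 / 8\<close>, the other resamples add \<open>1 / 8192\<close>.\<close>
  have start: "(\<integral>x. boot_mean n (H 0) x \<partial>S) < 1 / 2"
  proof -
    have m[measurable]: "{x \<in> space S. K1 < g x} \<in> sets S" using g(1) by measurable
    have iK: "integrable S (indicat_real {x \<in> space S. K1 < g x})"
      by (rule P.bounded_meas_integrable, rule bounded_measI[of _ _ 1]) (auto simp: m indicator_def)
    have "(\<integral>x. boot_mean n (H 0) x \<partial>S) \<le> (\<integral>x. indicat_real bad x + indicat_real {x \<in> space S. K1 < g x} x + 1 / 8192 \<partial>S)"
    proof (rule integral_mono)
      show "integrable S (boot_mean n (H 0))" by (rule P.bounded_meas_integrable[OF bounded_meas_boot_mean[OF n0 bH dH]])
      show "integrable S (\<lambda>x. indicat_real bad x + indicat_real {x \<in> space S. K1 < g x} x + 1 / 8192)"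
          by (intro Bochner_Integration.integrable_add P.bounded_meas_integrable[OF bad(1)] iK) auto
      fix x assume x: "x \<in> space S"
      show "boot_mean n (H 0) x \<le> indicat_real bad x + indicat_real {x \<in> space S. K1 < g x} x + 1 / 8192"
      proof (cases "x \<in> bad \<or> K1 < g x")
        case True
        then show ?thesis using boot_mean_bounds(2)[of n "H 0" x, OF n0 H01] x by (auto simp: indicator_def)
      next
        case False
        have "boot_mean n (H 0) x \<le> measure_pmf.prob (bootstrap n x) (?A x)"
        proof (rule boot_mean_le_prob)
          show "0 < n" "0 \<le> H 0 y" "H 0 y \<le> 1" for y by (rule n0 H01)+
          fix y assume "y \<notin> ?A x"
          then have "g y \<le> w" using False K by auto
          then have "g y / w \<le> 1" using K by simp
          then show "H 0 y = 0" by (simp add: H_def clip_def)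
        qed
        then show ?thesis using bad(2)[OF x] False by (auto simp: indicator_def)
      qed
    qed
    also have "\<dots> = (\<integral>x. indicat_real bad x \<partial>S) + P.prob {x \<in> space S. K1 < g x} + 1 / 8192"
    proof -
      have "integrable S (indicat_real bad)" by (rule P.bounded_meas_integrable[OF bad(1)])
      moreover note iK
      moreover have "(\<integral>x. indicat_real {x \<in> space S. K1 < g x} x \<partial>S) = P.prob {x \<in> space S. K1 < g x}" by simp
      ultimately show ?thesis
        by (simp add: P.prob_space)
    qed
    also have "\<dots> < 1 / 2" using small by simp
    finally show ?thesis .
  qed
  interpret level_chain M n H "indicator bad"
    by unfold_locales (use n bH dH H01 Hstep bad(1) var start in auto)
  let ?L = "{x. \<exists>s\<le>n. 1 / 2 \<le> cond s (G j) x \<and> ok (indicator bad) s x}"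
  have "{x \<in> space S. x \<notin> bad \<and> ok (indicator bad) n x \<and> b < g x} \<subseteq> ?L \<inter> space S"
  proof safe
    fix x assume x: "x \<in> space S" "x \<notin> bad" "ok (indicator bad) n x" "b < g x"
    have "1 - measure_pmf.prob (bootstrap n x) (?A x) = measure_pmf.prob (bootstrap n x) (- ?A x)"
      using measure_pmf.prob_compl[of "?A x" "bootstrap n x"] by (simp add: Compl_eq_Diff_UNIV)
    also have "\<dots> \<le> boot_mean n (H j) x"
    proof (rule prob_le_boot_mean)
      show "0 < n" "0 \<le> H j y" for y by (rule n0 H01)+
      fix y assume "y \<in> - ?A x"
      then have "w * (real j + 2) \<le> g y" using j x(4) by auto
      then have "real j + 2 \<le> g y / w" using K by (simp add: field_simps)
      then show "H j y = 1" by (simp add: H_def clip_def)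
    qed
    finally have "1 / 2 \<le> boot_mean n (H j) x" using bad(2)[OF x(1,2)] by simp
    then have "1 / 2 \<le> cond n (G j) x" by (simp add: cond_depends_below[OF depends_below_boot_mean[OF n0 dH]])
    with x show "\<exists>s\<le>n. 1 / 2 \<le> cond s (G j) x \<and> ok (indicator bad) s x" by blast
  qed
  moreover have L: "?L \<inter> space S \<in> sets S"
  proof -
    have [measurable]: "cond t (indicator bad) \<in> borel_measurable S" "cond t (G j) \<in> borel_measurable S" for t
      using bounded_meas_cond[OF bad(1)] bounded_meas_cond[OF bounded_meas_G] by (auto simp: bounded_meas_def)
    have "?L \<inter> space S = {x \<in> space S. \<exists>s\<le>n. 1 / 2 \<le> cond s (G j) x \<and> ok (indicator bad) s x}" by auto
    also have "\<dots> \<in> sets S" unfolding ok_def by measurable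
    finally show ?thesis .
  qed
  ultimately have "P.prob {x \<in> space S. x \<notin> bad \<and> ok (indicator bad) n x \<and> b < g x} \<le> P.prob (?L \<inter> space S)"
    by (rule P.finite_measure_mono)
  also have "\<dots> = (\<integral>x. indicat_real ?L x \<partial>S)" by simp
  also have "\<dots> \<le> (1 / 16) ^ j" by (rule level_chain_bound)
  finally show ?thesis .
qed

text \<open>Doob's maximal inequality for the conditional probabilities of \<open>bad\<close>:
  \<open>A s\<close> is the first exceedance of \<open>1 / 4096\<close>, and
  \<open>sum_first_le\<close> is used with the trivial event at time 0.\<close>

lemma not_ok_bound:
  assumes bad: "bounded_meas S (indicator bad)"
  shows "P.prob {x \<in> space S. \<not> ok (indicator bad) N x} \<le> 4096 * (\<integral>x. indicat_real bad x \<partial>S)"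
proof -
  let ?C = "\<lambda>s. cond s (indicator bad)"
  define A where "A s = {x. 1 / 4096 < ?C s x \<and> (\<forall>t<s. ?C t x \<le> 1 / 4096)}" for s
  have [measurable]: "?C t \<in> borel_measurable S" for t
    using bounded_meas_cond[OF bad] by (auto simp: bounded_meas_def)
  have bA: "bounded_meas S (indicator (A s))" for s
    unfolding A_def by (rule bounded_meas_indicator) measurable
  have dis: "disjoint_family A"
  proof -
    have "m = n" if "x \<in> A m" "x \<in> A n" for m n x
      using that by (cases m n rule: linorder_cases) (auto simp: A_def not_less[symmetric])
    then show ?thesis unfolding disjoint_family_on_def by blast
  qed
  have dep: "depends_below s (\<lambda>x. indicat_real (A s) x)" for s
    unfolding depends_below_def
  proof (intro allI impI)
    fix x y :: "nat \<Rightarrow> 'a" assume "\<forall>i<s. x i = y i"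
    then have "?C t x = ?C t y" if "t \<le> s" for t using that by (auto intro!: cond_cong_below[of s])
    then have "x \<in> A s \<longleftrightarrow> y \<in> A s" by (auto simp: A_def)
    then show "indicat_real (A s) x = indicat_real (A s) y" by (simp add: indicator_def)
  qed
  have "(\<Sum>s\<le>N. \<integral>x. indicat_real (UNIV \<inter> A s) x \<partial>S) \<le> (\<integral>x. indicat_real bad x \<partial>S) / (1 / 4096) * (\<integral>x. indicat_real UNIV x \<partial>S)"
    by (rule sum_first_le[OF bA dis bad _ dep, where t = 0])
       (auto simp: A_def cond_0 depends_below_def intro: bounded_meas_const)
  then have 1: "(\<Sum>s\<le>N. P.prob (A s \<inter> space S)) \<le> 4096 * (\<integral>x. indicat_real bad x \<partial>S)"
    by (simp add: P.prob_space)
  have As: "A s \<inter> space S \<in> sets S" for s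
    using bounded_meas_measurable[OF bA] by (simp add: borel_measurable_indicator_iff)
  have "{x \<in> space S. \<not> ok (indicator bad) N x} \<subseteq> (\<Union>s\<le>N. A s \<inter> space S)"
  proof safe
    fix x assume x: "x \<in> space S" "\<not> ok (indicator bad) N x"
    then have ex: "\<exists>t. 1 / 4096 < ?C t x" by (auto simp: ok_def not_le)
    define t where "t = (LEAST t. 1 / 4096 < ?C t x)"
    have "1 / 4096 < ?C t x" using LeastI_ex[OF ex] by (simp add: t_def)
    moreover have "t \<le> N"
    proof -
      obtain u where "u \<le> N" "1 / 4096 < ?C u x" using x(2) by (auto simp: ok_def not_le)
      then show ?thesis unfolding t_def by (meson Least_le order_trans)
    qed
    moreover have "?C u x \<le> 1 / 4096" if "u < t" for u
      using not_less_Least[OF that[unfolded t_def]] by simp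
    ultimately show "x \<in> (\<Union>s\<le>N. A s \<inter> space S)" using x(1) by (auto simp: A_def)
  qed
  then have "P.prob {x \<in> space S. \<not> ok (indicator bad) N x} \<le> P.prob (\<Union>s\<le>N. A s \<inter> space S)"
    by (rule P.finite_measure_mono, intro sets.finite_UN As) simp
  also have "\<dots> \<le> (\<Sum>s\<le>N. P.prob (A s \<inter> space S))"
    by (rule P.finite_measure_subadditive_finite) (use As in auto)
  also note 1
  finally show ?thesis .
qed

end

section \<open>Consistency from bootstrap tightness\<close>

text \<open>The exponent \<open>j\<close> will be of order \<open>sqrt n\<close>, so the fourth
  power gives order \<open>1 / n^2\<close>, which is summable.\<close>

lemma sixteenth_power_le: "(1 / 16 :: real) ^ j \<le> 1 / (real j + 1) ^ 4"
proof -
  have "real j + 1 \<le> 2 ^ j" by (induction j) (auto simp: algebra_simps intro: order_trans)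
  then have "(real j + 1) ^ 4 \<le> (2 ^ j) ^ 4" by (intro power_mono) auto
  also have "\<dots> = 16 ^ j" by (simp add: power_mult[symmetric] mult.commute[of j]) (simp add: power_mult)
  finally have "1 / 16 ^ j \<le> 1 / (real j + 1) ^ 4" by (intro divide_left_mono) auto
  then show ?thesis by (simp add: power_divide)
qed

context sequence_space begin

text \<open>Both the bootstrap law and the event depend on \<open>x\<close>. As an average over the
  fixed finite law of index maps, the probability is visibly measurable in \<open>x\<close>.\<close>

lemma bounded_meas_prob_bootstrap:
  fixes g :: "(nat \<Rightarrow> 'a) \<Rightarrow> real"
  assumes "0 < n" "g \<in> borel_measurable S" "depends_below n g"
  shows "bounded_meas S (\<lambda>x. measure_pmf.prob (bootstrap n x) {y. K < \<bar>g y - g x\<bar>})"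
proof -
  have [measurable]: "g \<in> borel_measurable S" by fact
  have "measure_pmf.prob (bootstrap n x) {y. K < \<bar>g y - g x\<bar>}
      = measure_pmf.expectation (resample n) (\<lambda>I. indicator {x. K < \<bar>g (x \<circ> I) - g x\<bar>} x)" for x
  proof -
    have "measure_pmf.prob (bootstrap n x) {y. K < \<bar>g y - g x\<bar>}
       = measure_pmf.expectation (bootstrap n x) (indicator {y. K < \<bar>g y - g x\<bar>})" by simp
    also have "\<dots> = measure_pmf.expectation (resample n) (\<lambda>I. indicator {y. K < \<bar>g y - g x\<bar>} (x \<circ> I))"
    proof (rule expectation_bootstrap[OF assms(1)])
      show "depends_below n (indicat_real {y. K < \<bar>g y - g x\<bar>})"
        using assms(3) unfolding depends_below_def indicator_def mem_Collect_eq by metis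
    qed
    finally show ?thesis by (simp add: indicator_def)
  qed
  moreover have "bounded_meas S (\<lambda>x. measure_pmf.expectation (resample n) (\<lambda>I. indicator {x. K < \<bar>g (x \<circ> I) - g x\<bar>} x))"
  proof (rule bounded_meas_resample[OF assms(1)])
    fix I
    have [measurable]: "(\<lambda>x. g (x \<circ> I)) \<in> borel_measurable S"
      by (rule measurable_compose[OF measurable_reindex]) fact
    show "bounded_meas S (indicator {x. K < \<bar>g (x \<circ> I) - g x\<bar>})"
      by (rule bounded_meas_indicator) measurable
  qed
  ultimately show ?thesis by simp
qed

theorem bootstrap_tight_imp_consistent:
  fixes f :: "nat \<Rightarrow> (nat \<Rightarrow> 'a) \<Rightarrow> real"
  assumes f: "\<And>n. 0 < n \<Longrightarrow> f n \<in> borel_measurable S" "\<And>n. 0 < n \<Longrightarrow> depends_below n (f n)" "\<And>n x. 0 \<le> f n x"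
    and tight: "\<And>\<tau>. 0 < \<tau> \<Longrightarrow> \<exists>K. \<forall>\<^sub>F n in sequentially. P.prob {x \<in> space S. K < sqrt n * f n x} \<le> \<tau>"
    and boot: "\<And>\<tau>. 0 < \<tau> \<Longrightarrow> \<exists>K. AE x in S. \<forall>\<^sub>F n in sequentially.
        measure_pmf.prob (bootstrap n x) {y. K < sqrt n * \<bar>f n y - f n x\<bar>} \<le> \<tau>"
  shows "AE x in S. (\<lambda>n. f n x) \<longlonglongrightarrow> 0"
proof -
  define g where "g n x = sqrt (real n) * f n x" for n x
  have g: "g n \<in> borel_measurable S" "depends_below n (g n)" "0 \<le> g n x" if "0 < n" for n x
    using f[of n] that by (auto simp: g_def[abs_def] depends_below_def)
  obtain K1 where K1: "\<forall>\<^sub>F n in sequentially. P.prob {x \<in> space S. K1 < g n x} \<le> 1 / 8"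
    using tight[of "1 / 8"] by (auto simp: g_def)
  obtain K' where K': "AE x in S. \<forall>\<^sub>F n in sequentially.
        measure_pmf.prob (bootstrap n x) {y. K' < sqrt n * \<bar>f n y - f n x\<bar>} \<le> 1 / 8192"
    using boot[of "1 / 8192"] by auto
  define K where "K = max 0 K'"
  define p where "p n x = measure_pmf.prob (bootstrap n x) {y. K < \<bar>g n y - g n x\<bar>}" for n x
  \<comment> \<open>One width meets all demands of \<open>large_deviation_bound\<close>:
    \<open>128 * K\<close> for a small variance, \<open>K1 + K\<close> for a small start, and
    positivity.\<close>
  define w where "w = 128 * K + \<bar>K1\<bar> + K + 1"
  have K: "0 \<le> K" "128 * K \<le> w" "0 < w" "K1 + K \<le> w" by (auto simp: K_def w_def)
  have Kg: "AE x in S. \<forall>\<^sub>F n in sequentially. p n x \<le> 1 / 8192"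
    using K'
  proof eventually_elim
    case (elim x)
    then show ?case
    proof eventually_elim
      case (elim n)
      have "p n x \<le> measure_pmf.prob (bootstrap n x) {y. K' < sqrt n * \<bar>f n y - f n x\<bar>}"
        unfolding p_def by (intro measure_pmf.finite_measure_mono)
          (auto simp: g_def K_def abs_mult simp flip: right_diff_distrib)
      with elim show ?case by simp
    qed
  qed
  have pm: "bounded_meas S (p n)" if "0 < n" for n
    unfolding p_def[abs_def] using g that by (intro bounded_meas_prob_bootstrap) auto
  \<comment> \<open>One event for all sample sizes beyond \<open>N\<close>. Starting at
    \<open>Suc N\<close> keeps \<open>n\<close> positive, where \<open>p n\<close> is known to be
    measurable.\<close>
  define bad where "bad N = {x. \<exists>n\<ge>Suc N. 1 / 8192 < p n x}" for N
  have badm: "bad N \<inter> space S \<in> sets S" for N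
  proof -
    have [measurable]: "p (Suc n) \<in> borel_measurable S" for n using pm by (simp add: bounded_meas_def)
    have "bad N \<inter> space S = {x \<in> space S. \<exists>n. N \<le> n \<and> 1 / 8192 < p (Suc n) x}"
      unfolding bad_def by (auto; metis Suc_le_D Suc_le_mono)
    also have "\<dots> \<in> sets S" by measurable
    finally show ?thesis .
  qed
  have bbad: "bounded_meas S (indicator (bad N))" for N
    by (rule bounded_measI[of _ _ 1]) (simp_all only: borel_measurable_indicator_iff badm, simp add: indicator_def)
  have lim: "(\<lambda>N. P.prob (bad N \<inter> space S)) \<longlonglongrightarrow> 0"
  proof -
    have "(\<lambda>N. P.prob (bad N \<inter> space S)) \<longlonglongrightarrow> P.prob (\<Inter>N. bad N \<inter> space S)"
    proof (rule P.finite_Lim_measure_decseq)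
      show "range (\<lambda>N. bad N \<inter> space S) \<subseteq> sets S" using badm by blast
      have "bad n \<subseteq> bad m" if "m \<le> n" for m n unfolding bad_def using that by (intro Collect_mono) (meson Suc_le_mono order_trans)
      then show "decseq (\<lambda>N. bad N \<inter> space S)" unfolding decseq_def by blast
    qed
    moreover have "P.prob (\<Inter>N. bad N \<inter> space S) = 0"
    proof -
      have "AE x in S. x \<notin> (\<Inter>N. bad N \<inter> space S)"
        using Kg
      proof eventually_elim
        case (elim x)
        then obtain N where "\<forall>n\<ge>N. p n x \<le> 1 / 8192" by (auto simp: eventually_sequentially)
        then have "\<not> 1 / 8192 < p n x" if "Suc N \<le> n" for n using that by (metis Suc_leD not_less)
        then have "x \<notin> bad N" unfolding bad_def by blast
        then show ?case by auto
      qed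
      moreover have "(\<Inter>N. bad N \<inter> space S) \<in> sets S"
        by (rule sets.countable_INT'[OF _ _ image_subsetI[OF badm]]) auto
      ultimately show ?thesis by (simp only: P.prob_eq_0)
    qed
    ultimately show ?thesis by simp
  qed
  have ev: "AE x in S. \<forall>\<^sub>F n in sequentially. f n x \<le> a" if a: "0 < a" for a
  proof -
    \<comment> \<open>\<open>large_deviation_bound\<close> asks for
      \<open>w * (j + 2) <= a * sqrt n - K\<close>: the number of full widths that fit, less
      2.\<close>
    define j where "j n = nat \<lfloor>(a * sqrt (real n) - K) / w\<rfloor> - 2" for n
    have jb: "\<forall>\<^sub>F n in sequentially. w * (real (j n) + 2) \<le> a * sqrt (real n) - K \<and>
        a / (2 * w) * sqrt (real n) \<le> real (j n) + 1"
    proof -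
      have "filterlim (\<lambda>n. sqrt (real n)) at_top sequentially"
        by (rule filterlim_compose[OF sqrt_at_top filterlim_real_sequentially])
      \<comment> \<open>Past this threshold \<open>a * sqrt n >= 6 * w + 2 * K\<close>: at least
        three widths fit, so the subtraction of 2 in \<open>j n\<close> does not truncate, and
        \<open>w * (j n + 1)\<close> keeps half of \<open>a * sqrt n\<close>.\<close>
      then have "\<forall>\<^sub>F n in sequentially. 2 * (3 * w + K) / a \<le> sqrt (real n)" by (simp add: filterlim_at_top)
      then show ?thesis
      proof eventually_elim
        case (elim n)
        define r where "r = (a * sqrt (real n) - K) / w"
        have rw: "w * r = a * sqrt (real n) - K" using K by (simp add: r_def)
        have e: "6 * w + 2 * K \<le> a * sqrt (real n)" using elim a by (simp add: field_simps)
        have 1: "a * sqrt (real n) / 2 \<le> w * (r - 3 + 1)"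
        proof -
          have "a * sqrt (real n) / 2 \<le> a * sqrt (real n) - K - 2 * w" using e K(1,3) by linarith
          also have "\<dots> = w * (r - 3 + 1)" using rw by (simp add: algebra_simps)
          finally show ?thesis .
        qed
        have "w * 3 \<le> w * r" unfolding rw using e K(1,3) by linarith
        then have r3: "3 \<le> r" using K by simp
        then have fl: "3 \<le> \<lfloor>r\<rfloor>" by (simp add: le_floor_iff)
        have jr: "real (j n) = of_int \<lfloor>r\<rfloor> - 2"
        proof -
          have "2 \<le> nat \<lfloor>r\<rfloor>" using fl by linarith
          then show ?thesis using fl unfolding j_def r_def[symmetric] by (simp add: of_nat_diff)
        qed
        have "real (j n) + 2 \<le> r" unfolding jr by simp
        then have "w * (real (j n) + 2) \<le> w * r" using K by (intro mult_left_mono) auto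
        moreover have "w * (r - 3 + 1) \<le> w * (real (j n) + 1)"
          using K unfolding jr by (intro mult_left_mono) (auto, linarith)
        then have "a * sqrt (real n) / 2 \<le> w * (real (j n) + 1)" using 1 by linarith
        then have "a / (2 * w) * sqrt (real n) \<le> real (j n) + 1" using K by (simp add: field_simps)
        ultimately show ?case by (simp add: rw)
      qed
    qed
    have summ: "summable (\<lambda>n. (1 / 16 :: real) ^ j n)"
    proof (rule summable_comparison_test_ev)
      show "summable (\<lambda>n. 1 / (a / (2 * w)) ^ 4 * inverse ((real n) ^ 2))"
        by (intro summable_mult inverse_power_summable) auto
      show "\<forall>\<^sub>F n in sequentially. norm ((1 / 16 :: real) ^ j n) \<le> 1 / (a / (2 * w)) ^ 4 * inverse ((real n) ^ 2)"
        using jb eventually_gt_at_top[of 0]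
      proof eventually_elim
        case (elim n)
        have "(a / (2 * w) * sqrt (real n)) ^ 4 \<le> (real (j n) + 1) ^ 4"
          using elim a K by (intro power_mono) auto
        moreover have "sqrt (real n) ^ 4 = (real n) ^ 2"
        proof -
          show ?thesis using power_mult[of "sqrt (real n)" 2 2] by simp
        qed
        ultimately have "(a / (2 * w)) ^ 4 * (real n) ^ 2 \<le> (real (j n) + 1) ^ 4" by (simp only: power_mult_distrib)
        then have "1 / (real (j n) + 1) ^ 4 \<le> 1 / ((a / (2 * w)) ^ 4 * (real n) ^ 2)"
          using a K elim by (intro divide_left_mono) auto
        also have "\<dots> = 1 / (a / (2 * w)) ^ 4 * inverse ((real n) ^ 2)" by (simp only: divide_inverse inverse_mult_distrib mult_1_left)
        finally have "(1 / 16) ^ j n \<le> 1 / (a / (2 * w)) ^ 4 * inverse ((real n) ^ 2)"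
          by (rule order_trans[OF sixteenth_power_le])
        then show ?case by (simp only: real_norm_def abs_of_nonneg zero_le_power zero_le_divide_1_iff zero_le_numeral)
      qed
    qed
    define B where "B N = {x \<in> space S. \<exists>n\<ge>Suc N. a < f n x}" for N
    have fm: "f (Suc n) \<in> borel_measurable S" for n using f by simp
    note fm[measurable]
    have Bm: "B N \<in> sets S" for N
    proof -
      have "B N = {x \<in> space S. \<exists>n. N \<le> n \<and> a < f (Suc n) x}"
        unfolding B_def by (auto; metis Suc_le_D Suc_le_mono)
      also have "\<dots> \<in> sets S" by measurable
      finally show ?thesis .
    qed
    have "\<exists>N. P.prob (B N) \<le> e" if e: "0 < e" for e
    proof -
      \<comment> \<open>The final bound is \<open>e' + 4096 * e' + e'\<close>: for
        \<open>bad\<close>, for leaving \<open>ok\<close>, and for the tail of the series. The cap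
        \<open>1 / 8\<close> is the one put on \<open>bad\<close> by
        \<open>large_deviation_bound\<close>.\<close>
      define e' where "e' = min (1 / 8) (e / 8194)"
      have e': "0 < e'" using e by (simp add: e'_def)
      obtain N0 where N0: "\<And>n. N0 \<le> n \<Longrightarrow> P.prob {x \<in> space S. K1 < g n x} \<le> 1 / 8"
        using K1 by (auto simp: eventually_sequentially)
      obtain N1 where N1: "\<And>n. N1 \<le> n \<Longrightarrow> w * (real (j n) + 2) \<le> a * sqrt (real n) - K"
        using jb by (auto simp: eventually_sequentially)
      obtain N2 where N2: "\<And>n. N2 \<le> n \<Longrightarrow> P.prob (bad n \<inter> space S) < e'"
        using order_tendstoD(2)[OF lim e'] by (auto simp: eventually_sequentially)
      obtain N3 where N3: "\<And>n m. N3 \<le> n \<Longrightarrow> norm (\<Sum>k\<in>{n..<m}. (1 / 16 :: real) ^ j k) < e'"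
        using summable_Cauchy[of "\<lambda>n. (1 / 16 :: real) ^ j n"] summ e' by meson
      define N where "N = N0 + N1 + N2 + N3 + 1"
      have small: "(\<integral>x. indicat_real (bad N) x \<partial>S) \<le> e'" using N2[of N] by (simp add: N_def)
      \<comment> \<open>With a finite horizon \<open>m\<close>, \<open>ok\<close> at time
        \<open>m\<close> entails \<open>ok\<close> at every \<open>n < m\<close>, so one use of
        \<open>not_ok_bound\<close> serves them all. The horizon then tends to infinity.\<close>
      have fin: "P.prob {x \<in> space S. \<exists>n\<in>{Suc N..<m}. a < f n x} \<le> e" for m
      proof -
        let ?L = "\<lambda>n. {x \<in> space S. x \<notin> bad N \<and> ok (indicator (bad N)) n x \<and> a * sqrt (real n) < g n x}"
        have [measurable]: "cond t (indicator (bad N)) \<in> borel_measurable S" for t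
          using bounded_meas_cond[OF bbad] by (auto simp: bounded_meas_def)
        have Lm: "?L n \<in> sets S" if "n \<in> {Suc N..<m}" for n
        proof -
          have [measurable]: "g n \<in> borel_measurable S" using g(1)[of n] that by simp
          have "?L n = {x \<in> space S. ok (indicator (bad N)) n x \<and> a * sqrt (real n) < g n x} - (bad N \<inter> space S)"
            by auto
          also have "\<dots> \<in> sets S" using badm[of N] unfolding ok_def by measurable
          finally show ?thesis .
        qed
        have okm: "{x \<in> space S. \<not> ok (indicator (bad N)) m x} \<in> sets S" unfolding ok_def by measurable
        have L: "P.prob (?L n) \<le> (1 / 16) ^ j n" if n: "n \<in> {Suc N..<m}" for n
        proof (rule large_deviation_bound[where K = K and w = w and ?K1.0 = K1])
          show "2 \<le> n" "g n \<in> borel_measurable S" "depends_below n (g n)" "\<And>y. 0 \<le> g n y"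
            using n g[of n] by (auto simp: N_def)
          show "measure_pmf.prob (bootstrap n x) {y. K < \<bar>g n y - g n x\<bar>} \<le> 1 / 8192" if "x \<notin> bad N" for x
            using that n by (auto simp: bad_def p_def not_less)
          show "(\<integral>x. indicat_real (bad N) x \<partial>S) \<le> 1 / 8" using small by (simp add: e'_def)
          show "P.prob {x \<in> space S. K1 < g n x} \<le> 1 / 8" using n by (intro N0) (auto simp: N_def)
          show "w * (real (j n) + 2) \<le> a * sqrt (real n) - K" using n by (intro N1) (auto simp: N_def)
        qed (use K bbad in auto)
        have "{x \<in> space S. \<exists>n\<in>{Suc N..<m}. a < f n x} \<subseteq>
          (bad N \<inter> space S) \<union> {x \<in> space S. \<not> ok (indicator (bad N)) m x} \<union> (\<Union>n\<in>{Suc N..<m}. ?L n)"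
        proof
          fix x assume "x \<in> {x \<in> space S. \<exists>n\<in>{Suc N..<m}. a < f n x}"
          then obtain n where x: "x \<in> space S" "n \<in> {Suc N..<m}" "a < f n x" by blast
          have gx: "a * sqrt (real n) < g n x" using x by (simp add: g_def mult.commute)
          show "x \<in> (bad N \<inter> space S) \<union> {x \<in> space S. \<not> ok (indicator (bad N)) m x} \<union> (\<Union>n\<in>{Suc N..<m}. ?L n)"
          proof (cases "x \<in> bad N \<or> \<not> ok (indicator (bad N)) m x")
            case False
            then have "ok (indicator (bad N)) n x" using x(2) by (auto simp: ok_def)
            then have "x \<in> ?L n" using False x(1) gx by blast
            then show ?thesis using x(2) by blast
          qed (use x(1) in blast)
        qed
        moreover have UL: "(\<Union>n\<in>{Suc N..<m}. ?L n) \<in> sets S" by (rule sets.finite_UN[OF _ Lm]) simp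
        ultimately have "P.prob {x \<in> space S. \<exists>n\<in>{Suc N..<m}. a < f n x} \<le>
          P.prob ((bad N \<inter> space S) \<union> {x \<in> space S. \<not> ok (indicator (bad N)) m x} \<union> (\<Union>n\<in>{Suc N..<m}. ?L n))"
          using badm[of N] okm by (intro P.finite_measure_mono sets.Un)
        also have "\<dots> \<le> P.prob (bad N \<inter> space S) + P.prob {x \<in> space S. \<not> ok (indicator (bad N)) m x} + P.prob (\<Union>n\<in>{Suc N..<m}. ?L n)"
          by (rule order_trans[OF measure_Un_le add_mono[OF measure_Un_le order_refl]])
             (rule sets.Un badm okm UL)+
        also have "P.prob (\<Union>n\<in>{Suc N..<m}. ?L n) \<le> (\<Sum>n\<in>{Suc N..<m}. P.prob (?L n))"
          using Lm by (intro P.finite_measure_subadditive_finite finite_atLeastLessThan image_subsetI)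
        also have "\<dots> \<le> (\<Sum>n\<in>{Suc N..<m}. (1 / 16) ^ j n)" by (rule sum_mono[OF L])
        also have "\<dots> \<le> e'" using N3[of "Suc N" m] by (simp add: N_def)
        also have "P.prob {x \<in> space S. \<not> ok (indicator (bad N)) m x} \<le> 4096 * (\<integral>x. indicat_real (bad N) x \<partial>S)"
          by (rule not_ok_bound[OF bbad])
        also have "P.prob (bad N \<inter> space S) = (\<integral>x. indicat_real (bad N) x \<partial>S)" by simp
        finally have "P.prob {x \<in> space S. \<exists>n\<in>{Suc N..<m}. a < f n x}
          \<le> (\<integral>x. indicat_real (bad N) x \<partial>S) + 4096 * (\<integral>x. indicat_real (bad N) x \<partial>S) + e'" by simp
        moreover have "8194 * e' \<le> e" by (simp add: e'_def min_def)
        ultimately show ?thesis using small e' by linarith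
      qed
      have "(\<lambda>m. P.prob {x \<in> space S. \<exists>n\<in>{Suc N..<m}. a < f n x}) \<longlonglongrightarrow> P.prob (\<Union>m. {x \<in> space S. \<exists>n\<in>{Suc N..<m}. a < f n x})"
      proof (rule P.finite_Lim_measure_incseq)
        have "{x \<in> space S. \<exists>n\<in>{Suc N..<m}. a < f n x} \<in> sets S" for m
        proof -
          have "{x \<in> space S. \<exists>n\<in>{Suc N..<m}. a < f n x} = (\<Union>n\<in>{Suc N..<m}. {x \<in> space S. a < f n x})" by auto
          also have "\<dots> \<in> sets S"
          proof (intro sets.finite_UN)
            fix n assume "n \<in> {Suc N..<m}"
            then have [measurable]: "f n \<in> borel_measurable S" using f by auto
            show "{x \<in> space S. a < f n x} \<in> sets S" by measurable
          qed auto
          finally show ?thesis .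
        qed
        then show "range (\<lambda>m. {x \<in> space S. \<exists>n\<in>{Suc N..<m}. a < f n x}) \<subseteq> sets S" by blast
      qed (fastforce simp: incseq_def)
      moreover have "(\<Union>m. {x \<in> space S. \<exists>n\<in>{Suc N..<m}. a < f n x}) = B N"
        unfolding B_def by (auto simp: Bex_def)
      ultimately have "P.prob (B N) \<le> e" using fin by (auto intro: LIMSEQ_le_const2)
      then show ?thesis by blast
    qed
    note Bsmall = this
    have small: "P.prob (\<Inter>N. B N) \<le> e" if e: "0 < e" for e
    proof -
      obtain N where "P.prob (B N) \<le> e" using Bsmall[OF e] by blast
      moreover have "P.prob (\<Inter>N. B N) \<le> P.prob (B N)" by (rule P.finite_measure_mono[OF _ Bm]) blast
      ultimately show ?thesis by simp
    qed
    have "P.prob (\<Inter>N. B N) = 0"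
      using small[of "P.prob (\<Inter>N. B N) / 2"] measure_nonneg[of S "\<Inter>N. B N"] by (cases "P.prob (\<Inter>N. B N) = 0") auto
    moreover have "(\<Inter>N. B N) \<in> sets S"
      by (rule sets.countable_INT'[OF _ _ image_subsetI[OF Bm]]) auto
    ultimately have "AE x in S. x \<notin> (\<Inter>N. B N)" by (simp only: P.prob_eq_0)
    moreover have "AE x in S. x \<in> space S" by simp
    ultimately show ?thesis
    proof eventually_elim
      case (elim x)
      then obtain N where "x \<notin> B N" by auto
      with elim show ?case by (auto simp: B_def eventually_sequentially not_less intro!: exI[of _ "Suc N"])
    qed
  qed
  have "AE x in S. \<forall>k. \<forall>\<^sub>F n in sequentially. f n x \<le> 1 / (real k + 1)"
    unfolding AE_all_countable by (intro allI ev) auto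
  then show ?thesis
  proof eventually_elim
    case (elim x)
    show ?case
    proof (rule LIMSEQ_I)
      fix r :: real assume "0 < r"
      then obtain k where "inverse (of_nat (Suc k)) < r" using reals_Archimedean by blast
      then have k: "1 / (real k + 1) < r" by (simp add: inverse_eq_divide add.commute)
      obtain N where "\<And>n. N \<le> n \<Longrightarrow> f n x \<le> 1 / (real k + 1)" using elim by (auto simp: eventually_sequentially)
      then show "\<exists>no. \<forall>n\<ge>no. norm (f n x - 0) < r" using f(3)[of _ x] k by (intro exI[of _ N]) fastforce
    qed
  qed
qed

end

section \<open>A strong law for U-statistics\<close>

lemma Ustat_cong:
  assumes "\<And>i j. i < n \<Longrightarrow> j < n \<Longrightarrow> i \<noteq> j \<Longrightarrow> f (x i) (x j) = g (y i) (y j)"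
  shows "Ustat n f x = Ustat n g y"
  unfolding Ustat_def using assms by (intro arg_cong2[where f = scaleR] sum.cong refl) auto

lemma Ustat_pairs: "Ustat n f x = (1 / (real n * (real n - 1))) *\<^sub>R (\<Sum>(i, j)\<in>(SIGMA i:{..<n}. {..<n} - {i}). f (x i) (x j))"
  by (simp add: Ustat_def sum.Sigma)

lemma Ustat_permutes:
  assumes "\<pi> permutes {..<n}"
  shows "Ustat n f (x \<circ> \<pi>) = Ustat n f x"
proof -
  have inj: "inj \<pi>" using assms by (rule permutes_inj)
  have "bij_betw (\<lambda>(i, j). (\<pi> i, \<pi> j)) (SIGMA i:{..<n}. {..<n} - {i}) (SIGMA i:{..<n}. {..<n} - {i})"
  proof (rule bij_betw_byWitness[where f' = "\<lambda>(i, j). (inv \<pi> i, inv \<pi> j)"])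
    have p: "\<pi> i < n \<longleftrightarrow> i < n" "inv \<pi> i < n \<longleftrightarrow> i < n" for i
      using permutes_in_image[OF assms, of i] permutes_in_image[OF permutes_inv[OF assms], of i] by auto
    have q: "inv \<pi> i = inv \<pi> j \<longleftrightarrow> i = j" "\<pi> i = \<pi> j \<longleftrightarrow> i = j" for i j
      using inj permutes_inj[OF permutes_inv[OF assms]] by (auto simp: inj_eq)
    show "(\<lambda>(i, j). (\<pi> i, \<pi> j)) ` (SIGMA i:{..<n}. {..<n} - {i}) \<subseteq> (SIGMA i:{..<n}. {..<n} - {i})"
      by (auto simp: p q)
    show "(\<lambda>(i, j). (inv \<pi> i, inv \<pi> j)) ` (SIGMA i:{..<n}. {..<n} - {i}) \<subseteq> (SIGMA i:{..<n}. {..<n} - {i})"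
      by (auto simp: p q)
  qed (auto simp: permutes_inverses[OF assms])
  from sum.reindex_bij_betw[OF this, of "\<lambda>(i, j). f (x i) (x j)"] show ?thesis
    by (simp add: Ustat_pairs case_prod_unfold)
qed

lemma Ustat_const: "2 \<le> n \<Longrightarrow> Ustat n (\<lambda>_ _. c) x = (c :: real)"
  by (simp add: Ustat_def of_nat_diff)

lemma Ustat_add: "Ustat n (\<lambda>a b. f a b + g a b) x = Ustat n f x + Ustat n g x"
  by (simp add: Ustat_def sum.distrib scaleR_add_right)

lemma Ustat_diff: "Ustat n (\<lambda>a b. f a b - g a b) x = Ustat n f x - Ustat n g x"
  by (simp add: Ustat_def sum_subtractf scaleR_diff_right)

lemma Ustat_cmult: "Ustat n (\<lambda>a b. c * f a b) x = c * (Ustat n f x :: real)"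
  by (simp add: Ustat_def mult.left_commute flip: sum_distrib_left)

lemma Ustat_mono:
  fixes f g :: "'a \<Rightarrow> 'a \<Rightarrow> real"
  assumes "\<And>i j. i < n \<Longrightarrow> j < n \<Longrightarrow> i \<noteq> j \<Longrightarrow> f (x i) (x j) \<le> g (x i) (x j)"
  shows "Ustat n f x \<le> Ustat n g x"
proof -
  have "0 \<le> 1 / (real n * (real n - 1))" by (cases n) auto
  then show ?thesis unfolding Ustat_def using assms
    by (intro scaleR_left_mono sum_mono) auto
qed

lemma Ustat_abs_le: "\<bar>Ustat n f x\<bar> \<le> Ustat n (\<lambda>a b. \<bar>f a b\<bar> :: real) x"
proof -
  have "Ustat n f x \<le> Ustat n (\<lambda>a b. \<bar>f a b\<bar>) x" by (rule Ustat_mono) simp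
  moreover have "Ustat n (\<lambda>a b. -1 * \<bar>f a b\<bar>) x \<le> Ustat n f x" by (rule Ustat_mono) simp
  ultimately show ?thesis unfolding Ustat_cmult by simp
qed

section \<open>Exchangeability of the coordinates\<close>

context sequence_space begin

interpretation pairM: pair_prob_space M M ..

lemma distr_reindex_inj: "inj \<pi> \<Longrightarrow> distr S S (\<lambda>x. x \<circ> \<pi>) = S"
  using distr_PiM_reindex[of UNIV "\<lambda>_. M" \<pi> UNIV] M.prob_space_axioms by (simp add: comp_def restrict_def)

lemma integral_reindex_inj:
  fixes F :: "(nat \<Rightarrow> 'a) \<Rightarrow> real"
  assumes "inj \<pi>" "F \<in> borel_measurable S"
  shows "(\<integral>x. F (x \<circ> \<pi>) \<partial>S) = (\<integral>x. F x \<partial>S)"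
  by (subst (2) distr_reindex_inj[OF assms(1), symmetric], subst integral_distr) (use assms in auto)

lemma integrable_reindex_inj:
  fixes F :: "(nat \<Rightarrow> 'a) \<Rightarrow> real"
  assumes "inj \<pi>" "integrable S F"
  shows "integrable S (\<lambda>x. F (x \<circ> \<pi>))"
proof -
  have "integrable (distr S S (\<lambda>x. x \<circ> \<pi>)) F" using assms by (simp add: distr_reindex_inj)
  then show ?thesis by (rule integrable_distr[OF measurable_reindex])
qed

lemma distr_01: "distr S (M \<Otimes>\<^sub>M M) (\<lambda>x. (x 0, x 1)) = M \<Otimes>\<^sub>M M"
proof -
  have 1: "distr S M (\<lambda>x. x i) = M" for i
    using PiM_component[of i] by simp
  have "M \<Otimes>\<^sub>M M = distr M M id \<Otimes>\<^sub>M distr S M (\<lambda>x. x 0)" by (simp add: 1 distr_id[unfolded id_def] id_def)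
  also have "\<dots> = distr (M \<Otimes>\<^sub>M S) (M \<Otimes>\<^sub>M M) (\<lambda>(x, y). (id x, y 0))"
    by (rule pair_measure_distr) (auto simp: 1 M.sigma_finite_measure_axioms)
  also have "\<dots> = distr (distr (M \<Otimes>\<^sub>M S) S (\<lambda>(s, \<omega>). case_nat s \<omega>)) (M \<Otimes>\<^sub>M M) (\<lambda>x. (x 0, x 1))"
    by (subst distr_distr) (auto simp: comp_def case_prod_beta intro!: arg_cong2[where f = "distr _"])
  finally show ?thesis by (simp only: PiM_iter)
qed

lemma pair_transform:
  fixes f :: "'a \<Rightarrow> 'a \<Rightarrow> real"
  assumes "case_prod f \<in> borel_measurable (M \<Otimes>\<^sub>M M)"
  shows "integrable S (\<lambda>x. f (x 0) (x 1)) \<longleftrightarrow> integrable (M \<Otimes>\<^sub>M M) (case_prod f)"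
    "(\<integral>x. f (x 0) (x 1) \<partial>S) = (\<integral>z. case_prod f z \<partial>(M \<Otimes>\<^sub>M M))"
proof -
  have m: "(\<lambda>x. (x 0, x 1)) \<in> measurable S (M \<Otimes>\<^sub>M M)" by measurable
  show "integrable S (\<lambda>x. f (x 0) (x 1)) \<longleftrightarrow> integrable (M \<Otimes>\<^sub>M M) (case_prod f)"
    using integrable_distr_eq[OF m assms] by (simp only: distr_01 prod.case)
  show "(\<integral>x. f (x 0) (x 1) \<partial>S) = (\<integral>z. case_prod f z \<partial>(M \<Otimes>\<^sub>M M))"
    using integral_distr[OF m assms] by (simp only: distr_01 prod.case)
qed

text \<open>A finite permutation taking 0 to \<open>i\<close> and 1 to \<open>j\<close>, for moving
  any pair of observations to the first two. The inner transposition uses the preimage of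
  \<open>j\<close> under the outer one.\<close>

definition swap2 :: "nat \<Rightarrow> nat \<Rightarrow> nat \<Rightarrow> nat" where
  "swap2 i j = Transposition.transpose 0 i \<circ> Transposition.transpose 1 (Transposition.transpose 0 i j)"

lemma swap2:
  assumes "i \<noteq> j" shows "swap2 i j 0 = i" "swap2 i j 1 = j" "inj (swap2 i j)"
    "i < n \<Longrightarrow> j < n \<Longrightarrow> swap2 i j permutes {..<n}"
proof -
  show "swap2 i j 0 = i" "swap2 i j 1 = j" using assms by (auto simp: swap2_def Transposition.transpose_def)
  show "inj (swap2 i j)" by (simp add: swap2_def inj_compose)
  assume "i < n" "j < n"
  then have "2 \<le> n" "Transposition.transpose 0 i j < n" using assms by (auto simp: Transposition.transpose_def)
  then show "swap2 i j permutes {..<n}"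
    unfolding swap2_def using \<open>i < n\<close> by (intro permutes_compose permutes_swap_id) auto
qed

lemma integrable_pair:
  fixes f :: "'a \<Rightarrow> 'a \<Rightarrow> real"
  assumes "integrable (M \<Otimes>\<^sub>M M) (case_prod f)" "i \<noteq> j"
  shows "integrable S (\<lambda>x. f (x i) (x j))" "(\<integral>x. f (x i) (x j) \<partial>S) = (\<integral>z. case_prod f z \<partial>(M \<Otimes>\<^sub>M M))"
proof -
  have fm: "case_prod f \<in> borel_measurable (M \<Otimes>\<^sub>M M)" using assms(1) by simp
  have 0: "integrable S (\<lambda>x. f (x 0) (x 1))" using pair_transform(1)[OF fm] assms(1) by simp
  show "integrable S (\<lambda>x. f (x i) (x j))"
    using integrable_reindex_inj[OF swap2(3)[OF assms(2)] 0] swap2(1,2)[OF assms(2)] by (simp add: comp_def)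
  have "(\<integral>x. f (x i) (x j) \<partial>S) = (\<integral>x. f (x 0) (x 1) \<partial>S)"
    using integral_reindex_inj[OF swap2(3)[OF assms(2)] borel_measurable_integrable[OF 0]] swap2(1,2)[OF assms(2)] by (simp add: comp_def)
  then show "(\<integral>x. f (x i) (x j) \<partial>S) = (\<integral>z. case_prod f z \<partial>(M \<Otimes>\<^sub>M M))" using pair_transform(2)[OF fm] by simp
qed

lemma integrable_Ustat:
  fixes f :: "'a \<Rightarrow> 'a \<Rightarrow> real"
  assumes "integrable (M \<Otimes>\<^sub>M M) (case_prod f)"
  shows "integrable S (Ustat n f)"
  unfolding Ustat_def[abs_def] by (intro integrable_scaleR_right Bochner_Integration.integrable_sum integrable_pair assms) auto

text \<open>The reverse martingale property in weak form: paired with a function \<open>D\<close>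
  invariant under permutations of the first \<open>n\<close> coordinates, all pairs below
  \<open>m <= n\<close> have the same integral, so the value does not depend on
  \<open>m\<close>.\<close>

lemma integral_Ustat_exchange:
  fixes f :: "'a \<Rightarrow> 'a \<Rightarrow> real" and D :: "(nat \<Rightarrow> 'a) \<Rightarrow> real"
  assumes f: "integrable (M \<Otimes>\<^sub>M M) (case_prod f)" and D: "bounded_meas S D"
    and inv: "\<And>\<pi> x. \<pi> permutes {..<n} \<Longrightarrow> D (x \<circ> \<pi>) = D x" and m: "2 \<le> m" "m \<le> n"
  shows "(\<integral>x. Ustat m f x * D x \<partial>S) = (\<integral>x. f (x 0) (x 1) * D x \<partial>S)"
proof -
  have iD: "integrable S (\<lambda>x. f (x i) (x j) * D x)" if "i \<noteq> j" for i j
  proof -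
    obtain B where B: "0 \<le> B" "\<And>x. \<bar>D x\<bar> \<le> B" using D by (metis bounded_measE)
    have [measurable]: "D \<in> borel_measurable S" using D by (simp add: bounded_meas_def)
    have ii: "integrable S (\<lambda>x. f (x i) (x j) * B)" by (rule integrable_mult_left[OF integrable_pair(1)[OF f that]])
    have [measurable]: "(\<lambda>x. f (x i) (x j)) \<in> borel_measurable S" by (rule borel_measurable_integrable[OF integrable_pair(1)[OF f that]])
    show ?thesis
      by (rule Bochner_Integration.integrable_bound[OF ii])
         (use B in \<open>auto simp: abs_mult intro!: AE_I2 mult_mono \<close>)
  qed
  have eq: "(\<integral>x. f (x i) (x j) * D x \<partial>S) = (\<integral>x. f (x 0) (x 1) * D x \<partial>S)" if "i < m" "j < m" "i \<noteq> j" for i j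
  proof -
    have p: "swap2 i j permutes {..<n}" using that m by (intro swap2) auto
    have "(\<integral>x. f ((x \<circ> swap2 i j) 0) ((x \<circ> swap2 i j) 1) * D (x \<circ> swap2 i j) \<partial>S) = (\<integral>x. f (x 0) (x 1) * D x \<partial>S)"
      using that by (intro integral_reindex_inj swap2 borel_measurable_integrable iD) auto
    then show ?thesis using swap2(1,2)[OF that(3)] by (simp add: inv[OF p])
  qed
  have "(\<integral>x. Ustat m f x * D x \<partial>S) = (\<integral>x. 1 / (real m * (real m - 1)) * (\<Sum>i<m. \<Sum>j\<in>{..<m} - {i}. f (x i) (x j) * D x) \<partial>S)"
    by (simp add: Ustat_def sum_distrib_right)
  also have "\<dots> = 1 / (real m * (real m - 1)) * (\<Sum>i<m. \<Sum>j\<in>{..<m} - {i}. \<integral>x. f (x i) (x j) * D x \<partial>S)"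
  proof -
    have ii: "integrable S (\<lambda>x. \<Sum>j\<in>{..<m} - {i}. f (x i) (x j) * D x)" for i
      by (rule Bochner_Integration.integrable_sum, rule iD) auto
    have "(\<integral>x. (\<Sum>j\<in>{..<m} - {i}. f (x i) (x j) * D x) \<partial>S) = (\<Sum>j\<in>{..<m} - {i}. \<integral>x. f (x i) (x j) * D x \<partial>S)" for i
      by (rule Bochner_Integration.integral_sum, rule iD) auto
    then show ?thesis by (simp only: integral_mult_right_zero Bochner_Integration.integral_sum[OF ii])
  qed
  also have "(\<Sum>i<m. \<Sum>j\<in>{..<m} - {i}. \<integral>x. f (x i) (x j) * D x \<partial>S) = (\<Sum>i<m. \<Sum>j\<in>{..<m} - {i}. \<integral>x. f (x 0) (x 1) * D x \<partial>S)"
    by (intro sum.cong refl eq) auto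
  also have "1 / (real m * (real m - 1)) * \<dots> = (\<integral>x. f (x 0) (x 1) * D x \<partial>S)"
    using m by (simp add: of_nat_diff)
  finally show ?thesis .
qed

end

text \<open>Continuity from below in the horizon \<open>m\<close> and from above in the start
  \<open>N\<close>: uniform bounds over finite horizons are enough.\<close>

lemma (in prob_space) AE_eventually_not_of_tail:
  assumes m: "\<And>n. n0 \<le> n \<Longrightarrow> {x \<in> space M. Q n x} \<in> sets M"
    and tail: "\<And>e. 0 < e \<Longrightarrow> \<exists>N\<ge>n0. \<forall>m. prob {x \<in> space M. \<exists>n\<in>{N..<m}. Q n x} \<le> e"
  shows "AE x in M. \<forall>\<^sub>F n in sequentially. \<not> Q n x"
proof -
  define B where "B N = {x \<in> space M. \<exists>n\<ge>N. Q n x}" for N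
  have fm: "{x \<in> space M. \<exists>n\<in>{N..<m}. Q n x} \<in> sets M" if "n0 \<le> N" for N m
  proof -
    have "{x \<in> space M. \<exists>n\<in>{N..<m}. Q n x} = (\<Union>n\<in>{N..<m}. {x \<in> space M. Q n x})" by blast
    also have "\<dots> \<in> sets M" using that by (intro sets.finite_UN m) auto
    finally show ?thesis .
  qed
  have B: "B N = (\<Union>m. {x \<in> space M. \<exists>n\<in>{N..<m}. Q n x})" for N
  proof
    show "B N \<subseteq> (\<Union>m. {x \<in> space M. \<exists>n\<in>{N..<m}. Q n x})"
    proof
      fix x assume "x \<in> B N"
      then obtain n where "x \<in> space M" "N \<le> n" "Q n x" by (auto simp: B_def)
      then have "x \<in> {x \<in> space M. \<exists>n\<in>{N..<Suc n}. Q n x}" by auto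
      then show "x \<in> (\<Union>m. {x \<in> space M. \<exists>n\<in>{N..<m}. Q n x})" by blast
    qed
  qed (auto simp: B_def)
  have Bm: "B N \<in> sets M" if "n0 \<le> N" for N
    unfolding B using fm[OF that] by blast
  have Bsmall: "\<exists>N\<ge>n0. prob (B N) \<le> e" if e: "0 < e" for e
  proof -
    obtain N where N: "n0 \<le> N" "\<And>m. prob {x \<in> space M. \<exists>n\<in>{N..<m}. Q n x} \<le> e" using tail[OF e] by blast
    have "(\<lambda>m. prob {x \<in> space M. \<exists>n\<in>{N..<m}. Q n x}) \<longlonglongrightarrow> prob (B N)"
      unfolding B
    proof (rule finite_Lim_measure_incseq)
      show "range (\<lambda>m. {x \<in> space M. \<exists>n\<in>{N..<m}. Q n x}) \<subseteq> sets M" using fm[OF N(1)] by blast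
    qed (fastforce simp: incseq_def)
    with N show ?thesis by (blast intro: LIMSEQ_le_const2)
  qed
  have "prob (\<Inter>N\<in>{n0..}. B N) \<le> e" if e: "0 < e" for e
  proof -
    obtain N where N: "n0 \<le> N" "prob (B N) \<le> e" using Bsmall[OF e] by blast
    have "prob (\<Inter>N\<in>{n0..}. B N) \<le> prob (B N)" by (rule finite_measure_mono[OF _ Bm[OF N(1)]]) (use N in blast)
    with N show ?thesis by simp
  qed
  then have "prob (\<Inter>N\<in>{n0..}. B N) \<le> 0" by (rule field_le_epsilon[of _ 0, simplified])
  then have "prob (\<Inter>N\<in>{n0..}. B N) = 0" by (simp add: measure_le_0_iff)
  moreover have "(\<Inter>N\<in>{n0..}. B N) \<in> sets M"
    by (rule sets.countable_INT'[OF _ _ image_subsetI[OF Bm]]) auto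
  ultimately have "AE x in M. x \<notin> (\<Inter>N\<in>{n0..}. B N)" by (simp only: prob_eq_0)
  moreover have "AE x in M. x \<in> space M" by simp
  ultimately show ?thesis
  proof eventually_elim
    case (elim x)
    then obtain N where "x \<notin> B N" by blast
    then have "\<not> Q n x" if "N \<le> n" for n using elim(2) that by (auto simp: B_def)
    then show ?case unfolding eventually_sequentially by blast
  qed
qed

section \<open>Variance and mean convergence of U-statistics\<close>

context sequence_space begin

lemma measurable_Ustat:
  fixes f :: "'a \<Rightarrow> 'a \<Rightarrow> real"
  assumes "case_prod f \<in> borel_measurable (M \<Otimes>\<^sub>M M)"
  shows "Ustat n f \<in> borel_measurable S"
proof -
  have [measurable]: "(\<lambda>x. f (x i) (x j)) \<in> borel_measurable S" for i j
    using measurable_compose[OF _ assms, of "\<lambda>x. (x i, x j)" S] by simp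
  show ?thesis unfolding Ustat_def[abs_def] by measurable
qed

text \<open>Efron-Stein, where \<open>\<phi> i\<close> drops every term that involves observation
  \<open>i\<close>. At most \<open>2 * (n - 1)\<close> of the \<open>n * (n - 1)\<close> terms are
  lost, so the difference is at most \<open>2 * B / n\<close>, and \<open>n\<close> squares add up
  to \<open>4 * B^2 / n\<close>.\<close>

lemma Ustat_variance_le:
  fixes g :: "'a \<Rightarrow> 'a \<Rightarrow> real"
  assumes g: "case_prod g \<in> borel_measurable (M \<Otimes>\<^sub>M M)" "\<And>a b. \<bar>g a b\<bar> \<le> B"
    and zero: "(\<integral>z. case_prod g z \<partial>(M \<Otimes>\<^sub>M M)) = 0" and n: "2 \<le> n"
  shows "(\<integral>x. (Ustat n g x)\<^sup>2 \<partial>S) \<le> 4 * B\<^sup>2 / n"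
proof -
  have B: "0 \<le> B" using g(2)[of undefined undefined] by (meson abs_ge_zero order_trans)
  let ?c = "1 / (real n * (real n - 1))"
  have c: "0 \<le> ?c" using n by simp
  have [measurable]: "(\<lambda>x. g (x i) (x j)) \<in> borel_measurable S" for i j
    using measurable_compose[OF _ g(1), of "\<lambda>x. (x i, x j)" S] by simp
  define \<phi> where "\<phi> i x = ?c * (\<Sum>a<n. \<Sum>b\<in>{..<n} - {a}. if a = i \<or> b = i then 0 else g (x a) (x b))" for i x
  have bnd: "\<bar>?c * (\<Sum>a<n. \<Sum>b\<in>{..<n} - {a}. h a b)\<bar> \<le> B" if "\<And>a b. \<bar>h a b\<bar> \<le> B" for h
  proof -
    have "\<bar>\<Sum>a<n. \<Sum>b\<in>{..<n} - {a}. h a b\<bar> \<le> (\<Sum>a<n. \<Sum>b\<in>{..<n} - {a}. B)"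
      by (intro order_trans[OF sum_abs] sum_mono that)
    also have "\<dots> = (real n * (real n - 1)) * B" using n by (simp add: of_nat_diff)
    finally have "?c * \<bar>\<Sum>a<n. \<Sum>b\<in>{..<n} - {a}. h a b\<bar> \<le> ?c * ((real n * (real n - 1)) * B)"
      by (rule mult_left_mono[OF _ c])
    then show ?thesis using n c by (simp add: abs_mult)
  qed
  have bU: "bounded_meas S (Ustat n g)"
    by (rule bounded_measI[OF measurable_Ustat[OF g(1)], of _ B]) (use bnd g(2) in \<open>simp add: Ustat_def\<close>)
  have "(\<integral>x. (Ustat n g x)\<^sup>2 \<partial>S) - (\<integral>x. Ustat n g x \<partial>S)\<^sup>2 \<le> (\<Sum>i<n. \<integral>x. (Ustat n g x - \<phi> i x)\<^sup>2 \<partial>S)"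
  proof (rule efron_stein[OF bU])
    show "depends_below n (Ustat n g)"
      unfolding depends_below_def by (auto intro!: Ustat_cong)
    show "bounded_meas S (\<phi> i)" for i
    proof (rule bounded_measI[of _ _ B])
      show "\<phi> i \<in> borel_measurable S" unfolding \<phi>_def by measurable
      show "\<bar>\<phi> i x\<bar> \<le> B" for x unfolding \<phi>_def by (rule bnd) (use g(2) B in auto)
    qed
    show "\<phi> i (x(i := a)) = \<phi> i x" for i x a
      unfolding \<phi>_def by (intro arg_cong2[where f = "(*)"] sum.cong refl) auto
  qed
  also have "\<dots> \<le> (\<Sum>i<n. (2 * B / n)\<^sup>2)"
  proof (rule sum_mono)
    fix i assume i: "i \<in> {..<n}"
    have d: "\<bar>Ustat n g x - \<phi> i x\<bar> \<le> 2 * B / n" for x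
    proof -
      \<comment> \<open>Row \<open>i\<close> loses all its \<open>n - 1\<close> terms, each of the
        other \<open>n - 1\<close> rows loses one.\<close>
      have s: "(\<Sum>a<n. \<Sum>b\<in>{..<n} - {a}. if a = i \<or> b = i then B else 0) \<le> 2 * ((real n - 1) * B)"
      proof -
        have "(\<Sum>a<n. \<Sum>b\<in>{..<n} - {a}. if a = i \<or> b = i then B else 0) \<le> (\<Sum>a<n. if a = i then (real n - 1) * B else B)"
        proof (rule sum_mono)
          fix a assume a: "a \<in> {..<n}"
          show "(\<Sum>b\<in>{..<n} - {a}. if a = i \<or> b = i then B else 0) \<le> (if a = i then (real n - 1) * B else B)"
          proof (cases "a = i")
            case True
            then show ?thesis using a n by (simp add: of_nat_diff)
          next
            case False
            then show ?thesis using i by simp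
          qed
        qed
        also have "\<dots> = (real n - 1) * B + (\<Sum>a\<in>{..<n} - {i}. B)"
          using i by (subst sum.remove[of _ i]) (auto intro!: sum.cong)
        also have "(\<Sum>a\<in>{..<n} - {i}. B) = (real n - 1) * B" using i n by (simp add: of_nat_diff)
        finally show ?thesis by (simp add: mult.commute)
      qed
      have "Ustat n g x - \<phi> i x = ?c * (\<Sum>a<n. \<Sum>b\<in>{..<n} - {a}. if a = i \<or> b = i then g (x a) (x b) else 0)"
        unfolding Ustat_def \<phi>_def real_scaleR_def right_diff_distrib[symmetric] sum_subtractf[symmetric]
        by (intro arg_cong2[where f = "(*)"] sum.cong refl) auto
      also have "\<bar>\<dots>\<bar> \<le> ?c * (\<Sum>a<n. \<Sum>b\<in>{..<n} - {a}. if a = i \<or> b = i then B else 0)"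
        unfolding abs_mult abs_of_nonneg[OF c]
        by (intro mult_left_mono c order_trans[OF sum_abs] sum_mono) (use g(2) B in auto)
      also have "\<dots> \<le> ?c * (2 * ((real n - 1) * B))" by (rule mult_left_mono[OF s c])
      also have "?c * (2 * ((real n - 1) * B)) = 2 * B / n" using n by (simp add: field_simps)
      finally show ?thesis .
    qed
    have "(\<integral>x. (Ustat n g x - \<phi> i x)\<^sup>2 \<partial>S) \<le> \<bar>\<integral>x. (Ustat n g x - \<phi> i x)\<^sup>2 \<partial>S\<bar>" by simp
    also have "\<dots> \<le> (2 * B / n)\<^sup>2"
    proof (rule P.abs_integral_le_bound)
      fix x
      have "\<bar>Ustat n g x - \<phi> i x\<bar>\<^sup>2 \<le> (2 * B / n)\<^sup>2" using d[of x] by (intro power_mono) auto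
      then show "\<bar>(Ustat n g x - \<phi> i x)\<^sup>2\<bar> \<le> (2 * B / n)\<^sup>2" by simp
    qed auto
    finally show "(\<integral>x. (Ustat n g x - \<phi> i x)\<^sup>2 \<partial>S) \<le> (2 * B / n)\<^sup>2" .
  qed
  also have "\<dots> = 4 * B\<^sup>2 / n" using n by (simp add: power2_eq_square)
  also have "(\<integral>x. Ustat n g x \<partial>S) = 0"
  proof -
    have "integrable (M \<Otimes>\<^sub>M M) (case_prod g)"
    proof -
      interpret pp: pair_prob_space M M ..
      show ?thesis using g by (intro pp.P.integrable_const_bound[of _ B]) auto
    qed
    from integral_Ustat_exchange[OF this bounded_meas_const[of S 1], of n n] integrable_pair(2)[OF this, of 0 1] n zero
    show ?thesis by simp
  qed
  finally show ?thesis by simp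
qed

lemma Ustat_L1_le:
  fixes f :: "'a \<Rightarrow> 'a \<Rightarrow> real"
  assumes f: "integrable (M \<Otimes>\<^sub>M M) (case_prod f)" and n: "2 \<le> n"
  shows "(\<integral>x. \<bar>Ustat n f x\<bar> \<partial>S) \<le> (\<integral>z. \<bar>case_prod f z\<bar> \<partial>(M \<Otimes>\<^sub>M M))"
proof -
  have a: "integrable (M \<Otimes>\<^sub>M M) (case_prod (\<lambda>a b. \<bar>f a b\<bar>))" using integrable_abs[OF f] by (simp add: case_prod_unfold)
  have "(\<integral>x. \<bar>Ustat n f x\<bar> \<partial>S) \<le> (\<integral>x. Ustat n (\<lambda>a b. \<bar>f a b\<bar>) x \<partial>S)"
    by (rule integral_mono[OF integrable_abs[OF integrable_Ustat[OF f]] integrable_Ustat[OF a] Ustat_abs_le])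
  also have "\<dots> = (\<integral>x. \<bar>f (x 0) (x 1)\<bar> \<partial>S)"
    using integral_Ustat_exchange[OF a bounded_meas_const[of S 1], of n n] n by simp
  also have "\<dots> = (\<integral>z. \<bar>case_prod f z\<bar> \<partial>(M \<Otimes>\<^sub>M M))"
    using integrable_pair(2)[OF a, of 0 1] by (simp add: case_prod_unfold)
  finally show ?thesis .
qed

end

context sequence_space begin

lemma integrable_truncation_tendsto:
  fixes f :: "'b \<Rightarrow> real"
  assumes f: "integrable N f"
  shows "(\<lambda>k. \<integral>z. \<bar>f z\<bar> * indicator {z. real k < \<bar>f z\<bar>} z \<partial>N) \<longlonglongrightarrow> 0"
proof -
  have [measurable]: "f \<in> borel_measurable N" using f by simp
  have "(\<lambda>k. \<integral>z. \<bar>f z\<bar> * indicator {z. real k < \<bar>f z\<bar>} z \<partial>N) \<longlonglongrightarrow> (\<integral>z. 0 \<partial>N)"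
  proof (rule integral_dominated_convergence[where w = "\<lambda>z. \<bar>f z\<bar>"])
    have [measurable]: "indicat_real {z. real k < \<bar>f z\<bar>} \<in> borel_measurable N" for k
      by (subst borel_measurable_indicator_iff) measurable
    show "(\<lambda>z. \<bar>f z\<bar> * indicator {z. real k < \<bar>f z\<bar>} z) \<in> borel_measurable N" for k by measurable
    show "AE z in N. (\<lambda>k. \<bar>f z\<bar> * indicator {z. real k < \<bar>f z\<bar>} z) \<longlonglongrightarrow> 0"
    proof (rule AE_I2)
      fix z
      obtain K where K: "\<bar>f z\<bar> \<le> real K" using real_arch_simple by blast
      have "\<forall>\<^sub>F k in sequentially. \<bar>f z\<bar> * indicator {z. real k < \<bar>f z\<bar>} z = 0"
        using eventually_ge_at_top[of K]
      proof eventually_elim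
        case (elim k)
        then have "\<not> real k < \<bar>f z\<bar>" using K by (meson not_less of_nat_mono order_trans)
        then show ?case by simp
      qed
      then show "(\<lambda>k. \<bar>f z\<bar> * indicator {z. real k < \<bar>f z\<bar>} z) \<longlonglongrightarrow> 0" by (rule tendsto_eventually)
    qed
  qed (use f in \<open>auto simp: indicator_def\<close>)
  then show ?thesis by simp
qed

text \<open>Truncation: the part cut off is small in mean uniformly in \<open>n\<close>, and the
  bounded centered part is of order \<open>1 / sqrt n\<close> by
  \<open>Ustat_variance_le\<close>.\<close>

lemma Ustat_L1_tendsto:
  fixes f :: "'a \<Rightarrow> 'a \<Rightarrow> real"
  assumes f: "integrable (M \<Otimes>\<^sub>M M) (case_prod f)"
  defines "\<mu> \<equiv> \<integral>z. case_prod f z \<partial>(M \<Otimes>\<^sub>M M)"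
  shows "(\<lambda>n. \<integral>x. \<bar>Ustat n f x - \<mu>\<bar> \<partial>S) \<longlonglongrightarrow> 0"
proof (rule LIMSEQ_I)
  interpret pairM: pair_prob_space M M ..
  fix e :: real assume e: "0 < e"
  have [measurable]: "case_prod f \<in> borel_measurable (M \<Otimes>\<^sub>M M)" using f by simp
  obtain K where "norm ((\<integral>z. \<bar>case_prod f z\<bar> * indicator {z. real K < \<bar>case_prod f z\<bar>} z \<partial>(M \<Otimes>\<^sub>M M)) - 0) < e / 4"
    using LIMSEQ_D[OF integrable_truncation_tendsto[OF f], of "e / 4"] e by auto
  then have K: "(\<integral>z. \<bar>case_prod f z\<bar> * indicator {z. real K < \<bar>case_prod f z\<bar>} z \<partial>(M \<Otimes>\<^sub>M M)) < e / 4"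
    by (simp only: diff_zero real_norm_def abs_less_iff)
  define t where "t a b = (if \<bar>f a b\<bar> \<le> K then f a b else 0)" for a b
  define \<nu> where "\<nu> = (\<integral>z. case_prod t z \<partial>(M \<Otimes>\<^sub>M M))"
  have t': "case_prod t = (\<lambda>z. if \<bar>case_prod f z\<bar> \<le> K then case_prod f z else 0)" by (auto simp: t_def)
  have tm [measurable]: "case_prod t \<in> borel_measurable (M \<Otimes>\<^sub>M M)" unfolding t' by measurable
  have tb: "\<bar>t a b\<bar> \<le> K" for a b by (simp add: t_def)
  have ti: "integrable (M \<Otimes>\<^sub>M M) (case_prod t)" using tb by (intro pairM.P.integrable_const_bound[of _ K]) auto
  have \<nu>: "\<bar>\<nu>\<bar> \<le> K" unfolding \<nu>_def using tb by (intro pairM.P.abs_integral_le_bound) auto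
  let ?d = "\<lambda>a b. f a b - t a b" and ?g = "\<lambda>a b. t a b - \<nu>"
  have di: "integrable (M \<Otimes>\<^sub>M M) (case_prod ?d)" using Bochner_Integration.integrable_diff[OF f ti] by (simp add: case_prod_unfold)
  have dd: "(\<integral>z. \<bar>case_prod ?d z\<bar> \<partial>(M \<Otimes>\<^sub>M M)) < e / 4"
  proof -
    have "\<bar>case_prod ?d z\<bar> = \<bar>case_prod f z\<bar> * indicator {z. real K < \<bar>case_prod f z\<bar>} z" for z
      by (auto simp: t_def indicator_def split: prod.split)
    then show ?thesis using K by simp
  qed
  have md: "\<bar>\<mu> - \<nu>\<bar> < e / 4"
  proof -
    have "\<mu> - \<nu> = (\<integral>z. case_prod ?d z \<partial>(M \<Otimes>\<^sub>M M))"
      unfolding \<mu>_def \<nu>_def Bochner_Integration.integral_diff[OF f ti, symmetric] by (simp add: case_prod_unfold)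
    also have "\<bar>\<dots>\<bar> \<le> (\<integral>z. \<bar>case_prod ?d z\<bar> \<partial>(M \<Otimes>\<^sub>M M))" by (rule integral_abs_bound)
    finally show ?thesis using dd by simp
  qed
  have gm: "case_prod ?g \<in> borel_measurable (M \<Otimes>\<^sub>M M)"
  proof -
    have "case_prod ?g = (\<lambda>z. case_prod t z - \<nu>)" by auto
    then show ?thesis by simp
  qed
  have gi: "integrable (M \<Otimes>\<^sub>M M) (case_prod ?g)"
    using Bochner_Integration.integrable_diff[OF ti pairM.P.integrable_const[of \<nu>]] by (simp add: case_prod_unfold)
  have gb: "\<bar>?g a b\<bar> \<le> 2 * real K" for a b using tb[of a b] \<nu> by linarith
  have g0: "(\<integral>z. case_prod ?g z \<partial>(M \<Otimes>\<^sub>M M)) = 0"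
  proof -
    have "(\<integral>z. case_prod t z - \<nu> \<partial>(M \<Otimes>\<^sub>M M)) = 0"
      by (subst Bochner_Integration.integral_diff[OF ti]) (auto simp: \<nu>_def pairM.P.prob_space)
    then show ?thesis by (simp add: case_prod_unfold)
  qed
  have bound: "(\<integral>x. \<bar>Ustat n f x - \<mu>\<bar> \<partial>S) \<le> e / 4 + sqrt (4 * (2 * real K)\<^sup>2 / n) + e / 4" if n: "2 \<le> n" for n
  proof -
    have dec: "\<bar>Ustat n f x - \<mu>\<bar> \<le> \<bar>Ustat n ?d x\<bar> + \<bar>Ustat n ?g x\<bar> + e / 4" for x
    proof -
      have "Ustat n ?d x = Ustat n f x - Ustat n t x" "Ustat n ?g x = Ustat n t x - \<nu>"
        using Ustat_const[OF n, of \<nu>] by (simp_all add: Ustat_diff)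
      then show ?thesis using md by linarith
    qed
    have i1: "integrable S (\<lambda>x. \<bar>Ustat n ?d x\<bar>)" and i2: "integrable S (\<lambda>x. \<bar>Ustat n ?g x\<bar>)"
      and i3: "integrable S (\<lambda>x. \<bar>Ustat n f x - \<mu>\<bar>)"
      using integrable_Ustat[OF di] integrable_Ustat[OF gi] integrable_Ustat[OF f] by auto
    have "(\<integral>x. \<bar>Ustat n f x - \<mu>\<bar> \<partial>S) \<le> (\<integral>x. \<bar>Ustat n ?d x\<bar> + \<bar>Ustat n ?g x\<bar> + e / 4 \<partial>S)"
      using dec i1 i2 i3 by (intro integral_mono) auto
    also have "\<dots> = (\<integral>x. \<bar>Ustat n ?d x\<bar> \<partial>S) + (\<integral>x. \<bar>Ustat n ?g x\<bar> \<partial>S) + e / 4"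
      using i1 i2 by (simp add: P.prob_space)
    also have "(\<integral>x. \<bar>Ustat n ?d x\<bar> \<partial>S) \<le> e / 4" using Ustat_L1_le[OF di n] dd by linarith
    also have "(\<integral>x. \<bar>Ustat n ?g x\<bar> \<partial>S) \<le> sqrt (4 * (2 * real K)\<^sup>2 / n)"
    proof (rule real_le_rsqrt)
      have "\<bar>Ustat n ?g x\<bar> \<le> 2 * real K" for x
      proof -
        have "Ustat n (\<lambda>a b. \<bar>?g a b\<bar>) x \<le> Ustat n (\<lambda>_ _. 2 * real K) x" by (rule Ustat_mono) (rule gb)
        then show ?thesis using Ustat_abs_le[of n ?g x] Ustat_const[OF n, of "2 * real K" x] by linarith
      qed
      then have bm: "bounded_meas S (\<lambda>x. \<bar>Ustat n ?g x\<bar>)"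
        using measurable_Ustat[OF gm, of n] by (intro bounded_measI[of _ _ "2 * real K"]) auto
      have "(\<integral>x. \<bar>Ustat n ?g x\<bar> \<partial>S)\<^sup>2 \<le> (\<integral>x. \<bar>Ustat n ?g x\<bar>\<^sup>2 \<partial>S)"
        by (rule P.square_integral_le[OF P.bounded_meas_integrable[OF bounded_meas_power2[OF bm]] i2])
      also have "\<dots> \<le> 4 * (2 * real K)\<^sup>2 / n" using Ustat_variance_le[OF gm gb g0 n] by simp
      finally show "(\<integral>x. \<bar>Ustat n ?g x\<bar> \<partial>S)\<^sup>2 \<le> 4 * (2 * real K)\<^sup>2 / n" .
    qed
    finally show ?thesis by simp
  qed
  have "(\<lambda>n. sqrt (4 * (2 * real K)\<^sup>2 / real n)) \<longlonglongrightarrow> sqrt 0"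
    by (intro tendsto_intros lim_const_over_n)
  then have "\<forall>\<^sub>F n in sequentially. sqrt (4 * (2 * real K)\<^sup>2 / real n) < e / 4"
    using e by (intro order_tendstoD(2)[where y = "sqrt 0"]) auto
  then obtain N where N: "\<And>n. N \<le> n \<Longrightarrow> sqrt (4 * (2 * real K)\<^sup>2 / real n) < e / 4" by (auto simp: eventually_sequentially)
  show "\<exists>no. \<forall>n\<ge>no. norm ((\<integral>x. \<bar>Ustat n f x - \<mu>\<bar> \<partial>S) - 0) < e"
  proof (intro exI[of _ "max N 2"] allI impI)
    fix n assume "max N 2 \<le> n"
    then have "(\<integral>x. \<bar>Ustat n f x - \<mu>\<bar> \<partial>S) < e" using bound[of n] N[of n] e by simp
    moreover have "0 \<le> (\<integral>x. \<bar>Ustat n f x - \<mu>\<bar> \<partial>S)" by simp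
    ultimately show "norm ((\<integral>x. \<bar>Ustat n f x - \<mu>\<bar> \<partial>S) - 0) < e" by simp
  qed
qed

text \<open>The events that \<open>n\<close> is the last index below \<open>N'\<close> with a large deviation are invariant under
  permutations of the first \<open>n\<close> observations.\<close>

lemma Ustat_maximal_ineq:
  fixes f :: "'a \<Rightarrow> 'a \<Rightarrow> real"
  assumes f: "integrable (M \<Otimes>\<^sub>M M) (case_prod f)" and N: "2 \<le> N" and l: "0 < l"
  shows "P.prob {x \<in> space S. \<exists>n\<in>{N..<N'}. l < \<bar>Ustat n f x - \<mu>\<bar>} \<le> (\<integral>x. \<bar>Ustat N f x - \<mu>\<bar> \<partial>S) / l"
proof -
  define D where "D n = {x \<in> space S. l < \<bar>Ustat n f x - \<mu>\<bar> \<and> (\<forall>m\<in>{n<..<N'}. \<bar>Ustat m f x - \<mu>\<bar> \<le> l)}" for n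
  have [measurable]: "Ustat n f \<in> borel_measurable S" for n using integrable_Ustat[OF f] by simp
  have Dm [measurable]: "D n \<in> sets S" for n unfolding D_def by measurable
  have Dd: "disjoint_family_on D {N..<N'}"
  proof -
    have "\<not> (x \<in> D m \<and> x \<in> D n)" if "m < n" "n < N'" for m n x
      using that unfolding D_def by (auto simp: not_less[symmetric])
    then show ?thesis unfolding disjoint_family_on_def
      by (auto, metis atLeastLessThan_iff linorder_neqE_nat)
  qed
  have eq: "{x \<in> space S. \<exists>n\<in>{N..<N'}. l < \<bar>Ustat n f x - \<mu>\<bar>} = (\<Union>n\<in>{N..<N'}. D n)"
  proof
    show "{x \<in> space S. \<exists>n\<in>{N..<N'}. l < \<bar>Ustat n f x - \<mu>\<bar>} \<subseteq> (\<Union>n\<in>{N..<N'}. D n)"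
    proof
      fix x assume x: "x \<in> {x \<in> space S. \<exists>n\<in>{N..<N'}. l < \<bar>Ustat n f x - \<mu>\<bar>}"
      let ?A = "{n\<in>{N..<N'}. l < \<bar>Ustat n f x - \<mu>\<bar>}"
      have A: "finite ?A" "?A \<noteq> {}" using x by auto
      have "Max ?A \<in> ?A" using Max_in[OF A] .
      moreover have "\<bar>Ustat m f x - \<mu>\<bar> \<le> l" if "m \<in> {Max ?A<..<N'}" for m
      proof (rule ccontr)
        assume "\<not> \<bar>Ustat m f x - \<mu>\<bar> \<le> l"
        then have "m \<in> ?A" using that \<open>Max ?A \<in> ?A\<close> by auto
        then have "m \<le> Max ?A" by (rule Max_ge[OF A(1)])
        then show False using that by simp
      qed
      ultimately have "x \<in> D (Max ?A)" using x by (auto simp: D_def)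
      then show "x \<in> (\<Union>n\<in>{N..<N'}. D n)" using \<open>Max ?A \<in> ?A\<close> by blast
    qed
  qed (auto simp: D_def)
  have inv: "x \<circ> \<pi> \<in> D n \<longleftrightarrow> x \<in> D n" if p: "\<pi> permutes {..<n}" and x: "x \<in> space S" for n \<pi> x
  proof -
    have "Ustat m f (x \<circ> \<pi>) = Ustat m f x" if "n \<le> m" for m
      using that by (intro Ustat_permutes permutes_subset[OF p]) auto
    moreover have "x \<circ> \<pi> \<in> space S" using measurable_space[OF measurable_reindex x] .
    ultimately show ?thesis using x by (auto simp: D_def)
  qed
  have step: "l * P.prob (D n) \<le> (\<integral>x. \<bar>Ustat N f x - \<mu>\<bar> * indicator (D n) x \<partial>S)" if n: "n \<in> {N..<N'}" for n
  proof -
    \<comment> \<open>On the space this is the sign of the deviation times the indicator of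
      \<open>D n\<close>. The quantifier over permutations makes it invariant at every point, as
      \<open>integral_Ustat_exchange\<close> demands.\<close>
    define s where "s x = (if \<exists>\<pi>. \<pi> permutes {..<n} \<and> x \<circ> \<pi> \<in> D n then sgn (Ustat n f x - \<mu>) else 0)" for x
    have s_eq: "s x = sgn (Ustat n f x - \<mu>) * indicator (D n) x" if "x \<in> space S" for x
    proof -
      have "(\<exists>\<pi>. \<pi> permutes {..<n} \<and> x \<circ> \<pi> \<in> D n) \<longleftrightarrow> x \<in> D n"
        using inv[OF _ that, of _ n] permutes_id[of "{..<n}"] by metis
      then show ?thesis by (simp add: s_def indicator_def)
    qed
    have s_inv: "s (x \<circ> \<pi>) = s x" if p: "\<pi> permutes {..<n}" for \<pi> x
    proof -
      have "(\<exists>\<pi>'. \<pi>' permutes {..<n} \<and> (x \<circ> \<pi>) \<circ> \<pi>' \<in> D n) \<longleftrightarrow> (\<exists>\<pi>'. \<pi>' permutes {..<n} \<and> x \<circ> \<pi>' \<in> D n)"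
      proof
        assume "\<exists>\<pi>'. \<pi>' permutes {..<n} \<and> (x \<circ> \<pi>) \<circ> \<pi>' \<in> D n"
        then show "\<exists>\<pi>'. \<pi>' permutes {..<n} \<and> x \<circ> \<pi>' \<in> D n" using permutes_compose[OF _ p] by (auto simp: comp_assoc)
      next
        assume "\<exists>\<pi>'. \<pi>' permutes {..<n} \<and> x \<circ> \<pi>' \<in> D n"
        then obtain \<pi>' where "\<pi>' permutes {..<n}" "x \<circ> \<pi>' \<in> D n" by blast
        moreover have "(x \<circ> \<pi>) \<circ> (inv \<pi> \<circ> \<pi>') = x \<circ> \<pi>'"
          using permutes_inv_o(1)[OF p] by (metis comp_assoc comp_id)
        ultimately show "\<exists>\<pi>'. \<pi>' permutes {..<n} \<and> (x \<circ> \<pi>) \<circ> \<pi>' \<in> D n"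
          using permutes_compose[OF _ permutes_inv[OF p], of \<pi>'] by metis
      qed
      then show ?thesis unfolding s_def Ustat_permutes[OF p] by (simp only:)
    qed
    have sm: "s \<in> borel_measurable S"
    proof -
      have "(\<lambda>x. sgn (Ustat n f x - \<mu>) * indicator (D n) x) \<in> borel_measurable S" by measurable
      then show ?thesis using measurable_cong[of S s "\<lambda>x. sgn (Ustat n f x - \<mu>) * indicator (D n) x" borel] s_eq by simp
    qed
    have bs: "bounded_meas S s" by (rule bounded_measI[OF sm, of 1]) (auto simp: s_def sgn_if)
    have iUs: "integrable S (\<lambda>x. Ustat m f x * s x)" for m
    proof (rule Bochner_Integration.integrable_bound[OF integrable_Ustat[OF f, of m]])
      show "(\<lambda>x. Ustat m f x * s x) \<in> borel_measurable S" using sm by measurable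
    qed (auto simp: abs_mult s_def sgn_if)
    have i_s: "integrable S s" by (rule P.bounded_meas_integrable[OF bs])
    have ex: "(\<integral>x. (Ustat m f x - \<mu>) * s x \<partial>S) = (\<integral>x. f (x 0) (x 1) * s x \<partial>S) - \<mu> * (\<integral>x. s x \<partial>S)" if "2 \<le> m" "m \<le> n" for m
    proof -
      have "(\<integral>x. (Ustat m f x - \<mu>) * s x \<partial>S) = (\<integral>x. Ustat m f x * s x - \<mu> * s x \<partial>S)" by (simp add: left_diff_distrib)
      also have "\<dots> = (\<integral>x. Ustat m f x * s x \<partial>S) - \<mu> * (\<integral>x. s x \<partial>S)" using iUs i_s by simp
      finally show ?thesis using integral_Ustat_exchange[OF f bs s_inv that] by simp
    qed
    have i4: "integrable S (\<lambda>x. (Ustat m f x - \<mu>) * s x)" for m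
      using Bochner_Integration.integrable_diff[OF iUs integrable_mult_right[OF i_s, of \<mu>], of m] by (simp add: left_diff_distrib)
    have i5: "integrable S (\<lambda>x. \<bar>Ustat N f x - \<mu>\<bar> * indicator (D n) x)"
      using integrable_Ustat[OF f, of N] Dm by (intro integrable_real_mult_indicator integrable_abs) auto
    have "l * P.prob (D n) = (\<integral>x. l * indicator (D n) x \<partial>S)" by simp
    also have "\<dots> \<le> (\<integral>x. (Ustat n f x - \<mu>) * s x \<partial>S)"
    proof (rule integral_mono[OF _ i4])
      show "integrable S (\<lambda>x. l * indicator (D n) x)"
        by (rule P.integrable_const_bound[of _ l]) (use l in \<open>auto simp: indicator_def\<close>)
      fix x assume "x \<in> space S"
      then show "l * indicator (D n) x \<le> (Ustat n f x - \<mu>) * s x"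
        by (auto simp: s_eq D_def indicator_def abs_sgn)
    qed
    \<comment> \<open>The right side of \<open>ex\<close> does not mention \<open>m\<close>: this
      trades the index \<open>n\<close> of the last deviation for the smallest index
      \<open>N\<close>.\<close>
    also have "\<dots> = (\<integral>x. (Ustat N f x - \<mu>) * s x \<partial>S)" using ex[of n] ex[of N] n N by simp
    also have "\<dots> \<le> (\<integral>x. \<bar>Ustat N f x - \<mu>\<bar> * indicator (D n) x \<partial>S)"
    proof (rule integral_mono[OF i4 i5])
      fix x assume "x \<in> space S"
      then show "(Ustat N f x - \<mu>) * s x \<le> \<bar>Ustat N f x - \<mu>\<bar> * indicator (D n) x"
        by (auto simp: s_eq indicator_def sgn_if)
    qed
    finally show ?thesis .
  qed
  have iD: "integrable S (\<lambda>x. \<bar>Ustat N f x - \<mu>\<bar> * indicator (D n) x)" for n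
    using integrable_Ustat[OF f, of N] Dm by (intro integrable_real_mult_indicator integrable_abs) auto
  have "l * P.prob {x \<in> space S. \<exists>n\<in>{N..<N'}. l < \<bar>Ustat n f x - \<mu>\<bar>} = (\<Sum>n\<in>{N..<N'}. l * P.prob (D n))"
    unfolding eq using Dd Dm by (subst P.finite_measure_finite_Union) (auto simp: sum_distrib_left)
  also have "\<dots> \<le> (\<Sum>n\<in>{N..<N'}. \<integral>x. \<bar>Ustat N f x - \<mu>\<bar> * indicator (D n) x \<partial>S)" by (rule sum_mono[OF step])
  also have "\<dots> = (\<integral>x. (\<Sum>n\<in>{N..<N'}. \<bar>Ustat N f x - \<mu>\<bar> * indicator (D n) x) \<partial>S)"
    by (rule Bochner_Integration.integral_sum[OF iD, symmetric])
  also have "\<dots> \<le> (\<integral>x. \<bar>Ustat N f x - \<mu>\<bar> \<partial>S)"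
  proof (rule integral_mono[OF Bochner_Integration.integrable_sum[OF iD]])
    show "integrable S (\<lambda>x. \<bar>Ustat N f x - \<mu>\<bar>)" using integrable_Ustat[OF f, of N] by simp
    fix x
    have "(\<Sum>n\<in>{N..<N'}. indicat_real (D n) x) = indicat_real (\<Union>n\<in>{N..<N'}. D n) x"
      using Dd by (intro indicator_UN_disjoint[symmetric]) auto
    then show "(\<Sum>n\<in>{N..<N'}. \<bar>Ustat N f x - \<mu>\<bar> * indicator (D n) x) \<le> \<bar>Ustat N f x - \<mu>\<bar>"
      by (simp add: indicator_def flip: sum_distrib_left)
  qed
  finally show ?thesis using l by (simp add: field_simps)
qed

text \<open>All deviations from \<open>N\<close> on are controlled by the mean deviation at
  \<open>N\<close> alone, which tends to 0.\<close>

theorem Ustat_strong_law: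
  fixes f :: "'a \<Rightarrow> 'a \<Rightarrow> real"
  assumes f: "integrable (M \<Otimes>\<^sub>M M) (case_prod f)"
  shows "AE x in S. (\<lambda>n. Ustat n f x) \<longlonglongrightarrow> (\<integral>z. case_prod f z \<partial>(M \<Otimes>\<^sub>M M))"
proof -
  define \<mu> where "\<mu> = (\<integral>z. case_prod f z \<partial>(M \<Otimes>\<^sub>M M))"
  have [measurable]: "Ustat n f \<in> borel_measurable S" for n using integrable_Ustat[OF f] by simp
  have "AE x in S. \<forall>\<^sub>F n in sequentially. \<not> l < \<bar>Ustat n f x - \<mu>\<bar>" if l: "0 < l" for l
  proof (rule P.AE_eventually_not_of_tail[where ?n0.0 = 2])
    fix e :: real assume e: "0 < e"
    obtain N where N: "\<And>n. N \<le> n \<Longrightarrow> norm ((\<integral>x. \<bar>Ustat n f x - \<mu>\<bar> \<partial>S) - 0) < e * l"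
      using LIMSEQ_D[OF Ustat_L1_tendsto[OF f, folded \<mu>_def], of "e * l"] e l by auto
    have "(\<integral>x. \<bar>Ustat (max N 2) f x - \<mu>\<bar> \<partial>S) < e * l" using N[of "max N 2"] by simp
    then have "(\<integral>x. \<bar>Ustat (max N 2) f x - \<mu>\<bar> \<partial>S) / l \<le> e" using l by (simp add: field_simps)
    then show "\<exists>N\<ge>2. \<forall>m. P.prob {x \<in> space S. \<exists>n\<in>{N..<m}. l < \<bar>Ustat n f x - \<mu>\<bar>} \<le> e"
      using Ustat_maximal_ineq[OF f _ l, of "max N 2" _ \<mu>] by (intro exI[of _ "max N 2"] conjI allI) (auto intro: order_trans)
  qed measurable
  then have "AE x in S. \<forall>k. \<forall>\<^sub>F n in sequentially. \<not> 1 / (real k + 1) < \<bar>Ustat n f x - \<mu>\<bar>"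
    unfolding AE_all_countable by simp
  then show ?thesis unfolding \<mu>_def[symmetric]
  proof eventually_elim
    case (elim x)
    show ?case
    proof (rule LIMSEQ_I)
      fix r :: real assume "0 < r"
      then obtain k where "inverse (of_nat (Suc k)) < r" using reals_Archimedean by blast
      then have k: "1 / (real k + 1) < r" by (simp add: inverse_eq_divide add.commute)
      obtain N where "\<And>n. N \<le> n \<Longrightarrow> \<not> 1 / (real k + 1) < \<bar>Ustat n f x - \<mu>\<bar>" using elim by (auto simp: eventually_sequentially)
      then show "\<exists>no. \<forall>n\<ge>no. norm (Ustat n f x - \<mu>) < r" using k by (intro exI[of _ N]) force
    qed
  qed
qed

end

section \<open>Bootstrap moments of U-statistics\<close>

definition emean :: "nat \<Rightarrow> (nat \<Rightarrow> 'a) \<Rightarrow> ('a \<Rightarrow> real) \<Rightarrow> real" where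
  "emean n x h = (\<Sum>i<n. h (x i)) / n"

text \<open>The V-statistic, diagonal included: the mean of \<open>f\<close> over two independent
  draws from the data. This, and not the U-statistic of the data, is the bootstrap mean of
  \<open>Ustat n f\<close>.\<close>

definition Vstat :: "nat \<Rightarrow> ('a \<Rightarrow> 'a \<Rightarrow> real) \<Rightarrow> (nat \<Rightarrow> 'a) \<Rightarrow> real" where
  "Vstat n f x = emean n x (\<lambda>a. emean n x (\<lambda>b. f a b))"

lemma finite_empirical [simp]: "0 < n \<Longrightarrow> finite (set_pmf (empirical n x))"
  by (auto simp: empirical_def set_pmf_of_set lessThan_empty_iff)

lemma expectation_empirical: "0 < n \<Longrightarrow> measure_pmf.expectation (empirical n x) h = emean n x h"
  by (simp add: empirical_def emean_def integral_pmf_of_set lessThan_empty_iff)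

lemma emean_add: "emean n x (\<lambda>a. f a + g a) = emean n x f + emean n x g"
  by (simp add: emean_def sum.distrib add_divide_distrib)

lemma emean_diff: "emean n x (\<lambda>a. f a - g a) = emean n x f - emean n x g"
  by (simp add: emean_def sum_subtractf diff_divide_distrib)

lemma emean_cmult: "emean n x (\<lambda>a. c * f a) = c * emean n x f"
  by (simp add: emean_def flip: sum_distrib_left)

lemma emean_const: "0 < n \<Longrightarrow> emean n x (\<lambda>a. c) = c"
  by (simp add: emean_def)

lemma emean_mono: "(\<And>i. i < n \<Longrightarrow> f (x i) \<le> g (x i)) \<Longrightarrow> emean n x f \<le> emean n x g"
  by (auto simp: emean_def intro!: divide_right_mono sum_mono)

lemma emean_swap: "emean n x (\<lambda>a. emean n x (\<lambda>b. f a b)) = emean n x (\<lambda>b. emean n x (\<lambda>a. f a b))"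
  unfolding emean_def by (simp add: sum_divide_distrib[symmetric]) (rule disjI2, rule sum.swap)

lemma emean_abs_le: "\<bar>emean n x f\<bar> \<le> emean n x (\<lambda>a. \<bar>f a\<bar>)"
  by (simp add: emean_def abs_divide divide_right_mono sum_abs)

lemma emean_square_le:
  assumes "0 < n" shows "(emean n x f)\<^sup>2 \<le> emean n x (\<lambda>a. (f a)\<^sup>2)"
proof -
  have "0 \<le> emean n x (\<lambda>a. (f a - emean n x f)\<^sup>2)" using emean_mono[of n "\<lambda>_. 0" x "\<lambda>a. (f a - emean n x f)\<^sup>2"] assms by (simp add: emean_const)
  also have "\<dots> = emean n x (\<lambda>a. (f a)\<^sup>2 - (2 * emean n x f * f a - (emean n x f)\<^sup>2))" by (simp add: power2_diff algebra_simps)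
  also have "\<dots> = emean n x (\<lambda>a. (f a)\<^sup>2) - (2 * emean n x f * emean n x f - (emean n x f)\<^sup>2)"
    using assms by (simp only: emean_diff emean_cmult emean_const)
  finally show ?thesis by (simp add: power2_eq_square)
qed

lemma Vstat_mono:
  "(\<And>i j. i < n \<Longrightarrow> j < n \<Longrightarrow> f (x i) (x j) \<le> g (x i) (x j)) \<Longrightarrow> Vstat n f x \<le> Vstat n g x"
  unfolding Vstat_def by (intro emean_mono)

lemma Vstat_add: "Vstat n (\<lambda>a b. f a b + g a b) x = Vstat n f x + Vstat n g x"
  by (simp add: Vstat_def emean_add)

lemma Vstat_cmult: "Vstat n (\<lambda>a b. c * f a b) x = c * Vstat n f x"
  by (simp add: Vstat_def emean_cmult)

lemma Vstat_const: "0 < n \<Longrightarrow> Vstat n (\<lambda>a b. c) x = c"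
  by (simp add: Vstat_def emean_const)

lemma Vstat_nonneg:
  assumes "\<And>i j. i < n \<Longrightarrow> j < n \<Longrightarrow> 0 \<le> f (x i) (x j)" shows "0 \<le> Vstat n f x"
  using assms unfolding Vstat_def emean_def by (intro divide_nonneg_nonneg sum_nonneg) auto

lemma Vstat_abs_le: "\<bar>Vstat n f x\<bar> \<le> Vstat n (\<lambda>a b. \<bar>f a b\<bar>) x"
proof -
  have "\<bar>Vstat n f x\<bar> \<le> emean n x (\<lambda>a. \<bar>emean n x (\<lambda>b. f a b)\<bar>)" unfolding Vstat_def by (rule emean_abs_le)
  also have "\<dots> \<le> Vstat n (\<lambda>a b. \<bar>f a b\<bar>) x" unfolding Vstat_def by (intro emean_mono emean_abs_le)
  finally show ?thesis .
qed

lemma Vstat_fst: "0 < n \<Longrightarrow> Vstat n (\<lambda>a b. h a) x = emean n x h"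
  by (simp add: Vstat_def emean_const)

lemma Vstat_snd: "0 < n \<Longrightarrow> Vstat n (\<lambda>a b. h b) x = emean n x h"
  by (simp add: Vstat_def emean_const)

lemma expectation_pair_pmf:
  fixes f :: "'a \<times> 'b \<Rightarrow> real"
  assumes "finite (set_pmf A)" "finite (set_pmf B)"
  shows "measure_pmf.expectation (pair_pmf A B) f = measure_pmf.expectation B (\<lambda>b. measure_pmf.expectation A (\<lambda>a. f (a, b)))"
proof -
  have "measure_pmf.expectation (pair_pmf A B) f = (\<Sum>(a, b)\<in>set_pmf A \<times> set_pmf B. f (a, b) * (pmf A a * pmf B b))"
    using assms by (subst integral_measure_pmf_real[where A = "set_pmf A \<times> set_pmf B"]) (auto simp: pmf_pair intro!: sum.cong)
  also have "\<dots> = (\<Sum>b\<in>set_pmf B. \<Sum>a\<in>set_pmf A. f (a, b) * (pmf A a * pmf B b))"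
    by (subst sum.swap) (simp add: sum.cartesian_product)
  also have "\<dots> = (\<Sum>b\<in>set_pmf B. (\<Sum>a\<in>set_pmf A. f (a, b) * pmf A a) * pmf B b)"
    by (simp only: sum_distrib_right mult.assoc)
  also have "\<dots> = measure_pmf.expectation B (\<lambda>b. measure_pmf.expectation A (\<lambda>a. f (a, b)))"
    using assms by (simp add: integral_measure_pmf_real[where A = "set_pmf B"] integral_measure_pmf_real[where A = "set_pmf A"])
  finally show ?thesis .
qed

text \<open>The coordinates of a bootstrap sample are independent draws, so one of them may be
  averaged over the data first. All bootstrap moments below are computed by this one step.\<close>

lemma boot_mean_resample:
  assumes n: "0 < n" and i: "i < n"
  shows "boot_mean n \<phi> x = boot_mean n (\<lambda>y. emean n x (\<lambda>z. \<phi> (y(i := z)))) x"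
proof -
  define R where "R = Pi_pmf ({..<n} - {i}) undefined (\<lambda>_. empirical n x)"
  have ins: "bootstrap n x = map_pmf (\<lambda>(z, f). f(i := z)) (pair_pmf (empirical n x) R)"
  proof -
    have "{..<n} = insert i ({..<n} - {i})" using i by auto
    then show ?thesis unfolding bootstrap_def R_def by (metis Pi_pmf_insert finite_Diff finite_lessThan Diff_iff insertI1)
  qed
  have R: "finite (set_pmf R)"
    unfolding R_def using n by (subst set_Pi_pmf) (auto intro!: finite_PiE_dflt)
  have *: "boot_mean n \<psi> x = measure_pmf.expectation R (\<lambda>f. emean n x (\<lambda>z. \<psi> (f(i := z))))" for \<psi>
    unfolding boot_mean_def ins integral_map_pmf expectation_pair_pmf[OF finite_empirical[OF n] R] expectation_empirical[OF n]
    by simp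
  show ?thesis unfolding *[of \<phi>] *[of "\<lambda>y. emean n x (\<lambda>z. \<phi> (y(i := z)))"] using n by (simp add: emean_const)
qed

lemma boot_mean_const: "0 < n \<Longrightarrow> boot_mean n (\<lambda>y. c) x = c"
  by (simp add: boot_mean_def)

lemma boot_mean_add: "0 < n \<Longrightarrow> boot_mean n (\<lambda>y. f y + g y) x = boot_mean n f x + boot_mean n g x"
  unfolding boot_mean_def by (intro Bochner_Integration.integral_add integrable_measure_pmf_finite) auto

lemma boot_mean_sum: "0 < n \<Longrightarrow> boot_mean n (\<lambda>y. \<Sum>a\<in>A. f a y) x = (\<Sum>a\<in>A. boot_mean n (f a) x)"
  unfolding boot_mean_def by (intro Bochner_Integration.integral_sum integrable_measure_pmf_finite) auto

lemma boot_mean_eq_0: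
  assumes "0 < n" "i < n" "\<And>y. emean n x (\<lambda>z. \<phi> (y(i := z))) = 0"
  shows "boot_mean n \<phi> x = 0"
  using boot_mean_resample[OF assms(1,2), of \<phi> x] assms by (simp add: boot_mean_const)

lemma boot_mean_pair:
  assumes "i < n" "j < n" "i \<noteq> j"
  shows "boot_mean n (\<lambda>y. g (y i) (y j)) x = Vstat n g x"
proof -
  have n: "0 < n" using assms by simp
  show ?thesis using assms
    by (subst boot_mean_resample[OF n assms(2)], subst boot_mean_resample[OF n assms(1)])
       (simp add: boot_mean_const n Vstat_def)
qed

lemma boot_mean_single:
  assumes "i < n" shows "boot_mean n (\<lambda>y. h (y i)) x = emean n x h"
proof -
  have n: "0 < n" using assms by simp
  show ?thesis using assms by (subst boot_mean_resample[OF n assms]) (simp add: boot_mean_const n)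
qed

lemma boot_mean_Ustat:
  assumes n: "2 \<le> n" shows "boot_mean n (Ustat n g) x = Vstat n g x"
proof -
  have n0: "0 < n" using n by simp
  have "boot_mean n (Ustat n g) x = 1 / (real n * (real n - 1)) * (\<Sum>i<n. \<Sum>j\<in>{..<n} - {i}. boot_mean n (\<lambda>y. g (y i) (y j)) x)"
    unfolding Ustat_def[abs_def] real_scaleR_def boot_mean_cmult boot_mean_sum[OF n0] ..
  also have "(\<Sum>i<n. \<Sum>j\<in>{..<n} - {i}. boot_mean n (\<lambda>y. g (y i) (y j)) x) = (\<Sum>i<n. \<Sum>j\<in>{..<n} - {i}. Vstat n g x)"
    by (intro sum.cong refl boot_mean_pair) auto
  finally show ?thesis using n by (simp add: of_nat_diff)
qed

lemma boot_mean_abs_Ustat_le: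
  assumes n: "2 \<le> n" shows "boot_mean n (\<lambda>y. \<bar>Ustat n g y\<bar>) x \<le> Vstat n (\<lambda>a b. \<bar>g a b\<bar>) x"
proof -
  have "boot_mean n (\<lambda>y. \<bar>Ustat n g y\<bar>) x \<le> boot_mean n (Ustat n (\<lambda>a b. \<bar>g a b\<bar>)) x"
    using n by (intro boot_mean_mono Ustat_abs_le) auto
  then show ?thesis using boot_mean_Ustat[OF n, of "\<lambda>a b. \<bar>g a b\<bar>" x] by simp
qed

text \<open>A product of two terms has mean 0 as soon as an index of the first pair is absent from
  the second. Each pair is left with itself and its reversal; as \<open>c\<close> is not assumed
  symmetric, the product is bounded by half the sum of the squares.\<close>

lemma boot_mean_degenerate_Ustat_square_le:
  assumes n: "2 \<le> n" and c1: "\<And>b. emean n x (\<lambda>a. c a b) = 0" and c2: "\<And>a. emean n x (\<lambda>b. c a b) = 0"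
  shows "boot_mean n (\<lambda>y. (Ustat n c y)\<^sup>2) x \<le> 2 / (real n * (real n - 1)) * Vstat n (\<lambda>a b. (c a b)\<^sup>2) x"
proof -
  have n0: "0 < n" using n by simp
  let ?C = "1 / (real n * (real n - 1))" and ?K = "SIGMA i:{..<n}. {..<n} - {i}" and ?v = "Vstat n (\<lambda>a b. (c a b)\<^sup>2) x"
  have C0: "0 \<le> ?C" using n by simp
  have v0: "0 \<le> ?v" by (rule Vstat_nonneg) simp
  define F where "F p y = (case p of (i, j) \<Rightarrow> c (y i) (y j))" for p :: "nat \<times> nat" and y
  have U: "Ustat n c y = ?C * (\<Sum>p\<in>?K. F p y)" for y by (simp add: Ustat_pairs F_def case_prod_unfold)
  have E: "boot_mean n (\<lambda>y. F p y * F q y) x \<le> (if q = p \<or> q = (snd p, fst p) then ?v else 0)" if pq: "p \<in> ?K" "q \<in> ?K" for p q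
  proof -
    obtain i j k l where [simp]: "p = (i, j)" "q = (k, l)" by fastforce
    have ij: "i < n" "j < n" "i \<noteq> j" and kl: "k < n" "l < n" "k \<noteq> l" using pq by auto
    consider "i \<noteq> k \<and> i \<noteq> l" | "j \<noteq> k \<and> j \<noteq> l" | "q = p \<or> q = (snd p, fst p)" using ij kl by auto
    then show ?thesis
    proof cases
      case 1
      have "boot_mean n (\<lambda>y. F p y * F q y) x = 0"
        by (rule boot_mean_eq_0[OF n0 ij(1)]) (use 1 ij in \<open>simp add: F_def emean_cmult c1 mult.commute[of _ "c (_ k) (_ l)"]\<close>)
      then show ?thesis using v0 by simp
    next
      case 2
      have "boot_mean n (\<lambda>y. F p y * F q y) x = 0"
        by (rule boot_mean_eq_0[OF n0 ij(2)]) (use 2 ij in \<open>simp add: F_def emean_cmult c2 mult.commute[of _ "c (_ k) (_ l)"]\<close>)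
      then show ?thesis using v0 by simp
    next
      case 3
      have "boot_mean n (\<lambda>y. F p y * F q y) x \<le> boot_mean n (\<lambda>y. 1 / 2 * (F p y)\<^sup>2 + 1 / 2 * (F q y)\<^sup>2) x"
      proof (rule boot_mean_mono[OF n0])
        fix y
        have "0 \<le> (F p y - F q y)\<^sup>2" by simp
        then show "F p y * F q y \<le> 1 / 2 * (F p y)\<^sup>2 + 1 / 2 * (F q y)\<^sup>2" unfolding power2_diff by linarith
      qed
      also have "\<dots> = 1 / 2 * boot_mean n (\<lambda>y. (F p y)\<^sup>2) x + 1 / 2 * boot_mean n (\<lambda>y. (F q y)\<^sup>2) x"
        by (simp only: boot_mean_add[OF n0] boot_mean_cmult)
      also have "boot_mean n (\<lambda>y. (F p y)\<^sup>2) x = ?v" using boot_mean_pair[OF ij, of "\<lambda>a b. (c a b)\<^sup>2" x] by (simp add: F_def)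
      also have "boot_mean n (\<lambda>y. (F q y)\<^sup>2) x = ?v" using boot_mean_pair[OF kl, of "\<lambda>a b. (c a b)\<^sup>2" x] by (simp add: F_def)
      finally show ?thesis using 3 by auto
    qed
  qed
  have "boot_mean n (\<lambda>y. (Ustat n c y)\<^sup>2) x = boot_mean n (\<lambda>y. ?C\<^sup>2 * (\<Sum>p\<in>?K. \<Sum>q\<in>?K. F p y * F q y)) x"
    unfolding U by (simp add: power_mult_distrib power2_eq_square[of "sum _ _"] sum_product power_divide)
  also have "\<dots> = ?C\<^sup>2 * (\<Sum>p\<in>?K. \<Sum>q\<in>?K. boot_mean n (\<lambda>y. F p y * F q y) x)"
    by (simp only: boot_mean_cmult boot_mean_sum[OF n0])
  also have "\<dots> \<le> ?C\<^sup>2 * (\<Sum>p\<in>?K. \<Sum>q\<in>?K. if q = p \<or> q = (snd p, fst p) then ?v else 0)"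
    by (intro mult_left_mono sum_mono E) auto
  also have "\<dots> \<le> ?C\<^sup>2 * (\<Sum>p\<in>?K. 2 * ?v)"
  proof (intro mult_left_mono sum_mono)
    fix p :: "nat \<times> nat"
    have "(\<Sum>q\<in>?K. if q = p \<or> q = (snd p, fst p) then ?v else 0) \<le> (\<Sum>q\<in>?K. (if q = p then ?v else 0) + (if q = (snd p, fst p) then ?v else 0))"
      using v0 by (intro sum_mono) auto
    also have "\<dots> \<le> 2 * ?v" using v0 by (simp add: sum.distrib)
    finally show "(\<Sum>q\<in>?K. if q = p \<or> q = (snd p, fst p) then ?v else 0) \<le> 2 * ?v" .
  qed auto
  also have "\<dots> = 2 * ?C * ?v"
  proof -
    have "card ?K = n * (n - 1)" by (subst card_SigmaI) (auto simp: sum.cong)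
    then have "real (card ?K) = real n * (real n - 1)" using n by (simp add: of_nat_diff)
    then show ?thesis using n by (simp add: power2_eq_square)
  qed
  finally show ?thesis by simp
qed

section \<open>Centered kernels and the Hoeffding decomposition under the bootstrap\<close>

lemma centered_eq:
  assumes "0 < n"
  shows "centered (empirical n x) g a b = g a b - emean n x (\<lambda>z. g a z) - emean n x (\<lambda>z. g z b) + Vstat n g x"
  using assms emean_swap[of n x g]
  by (simp add: centered_def expectation_pair_pmf expectation_empirical Vstat_def)

lemma centered_degenerate:
  assumes "0 < n"
  shows "emean n x (\<lambda>a. centered (empirical n x) g a b) = 0" "emean n x (\<lambda>b. centered (empirical n x) g a b) = 0"
  using assms emean_swap[of n x g]
  by (simp_all add: centered_eq emean_add emean_diff emean_const Vstat_def)

text \<open>A factor 4 for the square of a sum of four terms, and four means each bounded by the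
  same one through Jensen.\<close>

lemma Vstat_centered_square_le:
  assumes n: "0 < n"
  shows "Vstat n (\<lambda>a b. (centered (empirical n x) g a b)\<^sup>2) x \<le> 16 * Vstat n (\<lambda>a b. (g a b)\<^sup>2) x"
proof -
  let ?g2 = "Vstat n (\<lambda>a b. (g a b)\<^sup>2) x"
  have sq: "(p - q - r + s)\<^sup>2 \<le> 4 * (p\<^sup>2 + (q\<^sup>2 + (r\<^sup>2 + s\<^sup>2)))" for p q r s :: real
  proof -
    have "4 * (p\<^sup>2 + (q\<^sup>2 + (r\<^sup>2 + s\<^sup>2))) - (p - q - r + s)\<^sup>2 = (p + q)\<^sup>2 + (p + r)\<^sup>2 + (p - s)\<^sup>2 + (q - r)\<^sup>2 + (q + s)\<^sup>2 + (r + s)\<^sup>2"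
      by (simp add: power2_eq_square algebra_simps)
    also have "0 \<le> \<dots>" by simp
    finally show ?thesis by simp
  qed
  have "Vstat n (\<lambda>a b. (centered (empirical n x) g a b)\<^sup>2) x
      \<le> Vstat n (\<lambda>a b. 4 * ((g a b)\<^sup>2 + ((emean n x (\<lambda>z. g a z))\<^sup>2 + ((emean n x (\<lambda>z. g z b))\<^sup>2 + (Vstat n g x)\<^sup>2)))) x"
    unfolding centered_eq[OF n] by (intro Vstat_mono sq)
  also have "\<dots> = 4 * (?g2 + (emean n x (\<lambda>a. (emean n x (\<lambda>z. g a z))\<^sup>2) + (emean n x (\<lambda>b. (emean n x (\<lambda>z. g z b))\<^sup>2) + (Vstat n g x)\<^sup>2)))"
    by (simp only: Vstat_cmult Vstat_add Vstat_fst[OF n] Vstat_snd[OF n] Vstat_const[OF n] emean_const[OF n])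
  also have "\<dots> \<le> 4 * (?g2 + (?g2 + (?g2 + ?g2)))"
  proof (intro mult_left_mono add_mono order_refl)
    show "emean n x (\<lambda>a. (emean n x (\<lambda>z. g a z))\<^sup>2) \<le> ?g2"
      unfolding Vstat_def by (intro emean_mono emean_square_le n)
    show "emean n x (\<lambda>b. (emean n x (\<lambda>z. g z b))\<^sup>2) \<le> ?g2"
    proof -
      have "emean n x (\<lambda>b. (emean n x (\<lambda>z. g z b))\<^sup>2) \<le> emean n x (\<lambda>b. emean n x (\<lambda>a. (g a b)\<^sup>2))"
        by (intro emean_mono emean_square_le n)
      also have "\<dots> = ?g2" unfolding Vstat_def by (rule emean_swap)
      finally show ?thesis .
    qed
    have "(Vstat n g x)\<^sup>2 \<le> emean n x (\<lambda>a. (emean n x (\<lambda>z. g a z))\<^sup>2)"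
      unfolding Vstat_def by (rule emean_square_le[OF n])
    also have "\<dots> \<le> ?g2" unfolding Vstat_def by (intro emean_mono emean_square_le n)
    finally show "(Vstat n g x)\<^sup>2 \<le> ?g2" .
  qed auto
  finally show ?thesis by simp
qed

text \<open>\<open>2 * 16 / (n * (n - 1)) <= 64 / n^2\<close> for \<open>n >= 2\<close>. Order
  \<open>1 / n\<close> in mean square is just what multiplication by \<open>n\<close> can
  afford.\<close>

lemma boot_mean_centered_Ustat_square_le:
  assumes n: "2 \<le> n"
  shows "boot_mean n (\<lambda>y. (Ustat n (centered (empirical n x) g) y)\<^sup>2) x \<le> 64 / (real n)\<^sup>2 * Vstat n (\<lambda>a b. (g a b)\<^sup>2) x"
proof -
  have n0: "0 < n" using n by simp
  let ?v = "Vstat n (\<lambda>a b. (g a b)\<^sup>2) x"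
  have v0: "0 \<le> ?v" by (rule Vstat_nonneg) simp
  have "boot_mean n (\<lambda>y. (Ustat n (centered (empirical n x) g) y)\<^sup>2) x
    \<le> 2 / (real n * (real n - 1)) * Vstat n (\<lambda>a b. (centered (empirical n x) g a b)\<^sup>2) x"
    by (rule boot_mean_degenerate_Ustat_square_le[OF n centered_degenerate[OF n0]])
  also have "\<dots> \<le> 2 / (real n * (real n - 1)) * (16 * ?v)"
    using n by (intro mult_left_mono Vstat_centered_square_le n0) auto
  also have "\<dots> \<le> 4 / (real n)\<^sup>2 * (16 * ?v)"
  proof (intro mult_right_mono)
    show "2 / (real n * (real n - 1)) \<le> 4 / (real n)\<^sup>2" using n by (simp add: field_simps power2_eq_square)
  qed (use v0 in auto)
  finally show ?thesis by simp
qed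

lemma boot_mean_abs_centered_Ustat_le:
  assumes n: "2 \<le> n"
  shows "boot_mean n (\<lambda>y. \<bar>Ustat n (centered (empirical n x) g) y\<bar>) x \<le> 4 * Vstat n (\<lambda>a b. \<bar>g a b\<bar>) x"
proof -
  have n0: "0 < n" using n by simp
  let ?v = "Vstat n (\<lambda>a b. \<bar>g a b\<bar>) x"
  have "boot_mean n (\<lambda>y. \<bar>Ustat n (centered (empirical n x) g) y\<bar>) x \<le> Vstat n (\<lambda>a b. \<bar>centered (empirical n x) g a b\<bar>) x"
    by (rule boot_mean_abs_Ustat_le[OF n])
  also have "\<dots> \<le> Vstat n (\<lambda>a b. \<bar>g a b\<bar> + (emean n x (\<lambda>z. \<bar>g a z\<bar>) + (emean n x (\<lambda>z. \<bar>g z b\<bar>) + ?v))) x"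
  proof (rule Vstat_mono)
    fix i j
    show "\<bar>centered (empirical n x) g (x i) (x j)\<bar> \<le> \<bar>g (x i) (x j)\<bar> + (emean n x (\<lambda>z. \<bar>g (x i) z\<bar>) + (emean n x (\<lambda>z. \<bar>g z (x j)\<bar>) + ?v))"
      using emean_abs_le[of n x "\<lambda>z. g (x i) z"] emean_abs_le[of n x "\<lambda>z. g z (x j)"] Vstat_abs_le[of n g x]
      unfolding centered_eq[OF n0] by linarith
  qed
  also have "\<dots> = ?v + (emean n x (\<lambda>a. emean n x (\<lambda>z. \<bar>g a z\<bar>)) + (emean n x (\<lambda>b. emean n x (\<lambda>z. \<bar>g z b\<bar>)) + ?v))"
    by (simp only: Vstat_add Vstat_fst[OF n0] Vstat_snd[OF n0] Vstat_const[OF n0] emean_const[OF n0])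
  also have "\<dots> = 4 * ?v" using emean_swap[of n x "\<lambda>a b. \<bar>g a b\<bar>"] by (simp add: Vstat_def)
  finally show ?thesis .
qed

lemma boot_mean_centered_mean_square:
  assumes n: "0 < n" and a: "emean n x h = 0"
  shows "boot_mean n (\<lambda>y. (emean n y h)\<^sup>2) x = emean n x (\<lambda>z. (h z)\<^sup>2) / n"
proof -
  have E: "boot_mean n (\<lambda>y. h (y i) * h (y j)) x = (if i = j then emean n x (\<lambda>z. (h z)\<^sup>2) else 0)" if "i < n" "j < n" for i j
  proof (cases "i = j")
    case True
    then show ?thesis using boot_mean_single[OF that(1), of "\<lambda>z. (h z)\<^sup>2" x] by (simp add: power2_eq_square)
  next
    case False
    have "boot_mean n (\<lambda>y. h (y i) * h (y j)) x = 0"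
      by (rule boot_mean_eq_0[OF n that(1)]) (use False a in \<open>simp add: mult.commute[of _ "h (_ j)"] emean_cmult\<close>)
    then show ?thesis using False by simp
  qed
  have "boot_mean n (\<lambda>y. (emean n y h)\<^sup>2) x = boot_mean n (\<lambda>y. 1 / (real n)\<^sup>2 * (\<Sum>i<n. \<Sum>j<n. h (y i) * h (y j))) x"
    by (simp add: emean_def power_divide power2_eq_square[of "sum _ _"] sum_product)
  also have "\<dots> = 1 / (real n)\<^sup>2 * (\<Sum>i<n. \<Sum>j<n. boot_mean n (\<lambda>y. h (y i) * h (y j)) x)"
    by (simp only: boot_mean_cmult boot_mean_sum[OF n])
  also have "(\<Sum>i<n. \<Sum>j<n. boot_mean n (\<lambda>y. h (y i) * h (y j)) x) = n * emean n x (\<lambda>z. (h z)\<^sup>2)"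
    by (simp add: E)
  finally show ?thesis using n by (simp add: power2_eq_square)
qed

text \<open>Hoeffding decomposition: the deviation is the centered U-statistic plus the mean of the
  centered projections \<open>h\<close>. The parts cost \<open>2 * 32 / n\<close>, from
  \<open>64 / n^2 <= 32 / n\<close>, and \<open>2 * 4 / n\<close>.\<close>

lemma boot_mean_Ustat_square_dev_le:
  assumes n: "2 \<le> n"
  shows "boot_mean n (\<lambda>y. (Ustat n g y - Vstat n g x)\<^sup>2) x \<le> 72 / n * Vstat n (\<lambda>a b. (g a b)\<^sup>2) x"
proof -
  have n0: "0 < n" using n by simp
  let ?v = "Vstat n (\<lambda>a b. (g a b)\<^sup>2) x" and ?m = "Vstat n g x" and ?c = "centered (empirical n x) g"
  have v0: "0 \<le> ?v" by (rule Vstat_nonneg) simp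
  define p where "p a = emean n x (\<lambda>z. g a z)" for a
  define q where "q b = emean n x (\<lambda>z. g z b)" for b
  define h where "h a = p a + q a - 2 * ?m" for a
  have mp: "emean n x p = ?m" by (simp add: p_def[abs_def] Vstat_def)
  have mq: "emean n x q = ?m" unfolding q_def[abs_def] Vstat_def by (rule emean_swap)
  have mh: "emean n x h = 0" unfolding h_def using n0 by (simp only: emean_add emean_diff emean_const mp mq)
  have dec: "Ustat n g y - ?m = Ustat n ?c y + emean n y h" for y
  proof -
    have U1: "Ustat n (\<lambda>a b. u a) y = emean n y u" for u
    proof -
      have "(\<Sum>i<n. \<Sum>j\<in>{..<n} - {i}. u (y i)) = (real n - 1) * (\<Sum>i<n. u (y i))"
        using n by (simp add: of_nat_diff sum_distrib_left)
      then show ?thesis using n by (simp add: Ustat_def emean_def)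
    qed
    have U2: "Ustat n (\<lambda>a b. u b) y = emean n y u" for u
    proof -
      have "(\<Sum>i<n. \<Sum>j\<in>{..<n} - {i}. u (y j)) = (\<Sum>i<n. (\<Sum>j<n. u (y j)) - u (y i))"
        by (intro sum.cong refl) (simp add: sum_diff1)
      also have "\<dots> = (real n - 1) * (\<Sum>i<n. u (y i))" by (simp add: sum_subtractf algebra_simps)
      finally show ?thesis using n by (simp add: Ustat_def emean_def)
    qed
    have "Ustat n ?c y = Ustat n g y - emean n y p - emean n y q + ?m"
      unfolding centered_eq[OF n0] by (simp only: Ustat_add Ustat_diff Ustat_const[OF n] U1 U2 p_def[symmetric] q_def[symmetric])
    moreover have "emean n y h = emean n y p + emean n y q - 2 * ?m"
      unfolding h_def using n0 by (simp only: emean_add emean_diff emean_const)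
    ultimately show ?thesis by simp
  qed
  have "boot_mean n (\<lambda>y. (Ustat n g y - ?m)\<^sup>2) x \<le> boot_mean n (\<lambda>y. 2 * (Ustat n ?c y)\<^sup>2 + 2 * (emean n y h)\<^sup>2) x"
  proof (rule boot_mean_mono[OF n0])
    fix y
    have "0 \<le> (Ustat n ?c y - emean n y h)\<^sup>2" by simp
    then show "(Ustat n g y - ?m)\<^sup>2 \<le> 2 * (Ustat n ?c y)\<^sup>2 + 2 * (emean n y h)\<^sup>2"
      unfolding dec power2_diff power2_sum by linarith
  qed
  also have "\<dots> = 2 * boot_mean n (\<lambda>y. (Ustat n ?c y)\<^sup>2) x + 2 * boot_mean n (\<lambda>y. (emean n y h)\<^sup>2) x"
    by (simp only: boot_mean_add[OF n0] boot_mean_cmult)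
  also have "boot_mean n (\<lambda>y. (emean n y h)\<^sup>2) x = emean n x (\<lambda>z. (h z)\<^sup>2) / n"
    by (rule boot_mean_centered_mean_square[OF n0 mh])
  also have "emean n x (\<lambda>z. (h z)\<^sup>2) / n \<le> (4 * ?v) / n"
  proof (rule divide_right_mono)
    have "emean n x (\<lambda>z. (h z)\<^sup>2) \<le> emean n x (\<lambda>z. 2 * ((p z)\<^sup>2 - (2 * ?m * p z - ?m\<^sup>2)) + 2 * ((q z)\<^sup>2 - (2 * ?m * q z - ?m\<^sup>2)))"
    proof (rule emean_mono)
      fix i
      let ?a = "p (x i) - ?m" and ?b = "q (x i) - ?m"
      have "0 \<le> (?a - ?b)\<^sup>2" by simp
      then have "(?a + ?b)\<^sup>2 \<le> 2 * ?a\<^sup>2 + 2 * ?b\<^sup>2" unfolding power2_diff[of ?a] power2_sum[of ?a] by linarith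
      then show "(h (x i))\<^sup>2 \<le> 2 * ((p (x i))\<^sup>2 - (2 * ?m * p (x i) - ?m\<^sup>2)) + 2 * ((q (x i))\<^sup>2 - (2 * ?m * q (x i) - ?m\<^sup>2))"
        by (simp add: h_def power2_diff algebra_simps)
    qed
    also have "\<dots> = 2 * (emean n x (\<lambda>z. (p z)\<^sup>2) - (2 * ?m * ?m - ?m\<^sup>2)) + 2 * (emean n x (\<lambda>z. (q z)\<^sup>2) - (2 * ?m * ?m - ?m\<^sup>2))"
      using n0 by (simp only: emean_add emean_cmult emean_diff emean_const mp mq)
    also have "\<dots> \<le> 2 * emean n x (\<lambda>z. (p z)\<^sup>2) + 2 * emean n x (\<lambda>z. (q z)\<^sup>2)"
      by (simp add: power2_eq_square)
    also have "emean n x (\<lambda>z. (p z)\<^sup>2) \<le> ?v" unfolding p_def Vstat_def by (intro emean_mono emean_square_le n0)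
    also have "emean n x (\<lambda>z. (q z)\<^sup>2) \<le> emean n x (\<lambda>b. emean n x (\<lambda>a. (g a b)\<^sup>2))"
      unfolding q_def by (intro emean_mono emean_square_le n0)
    also have "\<dots> = ?v" unfolding Vstat_def by (rule emean_swap)
    finally show "emean n x (\<lambda>z. (h z)\<^sup>2) \<le> 4 * ?v" by simp
  qed simp
  also have "boot_mean n (\<lambda>y. (Ustat n ?c y)\<^sup>2) x \<le> 64 / (real n)\<^sup>2 * ?v"
    by (rule boot_mean_centered_Ustat_square_le[OF n])
  also have "64 / (real n)\<^sup>2 * ?v \<le> 32 / n * ?v"
    using n v0 by (intro mult_right_mono) (auto simp: field_simps power2_eq_square)
  finally show ?thesis by (simp add: add_divide_distrib field_simps)
qed

section \<open>Convergence in probability and tightness\<close>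

definition pmf_null :: "(nat \<Rightarrow> 'b pmf) \<Rightarrow> (nat \<Rightarrow> 'b \<Rightarrow> real) \<Rightarrow> bool" where
  "pmf_null p T \<longleftrightarrow> (\<forall>\<epsilon>>0. \<forall>\<delta>>0. \<forall>\<^sub>F n in sequentially. measure_pmf.prob (p n) {y. \<epsilon> < \<bar>T n y\<bar>} \<le> \<delta>)"

definition pmf_tight :: "(nat \<Rightarrow> 'b pmf) \<Rightarrow> (nat \<Rightarrow> 'b \<Rightarrow> real) \<Rightarrow> bool" where
  "pmf_tight p T \<longleftrightarrow> (\<forall>\<delta>>0. \<exists>K>0. \<forall>\<^sub>F n in sequentially. measure_pmf.prob (p n) {y. K < \<bar>T n y\<bar>} \<le> \<delta>)"

lemma pmf_nullD: "pmf_null p T \<Longrightarrow> 0 < \<epsilon> \<Longrightarrow> 0 < \<delta> \<Longrightarrow> \<forall>\<^sub>F n in sequentially. measure_pmf.prob (p n) {y. \<epsilon> < \<bar>T n y\<bar>} \<le> \<delta>"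
  by (simp add: pmf_null_def)

lemma pmf_tightE:
  assumes "pmf_tight p T" "0 < \<delta>"
  obtains K where "0 < K" "\<forall>\<^sub>F n in sequentially. measure_pmf.prob (p n) {y. K < \<bar>T n y\<bar>} \<le> \<delta>"
  using assms by (auto simp: pmf_tight_def)

lemma prob_mono_on_support:
  assumes "\<And>y. y \<in> set_pmf p \<Longrightarrow> y \<in> A \<Longrightarrow> y \<in> B"
  shows "measure_pmf.prob p A \<le> measure_pmf.prob p B"
  using assms by (intro measure_pmf.finite_measure_mono_AE) (auto simp: AE_measure_pmf_iff)

lemma prob_le_sum:
  assumes "\<And>y. y \<in> set_pmf p \<Longrightarrow> y \<in> A \<Longrightarrow> y \<in> B \<or> y \<in> C"
  shows "measure_pmf.prob p A \<le> measure_pmf.prob p B + measure_pmf.prob p C"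
proof -
  have "measure_pmf.prob p A \<le> measure_pmf.prob p (B \<union> C)" using assms by (intro prob_mono_on_support) auto
  also have "\<dots> \<le> measure_pmf.prob p B + measure_pmf.prob p C" by (rule measure_Un_le) auto
  finally show ?thesis .
qed

lemma pmf_null_le:
  assumes "pmf_null p T" "\<forall>\<^sub>F n in sequentially. \<forall>y\<in>set_pmf (p n). \<bar>W n y\<bar> \<le> \<bar>T n y\<bar>"
  shows "pmf_null p W"
  unfolding pmf_null_def
proof (intro allI impI)
  fix \<epsilon> \<delta> :: real assume "0 < \<epsilon>" "0 < \<delta>"
  from pmf_nullD[OF assms(1) this] assms(2)
  show "\<forall>\<^sub>F n in sequentially. measure_pmf.prob (p n) {y. \<epsilon> < \<bar>W n y\<bar>} \<le> \<delta>"
  proof eventually_elim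
    case (elim n)
    have "measure_pmf.prob (p n) {y. \<epsilon> < \<bar>W n y\<bar>} \<le> measure_pmf.prob (p n) {y. \<epsilon> < \<bar>T n y\<bar>}"
      using elim(2) by (intro prob_mono_on_support) fastforce
    with elim show ?case by simp
  qed
qed

lemma pmf_tight_le:
  assumes "pmf_tight p T" "\<forall>\<^sub>F n in sequentially. \<forall>y\<in>set_pmf (p n). \<bar>W n y\<bar> \<le> \<bar>T n y\<bar>"
  shows "pmf_tight p W"
  unfolding pmf_tight_def
proof (intro allI impI)
  fix \<delta> :: real assume "0 < \<delta>"
  from pmf_tightE[OF assms(1) this] obtain K where K: "0 < K" "\<forall>\<^sub>F n in sequentially. measure_pmf.prob (p n) {y. K < \<bar>T n y\<bar>} \<le> \<delta>" .
  from K(2) assms(2)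
  have "\<forall>\<^sub>F n in sequentially. measure_pmf.prob (p n) {y. K < \<bar>W n y\<bar>} \<le> \<delta>"
  proof eventually_elim
    case (elim n)
    have "measure_pmf.prob (p n) {y. K < \<bar>W n y\<bar>} \<le> measure_pmf.prob (p n) {y. K < \<bar>T n y\<bar>}"
      using elim(2) by (intro prob_mono_on_support) fastforce
    with elim show ?case by simp
  qed
  with K(1) show "\<exists>K>0. \<forall>\<^sub>F n in sequentially. measure_pmf.prob (p n) {y. K < \<bar>W n y\<bar>} \<le> \<delta>" by blast
qed

lemma pmf_null_add:
  assumes "pmf_null p T" "pmf_null p W" shows "pmf_null p (\<lambda>n y. T n y + W n y)"
  unfolding pmf_null_def
proof (intro allI impI)
  fix \<epsilon> \<delta> :: real assume "0 < \<epsilon>" "0 < \<delta>"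
  then have "0 < \<epsilon> / 2" "0 < \<delta> / 2" by auto
  from pmf_nullD[OF assms(1) this] pmf_nullD[OF assms(2) this]
  show "\<forall>\<^sub>F n in sequentially. measure_pmf.prob (p n) {y. \<epsilon> < \<bar>T n y + W n y\<bar>} \<le> \<delta>"
  proof eventually_elim
    case (elim n)
    have "measure_pmf.prob (p n) {y. \<epsilon> < \<bar>T n y + W n y\<bar>} \<le> measure_pmf.prob (p n) {y. \<epsilon> / 2 < \<bar>T n y\<bar>} + measure_pmf.prob (p n) {y. \<epsilon> / 2 < \<bar>W n y\<bar>}"
      by (intro prob_le_sum) auto
    with elim show ?case by simp
  qed
qed

lemma abs_mult_less_cases: "0 < a \<Longrightarrow> 0 < b \<Longrightarrow> a * b < \<bar>s * t\<bar> \<Longrightarrow> a < \<bar>s\<bar> \<or> b < \<bar>t\<bar>" for s t a b :: real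
  by (metis abs_ge_zero abs_mult linorder_not_le mult_mono order_less_imp_le)

lemma pmf_null_mult:
  assumes "pmf_null p T" "pmf_tight p W" shows "pmf_null p (\<lambda>n y. T n y * W n y)"
  unfolding pmf_null_def
proof (intro allI impI)
  fix \<epsilon> \<delta> :: real assume e: "0 < \<epsilon>" "0 < \<delta>"
  then have d: "0 < \<delta> / 2" by simp
  from pmf_tightE[OF assms(2) d] obtain K where K: "0 < K" "\<forall>\<^sub>F n in sequentially. measure_pmf.prob (p n) {y. K < \<bar>W n y\<bar>} \<le> \<delta> / 2" .
  have "0 < \<epsilon> / K" using e K by simp
  from pmf_nullD[OF assms(1) this d] K(2)
  show "\<forall>\<^sub>F n in sequentially. measure_pmf.prob (p n) {y. \<epsilon> < \<bar>T n y * W n y\<bar>} \<le> \<delta>"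
  proof eventually_elim
    case (elim n)
    have "measure_pmf.prob (p n) {y. \<epsilon> < \<bar>T n y * W n y\<bar>} \<le> measure_pmf.prob (p n) {y. \<epsilon> / K < \<bar>T n y\<bar>} + measure_pmf.prob (p n) {y. K < \<bar>W n y\<bar>}"
      using abs_mult_less_cases[of "\<epsilon> / K" K] e K by (intro prob_le_sum) auto
    with elim show ?case by simp
  qed
qed

lemma pmf_tight_mult:
  assumes "pmf_tight p T" "pmf_tight p W" shows "pmf_tight p (\<lambda>n y. T n y * W n y)"
  unfolding pmf_tight_def
proof (intro allI impI)
  fix \<delta> :: real assume "0 < \<delta>"
  then have d: "0 < \<delta> / 2" by simp
  from pmf_tightE[OF assms(1) d] obtain K where K: "0 < K" "\<forall>\<^sub>F n in sequentially. measure_pmf.prob (p n) {y. K < \<bar>T n y\<bar>} \<le> \<delta> / 2" .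
  from pmf_tightE[OF assms(2) d] obtain L where L: "0 < L" "\<forall>\<^sub>F n in sequentially. measure_pmf.prob (p n) {y. L < \<bar>W n y\<bar>} \<le> \<delta> / 2" .
  from K(2) L(2) have "\<forall>\<^sub>F n in sequentially. measure_pmf.prob (p n) {y. K * L < \<bar>T n y * W n y\<bar>} \<le> \<delta>"
  proof eventually_elim
    case (elim n)
    have "measure_pmf.prob (p n) {y. K * L < \<bar>T n y * W n y\<bar>} \<le> measure_pmf.prob (p n) {y. K < \<bar>T n y\<bar>} + measure_pmf.prob (p n) {y. L < \<bar>W n y\<bar>}"
      using abs_mult_less_cases[of K L] K L by (intro prob_le_sum) auto
    with elim show ?case by simp
  qed
  then show "\<exists>K>0. \<forall>\<^sub>F n in sequentially. measure_pmf.prob (p n) {y. K < \<bar>T n y * W n y\<bar>} \<le> \<delta>"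
    using K(1) L(1) by (intro exI[of _ "K * L"]) auto
qed

lemma pmf_null_det:
  assumes "c \<longlonglongrightarrow> 0" shows "pmf_null p (\<lambda>n y. c n)"
  unfolding pmf_null_def
proof (intro allI impI)
  fix \<epsilon> \<delta> :: real assume "0 < \<epsilon>" "0 < \<delta>"
  have "\<forall>\<^sub>F n in sequentially. norm (c n) < \<epsilon>" using assms \<open>0 < \<epsilon>\<close> order_tendstoD(2)[OF tendsto_norm_zero[OF assms]] by blast
  then show "\<forall>\<^sub>F n in sequentially. measure_pmf.prob (p n) {y. \<epsilon> < \<bar>c n\<bar>} \<le> \<delta>"
    by eventually_elim (use \<open>0 < \<delta>\<close> in auto)
qed

lemma pmf_tight_det:
  assumes "\<forall>\<^sub>F n in sequentially. \<bar>c n\<bar> \<le> C" shows "pmf_tight p (\<lambda>n y. c n)"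
  unfolding pmf_tight_def
proof (intro allI impI)
  fix \<delta> :: real assume "0 < \<delta>"
  from assms have "\<forall>\<^sub>F n in sequentially. measure_pmf.prob (p n) {y. \<bar>C\<bar> + 1 < \<bar>c n\<bar>} \<le> \<delta>"
    by eventually_elim (use \<open>0 < \<delta>\<close> in auto)
  then show "\<exists>K>0. \<forall>\<^sub>F n in sequentially. measure_pmf.prob (p n) {y. K < \<bar>c n\<bar>} \<le> \<delta>"
    by (intro exI[of _ "\<bar>C\<bar> + 1"]) auto
qed

lemma pmf_null_cmult: "pmf_null p T \<Longrightarrow> pmf_null p (\<lambda>n y. c * T n y)"
  using pmf_null_mult[of p T "\<lambda>n y. c"] pmf_tight_det[of "\<lambda>_. c" "\<bar>c\<bar>" p] by (simp add: mult.commute)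

lemma pmf_null_zero: "pmf_null p (\<lambda>n y. 0)"
  using pmf_null_det[of "\<lambda>_. 0" p] by simp

lemma pmf_null_sum: "(\<And>i. i \<in> A \<Longrightarrow> pmf_null p (T i)) \<Longrightarrow> pmf_null p (\<lambda>n y. \<Sum>i\<in>A. T i n y)"
  by (induction A rule: infinite_finite_induct) (auto intro: pmf_null_add pmf_null_zero)

section \<open>Moment criteria under the bootstrap law\<close>

lemma prob_boot_le_mean:
  assumes n: "0 < n" and K: "0 < K" and W: "\<And>y. 0 \<le> W y"
  shows "measure_pmf.prob (bootstrap n x) {y. K < W y} \<le> boot_mean n W x / K"
proof -
  have "measure_pmf.expectation (bootstrap n x) (indicator {y. K < W y}) \<le> measure_pmf.expectation (bootstrap n x) (\<lambda>y. W y / K)"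
    using n K W by (intro integral_mono integrable_measure_pmf_finite) (auto simp: indicator_def)
  then show ?thesis by (simp add: boot_mean_def)
qed

lemma boot_null_L1:
  assumes "(\<lambda>n. boot_mean n (\<lambda>y. \<bar>T n y\<bar>) x) \<longlonglongrightarrow> 0"
  shows "pmf_null (\<lambda>n. bootstrap n x) T"
  unfolding pmf_null_def
proof (intro allI impI)
  fix \<epsilon> \<delta> :: real assume e: "0 < \<epsilon>" "0 < \<delta>"
  have "\<forall>\<^sub>F n in sequentially. boot_mean n (\<lambda>y. \<bar>T n y\<bar>) x < \<delta> * \<epsilon>"
    using order_tendstoD(2)[OF assms, of "\<delta> * \<epsilon>"] e by simp
  then show "\<forall>\<^sub>F n in sequentially. measure_pmf.prob (bootstrap n x) {y. \<epsilon> < \<bar>T n y\<bar>} \<le> \<delta>"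
    using eventually_gt_at_top[of 0]
  proof eventually_elim
    case (elim n)
    have "measure_pmf.prob (bootstrap n x) {y. \<epsilon> < \<bar>T n y\<bar>} \<le> boot_mean n (\<lambda>y. \<bar>T n y\<bar>) x / \<epsilon>"
      using e elim by (intro prob_boot_le_mean) auto
    also have "\<dots> \<le> \<delta>" using elim e by (simp add: field_simps)
    finally show ?case .
  qed
qed

lemma boot_tight_L1:
  assumes "\<forall>\<^sub>F n in sequentially. boot_mean n (\<lambda>y. \<bar>T n y\<bar>) x \<le> C"
  shows "pmf_tight (\<lambda>n. bootstrap n x) T"
  unfolding pmf_tight_def
proof (intro allI impI)
  fix \<delta> :: real assume d: "0 < \<delta>"
  let ?K = "(\<bar>C\<bar> + 1) / \<delta>"
  have K: "0 < ?K" using d by simp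
  from assms have "\<forall>\<^sub>F n in sequentially. measure_pmf.prob (bootstrap n x) {y. ?K < \<bar>T n y\<bar>} \<le> \<delta>"
    using eventually_gt_at_top[of 0]
  proof eventually_elim
    case (elim n)
    have "measure_pmf.prob (bootstrap n x) {y. ?K < \<bar>T n y\<bar>} \<le> boot_mean n (\<lambda>y. \<bar>T n y\<bar>) x / ?K"
      using K elim by (intro prob_boot_le_mean) auto
    also have "\<dots> \<le> (\<bar>C\<bar> + 1) / ?K" using elim K by (intro divide_right_mono) auto
    also have "\<dots> = \<delta>" by (simp add: add_pos_nonneg)
    finally show ?case .
  qed
  with K show "\<exists>K>0. \<forall>\<^sub>F n in sequentially. measure_pmf.prob (bootstrap n x) {y. K < \<bar>T n y\<bar>} \<le> \<delta>" by blast
qed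

lemma boot_null_L2:
  assumes "(\<lambda>n. boot_mean n (\<lambda>y. (T n y)\<^sup>2) x) \<longlonglongrightarrow> 0"
  shows "pmf_null (\<lambda>n. bootstrap n x) T"
  unfolding pmf_null_def
proof (intro allI impI)
  fix \<epsilon> \<delta> :: real assume e: "0 < \<epsilon>" "0 < \<delta>"
  have "pmf_null (\<lambda>n. bootstrap n x) (\<lambda>n y. (T n y)\<^sup>2)" using assms by (intro boot_null_L1) simp
  from pmf_nullD[OF this, of "\<epsilon>\<^sup>2" \<delta>] e
  have "\<forall>\<^sub>F n in sequentially. measure_pmf.prob (bootstrap n x) {y. \<epsilon>\<^sup>2 < \<bar>(T n y)\<^sup>2\<bar>} \<le> \<delta>" by simp
  then show "\<forall>\<^sub>F n in sequentially. measure_pmf.prob (bootstrap n x) {y. \<epsilon> < \<bar>T n y\<bar>} \<le> \<delta>"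
  proof eventually_elim
    case (elim n)
    have "measure_pmf.prob (bootstrap n x) {y. \<epsilon> < \<bar>T n y\<bar>} \<le> measure_pmf.prob (bootstrap n x) {y. \<epsilon>\<^sup>2 < \<bar>(T n y)\<^sup>2\<bar>}"
    proof (rule prob_mono_on_support)
      fix y assume "y \<in> {y. \<epsilon> < \<bar>T n y\<bar>}"
      then have "\<epsilon>\<^sup>2 < \<bar>T n y\<bar>\<^sup>2" using e by (intro power_strict_mono) auto
      then show "y \<in> {y. \<epsilon>\<^sup>2 < \<bar>(T n y)\<^sup>2\<bar>}" by simp
    qed
    with elim show ?case by simp
  qed
qed

lemma bootstrap_support:
  assumes "0 < n" "y \<in> set_pmf (bootstrap n x)" "i < n" shows "\<exists>j<n. y i = x j"
proof -
  obtain I where I: "I \<in> set_pmf (resample n)" "y = x(n := undefined) \<circ> I"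
    using assms(2) unfolding bootstrap_conv_resample[OF assms(1)] by auto
  then show ?thesis using set_resample[OF assms(1) I(1) assms(3)] by (intro exI[of _ "I i"]) auto
qed

section \<open>Expansion of the bootstrap statistic\<close>

definition centered_Ustat :: "nat \<Rightarrow> (nat \<Rightarrow> 'a) \<Rightarrow> ('a \<Rightarrow> 'a \<Rightarrow> real) \<Rightarrow> (nat \<Rightarrow> 'a) \<Rightarrow> real" where
  "centered_Ustat n x f y = Ustat n (centered (empirical n x) f) y"

lemma centered_add:
  assumes "0 < n"
  shows "centered (empirical n x) (\<lambda>a b. f a b + g a b) = (\<lambda>a b. centered (empirical n x) f a b + centered (empirical n x) g a b)"
  using assms by (intro ext) (simp add: centered_eq emean_add Vstat_add)

lemma centered_cmult:
  assumes "0 < n"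
  shows "centered (empirical n x) (\<lambda>a b. c * g a b) = (\<lambda>a b. c * centered (empirical n x) g a b)"
  using assms by (intro ext) (simp add: centered_eq emean_cmult Vstat_cmult algebra_simps)

lemma centered_Ustat_add: "0 < n \<Longrightarrow> centered_Ustat n x (\<lambda>a b. f a b + g a b) y = centered_Ustat n x f y + centered_Ustat n x g y"
  by (simp add: centered_Ustat_def centered_add Ustat_add)

lemma centered_Ustat_cmult: "0 < n \<Longrightarrow> centered_Ustat n x (\<lambda>a b. c * f a b) y = c * centered_Ustat n x f y"
  by (simp add: centered_Ustat_def centered_cmult Ustat_cmult)

lemma centered_Ustat_zero: "0 < n \<Longrightarrow> centered_Ustat n x (\<lambda>a b. 0) y = 0"
  using centered_Ustat_cmult[of n x 0 "\<lambda>_ _. 0" y] by simp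

lemma centered_Ustat_sum: "0 < n \<Longrightarrow> centered_Ustat n x (\<lambda>a b. \<Sum>i\<in>A. f i a b) y = (\<Sum>i\<in>A. centered_Ustat n x (f i) y)"
  by (induction A rule: infinite_finite_induct) (simp_all add: centered_Ustat_add centered_Ustat_zero)

lemma Ustat_sum: "Ustat n (\<lambda>a b. \<Sum>i\<in>A. f i a b :: real) y = (\<Sum>i\<in>A. Ustat n (f i) y)"
  by (induction A rule: infinite_finite_induct) (simp_all add: Ustat_add Ustat_def[of n "\<lambda>_ _. 0"])

text \<open>The four terms of a centered kernel with all signs made positive: it dominates the
  centered version of every kernel whose absolute value is at most \<open>S\<close> on the
  data.\<close>

definition majorant :: "nat \<Rightarrow> (nat \<Rightarrow> 'a) \<Rightarrow> ('a \<Rightarrow> 'a \<Rightarrow> real) \<Rightarrow> 'a \<Rightarrow> 'a \<Rightarrow> real" where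
  "majorant n x S a b = S a b + (emean n x (\<lambda>z. S a z) + (emean n x (\<lambda>z. S z b) + Vstat n S x))"

lemma boot_mean_majorant:
  assumes n: "2 \<le> n"
  shows "boot_mean n (Ustat n (majorant n x S)) x = 4 * Vstat n S x"
proof -
  have n0: "0 < n" using n by simp
  have "boot_mean n (Ustat n (majorant n x S)) x = Vstat n (majorant n x S) x" by (rule boot_mean_Ustat[OF n])
  also have "\<dots> = Vstat n S x + (emean n x (\<lambda>a. emean n x (\<lambda>z. S a z)) + (emean n x (\<lambda>b. emean n x (\<lambda>z. S z b)) + Vstat n S x))"
    unfolding majorant_def[abs_def]
    by (simp only: Vstat_add Vstat_fst[OF n0] Vstat_snd[OF n0] Vstat_const[OF n0] emean_const[OF n0])
  also have "\<dots> = 4 * Vstat n S x" using emean_swap[of n x "\<lambda>a b. S a b"] by (simp add: Vstat_def)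
  finally show ?thesis .
qed

text \<open>A Taylor remainder \<open>R\<close> varies with the bootstrap sample through the
  estimator, so bootstrap moments do not apply to it. The bound moves that dependence into the
  scalar \<open>c\<close> and leaves a kernel fixed by the data.\<close>

lemma centered_Ustat_le_majorant:
  assumes n: "2 \<le> n" and R: "\<And>i j. i < n \<Longrightarrow> j < n \<Longrightarrow> \<bar>R (x i) (x j)\<bar> \<le> c * S (x i) (x j)"
    and y: "y \<in> set_pmf (bootstrap n x)"
  shows "\<bar>centered_Ustat n x R y\<bar> \<le> c * Ustat n (majorant n x S) y"
proof -
  have n0: "0 < n" using n by simp
  have "\<bar>centered_Ustat n x R y\<bar> \<le> Ustat n (\<lambda>a b. \<bar>centered (empirical n x) R a b\<bar>) y"
    unfolding centered_Ustat_def using n by (intro Ustat_abs_le)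
  also have "\<dots> \<le> Ustat n (\<lambda>a b. c * majorant n x S a b) y"
  proof (rule Ustat_mono)
    fix i j assume ij: "i < n" "j < n"
    obtain k l where k: "k < n" "y i = x k" "l < n" "y j = x l" using bootstrap_support[OF n0 y] ij by metis
    have "emean n x (\<lambda>z. \<bar>R (x k) z\<bar>) \<le> c * emean n x (\<lambda>z. S (x k) z)"
      unfolding emean_cmult[symmetric] by (rule emean_mono) (use R k in auto)
    moreover have "emean n x (\<lambda>z. \<bar>R z (x l)\<bar>) \<le> c * emean n x (\<lambda>z. S z (x l))"
      unfolding emean_cmult[symmetric] by (rule emean_mono) (use R k in auto)
    moreover have "Vstat n (\<lambda>a b. \<bar>R a b\<bar>) x \<le> c * Vstat n S x"
      unfolding Vstat_cmult[symmetric] by (rule Vstat_mono) (use R in auto)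
    ultimately show "\<bar>centered (empirical n x) R (y i) (y j)\<bar> \<le> c * majorant n x S (y i) (y j)"
      using R[OF k(1,3)] emean_abs_le[of n x "\<lambda>z. R (x k) z"] emean_abs_le[of n x "\<lambda>z. R z (x l)"] Vstat_abs_le[of n R x]
      unfolding centered_eq[OF n0] k majorant_def distrib_left by linarith
  qed
  also have "\<dots> = c * Ustat n (majorant n x S) y" by (rule Ustat_cmult)
  finally show ?thesis .
qed

lemma Ustat_le_on_sample:
  fixes R S :: "'a \<Rightarrow> 'a \<Rightarrow> real"
  assumes n: "2 \<le> n" and R: "\<And>i j. i < n \<Longrightarrow> j < n \<Longrightarrow> \<bar>R (x i) (x j)\<bar> \<le> c * S (x i) (x j)"
    and y: "y \<in> set_pmf (bootstrap n x)"
  shows "\<bar>Ustat n R y\<bar> \<le> c * Ustat n S y"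
proof -
  have n0: "0 < n" using n by simp
  have "\<bar>Ustat n R y\<bar> \<le> Ustat n (\<lambda>a b. \<bar>R a b\<bar>) y" using n by (intro Ustat_abs_le)
  also have "\<dots> \<le> Ustat n (\<lambda>a b. c * S a b) y"
  proof (rule Ustat_mono)
    fix i j assume ij: "i < n" "j < n"
    obtain k l where k: "k < n" "y i = x k" "l < n" "y j = x l" using bootstrap_support[OF n0 y] ij by metis
    then show "\<bar>R (y i) (y j)\<bar> \<le> c * S (y i) (y j)" using R by simp
  qed
  also have "\<dots> = c * Ustat n S y" by (rule Ustat_cmult)
  finally show ?thesis .
qed

text \<open>The form in which truncation is used: \<open>V\<close> is the truncated part, handled in
  mean square, and \<open>W\<close> the rest, small in mean.\<close>

lemma boot_null_approx:
  assumes "\<And>\<epsilon>. 0 < \<epsilon> \<Longrightarrow> \<exists>V W. pmf_null (\<lambda>n. bootstrap n x) V \<and> (\<forall>\<^sub>F n in sequentially. boot_mean n (\<lambda>y. \<bar>W n y\<bar>) x \<le> \<epsilon>) \<and>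
     (\<forall>\<^sub>F n in sequentially. \<forall>y. \<bar>T n y\<bar> \<le> \<bar>V n y\<bar> + \<bar>W n y\<bar>)"
  shows "pmf_null (\<lambda>n. bootstrap n x) T"
  unfolding pmf_null_def
proof (intro allI impI)
  fix \<epsilon> \<delta> :: real assume e: "0 < \<epsilon>" "0 < \<delta>"
  define \<eta> where "\<eta> = \<delta> / 2 * (\<epsilon> / 2)"
  have "0 < \<eta>" using e by (simp add: \<eta>_def)
  from assms[OF this] obtain V W where V: "pmf_null (\<lambda>n. bootstrap n x) V"
    and W: "\<forall>\<^sub>F n in sequentially. boot_mean n (\<lambda>y. \<bar>W n y\<bar>) x \<le> \<eta>"
    and T: "\<forall>\<^sub>F n in sequentially. \<forall>y. \<bar>T n y\<bar> \<le> \<bar>V n y\<bar> + \<bar>W n y\<bar>" by blast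
  have "\<forall>\<^sub>F n in sequentially. measure_pmf.prob (bootstrap n x) {y. \<epsilon> / 2 < \<bar>V n y\<bar>} \<le> \<delta> / 2"
    using e by (intro pmf_nullD[OF V]) auto
  then show "\<forall>\<^sub>F n in sequentially. measure_pmf.prob (bootstrap n x) {y. \<epsilon> < \<bar>T n y\<bar>} \<le> \<delta>"
    using W T eventually_gt_at_top[of 0]
  proof eventually_elim
    case (elim n)
    have "measure_pmf.prob (bootstrap n x) {y. \<epsilon> < \<bar>T n y\<bar>}
      \<le> measure_pmf.prob (bootstrap n x) {y. \<epsilon> / 2 < \<bar>V n y\<bar>} + measure_pmf.prob (bootstrap n x) {y. \<epsilon> / 2 < \<bar>W n y\<bar>}"
    proof (rule prob_le_sum)
      fix y assume "y \<in> {y. \<epsilon> < \<bar>T n y\<bar>}"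
      then have "\<epsilon> < \<bar>V n y\<bar> + \<bar>W n y\<bar>" using elim(3) by (metis mem_Collect_eq order_less_le_trans)
      then show "y \<in> {y. \<epsilon> / 2 < \<bar>V n y\<bar>} \<or> y \<in> {y. \<epsilon> / 2 < \<bar>W n y\<bar>}" by auto
    qed
    moreover have "measure_pmf.prob (bootstrap n x) {y. \<epsilon> / 2 < \<bar>W n y\<bar>} \<le> boot_mean n (\<lambda>y. \<bar>W n y\<bar>) x / (\<epsilon> / 2)"
      using e elim by (intro prob_boot_le_mean) auto
    moreover have "\<dots> \<le> \<eta> / (\<epsilon> / 2)" using elim e by (intro divide_right_mono) auto
    moreover have "\<eta> / (\<epsilon> / 2) = \<delta> / 2" using e by (simp add: \<eta>_def)
    ultimately show ?case using elim by linarith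
  qed
qed

lemma tendsto_real_const_div: "(\<lambda>n. c / real n) \<longlonglongrightarrow> 0"
  by (rule lim_const_over_n)

lemma tendsto_real_const_div_square: "(\<lambda>n. c / (real n)\<^sup>2) \<longlonglongrightarrow> 0"
  using tendsto_mult[OF lim_const_over_n[of c] lim_const_over_n[of 1]] by (simp add: power2_eq_square)

lemma tendsto_0_of_eventually_le:
  assumes "\<forall>\<^sub>F n in sequentially. 0 \<le> f n" "\<forall>\<^sub>F n in sequentially. f n \<le> g n" "g \<longlonglongrightarrow> 0"
  shows "f \<longlonglongrightarrow> (0::real)"
  by (rule tendsto_sandwich[OF assms(1,2) tendsto_const assms(3)])

text \<open>\<open>tail\<close> is uniform integrability of \<open>e\<close> along the empirical
  measures of pairs.\<close>

context
  fixes x :: "nat \<Rightarrow> 'a" and e :: "'a \<Rightarrow> 'a \<Rightarrow> real"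
  assumes tail: "\<And>\<epsilon>. 0 < \<epsilon> \<Longrightarrow> \<exists>B. \<forall>\<^sub>F n in sequentially. Vstat n (\<lambda>a b. if B < \<bar>e a b\<bar> then \<bar>e a b\<bar> else 0) x \<le> \<epsilon>"
begin

lemma truncated_square_mean_le:
  "0 < n \<Longrightarrow> Vstat n (\<lambda>a b. (if B < \<bar>e a b\<bar> then 0 else e a b)\<^sup>2) x \<le> B\<^sup>2"
proof -
  assume "0 < n"
  have "Vstat n (\<lambda>a b. (if B < \<bar>e a b\<bar> then 0 else e a b)\<^sup>2) x \<le> Vstat n (\<lambda>a b. B\<^sup>2) x"
    by (rule Vstat_mono) (auto simp: abs_le_square_iff[symmetric])
  then show ?thesis using \<open>0 < n\<close> by (simp add: Vstat_const)
qed

text \<open>The bounded part is of order \<open>1 / n\<close> in mean square; centering costs the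
  other part a factor 4 in mean, whence the threshold \<open>\<epsilon> / 4\<close>.\<close>

lemma boot_Uc_null: "pmf_null (\<lambda>n. bootstrap n x) (\<lambda>n y. centered_Ustat n x e y)"
proof (rule boot_null_approx)
  fix \<epsilon> :: real assume "0 < \<epsilon>"
  then have "0 < \<epsilon> / 4" by simp
  from tail[OF this] obtain B where B: "\<forall>\<^sub>F n in sequentially. Vstat n (\<lambda>a b. if B < \<bar>e a b\<bar> then \<bar>e a b\<bar> else 0) x \<le> \<epsilon> / 4" by blast
  define f g where "f = (\<lambda>a b. if B < \<bar>e a b\<bar> then 0 else e a b)" and "g = (\<lambda>a b. if B < \<bar>e a b\<bar> then e a b else 0)"
  have e: "e = (\<lambda>a b. f a b + g a b)" by (intro ext) (simp add: f_def g_def)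
  have "pmf_null (\<lambda>n. bootstrap n x) (\<lambda>n y. centered_Ustat n x f y)"
  proof (rule boot_null_L2, rule tendsto_0_of_eventually_le[OF _ _ tendsto_real_const_div_square])
    show "\<forall>\<^sub>F n in sequentially. boot_mean n (\<lambda>y. (centered_Ustat n x f y)\<^sup>2) x \<le> 64 * B\<^sup>2 / (real n)\<^sup>2"
      using eventually_ge_at_top[of 2]
    proof eventually_elim
      case (elim n)
      have "boot_mean n (\<lambda>y. (centered_Ustat n x f y)\<^sup>2) x \<le> 64 / (real n)\<^sup>2 * Vstat n (\<lambda>a b. (f a b)\<^sup>2) x"
        unfolding centered_Ustat_def by (rule boot_mean_centered_Ustat_square_le[OF elim])
      also have "\<dots> \<le> 64 / (real n)\<^sup>2 * B\<^sup>2"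
        unfolding f_def using elim by (intro mult_left_mono truncated_square_mean_le) auto
      finally show ?case by simp
    qed
    show "\<forall>\<^sub>F n in sequentially. 0 \<le> boot_mean n (\<lambda>y. (centered_Ustat n x f y)\<^sup>2) x"
      by (simp add: boot_mean_def)
  qed
  moreover have "\<forall>\<^sub>F n in sequentially. boot_mean n (\<lambda>y. \<bar>centered_Ustat n x g y\<bar>) x \<le> \<epsilon>"
    using B eventually_ge_at_top[of 2]
  proof eventually_elim
    case (elim n)
    have "(\<lambda>a b. \<bar>g a b\<bar>) = (\<lambda>a b. if B < \<bar>e a b\<bar> then \<bar>e a b\<bar> else 0)" by (intro ext) (simp add: g_def)
    then show ?case using boot_mean_abs_centered_Ustat_le[OF elim(2), of x g] elim(1) by (simp add: centered_Ustat_def)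
  qed
  moreover have "\<forall>\<^sub>F n in sequentially. \<forall>y. \<bar>centered_Ustat n x e y\<bar> \<le> \<bar>centered_Ustat n x f y\<bar> + \<bar>centered_Ustat n x g y\<bar>"
    using eventually_gt_at_top[of 0]
  proof eventually_elim
    case (elim n)
    have "centered_Ustat n x e y = centered_Ustat n x f y + centered_Ustat n x g y" for y by (subst e) (rule centered_Ustat_add[OF elim])
    then show ?case by (simp add: abs_triangle_ineq)
  qed
  ultimately show "\<exists>V W. pmf_null (\<lambda>n. bootstrap n x) V \<and> (\<forall>\<^sub>F n in sequentially. boot_mean n (\<lambda>y. \<bar>W n y\<bar>) x \<le> \<epsilon>) \<and>
     (\<forall>\<^sub>F n in sequentially. \<forall>y. \<bar>centered_Ustat n x e y\<bar> \<le> \<bar>V n y\<bar> + \<bar>W n y\<bar>)"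
    by (intro exI[of _ "\<lambda>n y. centered_Ustat n x f y"] exI[of _ "\<lambda>n y. centered_Ustat n x g y"] conjI)
qed

lemma boot_Ustat_null: "pmf_null (\<lambda>n. bootstrap n x) (\<lambda>n y. Ustat n e y - Vstat n e x)"
proof (rule boot_null_approx)
  fix \<epsilon> :: real assume "0 < \<epsilon>"
  then have "0 < \<epsilon> / 2" by simp
  from tail[OF this] obtain B where B: "\<forall>\<^sub>F n in sequentially. Vstat n (\<lambda>a b. if B < \<bar>e a b\<bar> then \<bar>e a b\<bar> else 0) x \<le> \<epsilon> / 2" by blast
  define f g where "f = (\<lambda>a b. if B < \<bar>e a b\<bar> then 0 else e a b)" and "g = (\<lambda>a b. if B < \<bar>e a b\<bar> then e a b else 0)"
  have e: "e = (\<lambda>a b. f a b + g a b)" by (intro ext) (simp add: f_def g_def)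
  have gabs: "(\<lambda>a b. \<bar>g a b\<bar>) = (\<lambda>a b. if B < \<bar>e a b\<bar> then \<bar>e a b\<bar> else 0)" by (intro ext) (simp add: g_def)
  have "pmf_null (\<lambda>n. bootstrap n x) (\<lambda>n y. Ustat n f y - Vstat n f x)"
  proof (rule boot_null_L2, rule tendsto_0_of_eventually_le[OF _ _ tendsto_real_const_div])
    show "\<forall>\<^sub>F n in sequentially. boot_mean n (\<lambda>y. (Ustat n f y - Vstat n f x)\<^sup>2) x \<le> 72 * B\<^sup>2 / real n"
      using eventually_ge_at_top[of 2]
    proof eventually_elim
      case (elim n)
      have "boot_mean n (\<lambda>y. (Ustat n f y - Vstat n f x)\<^sup>2) x \<le> 72 / real n * Vstat n (\<lambda>a b. (f a b)\<^sup>2) x"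
        by (rule boot_mean_Ustat_square_dev_le[OF elim])
      also have "\<dots> \<le> 72 / real n * B\<^sup>2"
        unfolding f_def using elim by (intro mult_left_mono truncated_square_mean_le) auto
      finally show ?case by simp
    qed
    show "\<forall>\<^sub>F n in sequentially. 0 \<le> boot_mean n (\<lambda>y. (Ustat n f y - Vstat n f x)\<^sup>2) x"
      by (simp add: boot_mean_def)
  qed
  \<comment> \<open>The added constant absorbs \<open>Vstat n g x\<close>, which is not random given
    the data.\<close>
  moreover have "\<forall>\<^sub>F n in sequentially. boot_mean n (\<lambda>y. \<bar>\<bar>Ustat n g y\<bar> + \<epsilon> / 2\<bar>) x \<le> \<epsilon>"
    using B eventually_ge_at_top[of 2]
  proof eventually_elim
    case (elim n)
    have n0: "0 < n" using elim by simp
    have "boot_mean n (\<lambda>y. \<bar>\<bar>Ustat n g y\<bar> + \<epsilon> / 2\<bar>) x = boot_mean n (\<lambda>y. \<bar>Ustat n g y\<bar> + \<epsilon> / 2) x"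
      using \<open>0 < \<epsilon>\<close> by simp
    then show ?case using boot_mean_abs_Ustat_le[OF elim(2), of g x] elim(1) unfolding gabs by (simp add: boot_mean_add[OF n0] boot_mean_const[OF n0])
  qed
  moreover have "\<forall>\<^sub>F n in sequentially. \<forall>y. \<bar>Ustat n e y - Vstat n e x\<bar> \<le> \<bar>Ustat n f y - Vstat n f x\<bar> + \<bar>\<bar>Ustat n g y\<bar> + \<epsilon> / 2\<bar>"
    using B
  proof eventually_elim
    case (elim n)
    have "Ustat n e y = Ustat n f y + Ustat n g y" for y by (subst e) (rule Ustat_add)
    moreover have "Vstat n e x = Vstat n f x + Vstat n g x" by (subst e) (rule Vstat_add)
    moreover have "\<bar>Vstat n g x\<bar> \<le> \<epsilon> / 2" using Vstat_abs_le[of n g x] elim unfolding gabs by simp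
    ultimately show ?case using \<open>0 < \<epsilon>\<close> by (intro allI) (smt (verit))
  qed
  ultimately show "\<exists>V W. pmf_null (\<lambda>n. bootstrap n x) V \<and> (\<forall>\<^sub>F n in sequentially. boot_mean n (\<lambda>y. \<bar>W n y\<bar>) x \<le> \<epsilon>) \<and>
     (\<forall>\<^sub>F n in sequentially. \<forall>y. \<bar>Ustat n e y - Vstat n e x\<bar> \<le> \<bar>V n y\<bar> + \<bar>W n y\<bar>)"
    by (intro exI[of _ "\<lambda>n y. Ustat n f y - Vstat n f x"] exI[of _ "\<lambda>n y. \<bar>Ustat n g y\<bar> + \<epsilon> / 2"] conjI)
qed

end

lemma Vstat_conv_Ustat:
  assumes n: "2 \<le> n"
  shows "Vstat n f x = (1 - 1 / n) * Ustat n f x + emean n x (\<lambda>a. f a a) / n"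
proof -
  have "(\<Sum>i<n. \<Sum>j<n. f (x i) (x j)) = (\<Sum>i<n. (\<Sum>j\<in>{..<n} - {i}. f (x i) (x j)) + f (x i) (x i))"
    by (intro sum.cong refl) (subst sum.remove[of "{..<n}"], auto)
  also have "\<dots> = (\<Sum>i<n. \<Sum>j\<in>{..<n} - {i}. f (x i) (x j)) + (\<Sum>i<n. f (x i) (x i))"
    by (simp add: sum.distrib)
  finally have *: "(\<Sum>i<n. \<Sum>j<n. f (x i) (x j)) = (\<Sum>i<n. \<Sum>j\<in>{..<n} - {i}. f (x i) (x j)) + (\<Sum>i<n. f (x i) (x i))" .
  have "Vstat n f x = (\<Sum>i<n. \<Sum>j<n. f (x i) (x j)) / n / n"
    by (simp add: Vstat_def emean_def sum_divide_distrib)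
  also have "\<dots> = (1 - 1 / n) * Ustat n f x + emean n x (\<lambda>a. f a a) / n"
    unfolding * Ustat_def emean_def using n by (simp add: field_simps)
  finally show ?thesis .
qed

text \<open>One data sequence \<open>x\<close> is fixed and only the finite bootstrap laws remain
  random. On pairs of data points \<open>S1\<close>, \<open>S2\<close>, \<open>S3\<close> dominate
  the derivatives of orders 1 to 3, and \<open>e\<close> holds the second derivatives at
  \<open>t0\<close>.\<close>

locale boot_expansion =
  fixes x :: "nat \<Rightarrow> 'a" and \<Theta> :: "(real ^ 'p) set"
    and th :: "nat \<Rightarrow> real ^ 'p" and ts :: "nat \<Rightarrow> (nat \<Rightarrow> 'a) \<Rightarrow> real ^ 'p" and t0 :: "real ^ 'p"
    and h :: "real ^ 'p \<Rightarrow> 'a \<Rightarrow> 'a \<Rightarrow> real" and d :: "real ^ 'p \<Rightarrow> 'a \<Rightarrow> 'a \<Rightarrow> real ^ 'p"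
    and e :: "'p \<Rightarrow> 'p \<Rightarrow> 'a \<Rightarrow> 'a \<Rightarrow> real" and H :: "real ^ 'p ^ 'p"
    and S1 S2 S3 :: "'a \<Rightarrow> 'a \<Rightarrow> real" and C K :: real
  assumes C: "0 \<le> C"
    and th: "\<And>n. 0 < n \<Longrightarrow> th n \<in> \<Theta>" and ts: "\<And>n y. 0 < n \<Longrightarrow> y \<in> set_pmf (bootstrap n x) \<Longrightarrow> ts n y \<in> \<Theta>" and t0: "t0 \<in> \<Theta>"
    and consistent: "th \<longlonglongrightarrow> t0"
    and tight: "pmf_tight (\<lambda>n. bootstrap n x) (\<lambda>n y. sqrt n * norm (ts n y - th n))"
    and S3_nonneg: "\<And>i j. 0 \<le> S3 (x i) (x j)"
    and d_le: "\<And>i j l t. t \<in> \<Theta> \<Longrightarrow> \<bar>d t (x i) (x j) $ l\<bar> \<le> S1 (x i) (x j)"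
    and h_Lipschitz: "\<And>i j t u. t \<in> \<Theta> \<Longrightarrow> u \<in> \<Theta> \<Longrightarrow> \<bar>h u (x i) (x j) - h t (x i) (x j)\<bar> \<le> C * norm (u - t) * S1 (x i) (x j)"
    and d_Lipschitz: "\<And>i j l t u. t \<in> \<Theta> \<Longrightarrow> u \<in> \<Theta> \<Longrightarrow> \<bar>d u (x i) (x j) $ l - d t (x i) (x j) $ l\<bar> \<le> C * norm (u - t) * S2 (x i) (x j)"
    and d_Taylor: "\<And>i j l t u. t \<in> \<Theta> \<Longrightarrow> u \<in> \<Theta> \<Longrightarrow>
          \<bar>d u (x i) (x j) $ l - d t (x i) (x j) $ l - (\<Sum>k\<in>UNIV. (u - t) $ k * e k l (x i) (x j))\<bar>
            \<le> C * norm (u - t) * (norm (u - t) + norm (t - t0)) * S3 (x i) (x j)"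
    and h_Taylor: "\<And>i j t u. t \<in> \<Theta> \<Longrightarrow> u \<in> \<Theta> \<Longrightarrow>
          \<bar>h u (x i) (x j) - h t (x i) (x j) - (\<Sum>l\<in>UNIV. (u - t) $ l * d t (x i) (x j) $ l)
             - (\<Sum>k\<in>UNIV. \<Sum>l\<in>UNIV. (u - t) $ k * (u - t) $ l / 2 * e k l (x i) (x j))\<bar>
            \<le> C * (norm (u - t))\<^sup>2 * (norm (u - t) + norm (t - t0)) * S3 (x i) (x j)"
    and S1_square: "\<forall>\<^sub>F n in sequentially. Vstat n (\<lambda>a b. (S1 a b)\<^sup>2) x \<le> K"
    and S1_tail: "\<And>\<epsilon>. 0 < \<epsilon> \<Longrightarrow> \<exists>B. \<forall>\<^sub>F n in sequentially. Vstat n (\<lambda>a b. if B < S2 a b then (S1 a b)\<^sup>2 else 0) x \<le> \<epsilon>"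
    and S1_diag: "\<forall>\<^sub>F n in sequentially. emean n x (\<lambda>a. S1 a a) \<le> K"
    and S3_mean: "\<forall>\<^sub>F n in sequentially. Vstat n S3 x \<le> K"
    and e_tail: "\<And>k l \<epsilon>. 0 < \<epsilon> \<Longrightarrow> \<exists>B. \<forall>\<^sub>F n in sequentially. Vstat n (\<lambda>a b. if B < \<bar>e k l a b\<bar> then \<bar>e k l a b\<bar> else 0) x \<le> \<epsilon>"
    and e_mean: "\<And>k l. (\<lambda>n. Vstat n (e k l) x) \<longlonglongrightarrow> H $ k $ l"
begin

abbreviation "null \<equiv> pmf_null (\<lambda>n. bootstrap n x)"
abbreviation "bounded_prob \<equiv> pmf_tight (\<lambda>n. bootstrap n x)"
abbreviation "D n y l \<equiv> sqrt (real n) * (ts n y - th n) $ l"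

lemma S1_nonneg: "0 \<le> S1 (x i) (x j)"
  using d_le[OF t0, of i j undefined] by linarith

lemma tight_D: "bounded_prob (\<lambda>n y. D n y l)"
proof (rule pmf_tight_le[OF tight], intro always_eventually allI ballI)
  fix n y show "\<bar>D n y l\<bar> \<le> \<bar>sqrt n * norm (ts n y - th n)\<bar>"
    using component_le_norm_cart[of "ts n y - th n" l] by (simp add: abs_mult mult_left_mono)
qed

lemma th_null: "(\<lambda>n. norm (th n - t0)) \<longlonglongrightarrow> 0"
  using consistent by (simp add: LIM_zero tendsto_norm_zero)

lemma null_step: "null (\<lambda>n y. norm (ts n y - th n))"
proof -
  have "(\<lambda>n. 1 / sqrt (real n)) \<longlonglongrightarrow> 0" by real_asymp
  then have "null (\<lambda>n y. 1 / sqrt n * (sqrt n * norm (ts n y - th n)))"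
    by (intro pmf_null_mult[OF pmf_null_det tight])
  then show ?thesis
  proof (rule pmf_null_le)
    show "\<forall>\<^sub>F n in sequentially. \<forall>y\<in>set_pmf (bootstrap n x). \<bar>norm (ts n y - th n)\<bar> \<le> \<bar>1 / sqrt n * (sqrt n * norm (ts n y - th n))\<bar>"
      using eventually_gt_at_top[of 0] by eventually_elim simp
  qed
qed

lemma null_rho: "null (\<lambda>n y. norm (ts n y - th n) + norm (th n - t0))"
  by (intro pmf_null_add null_step pmf_null_det th_null)

abbreviation "g n l \<equiv> (\<lambda>a b. d (th n) a b $ l - d t0 a b $ l)"

text \<open>The Lipschitz constant of the gradient is \<open>S2\<close>, for which no square mean is
  at hand. Where \<open>S2\<close> exceeds \<open>B\<close> the difference is bounded by
  \<open>2 * S1\<close> and the tail condition applies; elsewhere it is at most a constant times the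
  distance of \<open>th n\<close> to \<open>t0\<close>.\<close>

lemma Vstat_g_square: "(\<lambda>n. Vstat n (\<lambda>a b. (g n l a b)\<^sup>2) x) \<longlonglongrightarrow> 0"
proof (rule LIMSEQ_I)
  fix r :: real assume "0 < r"
  then have "0 < r / 8" by simp
  from S1_tail[OF this] obtain B where B: "\<forall>\<^sub>F n in sequentially. Vstat n (\<lambda>a b. if B < S2 a b then (S1 a b)\<^sup>2 else 0) x \<le> r / 8" by blast
  let ?c = "\<lambda>n. (C * norm (th n - t0) * \<bar>B\<bar>)\<^sup>2"
  have "?c \<longlonglongrightarrow> (C * 0 * \<bar>B\<bar>)\<^sup>2" by (intro tendsto_intros th_null)
  then have c: "\<forall>\<^sub>F n in sequentially. ?c n < r / 2" by (rule order_tendstoD(2)) (use \<open>0 < r\<close> in simp)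
  have "\<forall>\<^sub>F n in sequentially. norm (Vstat n (\<lambda>a b. (g n l a b)\<^sup>2) x - 0) < r"
    using B c eventually_gt_at_top[of 0]
  proof eventually_elim
    case (elim n)
    have "Vstat n (\<lambda>a b. (g n l a b)\<^sup>2) x \<le> Vstat n (\<lambda>a b. 4 * (if B < S2 a b then (S1 a b)\<^sup>2 else 0) + ?c n) x"
    proof (rule Vstat_mono)
      fix i j
      show "(g n l (x i) (x j))\<^sup>2 \<le> 4 * (if B < S2 (x i) (x j) then (S1 (x i) (x j))\<^sup>2 else 0) + ?c n"
      proof (cases "B < S2 (x i) (x j)")
        case True
        have "\<bar>g n l (x i) (x j)\<bar> \<le> \<bar>2 * S1 (x i) (x j)\<bar>"
          using d_le[OF th[OF elim(3)], of i j l] d_le[OF t0, of i j l] by linarith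
        then have "(g n l (x i) (x j))\<^sup>2 \<le> (2 * S1 (x i) (x j))\<^sup>2" by (simp only: abs_le_square_iff)
        also have "\<dots> = 4 * (S1 (x i) (x j))\<^sup>2" by (simp add: power_mult_distrib)
        finally have "(g n l (x i) (x j))\<^sup>2 \<le> 4 * (S1 (x i) (x j))\<^sup>2" .
        then show ?thesis using True by (simp add: add_increasing2)
      next
        case False
        have "\<bar>g n l (x i) (x j)\<bar> \<le> C * norm (th n - t0) * S2 (x i) (x j)"
          by (rule d_Lipschitz[OF t0 th[OF elim(3)]])
        also have "\<dots> \<le> C * norm (th n - t0) * \<bar>B\<bar>" using False C by (intro mult_left_mono) auto
        finally have "\<bar>g n l (x i) (x j)\<bar> \<le> \<bar>C * norm (th n - t0) * \<bar>B\<bar>\<bar>" by linarith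
        then have "(g n l (x i) (x j))\<^sup>2 \<le> ?c n" by (simp only: abs_le_square_iff)
        then show ?thesis using False by simp
      qed
    qed
    also have "\<dots> = 4 * Vstat n (\<lambda>a b. if B < S2 a b then (S1 a b)\<^sup>2 else 0) x + ?c n"
      by (simp only: Vstat_add Vstat_cmult Vstat_const[OF elim(3)])
    finally have "Vstat n (\<lambda>a b. (g n l a b)\<^sup>2) x \<le> 4 * Vstat n (\<lambda>a b. if B < S2 a b then (S1 a b)\<^sup>2 else 0) x + ?c n" .
    moreover have "0 \<le> Vstat n (\<lambda>a b. (g n l a b)\<^sup>2) x" by (rule Vstat_nonneg) simp
    ultimately show ?case using elim by simp
  qed
  then show "\<exists>no. \<forall>n\<ge>no. norm (Vstat n (\<lambda>a b. (g n l a b)\<^sup>2) x - 0) < r" by (simp add: eventually_sequentially)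
qed

text \<open>The factor \<open>n\<close> uses up the whole rate of a centered U-statistic. What is
  left is the squared distance of \<open>th n\<close> to \<open>t0\<close>, so convergence along
  this very data sequence is essential here.\<close>

lemma null_h: "null (\<lambda>n y. n * centered_Ustat n x (\<lambda>a b. h (th n) a b - h t0 a b) y)"
proof (rule boot_null_L2, rule tendsto_0_of_eventually_le)
  show "\<forall>\<^sub>F n in sequentially. 0 \<le> boot_mean n (\<lambda>y. (n * centered_Ustat n x (\<lambda>a b. h (th n) a b - h t0 a b) y)\<^sup>2) x"
    by (simp add: boot_mean_def)
  have "(\<lambda>n. 64 * ((C * norm (th n - t0))\<^sup>2 * K)) \<longlonglongrightarrow> 64 * ((C * 0)\<^sup>2 * K)" by (intro tendsto_intros th_null)
  then show "(\<lambda>n. 64 * ((C * norm (th n - t0))\<^sup>2 * K)) \<longlonglongrightarrow> 0" by simp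
  show "\<forall>\<^sub>F n in sequentially. boot_mean n (\<lambda>y. (n * centered_Ustat n x (\<lambda>a b. h (th n) a b - h t0 a b) y)\<^sup>2) x \<le> 64 * ((C * norm (th n - t0))\<^sup>2 * K)"
    using S1_square eventually_ge_at_top[of 2]
  proof eventually_elim
    case (elim n)
    have n0: "0 < n" using elim by simp
    let ?f = "\<lambda>a b. h (th n) a b - h t0 a b"
    have "Vstat n (\<lambda>a b. (?f a b)\<^sup>2) x \<le> Vstat n (\<lambda>a b. (C * norm (th n - t0))\<^sup>2 * (S1 a b)\<^sup>2) x"
    proof (rule Vstat_mono)
      fix i j
      have "\<bar>?f (x i) (x j)\<bar> \<le> \<bar>C * norm (th n - t0) * S1 (x i) (x j)\<bar>"
        using h_Lipschitz[OF t0 th[OF n0], of i j] by linarith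
      then show "(?f (x i) (x j))\<^sup>2 \<le> (C * norm (th n - t0))\<^sup>2 * (S1 (x i) (x j))\<^sup>2"
        by (simp only: abs_le_square_iff power_mult_distrib)
    qed
    also have "\<dots> = (C * norm (th n - t0))\<^sup>2 * Vstat n (\<lambda>a b. (S1 a b)\<^sup>2) x" by (rule Vstat_cmult)
    also have "\<dots> \<le> (C * norm (th n - t0))\<^sup>2 * K" using elim by (intro mult_left_mono) auto
    finally have V: "Vstat n (\<lambda>a b. (?f a b)\<^sup>2) x \<le> (C * norm (th n - t0))\<^sup>2 * K" .
    have "boot_mean n (\<lambda>y. (n * centered_Ustat n x ?f y)\<^sup>2) x = (real n)\<^sup>2 * boot_mean n (\<lambda>y. (centered_Ustat n x ?f y)\<^sup>2) x"
      by (simp only: power_mult_distrib boot_mean_cmult)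
    also have "\<dots> \<le> (real n)\<^sup>2 * (64 / (real n)\<^sup>2 * Vstat n (\<lambda>a b. (?f a b)\<^sup>2) x)"
      unfolding centered_Ustat_def using elim by (intro mult_left_mono boot_mean_centered_Ustat_square_le) auto
    also have "\<dots> = 64 * Vstat n (\<lambda>a b. (?f a b)\<^sup>2) x" using n0 by simp
    finally show ?case using V by linarith
  qed
qed

lemma null_d: "null (\<lambda>n y. sqrt n * centered_Ustat n x (\<lambda>a b. d (th n) a b $ l) y)"
proof (rule boot_null_L2, rule tendsto_0_of_eventually_le[OF _ _ tendsto_real_const_div])
  show "\<forall>\<^sub>F n in sequentially. 0 \<le> boot_mean n (\<lambda>y. (sqrt n * centered_Ustat n x (\<lambda>a b. d (th n) a b $ l) y)\<^sup>2) x"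
    by (simp add: boot_mean_def)
  show "\<forall>\<^sub>F n in sequentially. boot_mean n (\<lambda>y. (sqrt n * centered_Ustat n x (\<lambda>a b. d (th n) a b $ l) y)\<^sup>2) x \<le> 64 * K / real n"
    using S1_square eventually_ge_at_top[of 2]
  proof eventually_elim
    case (elim n)
    have n0: "0 < n" using elim by simp
    let ?f = "\<lambda>a b. d (th n) a b $ l"
    have "Vstat n (\<lambda>a b. (?f a b)\<^sup>2) x \<le> Vstat n (\<lambda>a b. (S1 a b)\<^sup>2) x"
    proof (rule Vstat_mono)
      fix i j
      have "\<bar>?f (x i) (x j)\<bar> \<le> \<bar>S1 (x i) (x j)\<bar>" using d_le[OF th[OF n0], of i j l] by linarith
      then show "(?f (x i) (x j))\<^sup>2 \<le> (S1 (x i) (x j))\<^sup>2" by (simp only: abs_le_square_iff)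
    qed
    then have V: "Vstat n (\<lambda>a b. (?f a b)\<^sup>2) x \<le> K" using elim by linarith
    have "boot_mean n (\<lambda>y. (sqrt n * centered_Ustat n x ?f y)\<^sup>2) x = real n * boot_mean n (\<lambda>y. (centered_Ustat n x ?f y)\<^sup>2) x"
      by (simp add: power_mult_distrib boot_mean_cmult)
    also have "\<dots> \<le> real n * (64 / (real n)\<^sup>2 * K)"
      using order_trans[OF boot_mean_centered_Ustat_square_le[OF elim(2), of x ?f] mult_left_mono[OF V]] elim
      unfolding centered_Ustat_def by (intro mult_left_mono) auto
    also have "\<dots> = 64 * K / n" using n0 by (simp add: power2_eq_square)
    finally show ?case .
  qed
qed

lemma root_div: "0 < n \<Longrightarrow> sqrt (real n) * (z / real n) = z / sqrt n"
  by (simp add: field_simps)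

text \<open>The bootstrap centers at the V-statistic, whereas the statistic subtracts the
  U-statistic of the data. The two differ by a diagonal effect of order \<open>1 / n\<close>,
  negligible against \<open>sqrt n\<close>.\<close>

lemma null_g: "null (\<lambda>n y. sqrt n * (Ustat n (g n l) y - Ustat n (g n l) x))"
proof -
  have 1: "null (\<lambda>n y. sqrt n * (Ustat n (g n l) y - Vstat n (g n l) x))"
  proof (rule boot_null_L2, rule tendsto_0_of_eventually_le)
    show "\<forall>\<^sub>F n in sequentially. 0 \<le> boot_mean n (\<lambda>y. (sqrt n * (Ustat n (g n l) y - Vstat n (g n l) x))\<^sup>2) x"
      by (simp add: boot_mean_def)
    show "(\<lambda>n. 72 * Vstat n (\<lambda>a b. (g n l a b)\<^sup>2) x) \<longlonglongrightarrow> 0"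
      using tendsto_mult_left[OF Vstat_g_square, of 72] by simp
    show "\<forall>\<^sub>F n in sequentially. boot_mean n (\<lambda>y. (sqrt n * (Ustat n (g n l) y - Vstat n (g n l) x))\<^sup>2) x \<le> 72 * Vstat n (\<lambda>a b. (g n l a b)\<^sup>2) x"
      using eventually_ge_at_top[of 2]
    proof eventually_elim
      case (elim n)
      have "boot_mean n (\<lambda>y. (sqrt n * (Ustat n (g n l) y - Vstat n (g n l) x))\<^sup>2) x = real n * boot_mean n (\<lambda>y. (Ustat n (g n l) y - Vstat n (g n l) x)\<^sup>2) x"
        by (simp add: power_mult_distrib boot_mean_cmult)
      also have "\<dots> \<le> real n * (72 / n * Vstat n (\<lambda>a b. (g n l a b)\<^sup>2) x)"
        using elim by (intro mult_left_mono boot_mean_Ustat_square_dev_le) auto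
      finally show ?case using elim by simp
    qed
  qed
  have 2: "null (\<lambda>n y. sqrt n * (Vstat n (g n l) x - Ustat n (g n l) x))"
  proof (rule pmf_null_det, rule tendsto_rabs_zero_cancel, rule tendsto_0_of_eventually_le)
    \<comment> \<open>The diagonal contributes \<open>2 * K\<close> and the U-statistic
      \<open>2 * (2 + 2 * K)\<close>, rounded up.\<close>
    show "(\<lambda>n. (6 + 6 * K) / sqrt n) \<longlonglongrightarrow> 0" by real_asymp
    show "\<forall>\<^sub>F n in sequentially. \<bar>sqrt n * (Vstat n (g n l) x - Ustat n (g n l) x)\<bar> \<le> (6 + 6 * K) / sqrt n"
      using S1_square S1_diag eventually_ge_at_top[of 2]
    proof eventually_elim
      case (elim n)
      have n0: "0 < n" using elim by simp
      have "Vstat n S1 x \<le> Vstat n (\<lambda>a b. 1 + (S1 a b)\<^sup>2) x"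
      proof (rule Vstat_mono)
        fix i j show "S1 (x i) (x j) \<le> 1 + (S1 (x i) (x j))\<^sup>2"
          using S1_nonneg[of i j] sum_squares_bound[of 1 "S1 (x i) (x j)"] zero_le_power2[of "S1 (x i) (x j)"] by (simp add: power2_eq_square)
      qed
      also have "\<dots> = 1 + Vstat n (\<lambda>a b. (S1 a b)\<^sup>2) x" by (simp only: Vstat_add Vstat_const[OF n0])
      finally have V1: "Vstat n S1 x \<le> 1 + K" using elim by linarith
      have U0: "0 \<le> Ustat n S1 x"
      proof -
        have "Ustat n (\<lambda>_ _. 0 :: real) x \<le> Ustat n S1 x" by (rule Ustat_mono) (rule S1_nonneg)
        then show ?thesis by (simp add: Ustat_def[of n "\<lambda>_ _. 0"])
      qed
      have E0: "0 \<le> emean n x (\<lambda>a. S1 a a)"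
        unfolding emean_def using S1_nonneg by (intro divide_nonneg_nonneg sum_nonneg) auto
      have "Vstat n S1 x = (1 - 1 / n) * Ustat n S1 x + emean n x (\<lambda>a. S1 a a) / n" by (rule Vstat_conv_Ustat[OF elim(3)])
      \<comment> \<open>For \<open>n >= 2\<close> the off-diagonal weight \<open>1 - 1 / n\<close>
        is at least one half, so the U-statistic is at most twice the V-statistic.\<close>
      moreover have "1 / 2 * Ustat n S1 x \<le> (1 - 1 / n) * Ustat n S1 x"
        using U0 elim(3) by (intro mult_right_mono) (auto simp: field_simps)
      ultimately have "1 / 2 * Ustat n S1 x \<le> Vstat n S1 x" using E0 n0 by (simp add: add_increasing2)
      then have U1: "Ustat n S1 x \<le> 2 + 2 * K" using V1 by linarith
      have gle: "\<bar>g n l (x i) (x j)\<bar> \<le> 2 * S1 (x i) (x j)" for i j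
        using d_le[OF th[OF n0], of i j l] d_le[OF t0, of i j l] by linarith
      have Ug: "\<bar>Ustat n (g n l) x\<bar> \<le> 2 * Ustat n S1 x"
      proof -
        have "\<bar>Ustat n (g n l) x\<bar> \<le> Ustat n (\<lambda>a b. \<bar>g n l a b\<bar>) x" by (rule Ustat_abs_le)
        also have "\<dots> \<le> Ustat n (\<lambda>a b. 2 * S1 a b) x" by (rule Ustat_mono) (rule gle)
        also have "\<dots> = 2 * Ustat n S1 x" by (rule Ustat_cmult)
        finally show ?thesis .
      qed
      have Eg: "\<bar>emean n x (\<lambda>a. g n l a a)\<bar> \<le> 2 * emean n x (\<lambda>a. S1 a a)"
      proof -
        have "\<bar>emean n x (\<lambda>a. g n l a a)\<bar> \<le> emean n x (\<lambda>a. \<bar>g n l a a\<bar>)" by (rule emean_abs_le)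
        also have "\<dots> \<le> emean n x (\<lambda>a. 2 * S1 a a)" by (rule emean_mono) (rule gle)
        also have "\<dots> = 2 * emean n x (\<lambda>a. S1 a a)" by (rule emean_cmult)
        finally show ?thesis .
      qed
      have "Vstat n (g n l) x - Ustat n (g n l) x = (emean n x (\<lambda>a. g n l a a) - Ustat n (g n l) x) / n"
        unfolding Vstat_conv_Ustat[OF elim(3)] using n0 by (simp add: field_simps)
      then have "\<bar>sqrt n * (Vstat n (g n l) x - Ustat n (g n l) x)\<bar> = \<bar>emean n x (\<lambda>a. g n l a a) - Ustat n (g n l) x\<bar> / sqrt n"
        using n0 by (simp only: root_div) (simp add: abs_divide)
      also have "\<dots> \<le> (6 + 6 * K) / sqrt n" using Ug Eg U1 elim by (intro divide_right_mono) auto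
      finally show ?case .
    qed
  qed simp
  show ?thesis using pmf_null_add[OF 1 2] by (simp add: algebra_simps)
qed

lemma null_e: "null (\<lambda>n y. Ustat n (e k l) y - H $ k $ l)"
proof -
  have "null (\<lambda>n y. Vstat n (e k l) x - H $ k $ l)" using e_mean[of k l] by (intro pmf_null_det LIM_zero)
  from pmf_null_add[OF boot_Ustat_null[where x = x and e = "e k l", OF e_tail] this] show ?thesis by simp
qed

lemma null_Ue: "null (\<lambda>n y. centered_Ustat n x (e k l) y)"
  by (rule boot_Uc_null[OF e_tail])

lemma tight_S3: "bounded_prob (\<lambda>n y. Ustat n S3 y)"
proof (rule boot_tight_L1[of _ _ K])
  show "\<forall>\<^sub>F n in sequentially. boot_mean n (\<lambda>y. \<bar>Ustat n S3 y\<bar>) x \<le> K"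
    using S3_mean eventually_ge_at_top[of 2]
  proof eventually_elim
    case (elim n)
    have "boot_mean n (\<lambda>y. \<bar>Ustat n S3 y\<bar>) x \<le> Vstat n (\<lambda>a b. \<bar>S3 a b\<bar>) x" by (rule boot_mean_abs_Ustat_le[OF elim(2)])
    also have "\<dots> \<le> Vstat n S3 x" by (rule Vstat_mono) (use S3_nonneg in auto)
    finally show ?case using elim by linarith
  qed
qed

lemma tight_majorant: "bounded_prob (\<lambda>n y. Ustat n (majorant n x S3) y)"
proof (rule boot_tight_L1[of _ _ "4 * K"])
  show "\<forall>\<^sub>F n in sequentially. boot_mean n (\<lambda>y. \<bar>Ustat n (majorant n x S3) y\<bar>) x \<le> 4 * K"
    using S3_mean eventually_ge_at_top[of 2]
  proof eventually_elim
    case (elim n)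
    have M: "0 \<le> majorant n x S3 (x i) (x j)" for i j
      unfolding majorant_def emean_def by (intro add_nonneg_nonneg divide_nonneg_nonneg sum_nonneg Vstat_nonneg S3_nonneg) auto
    have "boot_mean n (\<lambda>y. \<bar>Ustat n (majorant n x S3) y\<bar>) x \<le> Vstat n (\<lambda>a b. \<bar>majorant n x S3 a b\<bar>) x"
      by (rule boot_mean_abs_Ustat_le[OF elim(2)])
    also have "\<dots> \<le> Vstat n (majorant n x S3) x" by (rule Vstat_mono) (use M in auto)
    also have "\<dots> = boot_mean n (Ustat n (majorant n x S3)) x" by (rule boot_mean_Ustat[OF elim(2), symmetric])
    also have "\<dots> = 4 * Vstat n S3 x" by (rule boot_mean_majorant[OF elim(2)])
    finally show ?case using elim by linarith
  qed
qed

definition Rh :: "nat \<Rightarrow> (nat \<Rightarrow> 'a) \<Rightarrow> 'a \<Rightarrow> 'a \<Rightarrow> real" where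
  "Rh n y a b = h (ts n y) a b - h (th n) a b - (\<Sum>l\<in>UNIV. (ts n y - th n) $ l * d (th n) a b $ l)
             - (\<Sum>k\<in>UNIV. \<Sum>l\<in>UNIV. (ts n y - th n) $ k * (ts n y - th n) $ l / 2 * e k l a b)"

definition Rd :: "nat \<Rightarrow> (nat \<Rightarrow> 'a) \<Rightarrow> 'p \<Rightarrow> 'a \<Rightarrow> 'a \<Rightarrow> real" where
  "Rd n y l a b = d (ts n y) a b $ l - d (th n) a b $ l - (\<Sum>k\<in>UNIV. (ts n y - th n) $ k * e k l a b)"

text \<open>The factor \<open>n\<close> is split between the two norms of the quadratic factor,
  making both tight; the third order factor tends to 0 and the U-statistic of the majorant is
  tight.\<close>

lemma null_Rh: "null (\<lambda>n y. n * centered_Ustat n x (Rh n y) y)"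
proof -
  let ?s = "\<lambda>n y. sqrt n * norm (ts n y - th n)"
  have "null (\<lambda>n y. C * (((norm (ts n y - th n) + norm (th n - t0)) * (?s n y * ?s n y)) * Ustat n (majorant n x S3) y))"
    by (intro pmf_null_cmult pmf_null_mult[OF pmf_null_mult[OF null_rho pmf_tight_mult[OF tight tight]] tight_majorant])
  then show ?thesis
  proof (rule pmf_null_le)
    show "\<forall>\<^sub>F n in sequentially. \<forall>y\<in>set_pmf (bootstrap n x). \<bar>n * centered_Ustat n x (Rh n y) y\<bar>
       \<le> \<bar>C * (((norm (ts n y - th n) + norm (th n - t0)) * (?s n y * ?s n y)) * Ustat n (majorant n x S3) y)\<bar>"
      using eventually_ge_at_top[of 2]
    proof eventually_elim
      case (elim n)
      show ?case
      proof
        fix y assume y: "y \<in> set_pmf (bootstrap n x)"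
        have n0: "0 < n" using elim by simp
        let ?N = "norm (ts n y - th n)"
        have "\<bar>centered_Ustat n x (Rh n y) y\<bar> \<le> (C * ?N\<^sup>2 * (?N + norm (th n - t0))) * Ustat n (majorant n x S3) y"
          by (rule centered_Ustat_le_majorant[OF elim _ y]) (unfold Rh_def, rule h_Taylor[OF th[OF n0] ts[OF n0 y]])
        then have "n * \<bar>centered_Ustat n x (Rh n y) y\<bar> \<le> n * ((C * ?N\<^sup>2 * (?N + norm (th n - t0))) * Ustat n (majorant n x S3) y)"
          by (intro mult_left_mono) auto
        also have "\<dots> = C * (((?N + norm (th n - t0)) * (?s n y * ?s n y)) * Ustat n (majorant n x S3) y)"
          by (simp add: power2_eq_square)
        finally show "\<bar>n * centered_Ustat n x (Rh n y) y\<bar> \<le> \<bar>C * (((?N + norm (th n - t0)) * (?s n y * ?s n y)) * Ustat n (majorant n x S3) y)\<bar>"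
          unfolding abs_mult[of "real n"] abs_of_nat by (rule order_trans[OF _ abs_ge_self])
      qed
    qed
  qed
qed

lemma null_Rd: "null (\<lambda>n y. sqrt n * Ustat n (Rd n y l) y)"
proof -
  let ?s = "\<lambda>n y. sqrt n * norm (ts n y - th n)"
  have "null (\<lambda>n y. C * (((norm (ts n y - th n) + norm (th n - t0)) * ?s n y) * Ustat n S3 y))"
    by (intro pmf_null_cmult pmf_null_mult[OF pmf_null_mult[OF null_rho tight] tight_S3])
  then show ?thesis
  proof (rule pmf_null_le)
    show "\<forall>\<^sub>F n in sequentially. \<forall>y\<in>set_pmf (bootstrap n x). \<bar>sqrt n * Ustat n (Rd n y l) y\<bar>
       \<le> \<bar>C * (((norm (ts n y - th n) + norm (th n - t0)) * ?s n y) * Ustat n S3 y)\<bar>"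
      using eventually_ge_at_top[of 2]
    proof eventually_elim
      case (elim n)
      show ?case
      proof
        fix y assume y: "y \<in> set_pmf (bootstrap n x)"
        have n0: "0 < n" using elim by simp
        let ?N = "norm (ts n y - th n)"
        have "\<bar>Ustat n (Rd n y l) y\<bar> \<le> (C * ?N * (?N + norm (th n - t0))) * Ustat n S3 y"
          by (rule Ustat_le_on_sample[OF elim _ y]) (unfold Rd_def, rule d_Taylor[OF th[OF n0] ts[OF n0 y]])
        then have "sqrt n * \<bar>Ustat n (Rd n y l) y\<bar> \<le> sqrt n * ((C * ?N * (?N + norm (th n - t0))) * Ustat n S3 y)"
          by (intro mult_left_mono) auto
        also have "\<dots> = C * (((?N + norm (th n - t0)) * ?s n y) * Ustat n S3 y)"
          by simp
        finally show "\<bar>sqrt n * Ustat n (Rd n y l) y\<bar> \<le> \<bar>C * (((?N + norm (th n - t0)) * ?s n y) * Ustat n S3 y)\<bar>"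
          unfolding abs_mult[of "sqrt n"] abs_of_nonneg[OF real_sqrt_ge_zero[OF of_nat_0_le_iff]] by (rule order_trans[OF _ abs_ge_self])
      qed
    qed
  qed
qed

lemma centered_Ustat_expand:
  assumes n: "0 < n"
  shows "centered_Ustat n x (h (ts n y)) y = centered_Ustat n x (h t0) y + centered_Ustat n x (\<lambda>a b. h (th n) a b - h t0 a b) y
    + (\<Sum>l\<in>UNIV. (ts n y - th n) $ l * centered_Ustat n x (\<lambda>a b. d (th n) a b $ l) y)
    + (\<Sum>k\<in>UNIV. \<Sum>l\<in>UNIV. (ts n y - th n) $ k * (ts n y - th n) $ l / 2 * centered_Ustat n x (e k l) y)
    + centered_Ustat n x (Rh n y) y"
proof -
  have "h (ts n y) = (\<lambda>a b. h t0 a b + (h (th n) a b - h t0 a b)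
    + (\<Sum>l\<in>UNIV. (ts n y - th n) $ l * d (th n) a b $ l)
    + (\<Sum>k\<in>UNIV. \<Sum>l\<in>UNIV. (ts n y - th n) $ k * (ts n y - th n) $ l / 2 * e k l a b) + Rh n y a b)"
    by (intro ext) (simp add: Rh_def)
  then have "centered_Ustat n x (h (ts n y)) y = centered_Ustat n x (\<lambda>a b. h t0 a b + (h (th n) a b - h t0 a b)
    + (\<Sum>l\<in>UNIV. (ts n y - th n) $ l * d (th n) a b $ l)
    + (\<Sum>k\<in>UNIV. \<Sum>l\<in>UNIV. (ts n y - th n) $ k * (ts n y - th n) $ l / 2 * e k l a b) + Rh n y a b) y" by (rule arg_cong)
  also have "\<dots> = centered_Ustat n x (h t0) y + centered_Ustat n x (\<lambda>a b. h (th n) a b - h t0 a b) y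
    + (\<Sum>l\<in>UNIV. (ts n y - th n) $ l * centered_Ustat n x (\<lambda>a b. d (th n) a b $ l) y)
    + (\<Sum>k\<in>UNIV. \<Sum>l\<in>UNIV. (ts n y - th n) $ k * (ts n y - th n) $ l / 2 * centered_Ustat n x (e k l) y)
    + centered_Ustat n x (Rh n y) y"
    by (simp only: centered_Ustat_add[OF n] centered_Ustat_sum[OF n] centered_Ustat_cmult[OF n])
  finally show ?thesis .
qed

lemma Ustat_expand:
  "Ustat n (\<lambda>a b. d (ts n y) a b $ l) y = Ustat n (\<lambda>a b. d t0 a b $ l) y + Ustat n (g n l) y
    + (\<Sum>k\<in>UNIV. (ts n y - th n) $ k * Ustat n (e k l) y) + Ustat n (Rd n y l) y"
proof -
  have "(\<lambda>a b. d (ts n y) a b $ l) = (\<lambda>a b. d t0 a b $ l + g n l a b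
    + (\<Sum>k\<in>UNIV. (ts n y - th n) $ k * e k l a b) + Rd n y l a b)"
    by (intro ext) (simp add: Rd_def)
  then have "Ustat n (\<lambda>a b. d (ts n y) a b $ l) y = Ustat n (\<lambda>a b. d t0 a b $ l + g n l a b
    + (\<Sum>k\<in>UNIV. (ts n y - th n) $ k * e k l a b) + Rd n y l a b) y" by (rule arg_cong)
  also have "\<dots> = Ustat n (\<lambda>a b. d t0 a b $ l) y + Ustat n (g n l) y
    + (\<Sum>k\<in>UNIV. (ts n y - th n) $ k * Ustat n (e k l) y) + Ustat n (Rd n y l) y"
    by (simp only: Ustat_add Ustat_sum Ustat_cmult)
  finally show ?thesis .
qed

lemma Ustat_component: "Ustat n f z $ l = Ustat n (\<lambda>a b. (f a b :: real ^ 'p) $ l) z"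
  by (simp add: Ustat_def)

lemma rearrange: "n * (\<Delta> * ((a + b + s + r) - (c + f))) = n * ((a - c) * \<Delta>) + n * ((b - f) * \<Delta>) + n * (\<Delta> * s) + n * (r * \<Delta>)" for n :: real
  by (simp add: algebra_simps)

text \<open>Every first or second order term of the centered U-statistic is a tight product of
  scaled steps times a centered U-statistic that still vanishes. The gradient difference keeps its
  value at \<open>t0\<close> and, because the uncentered second derivatives converge to
  \<open>H\<close>, the quadratic form.\<close>

theorem expansion:
  "null (\<lambda>n y. n * (Ustat n (centered (empirical n x) (h (ts n y))) y
        + (ts n y - th n) \<bullet> (Ustat n (d (ts n y)) y - Ustat n (d (th n)) x))
     - (n * Ustat n (centered (empirical n x) (h t0)) y
        + (sqrt n *\<^sub>R (Ustat n (d t0) y - Ustat n (d t0) x)) \<bullet> (sqrt n *\<^sub>R (ts n y - th n))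
        + (sqrt n *\<^sub>R (ts n y - th n)) \<bullet> (H *v (sqrt n *\<^sub>R (ts n y - th n)))))"
proof -
  \<comment> \<open>The exact remainder: four summands from the centered U-statistic, three from the
    gradient difference. The final comparison is an identity.\<close>
  let ?R = "\<lambda>n y. n * centered_Ustat n x (\<lambda>a b. h (th n) a b - h t0 a b) y
    + (\<Sum>l\<in>UNIV. sqrt n * centered_Ustat n x (\<lambda>a b. d (th n) a b $ l) y * D n y l)
    + (\<Sum>k\<in>UNIV. \<Sum>l\<in>UNIV. (1 / 2) * (centered_Ustat n x (e k l) y * (D n y k * D n y l)))
    + n * centered_Ustat n x (Rh n y) y
    + (\<Sum>l\<in>UNIV. sqrt n * (Ustat n (g n l) y - Ustat n (g n l) x) * D n y l)
    + (\<Sum>k\<in>UNIV. \<Sum>l\<in>UNIV. (Ustat n (e k l) y - H $ k $ l) * (D n y k * D n y l))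
    + (\<Sum>l\<in>UNIV. sqrt n * Ustat n (Rd n y l) y * D n y l)"
  have "null ?R"
    by (intro pmf_null_add pmf_null_sum null_h null_Rh pmf_null_cmult pmf_null_mult[OF null_d tight_D] pmf_null_mult[OF null_g tight_D]
          pmf_null_mult[OF null_Ue pmf_tight_mult[OF tight_D tight_D]] pmf_null_mult[OF null_e pmf_tight_mult[OF tight_D tight_D]]
          pmf_null_mult[OF null_Rd tight_D])
  then show ?thesis
  proof (rule pmf_null_le)
    show "\<forall>\<^sub>F n in sequentially. \<forall>y\<in>set_pmf (bootstrap n x).
      \<bar>n * (Ustat n (centered (empirical n x) (h (ts n y))) y
        + (ts n y - th n) \<bullet> (Ustat n (d (ts n y)) y - Ustat n (d (th n)) x))
     - (n * Ustat n (centered (empirical n x) (h t0)) y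
        + (sqrt n *\<^sub>R (Ustat n (d t0) y - Ustat n (d t0) x)) \<bullet> (sqrt n *\<^sub>R (ts n y - th n))
        + (sqrt n *\<^sub>R (ts n y - th n)) \<bullet> (H *v (sqrt n *\<^sub>R (ts n y - th n))))\<bar> \<le> \<bar>?R n y\<bar>"
      using eventually_gt_at_top[of 0]
    proof eventually_elim
      case (elim n)
      have sq2: "sqrt n * a * (sqrt n * b) = n * (a * b)" for a b :: real
      proof -
        have "sqrt n * a * (sqrt n * b) = (sqrt n * sqrt n) * (a * b)" by (simp only: ac_simps)
        then show ?thesis by simp
      qed
      show ?case
      proof
        fix y
        let ?\<Delta> = "ts n y - th n"
        have A: "n * (?\<Delta> \<bullet> (Ustat n (d (ts n y)) y - Ustat n (d (th n)) x))
          = (\<Sum>l\<in>UNIV. sqrt n * (Ustat n (\<lambda>a b. d t0 a b $ l) y - Ustat n (\<lambda>a b. d t0 a b $ l) x) * D n y l)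
          + (\<Sum>l\<in>UNIV. sqrt n * (Ustat n (g n l) y - Ustat n (g n l) x) * D n y l)
          + (\<Sum>k\<in>UNIV. \<Sum>l\<in>UNIV. Ustat n (e k l) y * (D n y k * D n y l))
          + (\<Sum>l\<in>UNIV. sqrt n * Ustat n (Rd n y l) y * D n y l)"
        proof -
          have Ux: "Ustat n (\<lambda>a b. d (th n) a b $ l) x = Ustat n (\<lambda>a b. d t0 a b $ l) x + Ustat n (g n l) x" for l
            by (simp add: Ustat_add[symmetric])
          have "n * (?\<Delta> \<bullet> (Ustat n (d (ts n y)) y - Ustat n (d (th n)) x))
             = (\<Sum>l\<in>UNIV. n * (?\<Delta> $ l * (Ustat n (\<lambda>a b. d (ts n y) a b $ l) y - Ustat n (\<lambda>a b. d (th n) a b $ l) x)))"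
            by (simp add: inner_vec_def Ustat_component sum_distrib_left)
          also have "\<dots> = (\<Sum>l\<in>UNIV. sqrt n * (Ustat n (\<lambda>a b. d t0 a b $ l) y - Ustat n (\<lambda>a b. d t0 a b $ l) x) * D n y l
             + sqrt n * (Ustat n (g n l) y - Ustat n (g n l) x) * D n y l
             + (\<Sum>k\<in>UNIV. Ustat n (e k l) y * (D n y k * D n y l)) + sqrt n * Ustat n (Rd n y l) y * D n y l)"
          proof (rule sum.cong[OF refl])
            fix l
            have "(\<Sum>k\<in>UNIV. Ustat n (e k l) y * (D n y k * D n y l)) = n * (?\<Delta> $ l * (\<Sum>k\<in>UNIV. ?\<Delta> $ k * Ustat n (e k l) y))"
              unfolding sum_distrib_left sq2 by (intro sum.cong refl) (simp add: algebra_simps)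
            then show "n * (?\<Delta> $ l * (Ustat n (\<lambda>a b. d (ts n y) a b $ l) y - Ustat n (\<lambda>a b. d (th n) a b $ l) x))
              = sqrt n * (Ustat n (\<lambda>a b. d t0 a b $ l) y - Ustat n (\<lambda>a b. d t0 a b $ l) x) * D n y l
             + sqrt n * (Ustat n (g n l) y - Ustat n (g n l) x) * D n y l
             + (\<Sum>k\<in>UNIV. Ustat n (e k l) y * (D n y k * D n y l)) + sqrt n * Ustat n (Rd n y l) y * D n y l"
              unfolding Ustat_expand Ux sq2 by (simp only: rearrange)
          qed
          also have "\<dots> = (\<Sum>l\<in>UNIV. sqrt n * (Ustat n (\<lambda>a b. d t0 a b $ l) y - Ustat n (\<lambda>a b. d t0 a b $ l) x) * D n y l)
          + (\<Sum>l\<in>UNIV. sqrt n * (Ustat n (g n l) y - Ustat n (g n l) x) * D n y l)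
          + (\<Sum>k\<in>UNIV. \<Sum>l\<in>UNIV. Ustat n (e k l) y * (D n y k * D n y l))
          + (\<Sum>l\<in>UNIV. sqrt n * Ustat n (Rd n y l) y * D n y l)"
            unfolding sum.distrib by (subst sum.swap) (rule refl)
          finally show ?thesis .
        qed
        have B1: "n * (\<Sum>l\<in>UNIV. ?\<Delta> $ l * centered_Ustat n x (\<lambda>a b. d (th n) a b $ l) y) = (\<Sum>l\<in>UNIV. sqrt n * centered_Ustat n x (\<lambda>a b. d (th n) a b $ l) y * D n y l)"
          unfolding sq2 sum_distrib_left by (intro sum.cong refl) (simp only: mult.commute)
        have B2: "n * (\<Sum>k\<in>UNIV. \<Sum>l\<in>UNIV. ?\<Delta> $ k * ?\<Delta> $ l / 2 * centered_Ustat n x (e k l) y)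
          = (\<Sum>k\<in>UNIV. \<Sum>l\<in>UNIV. (1 / 2) * (centered_Ustat n x (e k l) y * (D n y k * D n y l)))"
          unfolding sq2 sum_distrib_left by (intro sum.cong refl) simp
        have B: "n * centered_Ustat n x (h (ts n y)) y = n * centered_Ustat n x (h t0) y + n * centered_Ustat n x (\<lambda>a b. h (th n) a b - h t0 a b) y
          + (\<Sum>l\<in>UNIV. sqrt n * centered_Ustat n x (\<lambda>a b. d (th n) a b $ l) y * D n y l)
          + (\<Sum>k\<in>UNIV. \<Sum>l\<in>UNIV. (1 / 2) * (centered_Ustat n x (e k l) y * (D n y k * D n y l)))
          + n * centered_Ustat n x (Rh n y) y"
          unfolding centered_Ustat_expand[OF elim] B1[symmetric] B2[symmetric] by (simp only: distrib_left)
        have C: "(sqrt n *\<^sub>R ?\<Delta>) \<bullet> (H *v (sqrt n *\<^sub>R ?\<Delta>)) = (\<Sum>k\<in>UNIV. \<Sum>l\<in>UNIV. H $ k $ l * (D n y k * D n y l))"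
          unfolding inner_vec_def matrix_vector_mult_def sum_distrib_left by (intro sum.cong refl) (simp add: sum_distrib_left mult.left_commute)
        have E: "(sqrt n *\<^sub>R (Ustat n (d t0) y - Ustat n (d t0) x)) \<bullet> (sqrt n *\<^sub>R ?\<Delta>)
           = (\<Sum>l\<in>UNIV. sqrt n * (Ustat n (\<lambda>a b. d t0 a b $ l) y - Ustat n (\<lambda>a b. d t0 a b $ l) x) * D n y l)"
          by (simp add: inner_vec_def Ustat_component)
        have F: "(\<Sum>k\<in>UNIV. \<Sum>l\<in>UNIV. (Ustat n (e k l) y - H $ k $ l) * (D n y k * D n y l))
          = (\<Sum>k\<in>UNIV. \<Sum>l\<in>UNIV. Ustat n (e k l) y * (D n y k * D n y l)) - (\<Sum>k\<in>UNIV. \<Sum>l\<in>UNIV. H $ k $ l * (D n y k * D n y l))"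
          by (simp only: left_diff_distrib sum_subtractf)
        show "\<bar>n * (Ustat n (centered (empirical n x) (h (ts n y))) y
        + ?\<Delta> \<bullet> (Ustat n (d (ts n y)) y - Ustat n (d (th n)) x))
     - (n * Ustat n (centered (empirical n x) (h t0)) y
        + (sqrt n *\<^sub>R (Ustat n (d t0) y - Ustat n (d t0) x)) \<bullet> (sqrt n *\<^sub>R ?\<Delta>)
        + (sqrt n *\<^sub>R ?\<Delta>) \<bullet> (H *v (sqrt n *\<^sub>R ?\<Delta>)))\<bar> \<le> \<bar>?R n y\<bar>"
          unfolding C E F centered_Ustat_def[symmetric] distrib_left A B by linarith
      qed
    qed
  qed
qed

end

section \<open>Smooth functions on a convex set\<close>

text \<open>The difference of two derivatives vanishes on \<open>w - x\<close> for every
  \<open>w\<close> in \<open>S\<close>, by a one-sided derivative along the segment. Differences of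
  points of an interior ball reach every direction up to scale. On such sets the choice inside
  \<open>deriv_field\<close> is therefore forced, boundary points included.\<close>

lemma has_derivative_unique_on_convex:
  fixes f :: "'a::euclidean_space \<Rightarrow> 'b::real_normed_vector"
  assumes S: "convex S" "interior S \<noteq> {}" and x: "x \<in> S"
    and D: "(f has_derivative D) (at x within S)" and E: "(f has_derivative E) (at x within S)"
  shows "D = E"
proof -
  define L where "L v = D v - E v" for v
  have L: "((\<lambda>y. 0) has_derivative L) (at x within S)"
    using has_derivative_diff[OF D E] by (simp add: L_def[abs_def])
  interpret L: bounded_linear L by (rule has_derivative_bounded_linear[OF L])
  have zero: "L (w - x) = 0" if w: "w \<in> S" for w
  proof -
    have c: "((\<lambda>s::real. x + s *\<^sub>R (w - x)) has_derivative (\<lambda>s. s *\<^sub>R (w - x))) (at 0 within {0..1})"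
      by (auto intro!: derivative_eq_intros)
    have "(\<lambda>s::real. x + s *\<^sub>R (w - x)) ` {0..1} \<subseteq> S"
    proof safe
      fix s :: real assume "s \<in> {0..1}"
      then have "(1 - s) *\<^sub>R x + s *\<^sub>R w \<in> S" using S(1) x w by (intro convexD) auto
      then show "x + s *\<^sub>R (w - x) \<in> S" by (simp add: algebra_simps)
    qed
    then have "((\<lambda>s::real. (0::'b)) has_derivative (\<lambda>s. L (s *\<^sub>R (w - x)))) (at 0 within {0..1})"
      using has_derivative_in_compose[OF c, of "\<lambda>y. 0" L] has_derivative_subset[OF L] by simp
    then have "((\<lambda>s::real. (0::'b)) has_vector_derivative L (w - x)) (at 0 within cbox 0 1)"
      by (simp add: has_vector_derivative_def L.scaleR)
    moreover have "((\<lambda>s::real. (0::'b)) has_vector_derivative 0) (at 0 within cbox 0 1)"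
      by (rule has_vector_derivative_const)
    ultimately show ?thesis by (intro vector_derivative_unique_within_closed_interval[of 0 1 0 "\<lambda>_. 0"]) auto
  qed
  from S(2) obtain z r where z: "0 < r" "ball z r \<subseteq> S" by (auto simp: mem_interior)
  have "L v = 0" for v
  proof (cases "v = 0")
    case False
    define c where "c = r / 2 / norm v"
    have c: "c \<noteq> 0" using z False by (simp add: c_def)
    have "norm (c *\<^sub>R v) < r" using z False by (simp add: c_def)
    then have "z + c *\<^sub>R v \<in> S" "z \<in> S" using z by (auto simp: dist_norm subset_iff)
    from zero[OF this(1)] zero[OF this(2)] have "L (z + c *\<^sub>R v - x) - L (z - x) = 0" by simp
    then have "L ((z + c *\<^sub>R v - x) - (z - x)) = 0" unfolding L.diff[of "z + c *\<^sub>R v - x"] .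
    then have "c *\<^sub>R L v = 0" by (simp add: L.scaleR)
    then show ?thesis using c by simp
  qed (simp add: L.zero)
  then show ?thesis by (auto simp: L_def fun_eq_iff)
qed

lemma deriv_field_unique:
  assumes "convex S" "interior S \<noteq> {}" "f differentiable_on S" "x \<in> S" "(f has_derivative D) (at x within S)"
  shows "deriv_field S f x = D"
  by (rule has_derivative_unique_on_convex[OF assms(1,2,4) deriv_field_works[OF assms(3,4)] assms(5)])

text \<open>Stated for differentiability at the single point \<open>x\<close>: integrals over the
  data space will be differentiated at interior parameters only.\<close>

lemma deriv_field_at_interior:
  assumes x: "x \<in> interior S" and D: "(f has_derivative D) (at x)"
  shows "deriv_field S f x = D"
proof (cases "\<exists>D. is_deriv_field S f D \<and> continuous_field S D")
  case True
  then have "is_deriv_field S f (deriv_field S f)"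
    unfolding deriv_field_def by (simp, metis (mono_tags, lifting) someI_ex)
  then have "(f has_derivative deriv_field S f x) (at x)"
    unfolding is_deriv_field_def using subsetD[OF interior_subset x] at_within_interior[OF x] by metis
  then show ?thesis using D by (rule has_derivative_unique)
next
  case False
  have "deriv_field S f x = frechet_derivative f (at x within S)"
    unfolding deriv_field_def if_not_P[OF False] ..
  then show ?thesis unfolding at_within_interior[OF x] frechet_derivative_at[OF D, symmetric] .
qed

text \<open>The domain may be irregular and \<open>deriv_field\<close> may differ from the given
  \<open>D\<close>; but once some continuous derivative exists, the chosen one is continuous as
  well.\<close>

lemma continuous_deriv_field:
  assumes "is_deriv_field S f D" "continuous_field S D"
  shows "continuous_on S (\<lambda>x. deriv_field S f x u)"
proof -
  have "continuous_field S (deriv_field S f)"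
    using exI[of "\<lambda>D. is_deriv_field S f D \<and> continuous_field S D", OF conjI[OF assms]]
    unfolding deriv_field_def by (simp, metis (mono_tags, lifting) someI_ex)
  then show ?thesis by (simp add: continuous_field_def)
qed

section \<open>Iterated partial derivatives and their closure properties\<close>

lemma partials_append: "partials S (us @ vs) f = partials S us (partials S vs f)"
  by (induction us) simp_all

lemma dirs_0 [simp]: "dirs 0 = {[]}"
  by (auto simp: dirs_def)

lemma dirs_Suc_snoc: "us \<in> dirs (Suc m) \<longleftrightarrow> (\<exists>vs u. us = vs @ [u] \<and> vs \<in> dirs m \<and> u \<in> Basis)"
  by (cases us rule: rev_cases) (auto simp: dirs_def)

lemma dirs_Suc: "us \<in> dirs (Suc m) \<longleftrightarrow> (\<exists>vs u. us = u # vs \<and> vs \<in> dirs m \<and> u \<in> Basis)"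
  by (cases us) (auto simp: dirs_def)

lemma finite_dirs [simp]: "finite (dirs m :: 'a::euclidean_space list set)"
  unfolding dirs_def by (rule finite_lists_length_eq) simp

lemma times_differentiable_on_0 [simp]: "times_differentiable_on 0 S f"
  by (simp add: times_differentiable_on_def)

text \<open>Peels off the innermost derivative, the last entry of the list, so that inductions over
  the order can generalise the function.\<close>

lemma times_differentiable_on_Suc:
  "times_differentiable_on (Suc m) S f \<longleftrightarrow>
     f differentiable_on S \<and> (\<forall>u\<in>Basis. times_differentiable_on m S (\<lambda>x. deriv_field S f x u))"
proof -
  have p: "partials S us (\<lambda>x. deriv_field S f x u) = partials S (us @ [u]) f" for us u
    by (simp add: partials_append)
  show ?thesis
  proof (intro iffI conjI ballI)
    assume *: "times_differentiable_on (Suc m) S f"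
    then have *: "partials S us f differentiable_on S" if "l < Suc m" "us \<in> dirs l" for l us
      using that unfolding times_differentiable_on_def by blast
    from *[of 0 "[]"] show "f differentiable_on S" by simp
    fix u :: 'a assume u: "u \<in> Basis"
    show "times_differentiable_on m S (\<lambda>x. deriv_field S f x u)"
      unfolding times_differentiable_on_def p
    proof (intro allI impI ballI)
      fix l us assume "l < m" "us \<in> (dirs l :: 'a list set)"
      then show "partials S (us @ [u]) f differentiable_on S"
        using u by (intro *[of "Suc l"]) (auto simp: dirs_Suc_snoc)
    qed
  next
    assume *: "f differentiable_on S \<and> (\<forall>u\<in>Basis. times_differentiable_on m S (\<lambda>x. deriv_field S f x u))"
    show "times_differentiable_on (Suc m) S f"
      unfolding times_differentiable_on_def
    proof (intro allI impI ballI)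
      fix l us assume l: "l < Suc m" and us: "us \<in> (dirs l :: 'a list set)"
      show "partials S us f differentiable_on S"
      proof (cases l)
        case 0
        then show ?thesis using us * by simp
      next
        case (Suc l')
        then obtain vs u where "us = vs @ [u]" "vs \<in> dirs l'" "u \<in> Basis" using us by (auto simp: dirs_Suc_snoc)
        then show ?thesis using * l Suc unfolding times_differentiable_on_def by (metis p Suc_less_SucD)
      qed
    qed
  qed
qed

lemma times_differentiable_on_le: "times_differentiable_on m S f \<Longrightarrow> l \<le> m \<Longrightarrow> times_differentiable_on l S f"
  unfolding times_differentiable_on_def using order_less_le_trans by blast

lemma has_derivative_cong_on:
  assumes "\<And>x. x \<in> S \<Longrightarrow> f x = g x" "x \<in> S"
  shows "(f has_derivative D) (at x within S) \<longleftrightarrow> (g has_derivative D) (at x within S)"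
  using has_derivative_transform[OF assms(2), of g f] has_derivative_transform[OF assms(2), of f g] assms(1) by auto

lemma differentiable_on_cong:
  assumes "\<And>x. x \<in> S \<Longrightarrow> f x = g x"
  shows "f differentiable_on S \<longleftrightarrow> g differentiable_on S"
  unfolding differentiable_on_def differentiable_def using has_derivative_cong_on[of S f g, OF assms] by (intro ball_cong refl) simp

lemma deriv_field_cong:
  assumes "\<And>x. x \<in> S \<Longrightarrow> f x = g x" "x \<in> S"
  shows "deriv_field S f x = deriv_field S g x"
proof -
  note c = has_derivative_cong_on[of S f g, OF assms(1)]
  have "is_deriv_field S f = is_deriv_field S g" using c by (auto simp: is_deriv_field_def)
  moreover have "frechet_derivative f (at x within S) = frechet_derivative g (at x within S)"
    unfolding frechet_derivative_def using c[OF _ assms(2)] by simp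
  ultimately show ?thesis by (auto simp: deriv_field_def)
qed

lemma partials_cong:
  assumes "\<And>x. x \<in> S \<Longrightarrow> f x = g x" "x \<in> S"
  shows "partials S us f x = partials S us g x"
  using assms(2)
proof (induction us arbitrary: x)
  case (Cons u us)
  show ?case using deriv_field_cong[of S "partials S us f" "partials S us g", OF Cons.IH Cons.prems] by simp
qed (use assms in simp)

lemma times_differentiable_on_cong:
  assumes "\<And>x. x \<in> S \<Longrightarrow> f x = g x"
  shows "times_differentiable_on m S f \<longleftrightarrow> times_differentiable_on m S g"
proof -
  have "partials S us f differentiable_on S \<longleftrightarrow> partials S us g differentiable_on S" for us
    by (rule differentiable_on_cong) (rule partials_cong[OF assms])
  then show ?thesis by (simp add: times_differentiable_on_def)
qed

context
  fixes S :: "'a::euclidean_space set"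
  assumes S: "convex S" "interior S \<noteq> {}"
begin

lemma times_differentiable_on_const: "times_differentiable_on m S (\<lambda>x. c)"
proof (induction m arbitrary: c)
  case (Suc m)
  have "deriv_field S (\<lambda>x. c) x = (\<lambda>_. 0)" if "x \<in> S" for x
    by (rule deriv_field_unique[OF S _ that]) (auto intro: derivative_eq_intros)
  then have "times_differentiable_on m S (\<lambda>x. deriv_field S (\<lambda>x. c) x u)" for u
    using Suc.IH[of 0] by (subst times_differentiable_on_cong[where g = "\<lambda>_. 0"]) auto
  then show ?case by (simp add: times_differentiable_on_Suc)
qed simp

lemma times_differentiable_on_add:
  assumes "times_differentiable_on m S f" "times_differentiable_on m S g"
  shows "times_differentiable_on m S (\<lambda>x. f x + g x)"
  using assms
proof (induction m arbitrary: f g)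
  case (Suc m)
  note f = Suc.prems(1)[unfolded times_differentiable_on_Suc] and g = Suc.prems(2)[unfolded times_differentiable_on_Suc]
  have D: "(\<lambda>x. f x + g x) differentiable_on S" using f g by (intro differentiable_on_add) auto
  have "deriv_field S (\<lambda>x. f x + g x) x = (\<lambda>u. deriv_field S f x u + deriv_field S g x u)" if "x \<in> S" for x
    using f g that by (intro deriv_field_unique[OF S D that] has_derivative_add deriv_field_works) auto
  then have "times_differentiable_on m S (\<lambda>x. deriv_field S (\<lambda>x. f x + g x) x u)" if "u \<in> Basis" for u
    using f g that
    by (subst times_differentiable_on_cong[where g = "\<lambda>x. deriv_field S f x u + deriv_field S g x u"]) (auto intro!: Suc.IH)
  then show ?case using D by (simp add: times_differentiable_on_Suc)
qed simp

lemma times_differentiable_on_bilinear: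
  assumes b: "bounded_bilinear pr"
    and "times_differentiable_on m S f" "times_differentiable_on m S g"
  shows "times_differentiable_on m S (\<lambda>x. pr (f x) (g x))"
  using assms(2,3)
proof (induction m arbitrary: f g)
  case (Suc m)
  note f = Suc.prems(1)[unfolded times_differentiable_on_Suc] and g = Suc.prems(2)[unfolded times_differentiable_on_Suc]
  have H: "((\<lambda>x. pr (f x) (g x)) has_derivative (\<lambda>u. pr (f x) (deriv_field S g x u) + pr (deriv_field S f x u) (g x))) (at x within S)" if "x \<in> S" for x
    using f g that by (intro bounded_bilinear.FDERIV[OF b] deriv_field_works) auto
  then have D: "(\<lambda>x. pr (f x) (g x)) differentiable_on S"
    unfolding differentiable_on_def differentiable_def by blast
  have "deriv_field S (\<lambda>x. pr (f x) (g x)) x = (\<lambda>u. pr (f x) (deriv_field S g x u) + pr (deriv_field S f x u) (g x))" if "x \<in> S" for x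
    by (rule deriv_field_unique[OF S D that H[OF that]])
  moreover have "times_differentiable_on m S (\<lambda>x. pr (f x) (deriv_field S g x u) + pr (deriv_field S f x u) (g x))" if "u \<in> Basis" for u
    using f g that times_differentiable_on_le[OF Suc.prems(1), of m] times_differentiable_on_le[OF Suc.prems(2), of m]
    by (intro times_differentiable_on_add Suc.IH) auto
  ultimately have "times_differentiable_on m S (\<lambda>x. deriv_field S (\<lambda>x. pr (f x) (g x)) x u)" if "u \<in> Basis" for u
    using that
    by (subst times_differentiable_on_cong[where g = "\<lambda>x. pr (f x) (deriv_field S g x u) + pr (deriv_field S f x u) (g x)"]) auto
  then show ?case using D by (simp add: times_differentiable_on_Suc)
qed simp

end

text \<open>For fixed arguments \<open>a\<close> and \<open>b\<close> the kernel values are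
  constants, and \<open>stein_h\<close> is a bilinear expression in the two scores plus linear and
  constant terms.\<close>

lemma times_differentiable_on_stein_h:
  fixes \<Theta> :: "(real ^ 'p) set"
  assumes S: "convex \<Theta>" "interior \<Theta> \<noteq> {}"
    and a: "times_differentiable_on m \<Theta> (\<lambda>t. score \<X> (p t) a)" and b: "times_differentiable_on m \<Theta> (\<lambda>t. score \<X> (p t) b)"
  shows "times_differentiable_on m \<Theta> (\<lambda>t. stein_h \<X> k (p t) a b)"
proof -
  note c = times_differentiable_on_const[OF S]
  show ?thesis
    unfolding stein_h_def
    by (intro times_differentiable_on_add[OF S] times_differentiable_on_bilinear[OF S bounded_bilinear_inner]
        times_differentiable_on_bilinear[OF S bounded_bilinear_scaleR] a b c)
qed

definition deriv_bound :: "nat \<Rightarrow> (real ^ 'p) set \<Rightarrow> (real ^ 'p \<Rightarrow> real) \<Rightarrow> real \<Rightarrow> bool" where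
  "deriv_bound m S f B \<longleftrightarrow> (\<forall>us\<in>dirs m. \<forall>t\<in>S. \<bar>partials S us f t\<bar> \<le> B)"

lemma axis_Basis: "axis i (1::real) \<in> (Basis :: (real ^ 'p) set)"
  by (simp add: axis_in_Basis_iff)

lemma linear_le_sum_components:
  fixes L :: "real ^ 'p \<Rightarrow> real"
  assumes L: "linear L" and B: "\<And>i. \<bar>L (axis i 1)\<bar> \<le> B"
  shows "\<bar>L v\<bar> \<le> real CARD('p) * B * norm v"
proof -
  have "L v = (\<Sum>i\<in>UNIV. v $ i * L (axis i 1))"
    by (subst basis_expansion[of v, symmetric]) (simp add: linear_sum[OF L] linear_cmul[OF L] scalar_mult_eq_scaleR)
  then have "\<bar>L v\<bar> \<le> (\<Sum>i\<in>UNIV. \<bar>v $ i\<bar> * \<bar>L (axis i 1)\<bar>)"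
    using sum_abs[of "\<lambda>i. v $ i * L (axis i 1)" UNIV] by (simp add: abs_mult)
  also have "\<dots> \<le> (\<Sum>i\<in>(UNIV::'p set). norm v * B)"
    by (intro sum_mono mult_mono B component_le_norm_cart) auto
  finally show ?thesis by (simp add: mult_ac)
qed

lemma mean_value_bound:
  fixes f :: "real ^ 'p \<Rightarrow> real"
  assumes S: "convex S" "t \<in> S" "u \<in> S"
    and f: "\<And>x. x \<in> S \<Longrightarrow> (f has_derivative D x) (at x within S)"
    and B: "\<And>x i. x \<in> S \<Longrightarrow> \<bar>D x (axis i 1)\<bar> \<le> B"
  shows "\<bar>f u - f t\<bar> \<le> real CARD('p) * B * norm (u - t)"
proof -
  have "norm (f u - f t) \<le> real CARD('p) * B * norm (u - t)"
  proof (rule differentiable_bound[OF S(1) f _ S(3,2)])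
    fix x assume x: "x \<in> S"
    have "linear (D x)" using has_derivative_linear[OF f[OF x]] .
    then show "onorm (D x) \<le> real CARD('p) * B"
      unfolding real_norm_def by (intro onorm_le) (simp, rule linear_le_sum_components, simp, rule B[OF x])
  qed
  then show ?thesis by simp
qed

section \<open>Lipschitz and Taylor bounds on a convex set\<close>

context
  fixes \<Theta> :: "(real ^ 'p) set" and f :: "real ^ 'p \<Rightarrow> real"
  assumes S: "convex \<Theta>"
begin

lemma partials_has_derivative:
  assumes "times_differentiable_on m \<Theta> f" "us \<in> dirs l" "l < m" "t \<in> \<Theta>"
  shows "(partials \<Theta> us f has_derivative (\<lambda>v. \<Sum>i\<in>UNIV. v $ i * partials \<Theta> (axis i 1 # us) f t)) (at t within \<Theta>)"
proof -
  have D: "partials \<Theta> us f differentiable_on \<Theta>" using assms by (auto simp: times_differentiable_on_def)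
  note H = deriv_field_works[OF this assms(4)]
  have L: "linear (deriv_field \<Theta> (partials \<Theta> us f) t)" by (rule has_derivative_linear[OF H])
  have eq: "deriv_field \<Theta> (partials \<Theta> us f) t = (\<lambda>v. \<Sum>i\<in>UNIV. v $ i * partials \<Theta> (axis i 1 # us) f t)"
  proof
    fix v show "deriv_field \<Theta> (partials \<Theta> us f) t v = (\<Sum>i\<in>UNIV. v $ i * partials \<Theta> (axis i 1 # us) f t)"
      by (subst (1) basis_expansion[of v, symmetric]) (simp add: linear_sum[OF L] linear_cmul[OF L] scalar_mult_eq_scaleR)
  qed
  show ?thesis using H unfolding eq .
qed

lemma sum_axis: "(\<Sum>k\<in>UNIV. (axis i 1 :: real ^ 'p) $ k * c k) = c i"
proof -
  have "(axis i 1 :: real ^ 'p) $ k * c k = (if k = i then c k else 0)" for k by (simp add: axis_def)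
  then show ?thesis by simp
qed

lemma partials_Lipschitz:
  assumes "times_differentiable_on m \<Theta> f" "us \<in> dirs l" "l < m" "t \<in> \<Theta>" "u \<in> \<Theta>"
    and B: "deriv_bound (Suc l) \<Theta> f B"
  shows "\<bar>partials \<Theta> us f u - partials \<Theta> us f t\<bar> \<le> real CARD('p) * B * norm (u - t)"
proof (rule mean_value_bound[OF S assms(4,5) partials_has_derivative[OF assms(1-3)]])
  fix x i assume x: "x \<in> \<Theta>"
  have "axis i 1 # us \<in> dirs (Suc l)" using assms(2) by (auto simp: dirs_Suc axis_Basis)
  then show "\<bar>\<Sum>k\<in>UNIV. axis i 1 $ k * partials \<Theta> (axis k 1 # us) f x\<bar> \<le> B"
    unfolding sum_axis using B x by (auto simp: deriv_bound_def)
qed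

text \<open>
  The second-order coefficients are taken at a third point: this leaves only one matrix of second derivatives in the expansion.
\<close>

lemma partials_Taylor:
  assumes "times_differentiable_on m \<Theta> f" "us \<in> dirs l" "Suc l < m" "t \<in> \<Theta>" "u \<in> \<Theta>" "t0 \<in> \<Theta>"
    and B: "deriv_bound (Suc (Suc l)) \<Theta> f B"
  shows "\<bar>partials \<Theta> us f u - partials \<Theta> us f t - (\<Sum>k\<in>UNIV. (u - t) $ k * partials \<Theta> (axis k 1 # us) f t0)\<bar>
      \<le> real CARD('p) ^ 2 * norm (u - t) * (norm (u - t) + norm (t - t0)) * B"
proof -
  let ?e = "\<lambda>k. partials \<Theta> (axis k 1 # us) f t0" and ?\<rho> = "norm (u - t) + norm (t - t0)"
  \<comment> \<open>After subtraction of a linear function with coefficients from \<open>t0\<close>,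
    the partial derivatives of \<open>g\<close> are differences between \<open>x\<close> and
    \<open>t0\<close>, which the next order controls.\<close>
  define g where "g x = partials \<Theta> us f x - (\<Sum>k\<in>UNIV. x $ k * ?e k)" for x
  let ?T = "closed_segment t u"
  have T: "?T \<subseteq> \<Theta>" by (intro closed_segment_subset S assms)
  have "\<bar>g u - g t\<bar> \<le> real CARD('p) * (real CARD('p) * B * ?\<rho>) * norm (u - t)"
  proof (rule mean_value_bound)
    show "convex ?T" "t \<in> ?T" "u \<in> ?T" by auto
    fix x assume x: "x \<in> ?T"
    then have x': "x \<in> \<Theta>" using T by auto
    have "((\<lambda>x. \<Sum>k\<in>UNIV. x $ k * ?e k) has_derivative (\<lambda>v. \<Sum>k\<in>UNIV. v $ k * ?e k)) (at x within ?T)"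
      by (intro has_derivative_sum has_derivative_mult_left bounded_linear_imp_has_derivative bounded_linear_vec_nth)
    then show "(g has_derivative (\<lambda>v. (\<Sum>i\<in>UNIV. v $ i * partials \<Theta> (axis i 1 # us) f x) - (\<Sum>k\<in>UNIV. v $ k * ?e k))) (at x within ?T)"
      unfolding g_def using has_derivative_subset[OF partials_has_derivative[OF assms(1,2) _ x'] T] assms(3)
      by (intro has_derivative_diff) auto
    fix i
    have us: "axis i 1 # us \<in> dirs (Suc l)" using assms(2) by (auto simp: dirs_Suc axis_Basis)
    have B0: "0 \<le> B"
    proof -
      have "(axis i 1 :: real ^ 'p) # axis i 1 # us \<in> dirs (Suc (Suc l))" using assms(2) by (auto simp: dirs_Suc axis_Basis)
      then have "\<bar>partials \<Theta> (axis i 1 # axis i 1 # us) f t\<bar> \<le> B" using B assms(4) unfolding deriv_bound_def by blast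
      then show ?thesis by linarith
    qed
    have "norm (x - t0) \<le> ?\<rho>"
      using norm_triangle_ineq[of "x - t" "t - t0"] segment_bound(1)[OF x] by (simp add: norm_minus_commute)
    then have "real CARD('p) * B * norm (x - t0) \<le> real CARD('p) * B * ?\<rho>" using B0 by (intro mult_left_mono) auto
    then show "\<bar>(\<Sum>k\<in>UNIV. axis i 1 $ k * partials \<Theta> (axis k 1 # us) f x) - (\<Sum>k\<in>UNIV. axis i 1 $ k * ?e k)\<bar> \<le> real CARD('p) * B * ?\<rho>"
      unfolding sum_axis using partials_Lipschitz[OF assms(1) us assms(3,6) x' B] by linarith
  qed
  moreover have "g u - g t = partials \<Theta> us f u - partials \<Theta> us f t - (\<Sum>k\<in>UNIV. (u - t) $ k * ?e k)"
    by (simp add: g_def left_diff_distrib sum_subtractf)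
  ultimately show ?thesis by (simp add: power2_eq_square mult_ac)
qed

text \<open>
  Expanding along the segment avoids the symmetry of second derivatives.
\<close>

lemma second_order_Taylor:
  assumes "times_differentiable_on m \<Theta> f" "3 \<le> m" "t \<in> \<Theta>" "u \<in> \<Theta>" "t0 \<in> \<Theta>"
    and B: "deriv_bound 3 \<Theta> f B"
  shows "\<bar>f u - f t - (\<Sum>l\<in>UNIV. (u - t) $ l * partials \<Theta> [axis l 1] f t)
      - (\<Sum>k\<in>UNIV. \<Sum>l\<in>UNIV. (u - t) $ k * (u - t) $ l / 2 * partials \<Theta> [axis k 1, axis l 1] f t0)\<bar>
      \<le> real CARD('p) ^ 3 * (norm (u - t))\<^sup>2 * (norm (u - t) + norm (t - t0)) * B"
proof -
  let ?\<delta> = "u - t" and ?\<rho> = "norm (u - t) + norm (t - t0)"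
  let ?d = "\<lambda>l. partials \<Theta> [axis l 1] f" and ?e = "\<lambda>k l. partials \<Theta> [axis k 1, axis l 1] f t0"
  let ?a = "\<Sum>l\<in>UNIV. ?\<delta> $ l * ?d l t" and ?b = "\<Sum>k\<in>UNIV. \<Sum>l\<in>UNIV. ?\<delta> $ k * ?\<delta> $ l * ?e k l"
  \<comment> \<open>The remainder as a function of one variable. Its derivative \<open>G'\<close> is
    a sum over components of first order Taylor remainders of the gradient, whence one more factor
    \<open>CARD('p)\<close>.\<close>
  define G where "G s = f (t + s *\<^sub>R ?\<delta>) - s * ?a - s\<^sup>2 / 2 * ?b" for s :: real
  define G' where "G' s = (\<Sum>l\<in>UNIV. ?\<delta> $ l * ?d l (t + s *\<^sub>R ?\<delta>)) - ?a - s * ?b" for s :: real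
  have seg: "t + s *\<^sub>R ?\<delta> \<in> \<Theta>" if "s \<in> {0..1}" for s
  proof -
    have "(1 - s) *\<^sub>R t + s *\<^sub>R u \<in> \<Theta>" using S assms(3,4) that by (intro convexD) auto
    then show ?thesis by (simp add: algebra_simps)
  qed
  have D: "(G has_derivative (\<lambda>h. h * G' s)) (at s within {0..1})" if s: "s \<in> {0..1}" for s
  proof -
    have c: "((\<lambda>s::real. t + s *\<^sub>R ?\<delta>) has_derivative (\<lambda>h. h *\<^sub>R ?\<delta>)) (at s within {0..1})"
      by (auto intro!: derivative_eq_intros)
    have "(f has_derivative (\<lambda>v. \<Sum>i\<in>UNIV. v $ i * ?d i (t + s *\<^sub>R ?\<delta>))) (at (t + s *\<^sub>R ?\<delta>) within \<Theta>)"
      using partials_has_derivative[OF assms(1), of "[]" 0 "t + s *\<^sub>R ?\<delta>"] assms(2) seg[OF s] by simp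
    then have "(f has_derivative (\<lambda>v. \<Sum>i\<in>UNIV. v $ i * ?d i (t + s *\<^sub>R ?\<delta>))) (at (t + s *\<^sub>R ?\<delta>) within (\<lambda>s. t + s *\<^sub>R ?\<delta>) ` {0..1})"
      by (rule has_derivative_subset) (use seg in auto)
    from has_derivative_in_compose[OF c this]
    have 1: "((\<lambda>s. f (t + s *\<^sub>R ?\<delta>)) has_derivative (\<lambda>h. h * (\<Sum>i\<in>UNIV. ?\<delta> $ i * ?d i (t + s *\<^sub>R ?\<delta>)))) (at s within {0..1})"
      by (simp add: sum_distrib_left mult.assoc del: partials.simps)
    have 2: "((\<lambda>s. s * ?a + s\<^sup>2 / 2 * ?b) has_derivative (\<lambda>h. h * (?a + s * ?b))) (at s within {0..1})"
    proof -
      have "((\<lambda>s. s * a + s\<^sup>2 / 2 * b) has_derivative (\<lambda>h. h * (a + s * b))) (at s within {0..1})" for a b :: real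
        by (auto intro!: derivative_eq_intros simp: algebra_simps)
      then show ?thesis .
    qed
    show ?thesis using has_derivative_diff[OF 1 2] unfolding G_def[abs_def] G'_def by (simp only: diff_diff_eq right_diff_distrib)
  qed
  have bd: "\<bar>G' s\<bar> \<le> real CARD('p) ^ 3 * (norm ?\<delta>)\<^sup>2 * ?\<rho> * B" if s: "s \<in> {0..1}" for s
  proof -
    have B0: "0 \<le> B"
    proof -
      have "[axis undefined 1, axis undefined 1, axis undefined 1] \<in> (dirs 3 :: (real ^ 'p) list set)" by (auto simp: dirs_def axis_Basis)
      then have "\<bar>partials \<Theta> [axis undefined 1, axis undefined 1, axis undefined 1] f t\<bar> \<le> B" using B assms(3) unfolding deriv_bound_def by blast
      then show ?thesis by linarith
    qed
    have T: "\<bar>?d l (t + s *\<^sub>R ?\<delta>) - ?d l t - (\<Sum>k\<in>UNIV. (s *\<^sub>R ?\<delta>) $ k * ?e k l)\<bar> \<le> real CARD('p) ^ 2 * norm ?\<delta> * ?\<rho> * B" for l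
    proof -
      have "[axis l 1] \<in> (dirs 1 :: (real ^ 'p) list set)" by (auto simp: dirs_def axis_Basis)
      from partials_Taylor[OF assms(1) this _ assms(3) seg[OF s] assms(5), of B] assms(2) B
      have "\<bar>?d l (t + s *\<^sub>R ?\<delta>) - ?d l t - (\<Sum>k\<in>UNIV. (s *\<^sub>R ?\<delta>) $ k * ?e k l)\<bar>
        \<le> real CARD('p) ^ 2 * norm (s *\<^sub>R ?\<delta>) * (norm (s *\<^sub>R ?\<delta>) + norm (t - t0)) * B" by (simp add: numeral_3_eq_3 del: partials.simps)
      also have "\<dots> \<le> real CARD('p) ^ 2 * norm ?\<delta> * ?\<rho> * B"
        using s B0 by (intro mult_right_mono mult_mono add_right_mono) (auto simp: mult_left_le_one_le)
      finally show ?thesis .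
    qed
    have "G' s = (\<Sum>l\<in>UNIV. ?\<delta> $ l * (?d l (t + s *\<^sub>R ?\<delta>) - ?d l t - (\<Sum>k\<in>UNIV. (s *\<^sub>R ?\<delta>) $ k * ?e k l)))"
    proof -
      have "s * ?b = (\<Sum>l\<in>UNIV. ?\<delta> $ l * (\<Sum>k\<in>UNIV. (s *\<^sub>R ?\<delta>) $ k * ?e k l))"
        unfolding sum_distrib_left by (subst sum.swap) (simp add: algebra_simps del: partials.simps)
      then show ?thesis unfolding G'_def right_diff_distrib sum_subtractf by simp
    qed
    then have "\<bar>G' s\<bar> \<le> (\<Sum>l\<in>UNIV. \<bar>?\<delta> $ l\<bar> * \<bar>?d l (t + s *\<^sub>R ?\<delta>) - ?d l t - (\<Sum>k\<in>UNIV. (s *\<^sub>R ?\<delta>) $ k * ?e k l)\<bar>)"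
      by (simp only: abs_mult[symmetric] sum_abs)
    also have "\<dots> \<le> (\<Sum>l\<in>(UNIV::'p set). norm ?\<delta> * (real CARD('p) ^ 2 * norm ?\<delta> * ?\<rho> * B))"
      by (intro sum_mono mult_mono T component_le_norm_cart) auto
    also have "\<dots> = real CARD('p) ^ 3 * (norm ?\<delta>)\<^sup>2 * ?\<rho> * B" by (simp add: power2_eq_square power3_eq_cube)
    finally show ?thesis .
  qed
  have "norm (G 1 - G 0) \<le> real CARD('p) ^ 3 * (norm ?\<delta>)\<^sup>2 * ?\<rho> * B * norm (1 - 0 :: real)"
  proof (rule differentiable_bound[OF _ D])
    fix s :: real assume "s \<in> {0..1}"
    note b = bd[OF this]
    show "onorm (\<lambda>h. h * G' s) \<le> real CARD('p) ^ 3 * (norm ?\<delta>)\<^sup>2 * ?\<rho> * B"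
    proof (rule onorm_le)
      fix h :: real
      show "norm (h * G' s) \<le> real CARD('p) ^ 3 * (norm ?\<delta>)\<^sup>2 * ?\<rho> * B * norm h"
        using mult_right_mono[OF b, of "\<bar>h\<bar>"] by (simp only: real_norm_def abs_mult mult.commute[of "\<bar>h\<bar>"] abs_ge_zero)
    qed
  qed auto
  moreover have "G 1 - G 0 = f u - f t - ?a - (\<Sum>k\<in>UNIV. \<Sum>l\<in>UNIV. ?\<delta> $ k * ?\<delta> $ l / 2 * ?e k l)"
  proof -
    have "(\<Sum>k\<in>UNIV. \<Sum>l\<in>UNIV. ?\<delta> $ k * ?\<delta> $ l / 2 * ?e k l) = 1 / 2 * ?b"
      unfolding sum_distrib_left by (intro sum.cong refl) (simp del: partials.simps)
    then show ?thesis by (simp add: G_def del: partials.simps)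
  qed
  ultimately show ?thesis by (simp del: partials.simps)
qed

end

section \<open>Differentiation under the integral\<close>

text \<open>The quotient of the derivative of \<open>p\<close> by \<open>p\<close> is a continuous
  derivative of the logarithm, so the derivative chosen by \<open>deriv_field\<close> is continuous
  too.\<close>

lemma continuous_score:
  fixes p :: "real ^ 'd \<Rightarrow> real"
  assumes "C_on 1 \<X> p" "\<And>x. x \<in> \<X> \<Longrightarrow> 0 < p x"
  shows "continuous_on \<X> (score \<X> p)"
proof -
  have d: "p differentiable_on \<X>" and c: "\<And>u. u \<in> Basis \<Longrightarrow> continuous_on \<X> (\<lambda>x. deriv_field \<X> p x u)"
  proof -
    have "times_differentiable_on (Suc 0) \<X> p" using assms(1) by (simp add: C_on_def)
    then show "p differentiable_on \<X>" by (simp add: times_differentiable_on_Suc)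
    fix u :: "real ^ 'd" assume "u \<in> Basis"
    then have "[u] \<in> dirs 1" by (simp add: dirs_def)
    then have "continuous_on \<X> (partials \<X> [u] p)" using assms(1) by (auto simp: C_on_def simp del: partials.simps)
    then show "continuous_on \<X> (\<lambda>x. deriv_field \<X> p x u)" by simp
  qed
  have D: "(p has_derivative deriv_field \<X> p x) (at x within \<X>)" if "x \<in> \<X>" for x
    by (rule deriv_field_works[OF d that])
  define L where "L x u = deriv_field \<X> p x u / p x" for x u
  have "is_deriv_field \<X> (\<lambda>x. ln (p x)) L"
    unfolding is_deriv_field_def
  proof
    fix x assume x: "x \<in> \<X>"
    have "((\<lambda>x. ln (p x)) has_derivative (\<lambda>u. inverse (p x) * deriv_field \<X> p x u)) (at x within \<X>)"
      by (rule has_derivative_eq_rhs[OF has_derivative_ln[OF assms(2)[OF x] D[OF x]]]) (simp add: fun_eq_iff)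
    then show "((\<lambda>x. ln (p x)) has_derivative L x) (at x within \<X>)"
      by (simp add: L_def[abs_def] divide_inverse mult.commute)
  qed
  moreover have "continuous_field \<X> L"
    unfolding continuous_field_def
  proof
    fix u
    have nz: "\<forall>x\<in>\<X>. p x \<noteq> 0"
    proof
      fix x assume "x \<in> \<X>"
      from assms(2)[OF this] show "p x \<noteq> 0" by simp
    qed
    have pc: "continuous_on \<X> p" by (rule differentiable_imp_continuous_on[OF d])
    have "deriv_field \<X> p x u = (\<Sum>b\<in>Basis. (u \<bullet> b) * deriv_field \<X> p x b)" if "x \<in> \<X>" for x
      by (subst (1) euclidean_representation[of u, symmetric])
        (simp add: linear_sum[OF has_derivative_linear[OF D[OF that]]] linear_cmul[OF has_derivative_linear[OF D[OF that]]])
    then have "L x u = (\<Sum>b\<in>Basis. (u \<bullet> b) * deriv_field \<X> p x b) / p x" if "x \<in> \<X>" for x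
      using that by (simp add: L_def)
    moreover have "continuous_on \<X> (\<lambda>x. (\<Sum>b\<in>Basis. (u \<bullet> b) * deriv_field \<X> p x b) / p x)"
      by (intro continuous_on_divide continuous_on_sum continuous_on_mult continuous_on_const c pc nz)
    ultimately show "continuous_on \<X> (\<lambda>x. L x u)" by (subst continuous_on_cong[OF refl]) auto
  qed
  ultimately have "continuous_on \<X> (\<lambda>x. deriv_field \<X> (\<lambda>x. ln (p x)) x u)" for u by (rule continuous_deriv_field)
  then show ?thesis
    unfolding score_def grad_def by (auto intro!: continuous_intros)
qed

lemma continuous_stein_h:
  fixes p :: "real ^ 'd \<Rightarrow> real"
  assumes p: "C_on 1 \<X> p" "\<And>x. x \<in> \<X> \<Longrightarrow> 0 < p x" and k: "C_on 2 (\<X> \<times> \<X>) (case_prod k)"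
  shows "continuous_on (\<X> \<times> \<X>) (\<lambda>z. stein_h \<X> k p (fst z) (snd z))"
proof -
  note s = continuous_score[OF p]
  have s1: "continuous_on (\<X> \<times> \<X>) (\<lambda>z. score \<X> p (fst z))" "continuous_on (\<X> \<times> \<X>) (\<lambda>z. score \<X> p (snd z))"
    by (auto intro!: continuous_on_compose2[OF s] continuous_intros)
  have kd: "partials (\<X> \<times> \<X>) us (case_prod k) differentiable_on (\<X> \<times> \<X>)" if "l < 2" "us \<in> dirs l" for us l
    using k that unfolding C_on_def times_differentiable_on_def by blast
  have k0: "continuous_on (\<X> \<times> \<X>) (\<lambda>z. k (fst z) (snd z))"
    using differentiable_imp_continuous_on[OF kd[of 0 "[]"]] by (simp add: case_prod_unfold)
  have B: "(0, axis i 1) \<in> (Basis :: ((real ^ 'd) \<times> (real ^ 'd)) set)" "(axis i 1, 0) \<in> (Basis :: ((real ^ 'd) \<times> (real ^ 'd)) set)" for i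
    by (auto simp: Basis_prod_def axis_Basis)
  have k1: "continuous_on (\<X> \<times> \<X>) (partials (\<X> \<times> \<X>) [(0, axis i 1)] (case_prod k))"
      "continuous_on (\<X> \<times> \<X>) (partials (\<X> \<times> \<X>) [(axis i 1, 0)] (case_prod k))" for i
    using B by (auto intro!: differentiable_imp_continuous_on kd[of 1] simp: dirs_def simp del: partials.simps)
  have k2: "continuous_on (\<X> \<times> \<X>) (partials (\<X> \<times> \<X>) [(axis i 1, 0), (0, axis i 1)] (case_prod k))" for i
    using k B by (auto simp: C_on_def dirs_def simp del: partials.simps)
  show ?thesis
    unfolding stein_h_def prod.collapse
    by (intro continuous_on_add continuous_on_inner continuous_on_scaleR continuous_on_sum continuous_on_vec_lambda s1 k0 k1 k2)
qed

lemma measurable_stein_h: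
  fixes p :: "real ^ 'd \<Rightarrow> real"
  assumes X: "\<X> \<in> sets borel" and Q: "sets Q = sets (restrict_space borel \<X>)"
    and p: "C_on 1 \<X> p" "\<And>x. x \<in> \<X> \<Longrightarrow> 0 < p x" and k: "C_on 2 (\<X> \<times> \<X>) (case_prod k)"
  shows "(\<lambda>z. stein_h \<X> k p (fst z) (snd z)) \<in> borel_measurable (Q \<Otimes>\<^sub>M Q)"
proof -
  let ?g = "\<lambda>z. stein_h \<X> k p (fst z) (snd z)"
  have XX: "\<X> \<times> \<X> \<in> sets (borel :: ((real ^ 'd) \<times> (real ^ 'd)) measure)"
    using X unfolding borel_prod[symmetric] by auto
  have "?g \<in> borel_measurable (restrict_space borel (\<X> \<times> \<X>))"
    by (rule borel_measurable_continuous_on_restrict[OF continuous_stein_h[OF p k]])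
  \<comment> \<open>Extended by 0, since \<open>Q\<close> lives on the subspace and Borel sets of
    pairs are at hand in the ambient space.\<close>
  then have g: "(\<lambda>z. if z \<in> \<X> \<times> \<X> then ?g z else 0) \<in> borel_measurable (borel \<Otimes>\<^sub>M borel)"
    unfolding borel_prod using XX by (subst measurable_restrict_space_iff[symmetric]) auto
  have spQ: "space Q = \<X>" using sets_eq_imp_space_eq[OF Q] by (simp add: space_restrict_space)
  have i: "(\<lambda>x. x) \<in> measurable Q borel"
    unfolding measurable_cong_sets[OF Q refl] by (rule measurable_restrict_space1) simp
  have "(\<lambda>z. (fst z, snd z)) \<in> measurable (Q \<Otimes>\<^sub>M Q) (borel \<Otimes>\<^sub>M borel)"
    by (intro measurable_Pair measurable_compose[OF measurable_fst i] measurable_compose[OF measurable_snd i])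
  from measurable_compose[OF this g]
  show ?thesis by (rule measurable_cong[THEN iffD1, rotated]) (auto simp: space_pair_measure spQ)
qed

lemma has_derivative_of_quadratic_bound:
  fixes K :: "'a::real_normed_vector \<Rightarrow> real"
  assumes t: "t \<in> interior S" and L: "bounded_linear L"
    and q: "\<And>u. u \<in> S \<Longrightarrow> \<bar>K u - K t - L (u - t)\<bar> \<le> B * (norm (u - t))\<^sup>2"
  shows "(K has_derivative L) (at t)"
  unfolding has_derivative_iff_norm
proof (intro conjI L, rule tendsto_sandwich)
  show "\<forall>\<^sub>F u in at t. 0 \<le> norm (K u - K t - L (u - t)) / norm (u - t)" by simp
  have "\<forall>\<^sub>F u in at t. u \<in> interior S" using t by (intro eventually_at_topological[THEN iffD2]) auto
  then show "\<forall>\<^sub>F u in at t. norm (K u - K t - L (u - t)) / norm (u - t) \<le> B * norm (u - t)"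
    using eventually_neq_at_within[of t t UNIV]
  proof eventually_elim
    case (elim u)
    then have "u \<in> S" using interior_subset by auto
    from q[OF this] elim show ?case by (simp add: divide_le_eq power2_eq_square mult.assoc)
  qed
  have "((\<lambda>u. B * norm (u - t)) \<longlongrightarrow> B * norm (t - t)) (at t)" by (intro tendsto_intros)
  then show "((\<lambda>u. B * norm (u - t)) \<longlongrightarrow> 0) (at t)" by simp
qed simp

text \<open>Domination reaches order 3 because the integral is differentiated through a quadratic
  Taylor bound, which uses one order more than the derivative obtained.\<close>

locale smooth_family =
  fixes \<Theta> :: "(real ^ 'p) set" and Z :: "'z measure" and f :: "real ^ 'p \<Rightarrow> 'z \<Rightarrow> real" and B :: "nat \<Rightarrow> 'z \<Rightarrow> real"
  assumes S: "convex \<Theta>" "interior \<Theta> \<noteq> {}"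
    and smooth: "\<And>z. z \<in> space Z \<Longrightarrow> times_differentiable_on 3 \<Theta> (\<lambda>t. f t z)"
    and meas: "\<And>t. t \<in> \<Theta> \<Longrightarrow> f t \<in> borel_measurable Z"
    and intB: "\<And>m. m \<le> 3 \<Longrightarrow> integrable Z (B m)"
    and bound: "\<And>m. m \<le> 3 \<Longrightarrow> AE z in Z. deriv_bound m \<Theta> (\<lambda>t. f t z) (B m z)"
begin

abbreviation "pd us t z \<equiv> partials \<Theta> us (\<lambda>t. f t z) t"

text \<open>A partial derivative is the pointwise limit of difference quotients along a sequence of
  increments that stays inside a ball in \<open>\<Theta>\<close>.\<close>

lemma measurable_pd_step:
  assumes us: "us \<in> dirs l" "l < 3" and t: "t \<in> interior \<Theta>"
    and m: "\<And>t. t \<in> interior \<Theta> \<Longrightarrow> pd us t \<in> borel_measurable Z"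
  shows "pd (axis i 1 # us) t \<in> borel_measurable Z"
proof -
  obtain r where r: "0 < r" "ball t r \<subseteq> \<Theta>" using t by (auto simp: mem_interior)
  define s where "s n = r / 2 / real (Suc n)" for n
  have s: "0 < s n" "s n < r" for n
  proof -
    have "s n \<le> r / 2 / 1" unfolding s_def using r by (intro divide_left_mono) auto
    then show "s n < r" using r by linarith
    show "0 < s n" using r by (simp add: s_def)
  qed
  have int: "t + s n *\<^sub>R axis i 1 \<in> interior \<Theta>" for n
  proof -
    have "t + s n *\<^sub>R axis i 1 \<in> ball t r" using s[of n] by (simp add: dist_norm norm_axis_1)
    then show ?thesis using interior_maximal[OF r(2) open_ball] by auto
  qed
  have s0: "s \<longlonglongrightarrow> 0"
    unfolding s_def using LIMSEQ_Suc[OF lim_const_over_n[of "r / 2"]] by simp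
  show ?thesis
  proof (rule borel_measurable_LIMSEQ_real)
    fix n show "(\<lambda>z. (pd us (t + s n *\<^sub>R axis i 1) z - pd us t z) / s n) \<in> borel_measurable Z"
      using m[OF int[of n]] m[OF t] by measurable
  next
    fix z assume z: "z \<in> space Z"
    have t': "t \<in> \<Theta>" using t interior_subset by auto
    have c: "((\<lambda>x::real. t + x *\<^sub>R axis i 1) has_derivative (\<lambda>h. h *\<^sub>R axis i 1)) (at 0)"
      by (auto intro!: derivative_eq_intros)
    have "(partials \<Theta> us (\<lambda>t. f t z) has_derivative (\<lambda>v. \<Sum>k\<in>UNIV. v $ k * pd (axis k 1 # us) t z)) (at (t + 0 *\<^sub>R axis i 1))"
      using partials_has_derivative[OF S(1) smooth[OF z] us t'] by (simp add: at_within_interior[OF t])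
    from has_derivative_compose[OF c this]
    have "((\<lambda>x. pd us (t + x *\<^sub>R axis i 1) z) has_derivative (\<lambda>h. h * pd (axis i 1 # us) t z)) (at 0)"
      by (simp add: sum_axis[OF S(1)] mult.assoc sum_distrib_left[symmetric] del: partials.simps)
    then have "((\<lambda>x. pd us (t + x *\<^sub>R axis i 1) z) has_field_derivative pd (axis i 1 # us) t z) (at 0)"
      by (simp add: has_field_derivative_def mult_commute_abs del: partials.simps)
    then have "((\<lambda>h. (pd us (t + h *\<^sub>R axis i 1) z - pd us t z) / h) \<longlongrightarrow> pd (axis i 1 # us) t z) (at 0)"
      by (simp add: DERIV_def del: partials.simps)
    moreover have "filterlim s (at 0) sequentially"
      using s0 s(1) by (intro filterlim_atI) (auto simp: order_less_imp_not_eq2)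
    ultimately show "(\<lambda>n. (pd us (t + s n *\<^sub>R axis i 1) z - pd us t z) / s n) \<longlonglongrightarrow> pd (axis i 1 # us) t z"
      by (rule filterlim_compose)
  qed
qed

lemma measurable_pd0: "t \<in> interior \<Theta> \<Longrightarrow> pd [] t \<in> borel_measurable Z"
  using meas interior_subset by auto

lemma measurable_pd1: "t \<in> interior \<Theta> \<Longrightarrow> pd [axis i 1] t \<in> borel_measurable Z"
  by (rule measurable_pd_step[of "[]" 0]) (auto intro: measurable_pd0 simp del: partials.simps)

lemma measurable_pd2: "t \<in> interior \<Theta> \<Longrightarrow> pd [axis i 1, axis j 1] t \<in> borel_measurable Z"
  by (rule measurable_pd_step[of "[axis j 1]" 1]) (auto intro: measurable_pd1 simp: dirs_def axis_Basis simp del: partials.simps)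

lemma integrable_pd:
  assumes "us \<in> dirs m" "m \<le> 3" "t \<in> \<Theta>" "pd us t \<in> borel_measurable Z"
  shows "integrable Z (pd us t)"
proof (rule Bochner_Integration.integrable_bound[OF intB[OF assms(2)] assms(4)])
  from bound[OF assms(2)] show "AE z in Z. norm (pd us t z) \<le> norm (B m z)"
  proof eventually_elim
    case (elim z)
    then have "\<bar>pd us t z\<bar> \<le> B m z" using assms unfolding deriv_bound_def by blast
    then show ?case by simp
  qed
qed

text \<open>\<open>partials_Taylor\<close> with the third point equal to the base point leaves a
  remainder quadratic in \<open>u - t\<close> times the dominating function two orders up; it is
  then integrated.\<close>

lemma integral_pd_has_derivative:
  assumes us: "us \<in> dirs l" "l \<le> 1" and t: "t \<in> interior \<Theta>"
    and m0: "\<And>t. t \<in> \<Theta> \<Longrightarrow> l = 0 \<Longrightarrow> pd us t \<in> borel_measurable Z"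
    and m: "\<And>t. t \<in> interior \<Theta> \<Longrightarrow> pd us t \<in> borel_measurable Z"
  shows "((\<lambda>t. \<integral>z. pd us t z \<partial>Z) has_derivative (\<lambda>v. \<Sum>i\<in>UNIV. v $ i * (\<integral>z. pd (axis i 1 # us) t z \<partial>Z))) (at t)"
proof (rule has_derivative_of_quadratic_bound)
  let ?C = "real CARD('p) ^ 2"
  show "t \<in> interior (interior \<Theta>)" using t by simp
  show "bounded_linear (\<lambda>v. \<Sum>i\<in>UNIV. v $ i * (\<integral>z. pd (axis i 1 # us) t z \<partial>Z))"
    by (intro bounded_linear_sum bounded_linear_mult_const bounded_linear_vec_nth)
  fix u assume u: "u \<in> interior \<Theta>"
  have tu: "t \<in> \<Theta>" "u \<in> \<Theta>" using t u interior_subset by auto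
  have us1: "axis i 1 # us \<in> dirs (Suc l)" for i using us by (auto simp: dirs_Suc axis_Basis)
  have i1: "integrable Z (pd (axis i 1 # us) t)" for i
    using us by (intro integrable_pd[OF us1 _ tu(1)] measurable_pd_step[OF us(1) _ t m]) auto
  have i0: "integrable Z (pd us u)" "integrable Z (pd us t)"
    using us by (auto intro!: integrable_pd[OF us(1)] tu m t u simp del: partials.simps)
  have eq: "(\<integral>z. pd us u z \<partial>Z) - (\<integral>z. pd us t z \<partial>Z) - (\<Sum>i\<in>UNIV. (u - t) $ i * (\<integral>z. pd (axis i 1 # us) t z \<partial>Z))
    = (\<integral>z. pd us u z - pd us t z - (\<Sum>i\<in>UNIV. (u - t) $ i * pd (axis i 1 # us) t z) \<partial>Z)"
    using i0 i1 by (simp add: Bochner_Integration.integral_diff Bochner_Integration.integral_sum del: partials.simps)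
  have "\<bar>\<integral>z. pd us u z - pd us t z - (\<Sum>i\<in>UNIV. (u - t) $ i * pd (axis i 1 # us) t z) \<partial>Z\<bar>
     \<le> (\<integral>z. \<bar>pd us u z - pd us t z - (\<Sum>i\<in>UNIV. (u - t) $ i * pd (axis i 1 # us) t z)\<bar> \<partial>Z)"
    by (rule integral_abs_bound)
  also have "\<dots> \<le> (\<integral>z. ?C * (norm (u - t))\<^sup>2 * B (Suc (Suc l)) z \<partial>Z)"
  proof (rule integral_mono_AE)
    show "integrable Z (\<lambda>z. \<bar>pd us u z - pd us t z - (\<Sum>i\<in>UNIV. (u - t) $ i * pd (axis i 1 # us) t z)\<bar>)"
      using i0 i1 by (intro integrable_abs Bochner_Integration.integrable_diff Bochner_Integration.integrable_sum integrable_mult_right)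
    show "integrable Z (\<lambda>z. ?C * (norm (u - t))\<^sup>2 * B (Suc (Suc l)) z)" using intB[of "Suc (Suc l)"] us by simp
    have "AE z in Z. deriv_bound (Suc (Suc l)) \<Theta> (\<lambda>t. f t z) (B (Suc (Suc l)) z)" using us by (intro bound) auto
    then show "AE z in Z. \<bar>pd us u z - pd us t z - (\<Sum>i\<in>UNIV. (u - t) $ i * pd (axis i 1 # us) t z)\<bar> \<le> ?C * (norm (u - t))\<^sup>2 * B (Suc (Suc l)) z"
    proof (rule AE_mp, intro AE_I2 impI)
      fix z assume z: "z \<in> space Z" and b: "deriv_bound (Suc (Suc l)) \<Theta> (\<lambda>t. f t z) (B (Suc (Suc l)) z)"
      from partials_Taylor[OF S(1) smooth[OF z] us(1) _ tu tu(1) b] us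
      show "\<bar>pd us u z - pd us t z - (\<Sum>i\<in>UNIV. (u - t) $ i * pd (axis i 1 # us) t z)\<bar> \<le> ?C * (norm (u - t))\<^sup>2 * B (Suc (Suc l)) z"
        by (simp add: power2_eq_square mult_ac del: partials.simps)
    qed
  qed
  also have "\<dots> = ?C * (\<integral>z. B (Suc (Suc l)) z \<partial>Z) * (norm (u - t))\<^sup>2" by simp
  finally show "\<bar>(\<integral>z. pd us u z \<partial>Z) - (\<integral>z. pd us t z \<partial>Z) - (\<Sum>i\<in>UNIV. (u - t) $ i * (\<integral>z. pd (axis i 1 # us) t z \<partial>Z))\<bar>
     \<le> ?C * (\<integral>z. B (Suc (Suc l)) z \<partial>Z) * (norm (u - t))\<^sup>2" unfolding eq .
qed

theorem hessian_integral:
  assumes t: "t \<in> interior \<Theta>"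
  shows "hessian \<Theta> (\<lambda>t. \<integral>z. f t z \<partial>Z) t $ k $ l = (\<integral>z. pd [axis k 1, axis l 1] t z \<partial>Z)"
proof -
  let ?K = "\<lambda>t. \<integral>z. f t z \<partial>Z"
  \<comment> \<open>Needed on the whole interior and not only at \<open>t\<close>, since the result
    is differentiated once more.\<close>
  have 1: "partials \<Theta> [axis l 1] ?K u = (\<integral>z. pd [axis l 1] u z \<partial>Z)" if u: "u \<in> interior \<Theta>" for u
  proof -
    have "(?K has_derivative (\<lambda>v. \<Sum>i\<in>UNIV. v $ i * (\<integral>z. pd [axis i 1] u z \<partial>Z))) (at u)"
      using integral_pd_has_derivative[of "[]" 0 u] u meas measurable_pd0 by simp
    from deriv_field_at_interior[OF u this]
    have "deriv_field \<Theta> ?K u (axis l 1) = (\<Sum>i\<in>UNIV. axis l 1 $ i * (\<integral>z. pd [axis i 1] u z \<partial>Z))" by (rule fun_cong)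
    then show ?thesis unfolding sum_axis[OF S(1)] by simp
  qed
  have us: "[axis l 1] \<in> (dirs 1 :: (real ^ 'p) list set)" by (auto simp: dirs_def axis_Basis)
  have "((\<lambda>t. \<integral>z. pd [axis l 1] t z \<partial>Z) has_derivative (\<lambda>v. \<Sum>i\<in>UNIV. v $ i * (\<integral>z. pd [axis i 1, axis l 1] t z \<partial>Z))) (at t)"
    by (rule integral_pd_has_derivative[OF us _ t]) (auto intro: measurable_pd1 simp del: partials.simps)
  then have "(partials \<Theta> [axis l 1] ?K has_derivative (\<lambda>v. \<Sum>i\<in>UNIV. v $ i * (\<integral>z. pd [axis i 1, axis l 1] t z \<partial>Z))) (at t)"
    by (rule has_derivative_transform_within_open[OF _ open_interior t]) (simp only: 1)
  from deriv_field_at_interior[OF t this]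
  have "partials \<Theta> [axis k 1, axis l 1] ?K t = (\<Sum>i\<in>UNIV. axis k 1 $ i * (\<integral>z. pd [axis i 1, axis l 1] t z \<partial>Z))"
    by (simp only: partials.simps(2)[of _ "axis k 1"])
  then show ?thesis by (simp add: hessian_def sum_axis[OF S(1)] del: partials.simps)
qed

end

section \<open>The parametric Stein kernel\<close>

lemma finite_mean_AE: "finite_mean M f \<Longrightarrow> AE x in M. f x < \<infinity>"
  using nn_integral_PInf_AE[of f M] by (auto simp: finite_mean_def top.not_eq_extremum)

lemma finite_mean_integrable:
  assumes "finite_mean M f" shows "integrable M (\<lambda>x. enn2real (f x))"
proof (rule integrableI_nonneg)
  have "(\<integral>\<^sup>+ x. ennreal (enn2real (f x)) \<partial>M) \<le> (\<integral>\<^sup>+ x. f x \<partial>M)"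
    by (intro nn_integral_mono) (simp add: ennreal_enn2real_if)
  then show "(\<integral>\<^sup>+ x. ennreal (enn2real (f x)) \<partial>M) < \<infinity>" using assms by (auto simp: finite_mean_def)
  have [measurable]: "f \<in> borel_measurable M" using assms by (simp add: finite_mean_def)
  show "(\<lambda>x. enn2real (f x)) \<in> borel_measurable M" by measurable
qed simp

lemma integral_tail_tendsto:
  fixes g s :: "'z \<Rightarrow> real"
  assumes g: "integrable M g" "\<And>z. 0 \<le> g z" and s: "s \<in> borel_measurable M"
  shows "(\<lambda>B. \<integral>z. (if real B < s z then g z else 0) \<partial>M) \<longlonglongrightarrow> 0"
proof -
  have "(\<lambda>B. \<integral>z. (if real B < s z then g z else 0) \<partial>M) \<longlonglongrightarrow> (\<integral>z. 0 \<partial>M)"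
  proof (rule integral_dominated_convergence[where w = g])
    fix B
    show "(\<lambda>z. if real B < s z then g z else 0) \<in> borel_measurable M" using g(1) s by measurable
    show "AE z in M. norm (if real B < s z then g z else 0) \<le> g z" using g(2) by auto
  next
    show "AE z in M. (\<lambda>B. if real B < s z then g z else 0) \<longlonglongrightarrow> 0"
    proof (rule AE_I2, rule tendsto_eventually)
      fix z
      obtain B0 where "s z \<le> real B0" using real_arch_simple by blast
      then show "\<forall>\<^sub>F B in sequentially. (if real B < s z then g z else 0) = 0"
        by (auto simp: eventually_sequentially intro!: exI[of _ B0])
    qed
  qed (use g in auto)
  then show ?thesis by simp
qed

lemma nabla_norm1_ge: "us \<in> dirs m \<Longrightarrow> \<bar>partials S us f x\<bar> \<le> nabla_norm1 m S (f :: 'a::euclidean_space \<Rightarrow> real) x"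
  unfolding nabla_norm1_def by (simp add: member_le_sum[of us "dirs m" "\<lambda>us. \<bar>partials S us f x\<bar>"])

lemma nabla_norm2_ge: "us \<in> dirs m \<Longrightarrow> (partials S us f x)\<^sup>2 \<le> (nabla_norm2 m S (f :: 'a::euclidean_space \<Rightarrow> real) x)\<^sup>2"
  unfolding nabla_norm2_def by (simp add: sum_nonneg member_le_sum[of us "dirs m" "\<lambda>us. (partials S us f x)\<^sup>2"])

text \<open>Finiteness of the supremum matters: \<open>enn2real\<close> sends infinity to 0.\<close>

lemma deriv_bound_SUP1:
  fixes f :: "real ^ 'p \<Rightarrow> real"
  assumes "(SUP \<theta>\<in>\<Theta>. ennreal (nabla_norm1 m \<Theta> f \<theta>)) < \<infinity>"
  shows "deriv_bound m \<Theta> f (enn2real (SUP \<theta>\<in>\<Theta>. ennreal (nabla_norm1 m \<Theta> f \<theta>)))"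
  unfolding deriv_bound_def
proof (intro ballI)
  fix us t assume *: "us \<in> (dirs m :: (real ^ 'p) list set)" "t \<in> \<Theta>"
  let ?F = "SUP \<theta>\<in>\<Theta>. ennreal (nabla_norm1 m \<Theta> f \<theta>)"
  have "ennreal (nabla_norm1 m \<Theta> f t) \<le> ?F" using *(2) by (rule SUP_upper)
  then have "enn2real (ennreal (nabla_norm1 m \<Theta> f t)) \<le> enn2real ?F" using assms by (intro enn2real_mono) auto
  moreover have "0 \<le> nabla_norm1 m \<Theta> f t" by (simp add: nabla_norm1_def sum_nonneg)
  ultimately show "\<bar>partials \<Theta> us f t\<bar> \<le> enn2real ?F" using nabla_norm1_ge[OF *(1), of \<Theta> f t] by simp
qed

lemma deriv_bound_SUP2:
  fixes f :: "real ^ 'p \<Rightarrow> real"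
  assumes "(SUP \<theta>\<in>\<Theta>. ennreal (nabla_norm2 m \<Theta> f \<theta> ^ 2)) < \<infinity>"
  shows "deriv_bound m \<Theta> f (sqrt (enn2real (SUP \<theta>\<in>\<Theta>. ennreal (nabla_norm2 m \<Theta> f \<theta> ^ 2))))"
  unfolding deriv_bound_def
proof (intro ballI)
  fix us t assume *: "us \<in> (dirs m :: (real ^ 'p) list set)" "t \<in> \<Theta>"
  let ?F = "SUP \<theta>\<in>\<Theta>. ennreal (nabla_norm2 m \<Theta> f \<theta> ^ 2)"
  have "ennreal (nabla_norm2 m \<Theta> f t ^ 2) \<le> ?F" using *(2) by (rule SUP_upper)
  then have "enn2real (ennreal (nabla_norm2 m \<Theta> f t ^ 2)) \<le> enn2real ?F" using assms by (intro enn2real_mono) auto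
  then have "(partials \<Theta> us f t)\<^sup>2 \<le> enn2real ?F" using nabla_norm2_ge[OF *(1), of \<Theta> f t] by simp
  then show "\<bar>partials \<Theta> us f t\<bar> \<le> sqrt (enn2real ?F)" using real_sqrt_le_mono by fastforce
qed

section \<open>The strong law for V-statistics and almost sure properties of all sample
  pairs\<close>

context sequence_space
begin

text \<open>The mean over the diagonal is itself the U-statistic of the kernel \<open>f a a\<close>,
  so \<open>Ustat_strong_law\<close> covers both parts; the diagonal then has weight
  \<open>1 / n\<close>.\<close>

lemma Vstat_strong_law:
  fixes f :: "'a \<Rightarrow> 'a \<Rightarrow> real"
  assumes f: "integrable (M \<Otimes>\<^sub>M M) (\<lambda>z. f (fst z) (snd z))" and fd: "integrable (M \<Otimes>\<^sub>M M) (\<lambda>z. f (fst z) (fst z))"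
  shows "AE x in S. (\<lambda>n. Vstat n f x) \<longlonglongrightarrow> (\<integral>z. f (fst z) (snd z) \<partial>(M \<Otimes>\<^sub>M M))"
proof -
  have 1: "AE x in S. (\<lambda>n. Ustat n f x) \<longlonglongrightarrow> (\<integral>z. f (fst z) (snd z) \<partial>(M \<Otimes>\<^sub>M M))"
    using Ustat_strong_law[of f] f by (simp add: case_prod_unfold)
  have 2: "AE x in S. (\<lambda>n. Ustat n (\<lambda>a b. f a a) x) \<longlonglongrightarrow> (\<integral>z. f (fst z) (fst z) \<partial>(M \<Otimes>\<^sub>M M))"
    using Ustat_strong_law[of "\<lambda>a b. f a a"] fd by (simp add: case_prod_unfold)
  from 1 2 show ?thesis
  proof eventually_elim
    case (elim x)
    have "(\<lambda>n. (1 - 1 / real n) * Ustat n f x + 1 / real n * Ustat n (\<lambda>a b. f a a) x)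
       \<longlonglongrightarrow> (1 - 0) * (\<integral>z. f (fst z) (snd z) \<partial>(M \<Otimes>\<^sub>M M)) + 0 * (\<integral>z. f (fst z) (fst z) \<partial>(M \<Otimes>\<^sub>M M))"
      using elim lim_const_over_n[of "1::real"] by (intro tendsto_intros)
    then have lim: "(\<lambda>n. (1 - 1 / real n) * Ustat n f x + 1 / real n * Ustat n (\<lambda>a b. f a a) x)
       \<longlonglongrightarrow> (\<integral>z. f (fst z) (snd z) \<partial>(M \<Otimes>\<^sub>M M))" by simp
    show ?case
    proof (rule Lim_transform_eventually[OF lim])
      show "\<forall>\<^sub>F n in sequentially. (1 - 1 / real n) * Ustat n f x + 1 / real n * Ustat n (\<lambda>a b. f a a) x = Vstat n f x"
        using eventually_ge_at_top[of 2]
      proof eventually_elim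
        case (elim n)
        have "Ustat n (\<lambda>a b. f a a) x = emean n x (\<lambda>a. f a a)"
        proof -
          have "(\<Sum>i<n. \<Sum>j\<in>{..<n} - {i}. f (x i) (x i)) = (real n - 1) * (\<Sum>i<n. f (x i) (x i))"
            unfolding sum_distrib_left using elim by (intro sum.cong refl) (simp add: of_nat_diff)
          then show ?thesis using elim by (simp add: Ustat_def emean_def)
        qed
        then show ?case by (simp add: Vstat_conv_Ustat[OF elim])
      qed
    qed
  qed
qed

lemma distr_pair:
  assumes "i \<noteq> j" shows "distr S (M \<Otimes>\<^sub>M M) (\<lambda>x. (x i, x j)) = M \<Otimes>\<^sub>M M"
proof -
  have "M \<Otimes>\<^sub>M M = distr (distr S S (\<lambda>x. x \<circ> swap2 i j)) (M \<Otimes>\<^sub>M M) (\<lambda>x. (x 0, x 1))"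
    unfolding distr_reindex_inj[OF swap2(3)[OF assms]] distr_01 ..
  also have "\<dots> = distr S (M \<Otimes>\<^sub>M M) (\<lambda>x. (x i, x j))"
    using swap2(1,2)[OF assms] by (subst distr_distr[OF _ measurable_reindex]) (auto simp: comp_def)
  finally show ?thesis ..
qed

lemma AE_sample_pairs:
  assumes P: "AE z in M \<Otimes>\<^sub>M M. P (fst z) (snd z)" and Pd: "AE z in M \<Otimes>\<^sub>M M. P (fst z) (fst z)"
  shows "AE x in S. \<forall>i j. P (x i) (x j)"
proof -
  have "AE x in S. P (x i) (x j)" for i j
  proof (cases "i = j")
    case False
    have d: "distr S (M \<Otimes>\<^sub>M M) (\<lambda>x. (x i, x j)) = M \<Otimes>\<^sub>M M"
      by (rule distr_pair[OF False])
    have "AE z in distr S (M \<Otimes>\<^sub>M M) (\<lambda>x. (x i, x j)). P (fst z) (snd z)" unfolding d by (rule P)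
    then have "AE x in S. P (fst (x i, x j)) (snd (x i, x j))" by (rule AE_distrD[rotated]) measurable
    then show ?thesis by simp
  next
    case True
    \<comment> \<open>A diagonal pair is the first component, taken twice, of any pair of distinct
      observations.\<close>
    have "i \<noteq> Suc i" by simp
    then have d: "distr S (M \<Otimes>\<^sub>M M) (\<lambda>x. (x i, x (Suc i))) = M \<Otimes>\<^sub>M M"
      by (rule distr_pair)
    have "AE z in distr S (M \<Otimes>\<^sub>M M) (\<lambda>x. (x i, x (Suc i))). P (fst z) (fst z)" unfolding d by (rule Pd)
    then have "AE x in S. P (fst (x i, x (Suc i))) (fst (x i, x (Suc i)))" by (rule AE_distrD[rotated]) measurable
    then show ?thesis using True by simp
  qed
  then show ?thesis by (simp add: AE_all_countable)
qed

end

locale stein_model = sequence_space Q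
  for Q :: "(real ^ 'd) measure" +
  fixes \<X> :: "(real ^ 'd) set" and \<Theta> :: "(real ^ 'p) set" and \<theta>\<^sub>0 :: "real ^ 'p"
    and k :: "real ^ 'd \<Rightarrow> real ^ 'd \<Rightarrow> real" and p :: "real ^ 'p \<Rightarrow> real ^ 'd \<Rightarrow> real"
  assumes domain: "\<X> \<in> sets borel" and sets_Q: "sets Q = sets (restrict_space borel \<X>)"
    and convex: "convex \<Theta>" and interior: "\<theta>\<^sub>0 \<in> interior \<Theta>"
    and kernel: "C_on 2 (\<X> \<times> \<X>) (case_prod k)"
    and pos: "\<And>\<theta> x. \<theta> \<in> \<Theta> \<Longrightarrow> x \<in> \<X> \<Longrightarrow> 0 < p \<theta> x"
    and C1: "\<And>\<theta>. \<theta> \<in> \<Theta> \<Longrightarrow> C_on 1 \<X> (p \<theta>)"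
    and smooth_score: "\<And>x. x \<in> \<X> \<Longrightarrow> times_differentiable_on 3 \<Theta> (\<lambda>\<theta>. score \<X> (p \<theta>) x)"
    and moments2: "\<And>Y\<^sub>1 Y\<^sub>2 m. Y\<^sub>1 \<in> {fst, snd} \<Longrightarrow> Y\<^sub>2 \<in> {fst, snd} \<Longrightarrow> m \<in> {0, 1} \<Longrightarrow> finite_mean (Q \<Otimes>\<^sub>M Q)
           (\<lambda>z. SUP \<theta>\<in>\<Theta>. ennreal (nabla_norm2 m \<Theta> (\<lambda>t. stein_h \<X> k (p t) (Y\<^sub>1 z) (Y\<^sub>2 z)) \<theta> ^ 2))"
    and moments1: "\<And>Y\<^sub>1 Y\<^sub>2 m. Y\<^sub>1 \<in> {fst, snd} \<Longrightarrow> Y\<^sub>2 \<in> {fst, snd} \<Longrightarrow> m \<in> {2, 3} \<Longrightarrow> finite_mean (Q \<Otimes>\<^sub>M Q)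
           (\<lambda>z. SUP \<theta>\<in>\<Theta>. ennreal (nabla_norm1 m \<Theta> (\<lambda>t. stein_h \<X> k (p t) (Y\<^sub>1 z) (Y\<^sub>2 z)) \<theta>))"
begin

abbreviation "h t a b \<equiv> stein_h \<X> k (p t) a b"
text \<open>The suprema of the moment assumptions, squared norms up to order 1 and plain norms
  above. \<open>B\<close> takes the root where there is a square, so that it dominates the
  derivatives in every order.\<close>

definition "F m a b = (if m \<le> 1 then SUP \<theta>\<in>\<Theta>. ennreal (nabla_norm2 m \<Theta> (\<lambda>t. h t a b) \<theta> ^ 2)
   else SUP \<theta>\<in>\<Theta>. ennreal (nabla_norm1 m \<Theta> (\<lambda>t. h t a b) \<theta>))"
definition "B m a b = (if m \<le> 1 then sqrt (enn2real (F m a b)) else enn2real (F m a b))"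
abbreviation "e i j a b \<equiv> partials \<Theta> [axis i 1, axis j 1] (\<lambda>t. h t a b) \<theta>\<^sub>0"

lemma interior_nonempty: "interior \<Theta> \<noteq> {}" using interior by auto

lemma \<theta>\<^sub>0_in: "\<theta>\<^sub>0 \<in> \<Theta>" using interior interior_subset by auto

lemma space_Q: "space Q = \<X>"
  using sets_eq_imp_space_eq[OF sets_Q] by (simp add: space_restrict_space)

lemma smooth_h: "a \<in> \<X> \<Longrightarrow> b \<in> \<X> \<Longrightarrow> times_differentiable_on 3 \<Theta> (\<lambda>t. h t a b)"
  by (intro times_differentiable_on_stein_h convex interior_nonempty smooth_score)

lemma finite_mean_F:
  assumes "m \<le> 3" shows "finite_mean (Q \<Otimes>\<^sub>M Q) (\<lambda>z. F m (fst z) (snd z))" "finite_mean (Q \<Otimes>\<^sub>M Q) (\<lambda>z. F m (fst z) (fst z))"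
proof -
  consider "m \<in> {0, 1}" | "m \<in> {2, 3}" using assms by force
  then have "finite_mean (Q \<Otimes>\<^sub>M Q) (\<lambda>z. F m (fst z) (snd z)) \<and> finite_mean (Q \<Otimes>\<^sub>M Q) (\<lambda>z. F m (fst z) (fst z))"
  proof cases
    case 1
    then show ?thesis using moments2[of fst snd m] moments2[of fst fst m] by (auto simp: F_def)
  next
    case 2
    then show ?thesis using moments1[of fst snd m] moments1[of fst fst m] by (auto simp: F_def)
  qed
  then show "finite_mean (Q \<Otimes>\<^sub>M Q) (\<lambda>z. F m (fst z) (snd z))" "finite_mean (Q \<Otimes>\<^sub>M Q) (\<lambda>z. F m (fst z) (fst z))" by auto
qed

lemma B_nonneg: "0 \<le> B m a b" by (simp add: B_def)

lemma deriv_bound_B: "F m a b < \<infinity> \<Longrightarrow> deriv_bound m \<Theta> (\<lambda>t. h t a b) (B m a b)"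
proof (cases "m \<le> 1")
  case True
  assume "F m a b < \<infinity>"
  with deriv_bound_SUP2[of m \<Theta> "\<lambda>t. h t a b"] show ?thesis unfolding F_def B_def if_P[OF True] .
next
  case False
  assume "F m a b < \<infinity>"
  with deriv_bound_SUP1[of m \<Theta> "\<lambda>t. h t a b"] show ?thesis unfolding F_def B_def if_not_P[OF False] .
qed

lemma integrable_of_square:
  assumes "g \<in> borel_measurable (Q \<Otimes>\<^sub>M Q)" "integrable (Q \<Otimes>\<^sub>M Q) (\<lambda>z. (g z)\<^sup>2)" shows "integrable (Q \<Otimes>\<^sub>M Q) (g :: _ \<Rightarrow> real)"
proof -
  interpret pp: pair_prob_space Q Q ..
  show ?thesis by (rule pp.square_integrable_imp_integrable[OF assms])
qed

lemma B_sq: "m \<le> 1 \<Longrightarrow> (B m a b)\<^sup>2 = enn2real (F m a b)" by (simp add: B_def)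

lemma measurable_B:
  assumes "m \<le> 3"
  shows "(\<lambda>z. B m (fst z) (snd z)) \<in> borel_measurable (Q \<Otimes>\<^sub>M Q)" "(\<lambda>z. B m (fst z) (fst z)) \<in> borel_measurable (Q \<Otimes>\<^sub>M Q)"
proof -
  note [measurable] = finite_mean_F[OF assms, unfolded finite_mean_def, THEN conjunct1]
  show "(\<lambda>z. B m (fst z) (snd z)) \<in> borel_measurable (Q \<Otimes>\<^sub>M Q)" "(\<lambda>z. B m (fst z) (fst z)) \<in> borel_measurable (Q \<Otimes>\<^sub>M Q)"
    by (cases "m \<le> 1"; simp only: B_def if_True if_False; measurable)+
qed

lemma integrable_B2:
  assumes "m \<le> 1"
  shows "integrable (Q \<Otimes>\<^sub>M Q) (\<lambda>z. (B m (fst z) (snd z))\<^sup>2)" "integrable (Q \<Otimes>\<^sub>M Q) (\<lambda>z. (B m (fst z) (fst z))\<^sup>2)"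
  unfolding B_sq[OF assms] by (rule finite_mean_integrable, rule finite_mean_F, use assms in linarith)+

lemma integrable_B:
  assumes "m \<le> 3"
  shows "integrable (Q \<Otimes>\<^sub>M Q) (\<lambda>z. B m (fst z) (snd z))" "integrable (Q \<Otimes>\<^sub>M Q) (\<lambda>z. B m (fst z) (fst z))"
proof -
  have "integrable (Q \<Otimes>\<^sub>M Q) (\<lambda>z. B m (fst z) (snd z)) \<and> integrable (Q \<Otimes>\<^sub>M Q) (\<lambda>z. B m (fst z) (fst z))"
  proof (cases "m \<le> 1")
    case True
    show ?thesis
      using integrable_of_square[OF measurable_B(1)[OF assms] integrable_B2(1)[OF True]]
        integrable_of_square[OF measurable_B(2)[OF assms] integrable_B2(2)[OF True]] by (rule conjI)
  next
    case False
    show ?thesis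
      unfolding B_def if_not_P[OF False] by (intro conjI finite_mean_integrable finite_mean_F[OF assms])
  qed
  then show "integrable (Q \<Otimes>\<^sub>M Q) (\<lambda>z. B m (fst z) (snd z))" "integrable (Q \<Otimes>\<^sub>M Q) (\<lambda>z. B m (fst z) (fst z))" by auto
qed

lemma space_QQ: "z \<in> space (Q \<Otimes>\<^sub>M Q) \<longleftrightarrow> fst z \<in> \<X> \<and> snd z \<in> \<X>"
  by (cases z) (simp add: space_pair_measure space_Q)

sublocale family: smooth_family \<Theta> "Q \<Otimes>\<^sub>M Q" "\<lambda>t z. h t (fst z) (snd z)" "\<lambda>m z. B m (fst z) (snd z)"
proof
  show "convex \<Theta>" "interior \<Theta> \<noteq> {}" by (rule convex interior_nonempty)+
  show "times_differentiable_on 3 \<Theta> (\<lambda>t. h t (fst z) (snd z))" if "z \<in> space (Q \<Otimes>\<^sub>M Q)" for z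
    using that smooth_h by (simp add: space_QQ)
  show "(\<lambda>z. h t (fst z) (snd z)) \<in> borel_measurable (Q \<Otimes>\<^sub>M Q)" if "t \<in> \<Theta>" for t
    using that by (intro measurable_stein_h domain sets_Q C1 pos kernel)
  fix m :: nat assume m: "m \<le> 3"
  show "integrable (Q \<Otimes>\<^sub>M Q) (\<lambda>z. B m (fst z) (snd z))" by (rule integrable_B[OF m])
  from finite_mean_AE[OF finite_mean_F(1)[OF m]]
  show "AE z in Q \<Otimes>\<^sub>M Q. deriv_bound m \<Theta> (\<lambda>t. h t (fst z) (snd z)) (B m (fst z) (snd z))"
    by eventually_elim (rule deriv_bound_B)
qed

lemma dirs2: "[axis i 1, axis j 1] \<in> (dirs 2 :: (real ^ 'p) list set)"
  by (auto simp: dirs_def axis_Basis)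

lemma e_integrable: "integrable (Q \<Otimes>\<^sub>M Q) (\<lambda>z. e i j (fst z) (snd z))"
  by (rule family.integrable_pd[OF dirs2 _ \<theta>\<^sub>0_in family.measurable_pd2[OF interior]]) simp

lemma e_diag_integrable: "integrable (Q \<Otimes>\<^sub>M Q) (\<lambda>z. e i j (fst z) (fst z))"
proof (rule Bochner_Integration.integrable_bound[OF integrable_B(2)[of 2]])
  have "(\<lambda>z. (fst z, fst z)) \<in> measurable (Q \<Otimes>\<^sub>M Q) (Q \<Otimes>\<^sub>M Q)" by measurable
  from measurable_compose[OF this family.measurable_pd2[OF interior, of i j]]
  show "(\<lambda>z. e i j (fst z) (fst z)) \<in> borel_measurable (Q \<Otimes>\<^sub>M Q)" by (simp only: fst_conv snd_conv)
  from finite_mean_AE[OF finite_mean_F(2)[of 2]]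
  show "AE z in Q \<Otimes>\<^sub>M Q. norm (e i j (fst z) (fst z)) \<le> norm (B 2 (fst z) (fst z))"
  proof (rule AE_mp, simp, intro AE_I2 impI)
    fix z :: "(real ^ 'd) \<times> (real ^ 'd)"
    assume "F 2 (fst z) (fst z) < \<infinity>"
    from deriv_bound_B[OF this] have "\<bar>e i j (fst z) (fst z)\<bar> \<le> B 2 (fst z) (fst z)"
      using dirs2 \<theta>\<^sub>0_in unfolding deriv_bound_def by blast
    then show "norm (e i j (fst z) (fst z)) \<le> norm (B 2 (fst z) (fst z))" by simp
  qed
qed simp

lemma hessian_KSD2: "hessian \<Theta> (\<lambda>\<theta>. KSD2 \<X> k Q (p \<theta>)) \<theta>\<^sub>0 $ i $ j = (\<integral>z. e i j (fst z) (snd z) \<partial>(Q \<Otimes>\<^sub>M Q))"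
  using family.hessian_integral[OF interior, of i j] by (simp add: KSD2_def case_prod_unfold)

text \<open>Thresholds are restricted to the naturals so that one null set serves them all. The
  threshold is chosen from the limiting mean, before \<open>n\<close>.\<close>

lemma tail_strong_law:
  fixes g s :: "real ^ 'd \<Rightarrow> real ^ 'd \<Rightarrow> real"
  assumes g: "integrable (Q \<Otimes>\<^sub>M Q) (\<lambda>z. g (fst z) (snd z))" "integrable (Q \<Otimes>\<^sub>M Q) (\<lambda>z. g (fst z) (fst z))" "\<And>a b. 0 \<le> g a b"
    and s: "(\<lambda>z. s (fst z) (snd z)) \<in> borel_measurable (Q \<Otimes>\<^sub>M Q)" "(\<lambda>z. s (fst z) (fst z)) \<in> borel_measurable (Q \<Otimes>\<^sub>M Q)"
  shows "AE x in S. \<forall>\<epsilon>>0. \<exists>B. \<forall>\<^sub>F n in sequentially. Vstat n (\<lambda>a b. if B < s a b then g a b else 0) x \<le> \<epsilon>"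
proof -
  let ?t = "\<lambda>B a b. if real B < s a b then g a b else 0"
  have "AE x in S. (\<lambda>n. Vstat n (?t B) x) \<longlonglongrightarrow> (\<integral>z. ?t B (fst z) (snd z) \<partial>(Q \<Otimes>\<^sub>M Q))" for B
  proof (rule Vstat_strong_law)
    show "integrable (Q \<Otimes>\<^sub>M Q) (\<lambda>z. ?t B (fst z) (snd z))"
      using g s by (intro Bochner_Integration.integrable_bound[OF g(1)]) auto
    show "integrable (Q \<Otimes>\<^sub>M Q) (\<lambda>z. ?t B (fst z) (fst z))"
      using g s by (intro Bochner_Integration.integrable_bound[OF g(2)]) auto
  qed
  then have "AE x in S. \<forall>B. (\<lambda>n. Vstat n (?t B) x) \<longlonglongrightarrow> (\<integral>z. ?t B (fst z) (snd z) \<partial>(Q \<Otimes>\<^sub>M Q))"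
    unfolding AE_all_countable by blast
  then show ?thesis
  proof eventually_elim
    case (elim x)
    show ?case
    proof (intro allI impI)
      fix \<epsilon> :: real assume "0 < \<epsilon>"
      then have "\<forall>\<^sub>F B in sequentially. (\<integral>z. ?t B (fst z) (snd z) \<partial>(Q \<Otimes>\<^sub>M Q)) < \<epsilon>"
        by (intro order_tendstoD(2)[OF integral_tail_tendsto[OF g(1) _ s(1)]] g(3))
      then obtain B where B: "(\<integral>z. ?t B (fst z) (snd z) \<partial>(Q \<Otimes>\<^sub>M Q)) < \<epsilon>" by (auto simp: eventually_sequentially)
      have "\<forall>\<^sub>F n in sequentially. Vstat n (?t B) x < \<epsilon>" using elim B by (intro order_tendstoD(2)) auto
      then show "\<exists>B. \<forall>\<^sub>F n in sequentially. Vstat n (\<lambda>a b. if B < s a b then g a b else 0) x \<le> \<epsilon>"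
        by (intro exI[of _ "real B"]) (auto elim: eventually_mono)
    qed
  qed
qed

text \<open>The properties of a data sequence that the expansion takes from strong laws. Consistency
  of the estimator is kept apart, since it comes from the bootstrap.\<close>

definition typical :: "(nat \<Rightarrow> real ^ 'd) \<Rightarrow> bool" where
  "typical x \<longleftrightarrow> (\<forall>i. x i \<in> \<X>) \<and> (\<forall>m\<le>3. \<forall>i j. F m (x i) (x j) < \<infinity>)
     \<and> (\<exists>K. \<forall>\<^sub>F n in sequentially. Vstat n (\<lambda>a b. (B 1 a b)\<^sup>2) x \<le> K)
     \<and> (\<forall>\<epsilon>>0. \<exists>c. \<forall>\<^sub>F n in sequentially. Vstat n (\<lambda>a b. if c < B 2 a b then (B 1 a b)\<^sup>2 else 0) x \<le> \<epsilon>)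
     \<and> (\<exists>K. \<forall>\<^sub>F n in sequentially. emean n x (\<lambda>a. B 1 a a) \<le> K)
     \<and> (\<exists>K. \<forall>\<^sub>F n in sequentially. Vstat n (B 3) x \<le> K)
     \<and> (\<forall>i j. \<forall>\<epsilon>>0. \<exists>c. \<forall>\<^sub>F n in sequentially. Vstat n (\<lambda>a b. if c < \<bar>e i j a b\<bar> then \<bar>e i j a b\<bar> else 0) x \<le> \<epsilon>)
     \<and> (\<forall>i j. (\<lambda>n. Vstat n (e i j) x) \<longlonglongrightarrow> hessian \<Theta> (\<lambda>\<theta>. KSD2 \<X> k Q (p \<theta>)) \<theta>\<^sub>0 $ i $ j)"

lemma eventually_bounded_of_tendsto: "f \<longlonglongrightarrow> (l::real) \<Longrightarrow> \<exists>K. \<forall>\<^sub>F n in sequentially. f n \<le> K"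
  using order_tendstoD(2)[of f l sequentially "l + 1"] by (intro exI[of _ "l + 1"]) (auto elim: eventually_mono)

lemma AE_typical: "AE x in S. typical x"
proof -
  have 1: "AE x in S. \<forall>i. x i \<in> \<X>"
    by (rule AE_I2) (auto simp: space_PiM space_Q PiE_iff)
  have 2: "AE x in S. \<forall>m\<in>{..3}. \<forall>i j. F m (x i) (x j) < \<infinity>"
    by (intro AE_ball_countable' AE_sample_pairs finite_mean_AE finite_mean_F) auto
  have 3: "AE x in S. (\<lambda>n. Vstat n (\<lambda>a b. (B 1 a b)\<^sup>2) x) \<longlonglongrightarrow> (\<integral>z. (B 1 (fst z) (snd z))\<^sup>2 \<partial>(Q \<Otimes>\<^sub>M Q))"
    by (rule Vstat_strong_law) (intro integrable_B2, simp)+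
  have 4: "AE x in S. \<forall>\<epsilon>>0. \<exists>c. \<forall>\<^sub>F n in sequentially. Vstat n (\<lambda>a b. if c < B 2 a b then (B 1 a b)\<^sup>2 else 0) x \<le> \<epsilon>"
    by (intro tail_strong_law integrable_B2 measurable_B) auto
  have 5: "AE x in S. (\<lambda>n. Vstat n (\<lambda>a b. B 1 a a) x) \<longlonglongrightarrow> (\<integral>z. B 1 (fst z) (fst z) \<partial>(Q \<Otimes>\<^sub>M Q))"
    by (rule Vstat_strong_law) (intro integrable_B(2), simp)+
  have 6: "AE x in S. (\<lambda>n. Vstat n (B 3) x) \<longlonglongrightarrow> (\<integral>z. B 3 (fst z) (snd z) \<partial>(Q \<Otimes>\<^sub>M Q))"
    by (rule Vstat_strong_law) (intro integrable_B, simp)+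
  have 7: "AE x in S. \<forall>i j. \<forall>\<epsilon>>0. \<exists>c. \<forall>\<^sub>F n in sequentially. Vstat n (\<lambda>a b. if c < \<bar>e i j a b\<bar> then \<bar>e i j a b\<bar> else 0) x \<le> \<epsilon>"
    unfolding AE_all_countable
    by (intro allI tail_strong_law integrable_abs e_integrable e_diag_integrable borel_measurable_abs borel_measurable_integrable) auto
  have 8: "AE x in S. \<forall>i j. (\<lambda>n. Vstat n (e i j) x) \<longlonglongrightarrow> (\<integral>z. e i j (fst z) (snd z) \<partial>(Q \<Otimes>\<^sub>M Q))"
    unfolding AE_all_countable by (intro allI Vstat_strong_law e_integrable e_diag_integrable)
  from 1 2 3 4 5 6 7 8 show ?thesis
  proof eventually_elim
    case (elim x)
    have "\<forall>\<^sub>F n in sequentially. emean n x (\<lambda>a. B 1 a a) = Vstat n (\<lambda>a b. B 1 a a) x"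
      using eventually_gt_at_top[of 0] by eventually_elim (simp add: Vstat_fst)
    moreover from eventually_bounded_of_tendsto[OF elim(5)] obtain K where "\<forall>\<^sub>F n in sequentially. Vstat n (\<lambda>a b. B 1 a a) x \<le> K" by blast
    ultimately have "\<forall>\<^sub>F n in sequentially. emean n x (\<lambda>a. B 1 a a) \<le> K" by eventually_elim simp
    then show ?case
      unfolding typical_def hessian_KSD2
      using elim(1,2,4,7,8) eventually_bounded_of_tendsto[OF elim(3)] eventually_bounded_of_tendsto[OF elim(6)] by blast
  qed
qed

theorem typical_expansion:
  assumes x: "typical x"
    and \<psi>: "\<And>n y. 0 < n \<Longrightarrow> (\<And>i. i < n \<Longrightarrow> y i \<in> \<X>) \<Longrightarrow> \<psi> (empirical n y) \<in> \<Theta>"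
    and consistent: "(\<lambda>n. \<psi> (empirical n x)) \<longlonglongrightarrow> \<theta>\<^sub>0"
    and tight: "pmf_tight (\<lambda>n. bootstrap n x) (\<lambda>n y. sqrt n * norm (\<psi> (empirical n y) - \<psi> (empirical n x)))"
  shows "pmf_null (\<lambda>n. bootstrap n x) (\<lambda>n y. n * KSD2_boot \<Theta> \<X> k p \<psi> n x y
     - (n * Ustat n (centered (empirical n x) (h \<theta>\<^sub>0)) y
        + (sqrt n *\<^sub>R (Ustat n (grad_h \<Theta> \<X> k p \<theta>\<^sub>0) y - Ustat n (grad_h \<Theta> \<X> k p \<theta>\<^sub>0) x)) \<bullet> (sqrt n *\<^sub>R (\<psi> (empirical n y) - \<psi> (empirical n x)))
        + (sqrt n *\<^sub>R (\<psi> (empirical n y) - \<psi> (empirical n x)))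
            \<bullet> (hessian \<Theta> (\<lambda>\<theta>. KSD2 \<X> k Q (p \<theta>)) \<theta>\<^sub>0 *v (sqrt n *\<^sub>R (\<psi> (empirical n y) - \<psi> (empirical n x))))))"
proof -
  have X: "x i \<in> \<X>" for i using x by (simp add: typical_def)
  have Fin: "F m (x i) (x j) < \<infinity>" if "m \<le> 3" for m i j using x that unfolding typical_def by blast
  note sm = smooth_h[OF X X] and db = deriv_bound_B[OF Fin]
  obtain K1 K2 K3 where K: "\<forall>\<^sub>F n in sequentially. Vstat n (\<lambda>a b. (B 1 a b)\<^sup>2) x \<le> K1"
     "\<forall>\<^sub>F n in sequentially. emean n x (\<lambda>a. B 1 a a) \<le> K2" "\<forall>\<^sub>F n in sequentially. Vstat n (B 3) x \<le> K3"
    using x unfolding typical_def by blast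
  \<comment> \<open>\<open>CARD('p)\<close> is at least 1, so its cube dominates the first and
    second powers that occur in the Lipschitz and first order Taylor bounds.\<close>
  let ?c = "real CARD('p)" let ?C = "?c ^ 3" let ?K = "max K1 (max K2 K3)"
  have c1: "1 \<le> ?c" by (simp add: Suc_le_eq)
  have c: "?c \<le> ?C" "?c ^ 2 \<le> ?C" using power_increasing[of 1 3 ?c] power_increasing[of 2 3 ?c] c1 by auto
  have gc: "grad_h \<Theta> \<X> k p t a b $ l = partials \<Theta> [axis l 1] (\<lambda>t. h t a b) t" for t a b l
    by (simp add: grad_h_def grad_def del: partials.simps)
  have d1: "[axis l 1] \<in> (dirs 1 :: (real ^ 'p) list set)" for l by (auto simp: dirs_def axis_Basis)
  interpret boot_expansion x \<Theta> "\<lambda>n. \<psi> (empirical n x)" "\<lambda>n y. \<psi> (empirical n y)" \<theta>\<^sub>0 h "grad_h \<Theta> \<X> k p" e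
     "hessian \<Theta> (\<lambda>\<theta>. KSD2 \<X> k Q (p \<theta>)) \<theta>\<^sub>0" "B 1" "B 2" "B 3" ?C ?K
  proof
    show "0 \<le> ?C" by simp
    show "\<psi> (empirical n x) \<in> \<Theta>" if "0 < n" for n using that X by (intro \<psi>)
    show "\<psi> (empirical n y) \<in> \<Theta>" if "0 < n" "y \<in> set_pmf (bootstrap n x)" for n y
      using bootstrap_support[OF that] X by (intro \<psi> that(1)) metis
    show "\<theta>\<^sub>0 \<in> \<Theta>" by (rule \<theta>\<^sub>0_in)
    show "(\<lambda>n. \<psi> (empirical n x)) \<longlonglongrightarrow> \<theta>\<^sub>0" by (rule consistent)
    show "pmf_tight (\<lambda>n. bootstrap n x) (\<lambda>n y. sqrt n * norm (\<psi> (empirical n y) - \<psi> (empirical n x)))" by (rule tight)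
    fix i j
    show "0 \<le> B 3 (x i) (x j)" by (rule B_nonneg)
    fix t u assume t: "t \<in> \<Theta>"
    show "\<bar>grad_h \<Theta> \<X> k p t (x i) (x j) $ l\<bar> \<le> B 1 (x i) (x j)" for l
      using db[of 1 i j, OF one_le_numeral] d1[of l] t unfolding gc deriv_bound_def by blast
    assume u: "u \<in> \<Theta>"
    show "\<bar>h u (x i) (x j) - h t (x i) (x j)\<bar> \<le> ?C * norm (u - t) * B 1 (x i) (x j)"
    proof -
      have "\<bar>h u (x i) (x j) - h t (x i) (x j)\<bar> \<le> ?c * B 1 (x i) (x j) * norm (u - t)"
        using partials_Lipschitz[OF convex sm, where us = "[]" and l = 0, OF _ _ t u, of i j "B 1 (x i) (x j)"] db[of 1 i j] by simp
      also have "\<dots> \<le> ?C * B 1 (x i) (x j) * norm (u - t)" using c B_nonneg by (intro mult_right_mono) auto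
      finally show ?thesis by (simp only: mult_ac)
    qed
    show "\<bar>grad_h \<Theta> \<X> k p u (x i) (x j) $ l - grad_h \<Theta> \<X> k p t (x i) (x j) $ l\<bar> \<le> ?C * norm (u - t) * B 2 (x i) (x j)" for l
    proof -
      have "\<bar>grad_h \<Theta> \<X> k p u (x i) (x j) $ l - grad_h \<Theta> \<X> k p t (x i) (x j) $ l\<bar> \<le> ?c * B 2 (x i) (x j) * norm (u - t)"
        unfolding gc by (rule partials_Lipschitz[OF convex sm d1 _ t u]) (use db[of 2 i j] in \<open>simp_all add: numeral_2_eq_2\<close>)
      also have "\<dots> \<le> ?C * B 2 (x i) (x j) * norm (u - t)" using c B_nonneg by (intro mult_right_mono) auto
      finally show ?thesis by (simp only: mult_ac)
    qed
    show "\<bar>grad_h \<Theta> \<X> k p u (x i) (x j) $ l - grad_h \<Theta> \<X> k p t (x i) (x j) $ l - (\<Sum>k\<in>UNIV. (u - t) $ k * e k l (x i) (x j))\<bar>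
       \<le> ?C * norm (u - t) * (norm (u - t) + norm (t - \<theta>\<^sub>0)) * B 3 (x i) (x j)" for l
    proof -
      have "\<bar>grad_h \<Theta> \<X> k p u (x i) (x j) $ l - grad_h \<Theta> \<X> k p t (x i) (x j) $ l - (\<Sum>k\<in>UNIV. (u - t) $ k * e k l (x i) (x j))\<bar>
       \<le> ?c ^ 2 * norm (u - t) * (norm (u - t) + norm (t - \<theta>\<^sub>0)) * B 3 (x i) (x j)"
        unfolding gc by (rule partials_Taylor[OF convex sm d1 _ t u \<theta>\<^sub>0_in]) (use db[of 3 i j] in \<open>simp_all add: numeral_3_eq_3\<close>)
      also have "\<dots> \<le> ?C * norm (u - t) * (norm (u - t) + norm (t - \<theta>\<^sub>0)) * B 3 (x i) (x j)"
        using c B_nonneg by (intro mult_right_mono) auto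
      finally show ?thesis .
    qed
    show "\<bar>h u (x i) (x j) - h t (x i) (x j) - (\<Sum>l\<in>UNIV. (u - t) $ l * grad_h \<Theta> \<X> k p t (x i) (x j) $ l)
         - (\<Sum>k\<in>UNIV. \<Sum>l\<in>UNIV. (u - t) $ k * (u - t) $ l / 2 * e k l (x i) (x j))\<bar>
       \<le> ?C * (norm (u - t))\<^sup>2 * (norm (u - t) + norm (t - \<theta>\<^sub>0)) * B 3 (x i) (x j)"
      unfolding gc by (rule second_order_Taylor[OF convex sm _ t u \<theta>\<^sub>0_in db]) auto
  next
    show "\<forall>\<^sub>F n in sequentially. Vstat n (\<lambda>a b. (B 1 a b)\<^sup>2) x \<le> ?K" using K(1) by eventually_elim simp
    show "\<forall>\<^sub>F n in sequentially. emean n x (\<lambda>a. B 1 a a) \<le> ?K" using K(2) by eventually_elim simp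
    show "\<forall>\<^sub>F n in sequentially. Vstat n (B 3) x \<le> ?K" using K(3) by eventually_elim simp
  qed (use x in \<open>unfold typical_def, blast+\<close>)
  show ?thesis using expansion unfolding KSD2_boot_def Let_def .
qed

end

section \<open>Weak convergence\<close>

text \<open>\<open>clip\<close> is a continuous stand-in for an indicator, as weak convergence tests
  continuous functions only.\<close>

lemma (in prob_space) prob_le_integral_clip:
  assumes [measurable]: "f \<in> borel_measurable M"
  shows "prob {x \<in> space M. K + 1 < f x} \<le> (\<integral>x. clip (f x - K) \<partial>M)"
proof -
  have c: "clip \<in> borel_measurable borel" unfolding clip_def by measurable
  have "prob {x \<in> space M. K + 1 < f x} = (\<integral>x. indicator {x \<in> space M. K + 1 < f x} x \<partial>M)" by simp
  also have "\<dots> \<le> (\<integral>x. clip (f x - K) \<partial>M)"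
  proof (rule integral_mono)
    show "integrable M (indicat_real {x \<in> space M. K + 1 < f x})" by (intro integrable_const_bound[of _ 1]) auto
    show "integrable M (\<lambda>x. clip (f x - K))"
      using clip_bounds by (intro integrable_const_bound[of _ 1] measurable_compose[OF _ c]) auto
  qed (auto simp: clip_def indicator_def)
  finally show ?thesis .
qed

lemma weakly_converges_map:
  fixes \<phi> :: "'b::topological_space \<Rightarrow> 'c::topological_space"
  assumes w: "weakly_converges \<mu> \<nu>" and s: "\<And>n. sets (\<mu> n) = sets borel" "sets \<nu> = sets borel"
    and \<phi>: "continuous_on UNIV \<phi>"
  shows "weakly_converges (\<lambda>n. distr (\<mu> n) borel \<phi>) (distr \<nu> borel \<phi>)"
  unfolding weakly_converges_def
proof (intro allI impI)
  fix f :: "'c \<Rightarrow> real" assume f: "continuous_on UNIV f \<and> bounded (range f)"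
  have "continuous_on UNIV (\<lambda>x. f (\<phi> x))" using f \<phi> continuous_on_compose2 by blast
  moreover have "bounded (range (\<lambda>x. f (\<phi> x)))" using f by (auto intro: bounded_subset)
  ultimately have "(\<lambda>n. \<integral>x. f (\<phi> x) \<partial>\<mu> n) \<longlonglongrightarrow> (\<integral>x. f (\<phi> x) \<partial>\<nu>)" using w unfolding weakly_converges_def by blast
  moreover have m: "\<phi> \<in> measurable borel borel" "f \<in> borel_measurable borel" using f \<phi> by (auto intro: borel_measurable_continuous_onI)
  have "(\<integral>x. f x \<partial>distr (\<mu> n) borel \<phi>) = (\<integral>x. f (\<phi> x) \<partial>\<mu> n)" for n
    using m by (intro integral_distr) (simp_all add: measurable_cong_sets[OF s(1)])
  moreover have "(\<integral>x. f x \<partial>distr \<nu> borel \<phi>) = (\<integral>x. f (\<phi> x) \<partial>\<nu>)"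
    using m by (intro integral_distr) (simp_all add: measurable_cong_sets[OF s(2)])
  ultimately show "(\<lambda>n. \<integral>x. f x \<partial>distr (\<mu> n) borel \<phi>) \<longlonglongrightarrow> (\<integral>x. f x \<partial>distr \<nu> borel \<phi>)" by simp
qed

text \<open>\<open>K\<close> is found from the limit law alone, before any converging sequence is
  named. One \<open>K\<close> thus serves almost every data sequence, as the order of quantifiers in
  \<open>bootstrap_tight_imp_consistent\<close> requires.\<close>

lemma weak_tail:
  fixes g :: "'b::topological_space \<Rightarrow> real"
  assumes \<nu>: "prob_space \<nu>" "sets \<nu> = sets borel" and g: "continuous_on UNIV g" and t: "0 < \<tau>"
  obtains K where "\<And>\<mu>. weakly_converges \<mu> \<nu> \<Longrightarrow> \<forall>\<^sub>F n in sequentially. (\<integral>x. clip (g x - K) \<partial>\<mu> n) \<le> \<tau>"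
proof -
  interpret \<nu>: prob_space \<nu> by fact
  have gm: "g \<in> borel_measurable \<nu>"
    using borel_measurable_continuous_onI[OF g] by (simp add: measurable_cong_sets[OF \<nu>(2)])
  have cm: "clip \<in> borel_measurable borel" unfolding clip_def by measurable
  have "(\<lambda>K. \<integral>x. clip (g x - real K) \<partial>\<nu>) \<longlonglongrightarrow> (\<integral>x. 0 \<partial>\<nu>)"
  proof (rule integral_dominated_convergence[where w = "\<lambda>_. 1"])
    fix K show "(\<lambda>x. clip (g x - real K)) \<in> borel_measurable \<nu>"
      by (rule measurable_compose[OF _ cm]) (use gm in measurable)
    show "AE x in \<nu>. norm (clip (g x - real K)) \<le> 1" by (auto simp: clip_def)
  next
    show "AE x in \<nu>. (\<lambda>K. clip (g x - real K)) \<longlonglongrightarrow> 0"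
    proof (rule AE_I2, rule tendsto_eventually)
      fix x
      obtain K0 where "g x \<le> real K0" using real_arch_simple by blast
      then show "\<forall>\<^sub>F K in sequentially. clip (g x - real K) = 0"
        by (auto simp: eventually_sequentially clip_def intro!: exI[of _ K0])
    qed
  qed auto
  then have "\<forall>\<^sub>F K in sequentially. (\<integral>x. clip (g x - real K) \<partial>\<nu>) < \<tau>" using t by (intro order_tendstoD(2)) auto
  then obtain K where K: "(\<integral>x. clip (g x - real K) \<partial>\<nu>) < \<tau>" by (auto simp: eventually_sequentially)
  have "continuous_on UNIV (\<lambda>x. clip (g x - real K))" unfolding clip_def by (intro continuous_intros g)
  moreover have "bounded (range (\<lambda>x. clip (g x - real K)))" by (rule boundedI[of _ 1]) (auto simp: clip_def)
  ultimately have lim: "(\<lambda>n. \<integral>x. clip (g x - real K) \<partial>\<mu> n) \<longlonglongrightarrow> (\<integral>x. clip (g x - real K) \<partial>\<nu>)" if "weakly_converges \<mu> \<nu>" for \<mu>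
    using that unfolding weakly_converges_def by blast
  have "\<forall>\<^sub>F n in sequentially. (\<integral>x. clip (g x - real K) \<partial>\<mu> n) \<le> \<tau>" if "weakly_converges \<mu> \<nu>" for \<mu>
    using order_tendstoD(2)[OF lim[OF that] K] by eventually_elim simp
  then show ?thesis by (rule that)
qed

lemma weakly_converges_tight:
  fixes g :: "'b::topological_space \<Rightarrow> real"
  assumes \<nu>: "prob_space \<nu>" "sets \<nu> = sets borel" and g: "continuous_on UNIV g" and t: "0 < \<tau>"
  obtains K where "\<And>(P :: nat \<Rightarrow> 'c measure) T. (\<And>n. prob_space (P n)) \<Longrightarrow> (\<forall>\<^sub>F n in sequentially. T n \<in> borel_measurable (P n)) \<Longrightarrow>
    weakly_converges (\<lambda>n. distr (P n) borel (T n)) \<nu> \<Longrightarrow>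
    \<forall>\<^sub>F n in sequentially. measure (P n) {y \<in> space (P n). K < g (T n y)} \<le> \<tau>"
proof -
  obtain K where K: "\<And>\<mu>. weakly_converges \<mu> \<nu> \<Longrightarrow> \<forall>\<^sub>F n in sequentially. (\<integral>x. clip (g x - K) \<partial>\<mu> n) \<le> \<tau>"
    using weak_tail[OF assms] by blast
  have gm: "g \<in> borel_measurable borel" by (rule borel_measurable_continuous_onI[OF g])
  have cm: "(\<lambda>x. clip (g x - K)) \<in> borel_measurable borel" unfolding clip_def using gm by measurable
  show ?thesis
  proof (rule that[of "K + 1"])
    fix P :: "nat \<Rightarrow> 'c measure" and T
    assume P: "\<And>n. prob_space (P n)" and T: "\<forall>\<^sub>F n in sequentially. T n \<in> borel_measurable (P n)"
      and w: "weakly_converges (\<lambda>n. distr (P n) borel (T n)) \<nu>"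
    from K[OF w] T show "\<forall>\<^sub>F n in sequentially. measure (P n) {y \<in> space (P n). K + 1 < g (T n y)} \<le> \<tau>"
    proof eventually_elim
      case (elim n)
      have "measure (P n) {y \<in> space (P n). K + 1 < g (T n y)} \<le> (\<integral>y. clip (g (T n y) - K) \<partial>P n)"
        by (rule prob_space.prob_le_integral_clip[OF P measurable_compose[OF elim(2) gm]])
      also have "\<dots> = (\<integral>x. clip (g x - K) \<partial>distr (P n) borel (T n))"
        by (rule integral_distr[OF elim(2) cm, symmetric])
      finally show ?case using elim(1) by linarith
    qed
  qed
qed

lemma pmf_single_tight:
  fixes T :: "'b \<Rightarrow> real"
  assumes "0 < \<epsilon>" shows "\<exists>C. measure_pmf.prob p {y. C < \<bar>T y\<bar>} \<le> \<epsilon>"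
proof -
  have "(\<lambda>C. measure_pmf.prob p {y. real C < \<bar>T y\<bar>}) \<longlonglongrightarrow> measure_pmf.prob p (\<Inter>C. {y. real C < \<bar>T y\<bar>})"
    by (intro measure_pmf.finite_Lim_measure_decseq) (auto simp: decseq_def intro: order_le_less_trans)
  moreover have "(\<Inter>C. {y. real C < \<bar>T y\<bar>}) = {}"
  proof -
    have "\<exists>C. \<not> real C < \<bar>T y\<bar>" for y using real_arch_simple[of "\<bar>T y\<bar>"] by (auto simp: not_less)
    then show ?thesis by auto
  qed
  ultimately have "\<forall>\<^sub>F C in sequentially. measure_pmf.prob p {y. real C < \<bar>T y\<bar>} < \<epsilon>"
    using assms by (intro order_tendstoD(2)) auto
  then obtain C where "measure_pmf.prob p {y. real C < \<bar>T y\<bar>} < \<epsilon>" by (auto simp: eventually_sequentially)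
  then show ?thesis by (intro exI[of _ "real C"]) simp
qed

text \<open>\<open>boot_bigo\<close> asks for one constant for every \<open>n\<close>; the finitely
  many early laws are tight one by one and a maximum is taken.\<close>

lemma pmf_uniformly_tight:
  assumes "\<forall>\<^sub>F n in sequentially. measure_pmf.prob (p n) {y. K < \<bar>T n y :: real\<bar>} \<le> \<epsilon>" "0 < \<epsilon>"
  shows "\<exists>C. \<forall>n. measure_pmf.prob (p n) {y. C < \<bar>T n y\<bar>} \<le> \<epsilon>"
proof -
  obtain m where m: "\<And>n. m \<le> n \<Longrightarrow> measure_pmf.prob (p n) {y. K < \<bar>T n y\<bar>} \<le> \<epsilon>"
    using assms(1) by (auto simp: eventually_sequentially)
  obtain C where C: "\<And>n. measure_pmf.prob (p n) {y. C n < \<bar>T n y\<bar>} \<le> \<epsilon>"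
    using choice[OF allI, OF pmf_single_tight[OF assms(2)]] by blast
  define D where "D = Max (insert K (C ` {..<m}))"
  have D: "K \<le> D" "\<And>n. n < m \<Longrightarrow> C n \<le> D" by (auto simp: D_def)
  have "measure_pmf.prob (p n) {y. D < \<bar>T n y\<bar>} \<le> \<epsilon>" for n
  proof (cases "n < m")
    case True
    have "measure_pmf.prob (p n) {y. D < \<bar>T n y\<bar>} \<le> measure_pmf.prob (p n) {y. C n < \<bar>T n y\<bar>}"
      using D(2)[OF True] by (intro prob_mono_on_support) auto
    with C show ?thesis by (rule order_trans[rotated])
  next
    case False
    have "measure_pmf.prob (p n) {y. D < \<bar>T n y\<bar>} \<le> measure_pmf.prob (p n) {y. K < \<bar>T n y\<bar>}"
      using D(1) by (intro prob_mono_on_support) auto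
    with m[of n] False show ?thesis by simp
  qed
  then show ?thesis by blast
qed

text \<open>On the line weak convergence may be tested on \<open>cts_step\<close>, which is
  uniformly continuous: closeness in probability of the arguments then gives closeness of the
  means.\<close>

lemma slutsky:
  fixes A T :: "nat \<Rightarrow> 'b \<Rightarrow> real"
  assumes null: "pmf_null p (\<lambda>n y. T n y - A n y)" and \<nu>: "real_distribution \<nu>"
    and A: "weakly_converges (\<lambda>n. distr (measure_pmf (p n)) borel (A n)) \<nu>"
  shows "weakly_converges (\<lambda>n. distr (measure_pmf (p n)) borel (T n)) \<nu>"
proof -
  have rd: "real_distribution (distr (measure_pmf (p n)) borel (W n))" for W :: "nat \<Rightarrow> 'b \<Rightarrow> real" and n
    by (intro prob_space.real_distribution_distr[OF measure_pmf.prob_space_axioms]) simp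
  show ?thesis
    unfolding weakly_converges_iff_weak_conv_m[OF rd[where W = T] \<nu>]
  proof (rule integral_cts_step_conv_imp_weak_conv[OF rd[where W = T] \<nu>])
    fix a b :: real assume ab: "a < b"
    let ?g = "cts_step a b"
    have uc: "uniformly_continuous_on UNIV ?g" by (rule cts_step_uniformly_continuous[OF ab])
    have gb: "0 \<le> ?g s" "?g s \<le> 1" for s using ab by (auto simp: cts_step_def field_simps)
    have gc: "continuous_on UNIV ?g" by (rule uniformly_continuous_imp_continuous[OF uc])
    have gm: "?g \<in> borel_measurable borel" by (rule borel_measurable_continuous_onI[OF gc])
    have bdd: "bounded (range ?g)" by (rule boundedI[of _ 1]) (use gb in auto)
    have lim: "(\<lambda>n. measure_pmf.expectation (p n) (\<lambda>y. ?g (A n y))) \<longlonglongrightarrow> integral\<^sup>L \<nu> ?g"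
    proof -
      have "(\<lambda>n. integral\<^sup>L (distr (measure_pmf (p n)) borel (A n)) ?g) \<longlonglongrightarrow> integral\<^sup>L \<nu> ?g"
        using A gc bdd unfolding weakly_converges_def by blast
      then show ?thesis by (simp add: integral_distr gm)
    qed
    have i: "integrable (measure_pmf (p n)) (\<lambda>y. ?g (W y))" for n W
      using gb by (intro measure_pmf.integrable_const_bound[of _ 1]) auto
    have diff: "(\<lambda>n. measure_pmf.expectation (p n) (\<lambda>y. ?g (T n y)) - measure_pmf.expectation (p n) (\<lambda>y. ?g (A n y))) \<longlonglongrightarrow> 0"
    proof (rule LIMSEQ_I)
      fix r :: real assume r: "0 < r"
      obtain \<delta> where d: "0 < \<delta>" "\<And>s t. dist s t < \<delta> \<Longrightarrow> dist (?g s) (?g t) < r / 3"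
        using uc[unfolded uniformly_continuous_on_def, rule_format, of "r / 3"] r by (auto simp: dist_commute)
      have "\<forall>\<^sub>F n in sequentially. measure_pmf.prob (p n) {y. \<delta> / 2 < \<bar>T n y - A n y\<bar>} \<le> r / 3"
        using d r by (intro pmf_nullD[OF null]) auto
      then have "\<forall>\<^sub>F n in sequentially. norm (measure_pmf.expectation (p n) (\<lambda>y. ?g (T n y)) - measure_pmf.expectation (p n) (\<lambda>y. ?g (A n y)) - 0) < r"
      proof eventually_elim
        case (elim n)
        let ?E = "{y. \<delta> / 2 < \<bar>T n y - A n y\<bar>}"
        have iI: "integrable (measure_pmf (p n)) (indicat_real ?E)" by (intro measure_pmf.integrable_const_bound[of _ 1]) auto
        then have iE: "integrable (measure_pmf (p n)) (\<lambda>y. r / 3 + indicat_real ?E y)" by (intro Bochner_Integration.integrable_add) auto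
        have "\<bar>measure_pmf.expectation (p n) (\<lambda>y. ?g (T n y)) - measure_pmf.expectation (p n) (\<lambda>y. ?g (A n y))\<bar>
          = \<bar>measure_pmf.expectation (p n) (\<lambda>y. ?g (T n y) - ?g (A n y))\<bar>"
          by (simp add: Bochner_Integration.integral_diff i)
        also have "\<dots> \<le> measure_pmf.expectation (p n) (\<lambda>y. \<bar>?g (T n y) - ?g (A n y)\<bar>)" by (rule integral_abs_bound)
        also have "\<dots> \<le> measure_pmf.expectation (p n) (\<lambda>y. r / 3 + indicat_real ?E y)"
        proof (rule integral_mono)
          show "integrable (measure_pmf (p n)) (\<lambda>y. \<bar>?g (T n y) - ?g (A n y)\<bar>)"
            by (intro integrable_abs Bochner_Integration.integrable_diff i)
          show "integrable (measure_pmf (p n)) (\<lambda>y. r / 3 + indicat_real ?E y)" by (rule iE)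
          fix y
          show "\<bar>?g (T n y) - ?g (A n y)\<bar> \<le> r / 3 + indicat_real ?E y"
          proof (cases "y \<in> ?E")
            case True
            then show ?thesis using gb[of "T n y"] gb[of "A n y"] r by (auto simp: abs_le_iff)
          next
            case False
            then have "dist (T n y) (A n y) < \<delta>" using d(1) by (simp add: dist_real_def)
            from d(2)[OF this] False show ?thesis by (simp add: dist_real_def)
          qed
        qed
        also have "\<dots> = r / 3 + measure_pmf.prob (p n) ?E" by (subst Bochner_Integration.integral_add[OF _ iI]) auto
        finally show ?case using elim r by simp
      qed
      then show "\<exists>no. \<forall>n\<ge>no. norm (measure_pmf.expectation (p n) (\<lambda>y. ?g (T n y)) - measure_pmf.expectation (p n) (\<lambda>y. ?g (A n y)) - 0) < r"
        by (simp add: eventually_sequentially)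
    qed
    have "(\<lambda>n. measure_pmf.expectation (p n) (\<lambda>y. ?g (T n y))) \<longlonglongrightarrow> integral\<^sup>L \<nu> ?g"
      using tendsto_add[OF diff lim] by simp
    then show "(\<lambda>n. integral\<^sup>L (distr (measure_pmf (p n)) borel (T n)) ?g) \<longlonglongrightarrow> integral\<^sup>L \<nu> ?g"
      by (simp add: integral_distr gm)
  qed
qed

lemma empirical_cong:
  assumes "0 < n" "\<And>i. i < n \<Longrightarrow> x i = y i" shows "empirical n x = empirical n y"
  unfolding empirical_def using assms by (intro map_pmf_cong refl) (auto simp: set_pmf_of_set lessThan_empty_iff)

section \<open>Consistency carried over to the underlying probability space\<close>

context stein_model
begin

text \<open>\<open>bootstrap_tight_imp_consistent\<close> lives on the product space of sequences;
  \<open>T\<close> sends an outcome to its data sequence. It is applied to the distance of the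
  estimator to \<open>\<theta>\<^sub>0\<close>, whose bootstrap changes are bounded by those of the
  estimator.\<close>

lemma consistency:
  fixes M :: "'w measure" and T :: "'w \<Rightarrow> nat \<Rightarrow> real ^ 'd" and \<psi> :: "(real ^ 'd) pmf \<Rightarrow> real ^ 'p"
  assumes T: "T \<in> measurable M S" "distr M S T = S"
    and \<psi>: "\<And>n. 0 < n \<Longrightarrow> (\<lambda>x. \<psi> (empirical n x)) \<in> borel_measurable (\<Pi>\<^sub>M i\<in>{..<n}. restrict_space borel \<X>)"
    and tight: "\<And>\<tau>. 0 < \<tau> \<Longrightarrow> \<exists>K. \<forall>\<^sub>F n in sequentially.
        measure M {\<omega> \<in> space M. K < sqrt n * norm (\<psi> (empirical n (T \<omega>)) - \<theta>\<^sub>0)} \<le> \<tau>"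
    and boot: "\<And>\<tau>. 0 < \<tau> \<Longrightarrow> \<exists>K. AE \<omega> in M. \<forall>\<^sub>F n in sequentially.
        measure_pmf.prob (bootstrap n (T \<omega>)) {y. K < sqrt n * norm (\<psi> (empirical n y) - \<psi> (empirical n (T \<omega>)))} \<le> \<tau>"
  shows "AE \<omega> in M. (\<lambda>n. \<psi> (empirical n (T \<omega>))) \<longlonglongrightarrow> \<theta>\<^sub>0"
proof -
  define f where "f n x = norm (\<psi> (empirical n x) - \<theta>\<^sub>0)" for n x
  have dep: "depends_below n (f n)" if "0 < n" for n
    unfolding depends_below_def f_def using empirical_cong[OF that] by metis
  have meas: "f n \<in> borel_measurable S" if n: "0 < n" for n
  proof -
    have "(\<lambda>x. restrict x {..<n}) \<in> measurable S (\<Pi>\<^sub>M i\<in>{..<n}. restrict_space borel \<X>)"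
      using measurable_restrict_subset[of "{..<n}" UNIV "\<lambda>_. Q"]
      by (simp add: measurable_cong_sets[OF refl sets_PiM_cong[OF refl sets_Q]])
    from measurable_compose[OF this \<psi>[OF n]]
    have "(\<lambda>x. \<psi> (empirical n (restrict x {..<n}))) \<in> borel_measurable S" .
    moreover have "(\<lambda>x. \<psi> (empirical n (restrict x {..<n}))) = (\<lambda>x. \<psi> (empirical n x))"
      by (intro ext arg_cong[where f = \<psi>] empirical_cong[OF n]) simp
    ultimately have "(\<lambda>x. \<psi> (empirical n x)) \<in> borel_measurable S" by (simp only:)
    then show ?thesis unfolding f_def[abs_def] by measurable
  qed
  have "AE x in S. (\<lambda>n. f n x) \<longlonglongrightarrow> 0"
  proof (rule bootstrap_tight_imp_consistent[of f])
    show "0 \<le> f n x" for n x by (simp add: f_def)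
    fix \<tau> :: real assume t: "0 < \<tau>"
    from tight[OF t] obtain K where K: "\<forall>\<^sub>F n in sequentially.
        measure M {\<omega> \<in> space M. K < sqrt n * norm (\<psi> (empirical n (T \<omega>)) - \<theta>\<^sub>0)} \<le> \<tau>" by blast
    have "\<forall>\<^sub>F n in sequentially. P.prob {x \<in> space S. K < sqrt n * f n x} \<le> \<tau>"
      using K eventually_gt_at_top[of 0]
    proof eventually_elim
      case (elim n)
      have [measurable]: "f n \<in> borel_measurable S" by (rule meas[OF elim(2)])
      have A: "{x \<in> space S. K < sqrt n * f n x} \<in> sets S" by measurable
      have "measure (distr M S T) {x \<in> space S. K < sqrt n * f n x} = measure M (T -` {x \<in> space S. K < sqrt n * f n x} \<inter> space M)"
        by (rule measure_distr[OF T(1) A])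
      also have "T -` {x \<in> space S. K < sqrt n * f n x} \<inter> space M = {\<omega> \<in> space M. K < sqrt n * norm (\<psi> (empirical n (T \<omega>)) - \<theta>\<^sub>0)}"
        using measurable_space[OF T(1)] by (auto simp: f_def)
      finally show ?case using elim(1) unfolding T(2) by simp
    qed
    then show "\<exists>K. \<forall>\<^sub>F n in sequentially. P.prob {x \<in> space S. K < sqrt n * f n x} \<le> \<tau>" by blast
    from boot[OF t] obtain K where K: "AE \<omega> in M. \<forall>\<^sub>F n in sequentially.
        measure_pmf.prob (bootstrap n (T \<omega>)) {y. K < sqrt n * norm (\<psi> (empirical n y) - \<psi> (empirical n (T \<omega>)))} \<le> \<tau>" by blast
    define c where "c n x = measure_pmf.prob (bootstrap n x) {y. K < sqrt n * \<bar>f n y - f n x\<bar>}" for n x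
    have cm: "c n \<in> borel_measurable S" if n: "0 < n" for n
    proof -
      define g where "g x = sqrt n * f n x" for x
      have "bounded_meas S (\<lambda>x. measure_pmf.prob (bootstrap n x) {y. K < \<bar>g y - g x\<bar>})"
        by (rule bounded_meas_prob_bootstrap[OF n])
          (use meas[OF n] dep[OF n] in \<open>auto simp: g_def[abs_def] depends_below_def\<close>)
      then show ?thesis unfolding bounded_meas_def c_def[abs_def] g_def
        by (simp add: right_diff_distrib[symmetric] abs_mult)
    qed
    \<comment> \<open>Shifted to \<open>Suc n\<close>: passing from \<open>M\<close> to the law of
      \<open>T\<close> needs a measurable event, and \<open>c n\<close> is known to be measurable
      for positive \<open>n\<close>.\<close>
    have "AE \<omega> in M. \<forall>\<^sub>F n in sequentially. c (Suc n) (T \<omega>) \<le> \<tau>"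
      using K
    proof eventually_elim
      case (elim \<omega>)
      have "\<forall>\<^sub>F n in sequentially. c n (T \<omega>) \<le> \<tau>"
        using elim
      proof eventually_elim
        case (elim n)
        have "c n (T \<omega>) \<le> measure_pmf.prob (bootstrap n (T \<omega>)) {y. K < sqrt n * norm (\<psi> (empirical n y) - \<psi> (empirical n (T \<omega>)))}"
          unfolding c_def
        proof (rule prob_mono_on_support)
          fix y assume "y \<in> {y. K < sqrt n * \<bar>f n y - f n (T \<omega>)\<bar>}"
          moreover have "\<bar>f n y - f n (T \<omega>)\<bar> \<le> norm (\<psi> (empirical n y) - \<psi> (empirical n (T \<omega>)))"
            unfolding f_def using norm_triangle_ineq3[of "\<psi> (empirical n y) - \<theta>\<^sub>0" "\<psi> (empirical n (T \<omega>)) - \<theta>\<^sub>0"] by simp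
          then have "sqrt n * \<bar>f n y - f n (T \<omega>)\<bar> \<le> sqrt n * norm (\<psi> (empirical n y) - \<psi> (empirical n (T \<omega>)))"
            by (rule mult_left_mono) simp
          ultimately show "y \<in> {y. K < sqrt n * norm (\<psi> (empirical n y) - \<psi> (empirical n (T \<omega>)))}" by simp
        qed
        with elim show ?case by linarith
      qed
      then show ?case by (subst eventually_sequentially_Suc)
    qed
    moreover have "{x \<in> space S. \<forall>\<^sub>F n in sequentially. c (Suc n) x \<le> \<tau>} \<in> sets S"
    proof -
      have [measurable]: "c (Suc n) \<in> borel_measurable S" for n by (rule cm) simp
      show ?thesis unfolding eventually_sequentially by measurable
    qed
    ultimately have "AE x in distr M S T. \<forall>\<^sub>F n in sequentially. c (Suc n) x \<le> \<tau>"
      by (intro iffD2[OF AE_distr_iff[OF T(1)]])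
    moreover have "(\<forall>\<^sub>F n in sequentially. c (Suc n) x \<le> \<tau>) = (\<forall>\<^sub>F n in sequentially. c n x \<le> \<tau>)" for x
      by (rule eventually_sequentially_Suc[of "\<lambda>n. c n x \<le> \<tau>"])
    ultimately have "AE x in S. \<forall>\<^sub>F n in sequentially. c n x \<le> \<tau>" by (simp only: T(2))
    then show "\<exists>K. AE x in S. \<forall>\<^sub>F n in sequentially. measure_pmf.prob (bootstrap n x) {y. K < sqrt n * \<bar>f n y - f n x\<bar>} \<le> \<tau>"
      unfolding c_def by blast
  qed (use meas dep in auto)
  then have "AE x in distr M S T. (\<lambda>n. f n x) \<longlonglongrightarrow> 0" unfolding T(2) .
  then have "AE \<omega> in M. (\<lambda>n. f n (T \<omega>)) \<longlonglongrightarrow> 0" by (rule AE_distrD[OF T(1)])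
  then show ?thesis unfolding f_def by eventually_elim (simp add: tendsto_norm_zero_iff LIM_zero_iff)
qed

end

lemma borel_measurable_vecI:
  fixes f :: "'a \<Rightarrow> real ^ 'n"
  assumes "\<And>i. (\<lambda>x. f x $ i) \<in> borel_measurable M" shows "f \<in> borel_measurable M"
proof (rule borel_measurable_euclidean_space[THEN iffD2], rule ballI)
  fix b :: "real ^ 'n" assume "b \<in> Basis"
  then obtain i where b: "b = axis i 1" unfolding Basis_vec_def Basis_real_def by blast
  have "(\<lambda>x. f x \<bullet> b) = (\<lambda>x. f x $ i)" by (intro ext) (simp add: b inner_axis)
  then show "(\<lambda>x. f x \<bullet> b) \<in> borel_measurable M" using assms[of i] by (simp only:)
qed

lemma (in stein_model) measurable_Ustat_h: "Ustat n (h \<theta>\<^sub>0) \<in> borel_measurable S"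
  by (rule measurable_Ustat) (unfold case_prod_unfold, rule family.meas[OF \<theta>\<^sub>0_in])

lemma (in stein_model) measurable_Ustat_grad_h: "Ustat n (grad_h \<Theta> \<X> k p \<theta>\<^sub>0) \<in> borel_measurable S"
proof (rule borel_measurable_vecI)
  fix i
  have g: "grad_h \<Theta> \<X> k p \<theta>\<^sub>0 a b $ i = partials \<Theta> [axis i 1] (\<lambda>t. h t a b) \<theta>\<^sub>0" for a b
    by (simp add: grad_h_def grad_def del: partials.simps)
  have "Ustat n (\<lambda>a b. grad_h \<Theta> \<X> k p \<theta>\<^sub>0 a b $ i) \<in> borel_measurable S"
    by (rule measurable_Ustat) (unfold case_prod_unfold g, rule family.measurable_pd1[OF interior])
  moreover have "(\<lambda>x. Ustat n (grad_h \<Theta> \<X> k p \<theta>\<^sub>0) x $ i) = Ustat n (\<lambda>a b. grad_h \<Theta> \<X> k p \<theta>\<^sub>0 a b $ i)"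
    by (intro ext) (simp add: Ustat_def)
  ultimately show "(\<lambda>x. Ustat n (grad_h \<Theta> \<X> k p \<theta>\<^sub>0) x $ i) \<in> borel_measurable S" by (simp only:)
qed

section \<open>The bootstrap limit of the corrected statistic\<close>

theorem corollary1:
  fixes \<X> :: "(real ^ 'd) set"
    and Q :: "(real ^ 'd) measure"
    and q :: "real ^ 'd \<Rightarrow> real"
    and M :: "'w measure"
    and X :: "nat \<Rightarrow> 'w \<Rightarrow> real ^ 'd"
    and \<Theta> :: "(real ^ 'p) set"
    and \<theta>\<^sub>0 :: "real ^ 'p"
    and k :: "real ^ 'd \<Rightarrow> real ^ 'd \<Rightarrow> real"
    and P :: "real ^ 'p \<Rightarrow> (real ^ 'd) measure"
    and p :: "real ^ 'p \<Rightarrow> real ^ 'd \<Rightarrow> real"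
    and \<psi> :: "(real ^ 'd) pmf \<Rightarrow> real ^ 'p"
    and N :: "'z measure"
    and Z\<^sub>1 :: "'z \<Rightarrow> real"
    and Z\<^sub>2 Z\<^sub>3 :: "'z \<Rightarrow> real ^ 'p"
  assumes domain: "\<X> \<in> sets borel" and "interior \<X> \<noteq> {}"
    and Q: "prob_space Q" and "full_support \<X> Q"
    and "Q = density (leb_on \<X>) (\<lambda>x. ennreal (q x))"
    and "\<And>x. x \<in> \<X> \<Longrightarrow> 0 < q x" and "C_on 1 \<X> q"
    and sample: "prob_space M"
    and "prob_space.indep_vars M (\<lambda>_. restrict_space borel \<X>) X UNIV"
    and "\<And>i. distr M (restrict_space borel \<X>) (X i) = Q"
    and parameter_set: "compact \<Theta>" and "convex \<Theta>" and "interior \<Theta> \<noteq> {}"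
    and argmin: "is_arg_min (\<lambda>\<theta>. KSD \<X> k Q (p \<theta>)) (\<lambda>\<theta>. \<theta> \<in> \<Theta>) \<theta>\<^sub>0"
    and "\<theta>\<^sub>0 \<in> interior \<Theta>"
    and kernel: "bounded (case_prod k ` (\<X> \<times> \<X>))"
    and "int_strictly_pos_def \<X> k"
    and "kernel_stein_class \<X> q k"
    and "\<And>u. u \<in> Basis \<Longrightarrow> bounded (partials (\<X> \<times> \<X>) [u] (case_prod k) ` (\<X> \<times> \<X>))"
    and model: "inj_on P \<Theta>"
    and "\<And>\<theta>. \<theta> \<in> \<Theta> \<Longrightarrow> prob_space (P \<theta>)"
    and "\<And>\<theta>. \<theta> \<in> \<Theta> \<Longrightarrow> full_support \<X> (P \<theta>)"
    and "\<And>\<theta>. \<theta> \<in> \<Theta> \<Longrightarrow> P \<theta> = density (leb_on \<X>) (\<lambda>x. ennreal (p \<theta> x))"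
    and "\<And>\<theta> x. \<theta> \<in> \<Theta> \<Longrightarrow> x \<in> \<X> \<Longrightarrow> 0 < p \<theta> x"
    and "\<And>\<theta>. \<theta> \<in> \<Theta> \<Longrightarrow> C_on 1 \<X> (p \<theta>)"
    and "\<And>x. x \<in> \<X> \<Longrightarrow> C_on 4 \<Theta> (\<lambda>\<theta>. p \<theta> x)"
    and "\<And>x. x \<in> \<X> \<Longrightarrow> times_differentiable_on 3 \<Theta> (\<lambda>\<theta>. score \<X> (p \<theta>) x)"
    and score_moments: "\<And>m. m \<in> {0, 1} \<Longrightarrow> finite_mean Q
           (\<lambda>x. SUP \<theta>\<in>\<Theta>. ennreal (nabla_norm1 m \<Theta> (\<lambda>t. score \<X> (p t) x) \<theta> ^ 4))"
    and "\<And>m. m \<in> {2, 3} \<Longrightarrow> finite_mean Q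
           (\<lambda>x. SUP \<theta>\<in>\<Theta>. ennreal (nabla_norm1 m \<Theta> (\<lambda>t. score \<X> (p t) x) \<theta> ^ 2))"
    and "\<And>\<theta>. \<theta> \<in> \<Theta> \<Longrightarrow> integrable (leb_on \<X>)
           (\<lambda>x. (norm (q x *\<^sub>R (score \<X> (p \<theta>) x - score \<X> q x)))\<^sup>2)"
    and estimator: "\<And>n x. 0 < n \<Longrightarrow> (\<And>i. i < n \<Longrightarrow> x i \<in> \<X>) \<Longrightarrow> \<psi> (empirical n x) \<in> \<Theta>"
    and "\<And>n. 0 < n \<Longrightarrow> (\<lambda>x. \<psi> (empirical n x))
           \<in> borel_measurable (\<Pi>\<^sub>M i\<in>{..<n}. restrict_space borel \<X>)"
    and limit: "prob_space N"
    and "Z\<^sub>1 \<in> borel_measurable N" and "Z\<^sub>2 \<in> borel_measurable N" and "Z\<^sub>3 \<in> borel_measurable N"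
    and joint_clt: "weakly_converges
           (\<lambda>n. distr M borel (\<lambda>\<omega>.
              let x = (\<lambda>i. X i \<omega>) in
                (real n * (Ustat n (stein_h \<X> k (p \<theta>\<^sub>0)) x
                   - (\<integral>(a, b). stein_h \<X> k (p \<theta>\<^sub>0) a b \<partial>(Q \<Otimes>\<^sub>M Q))),
                 sqrt (real n) *\<^sub>R (Ustat n (grad_h \<Theta> \<X> k p \<theta>\<^sub>0) x
                   - (\<integral>(a, b). grad_h \<Theta> \<X> k p \<theta>\<^sub>0 a b \<partial>(Q \<Otimes>\<^sub>M Q))),
                 sqrt (real n) *\<^sub>R (\<psi> (empirical n x) - \<theta>\<^sub>0))))
           (distr N borel (\<lambda>z. (Z\<^sub>1 z, Z\<^sub>2 z, Z\<^sub>3 z)))"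
    and joint_clt_null: "Q = P \<theta>\<^sub>0 \<Longrightarrow> weakly_converges
           (\<lambda>n. distr M borel (\<lambda>\<omega>.
              let x = (\<lambda>i. X i \<omega>) in
                (real n * Ustat n (stein_h \<X> k (p \<theta>\<^sub>0)) x,
                 sqrt (real n) *\<^sub>R Ustat n (grad_h \<Theta> \<X> k p \<theta>\<^sub>0) x,
                 sqrt (real n) *\<^sub>R (\<psi> (empirical n x) - \<theta>\<^sub>0))))
           (distr N borel (\<lambda>z. (Z\<^sub>1 z, Z\<^sub>2 z, Z\<^sub>3 z)))"
    and h_moments: "\<And>Y\<^sub>1 Y\<^sub>2 m. Y\<^sub>1 \<in> {fst, snd} \<Longrightarrow> Y\<^sub>2 \<in> {fst, snd} \<Longrightarrow> m \<in> {0, 1} \<Longrightarrow> finite_mean (Q \<Otimes>\<^sub>M Q)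
           (\<lambda>z. SUP \<theta>\<in>\<Theta>. ennreal (nabla_norm2 m \<Theta> (\<lambda>t. stein_h \<X> k (p t) (Y\<^sub>1 z) (Y\<^sub>2 z)) \<theta> ^ 2))"
    and "\<And>Y\<^sub>1 Y\<^sub>2 m. Y\<^sub>1 \<in> {fst, snd} \<Longrightarrow> Y\<^sub>2 \<in> {fst, snd} \<Longrightarrow> m \<in> {2, 3} \<Longrightarrow> finite_mean (Q \<Otimes>\<^sub>M Q)
           (\<lambda>z. SUP \<theta>\<in>\<Theta>. ennreal (nabla_norm1 m \<Theta> (\<lambda>t. stein_h \<X> k (p t) (Y\<^sub>1 z) (Y\<^sub>2 z)) \<theta>))"
    and bootstrap_clt: "boot_weakly_converges M X
           (\<lambda>n x y.
              (real n * Ustat n (centered (empirical n x) (stein_h \<X> k (p \<theta>\<^sub>0))) y,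
               sqrt (real n) *\<^sub>R (Ustat n (grad_h \<Theta> \<X> k p \<theta>\<^sub>0) y - Ustat n (grad_h \<Theta> \<X> k p \<theta>\<^sub>0) x),
               sqrt (real n) *\<^sub>R (\<psi> (empirical n y) - \<psi> (empirical n x))))
           (distr N borel (\<lambda>z. (Z\<^sub>1 z, Z\<^sub>2 z, Z\<^sub>3 z)))"
  shows "(Q = P \<theta>\<^sub>0 \<longrightarrow>
            boot_weakly_converges M X
              (\<lambda>n x y. real n * KSD2_boot \<Theta> \<X> k p \<psi> n x y)
              (distr N borel (\<lambda>z. Z\<^sub>1 z + Z\<^sub>2 z \<bullet> Z\<^sub>3 z
                 + Z\<^sub>3 z \<bullet> (hessian \<Theta> (\<lambda>\<theta>. KSD2 \<X> k Q (p \<theta>)) \<theta>\<^sub>0 *v Z\<^sub>3 z))))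
       \<and> (Q \<notin> P ` \<Theta> \<longrightarrow>
            boot_bigo M X (\<lambda>n x y. real n * KSD2_boot \<Theta> \<X> k p \<psi> n x y) (\<lambda>_. 1))"
proof -
  interpret N: prob_space N by (rule limit)
  interpret MM: prob_space M by (rule sample)
  have sets_Q: "sets Q = sets (restrict_space borel \<X>)"
    unfolding assms(5) by (simp add: sets_restrict_space)
  have "sequence_space Q"
    by (intro sequence_space.intro product_prob_space.intro product_prob_space_axioms.intro product_sigma_finite.intro
        prob_space_imp_sigma_finite Q)
  moreover have kC: "C_on 2 (\<X> \<times> \<X>) (case_prod k)" using \<open>kernel_stein_class \<X> q k\<close> by (simp add: kernel_stein_class_def)
  have "stein_model_axioms Q \<X> \<Theta> \<theta>\<^sub>0 k p"
    by (rule stein_model_axioms.intro[OF domain sets_Q assms(12,15) kC assms(24,25,27,39,40)])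
  ultimately have model: "stein_model Q \<X> \<Theta> \<theta>\<^sub>0 k p" by (rule stein_model.intro)
  let ?S = "\<Pi>\<^sub>M i\<in>(UNIV :: nat set). Q"
  define T where "T \<omega> = (\<lambda>i. X i \<omega>)" for \<omega>
  have rv: "X i \<in> measurable M (restrict_space borel \<X>)" for i
    using assms(9) by (simp add: MM.indep_vars_def)
  have sets_S: "sets (\<Pi>\<^sub>M i\<in>(UNIV :: nat set). restrict_space borel \<X>) = sets ?S"
    by (intro sets_PiM_cong refl sets_Q[symmetric])
  have T: "T \<in> measurable M ?S"
    unfolding measurable_cong_sets[OF refl sets_S[symmetric]] T_def
    by (rule measurable_PiM_single') (use rv measurable_space[OF rv] in \<open>auto simp: space_PiM\<close>)
  have distr_T: "distr M ?S T = ?S"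
  proof -
    have "distr M (\<Pi>\<^sub>M i\<in>(UNIV :: nat set). restrict_space borel \<X>) (\<lambda>\<omega>. \<lambda>i\<in>UNIV. X i \<omega>) = (\<Pi>\<^sub>M i\<in>UNIV. distr M (restrict_space borel \<X>) (X i))"
      using MM.indep_vars_iff_distr_eq_PiM'[where I = UNIV and M' = "\<lambda>_. restrict_space borel \<X>" and X = X] rv assms(9) by blast
    then have "distr M (\<Pi>\<^sub>M i\<in>(UNIV :: nat set). restrict_space borel \<X>) T = ?S"
      by (simp add: assms(10) T_def[abs_def] restrict_UNIV)
    then show ?thesis using distr_cong[OF refl sets_S, of M T T] by simp
  qed
  let ?h = "stein_h \<X> k (p \<theta>\<^sub>0)" and ?d = "grad_h \<Theta> \<X> k p \<theta>\<^sub>0" and ?H = "hessian \<Theta> (\<lambda>\<theta>. KSD2 \<X> k Q (p \<theta>)) \<theta>\<^sub>0"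
  let ?\<nu> = "distr N borel (\<lambda>z. (Z\<^sub>1 z, Z\<^sub>2 z, Z\<^sub>3 z))"
  have Z: "(\<lambda>z. (Z\<^sub>1 z, Z\<^sub>2 z, Z\<^sub>3 z)) \<in> borel_measurable N"
    using assms by (intro borel_measurable_Pair)
  have \<nu>: "prob_space ?\<nu>" by (rule N.prob_space_distr[OF Z])
  have third: "continuous_on UNIV (\<lambda>z :: real \<times> (real ^ 'p) \<times> (real ^ 'p). norm (snd (snd z)))"
    by (intro continuous_intros)
  have \<psi>_meas: "(\<lambda>\<omega>. \<psi> (empirical n (T \<omega>))) \<in> borel_measurable M" if n: "0 < n" for n
  proof -
    have "(\<lambda>\<omega>. restrict (T \<omega>) {..<n}) \<in> measurable M (\<Pi>\<^sub>M i\<in>{..<n}. restrict_space borel \<X>)"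
      unfolding T_def restrict_def by (rule measurable_PiM_single') (use rv measurable_space[OF rv] in \<open>auto simp: space_PiM PiE_iff extensional_def\<close>)
    from measurable_compose[OF this assms(32)[OF n]]
    have "(\<lambda>\<omega>. \<psi> (empirical n (restrict (T \<omega>) {..<n}))) \<in> borel_measurable M" .
    moreover have "(\<lambda>\<omega>. \<psi> (empirical n (restrict (T \<omega>) {..<n}))) = (\<lambda>\<omega>. \<psi> (empirical n (T \<omega>)))"
      by (intro ext arg_cong[where f = \<psi>] empirical_cong[OF n]) simp
    ultimately show ?thesis by (simp only:)
  qed
  define W where "W n \<omega> = (real n * (Ustat n ?h (T \<omega>) - (\<integral>(a, b). ?h a b \<partial>(Q \<Otimes>\<^sub>M Q))),
       sqrt (real n) *\<^sub>R (Ustat n ?d (T \<omega>) - (\<integral>(a, b). ?d a b \<partial>(Q \<Otimes>\<^sub>M Q))),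
       sqrt (real n) *\<^sub>R (\<psi> (empirical n (T \<omega>)) - \<theta>\<^sub>0))" for n \<omega>
  have W: "W n \<in> borel_measurable M" if n: "0 < n" for n
  proof -
    note [measurable] = measurable_compose[OF T stein_model.measurable_Ustat_h[OF model, of n]] measurable_compose[OF T stein_model.measurable_Ustat_grad_h[OF model, of n]] \<psi>_meas[OF n]
    show ?thesis unfolding W_def[abs_def] by (intro borel_measurable_Pair) measurable
  qed
  have wW: "weakly_converges (\<lambda>n. distr M borel (W n)) ?\<nu>"
    using joint_clt unfolding W_def[abs_def] T_def Let_def .
  define V where "V n x y = (real n * Ustat n (centered (empirical n x) ?h) y,
       sqrt (real n) *\<^sub>R (Ustat n ?d y - Ustat n ?d x),
       sqrt (real n) *\<^sub>R (\<psi> (empirical n y) - \<psi> (empirical n x)))" for n x y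
  have wV: "AE \<omega> in M. weakly_converges (\<lambda>n. distr (measure_pmf (bootstrap n (T \<omega>))) borel (V n (T \<omega>))) ?\<nu>"
    using bootstrap_clt unfolding boot_weakly_converges_def V_def[abs_def] T_def .
  have boot: "\<exists>K. AE \<omega> in M. \<forall>\<^sub>F n in sequentially.
        measure_pmf.prob (bootstrap n (T \<omega>)) {y. K < sqrt n * norm (\<psi> (empirical n y) - \<psi> (empirical n (T \<omega>)))} \<le> \<tau>"
    if \<tau>: "0 < \<tau>" for \<tau>
  proof -
    \<comment> \<open>Obtained outside the almost sure statement, so that it does not depend on the
      outcome.\<close>
    obtain K where K: "\<And>(P :: nat \<Rightarrow> (nat \<Rightarrow> real ^ 'd) measure) T. (\<And>n. prob_space (P n)) \<Longrightarrow> (\<forall>\<^sub>F n in sequentially. T n \<in> borel_measurable (P n)) \<Longrightarrow>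
      weakly_converges (\<lambda>n. distr (P n) borel (T n)) ?\<nu> \<Longrightarrow>
      \<forall>\<^sub>F n in sequentially. measure (P n) {y \<in> space (P n). K < norm (snd (snd (T n y)))} \<le> \<tau>"
      using weakly_converges_tight[OF \<nu> _ third \<tau>, where 'c = "nat \<Rightarrow> real ^ 'd"] by auto
    from wV have "AE \<omega> in M. \<forall>\<^sub>F n in sequentially.
        measure_pmf.prob (bootstrap n (T \<omega>)) {y. K < sqrt n * norm (\<psi> (empirical n y) - \<psi> (empirical n (T \<omega>)))} \<le> \<tau>"
    proof eventually_elim
      case (elim \<omega>)
      from K[OF measure_pmf.prob_space_axioms _ elim] show ?case by (simp add: V_def)
    qed
    then show ?thesis by blast
  qed
  have consistent: "AE \<omega> in M. (\<lambda>n. \<psi> (empirical n (T \<omega>))) \<longlonglongrightarrow> \<theta>\<^sub>0"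
  proof (rule stein_model.consistency[OF model T distr_T assms(32) _ boot])
    fix \<tau> :: real assume \<tau>: "0 < \<tau>"
    obtain K where K: "\<And>(P :: nat \<Rightarrow> 'w measure) T. (\<And>n. prob_space (P n)) \<Longrightarrow> (\<forall>\<^sub>F n in sequentially. T n \<in> borel_measurable (P n)) \<Longrightarrow>
      weakly_converges (\<lambda>n. distr (P n) borel (T n)) ?\<nu> \<Longrightarrow>
      \<forall>\<^sub>F n in sequentially. measure (P n) {y \<in> space (P n). K < norm (snd (snd (T n y)))} \<le> \<tau>"
      using weakly_converges_tight[OF \<nu> _ third \<tau>, where 'c = 'w] by auto
    have "\<forall>\<^sub>F n in sequentially. W n \<in> borel_measurable M"
      using eventually_gt_at_top[of 0] by eventually_elim (rule W)
    from K[OF MM.prob_space_axioms this wW]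
    have "\<forall>\<^sub>F n in sequentially. measure M {\<omega> \<in> space M. K < sqrt n * norm (\<psi> (empirical n (T \<omega>)) - \<theta>\<^sub>0)} \<le> \<tau>"
      by (simp add: W_def)
    then show "\<exists>K. \<forall>\<^sub>F n in sequentially. measure M {\<omega> \<in> space M. K < sqrt n * norm (\<psi> (empirical n (T \<omega>)) - \<theta>\<^sub>0)} \<le> \<tau>" by blast
  qed
  have "AE x in distr M ?S T. stein_model.typical Q \<X> \<Theta> \<theta>\<^sub>0 k p x" unfolding distr_T by (rule stein_model.AE_typical[OF model])
  then have typical: "AE \<omega> in M. stein_model.typical Q \<X> \<Theta> \<theta>\<^sub>0 k p (T \<omega>)" by (rule AE_distrD[OF T])
  define \<phi> where "\<phi> z = fst z + fst (snd z) \<bullet> snd (snd z) + snd (snd z) \<bullet> (?H *v snd (snd z))" for z :: "real \<times> (real ^ 'p) \<times> (real ^ 'p)"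
  have \<phi>: "continuous_on UNIV \<phi>"
    unfolding \<phi>_def by (intro continuous_intros continuous_on_compose2[OF linear_continuous_on[OF matrix_vector_mul_bounded_linear]]) auto
  let ?\<nu>' = "distr N borel (\<lambda>z. Z\<^sub>1 z + Z\<^sub>2 z \<bullet> Z\<^sub>3 z + Z\<^sub>3 z \<bullet> (?H *v Z\<^sub>3 z))"
  have \<phi>m: "\<phi> \<in> borel_measurable borel" by (rule borel_measurable_continuous_onI[OF \<phi>])
  have \<nu>': "distr ?\<nu> borel \<phi> = ?\<nu>'" using distr_distr[OF \<phi>m Z] by (simp add: comp_def \<phi>_def)
  have rd: "real_distribution ?\<nu>'"
    unfolding \<nu>'[symmetric] using prob_space.real_distribution_distr[OF \<nu>, of \<phi>] \<phi>m by simp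
  have conv: "AE \<omega> in M. weakly_converges (\<lambda>n. distr (measure_pmf (bootstrap n (T \<omega>))) borel
      (\<lambda>y. real n * KSD2_boot \<Theta> \<X> k p \<psi> n (T \<omega>) y)) ?\<nu>'"
    using wV typical consistent
  proof eventually_elim
    case (elim \<omega>)
    let ?x = "T \<omega>"
    have tight: "pmf_tight (\<lambda>n. bootstrap n ?x) (\<lambda>n y. sqrt n * norm (\<psi> (empirical n y) - \<psi> (empirical n ?x)))"
      unfolding pmf_tight_def
    proof (intro allI impI)
      fix \<delta> :: real assume \<delta>: "0 < \<delta>"
      obtain K where K: "\<And>(P :: nat \<Rightarrow> (nat \<Rightarrow> real ^ 'd) measure) T. (\<And>n. prob_space (P n)) \<Longrightarrow> (\<forall>\<^sub>F n in sequentially. T n \<in> borel_measurable (P n)) \<Longrightarrow>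
        weakly_converges (\<lambda>n. distr (P n) borel (T n)) ?\<nu> \<Longrightarrow>
        \<forall>\<^sub>F n in sequentially. measure (P n) {y \<in> space (P n). K < norm (snd (snd (T n y)))} \<le> \<delta>"
        using weakly_converges_tight[OF \<nu> _ third \<delta>, where 'c = "nat \<Rightarrow> real ^ 'd"] by auto
      have "\<forall>\<^sub>F n in sequentially. measure_pmf.prob (bootstrap n ?x) {y. K < sqrt n * norm (\<psi> (empirical n y) - \<psi> (empirical n ?x))} \<le> \<delta>"
        using K[OF measure_pmf.prob_space_axioms _ elim(1)] by (simp add: V_def)
      \<comment> \<open>\<open>pmf_tight\<close> asks for a positive constant, and \<open>K\<close>
        may have any sign.\<close>
      then have "\<forall>\<^sub>F n in sequentially. measure_pmf.prob (bootstrap n ?x) {y. \<bar>K\<bar> + 1 < \<bar>sqrt n * norm (\<psi> (empirical n y) - \<psi> (empirical n ?x))\<bar>} \<le> \<delta>"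
      proof eventually_elim
        case (elim n)
        have "measure_pmf.prob (bootstrap n ?x) {y. \<bar>K\<bar> + 1 < \<bar>sqrt n * norm (\<psi> (empirical n y) - \<psi> (empirical n ?x))\<bar>}
          \<le> measure_pmf.prob (bootstrap n ?x) {y. K < sqrt n * norm (\<psi> (empirical n y) - \<psi> (empirical n ?x))}"
          by (intro prob_mono_on_support) auto
        with elim show ?case by linarith
      qed
      then show "\<exists>K>0. \<forall>\<^sub>F n in sequentially. measure_pmf.prob (bootstrap n ?x) {y. K < \<bar>sqrt n * norm (\<psi> (empirical n y) - \<psi> (empirical n ?x))\<bar>} \<le> \<delta>"
        by (intro exI[of _ "\<bar>K\<bar> + 1"]) auto
    qed
    have null: "pmf_null (\<lambda>n. bootstrap n ?x) (\<lambda>n y. n * KSD2_boot \<Theta> \<X> k p \<psi> n ?x y - \<phi> (V n ?x y))"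
      using stein_model.typical_expansion[OF model elim(2) estimator elim(3) tight] by (simp add: \<phi>_def V_def)
    have "weakly_converges (\<lambda>n. distr (distr (measure_pmf (bootstrap n ?x)) borel (V n ?x)) borel \<phi>) (distr ?\<nu> borel \<phi>)"
      by (rule weakly_converges_map[OF elim(1) _ _ \<phi>]) auto
    then have "weakly_converges (\<lambda>n. distr (measure_pmf (bootstrap n ?x)) borel (\<lambda>y. \<phi> (V n ?x y))) ?\<nu>'"
      unfolding \<nu>' by (simp add: distr_distr \<phi>m comp_def)
    then show ?case by (rule slutsky[OF null rd])
  qed
  have "boot_weakly_converges M X (\<lambda>n x y. real n * KSD2_boot \<Theta> \<X> k p \<psi> n x y) ?\<nu>'"
    using conv unfolding boot_weakly_converges_def T_def .
  moreover have "boot_bigo M X (\<lambda>n x y. real n * KSD2_boot \<Theta> \<X> k p \<psi> n x y) (\<lambda>_. 1)"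
    unfolding boot_bigo_def using conv
  proof eventually_elim
    case (elim \<omega>)
    interpret \<nu>': real_distribution ?\<nu>' by (rule rd)
    show ?case
    proof (intro allI impI)
      fix \<epsilon> :: real assume \<epsilon>: "0 < \<epsilon>"
      have c: "continuous_on UNIV (abs :: real \<Rightarrow> real)" by (intro continuous_intros)
      obtain K where K: "\<And>(P :: nat \<Rightarrow> (nat \<Rightarrow> real ^ 'd) measure) T. (\<And>n. prob_space (P n)) \<Longrightarrow> (\<forall>\<^sub>F n in sequentially. T n \<in> borel_measurable (P n)) \<Longrightarrow>
        weakly_converges (\<lambda>n. distr (P n) borel (T n)) ?\<nu>' \<Longrightarrow>
        \<forall>\<^sub>F n in sequentially. measure (P n) {y \<in> space (P n). K < \<bar>T n y\<bar>} \<le> \<epsilon>"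
        using weakly_converges_tight[OF \<nu>'.prob_space_axioms _ c \<epsilon>, where 'c = "nat \<Rightarrow> real ^ 'd"] by auto
      have "\<forall>\<^sub>F n in sequentially. measure_pmf.prob (bootstrap n (T \<omega>)) {y. K < \<bar>real n * KSD2_boot \<Theta> \<X> k p \<psi> n (T \<omega>) y\<bar>} \<le> \<epsilon>"
        using K[OF measure_pmf.prob_space_axioms _ elim] by simp
      from pmf_uniformly_tight[OF this \<epsilon>]
      show "\<exists>C. \<forall>n. measure_pmf.prob (bootstrap n (\<lambda>i. X i \<omega>)) {y. C < \<bar>real n * KSD2_boot \<Theta> \<X> k p \<psi> n (\<lambda>i. X i \<omega>) y / 1\<bar>} \<le> \<epsilon>"
        unfolding T_def div_by_1 .
    qed
  qed
  ultimately show ?thesis by blast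
qed

end
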